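(* Let $\Gamma$ be a discrete subgroup of $\mathrm{SL}(2,\mathbb{R})$ commensurable with $\mathrm{SL}(2,\mathbb{Z})$, let $\chi:\Gamma\to\mathbb{C}^\times$ be a character of finite order, and let $f=f_0+f_1\phi+f_2\phi^2$ be a quasimodular form of weight $k$ and depth $2$ with character $\chi$ on $\Gamma$. Let $h_1,h_2,h_3,W_f$ and $g_j=h_j/\sqrt[3]{W_f}$ be as defined in the context, and let $$Q_2(z):=\frac{g_1'''g_2-g_1g_2'''}{g_1g_2'-g_1'g_2},\qquad Q_3(z):=\frac{g_1'g_2'''-g_2'g_1'''}{g_1g_2'-g_1'g_2}.$$ Consider the equation $y'''+Q_2(z)y'+Q_3(z)y=0$ on $\mathbb{H}$. Then: (1) The equation is a MODE on $\Gamma$, i.e. $Q_2(z)$ and $Q_3(z)-\frac12Q_2'(z)$ are meromorphic modular forms on $\Gamma$ (with trivial character) of weight $4$ and $6$, respectively. (2) Conditions (H1)--(H3) stated in the context hold for this equation. Furthermore, if $\Gamma=\mathrm{SL}(2,\mathbb{Z})$, then: (3) At the elliptic point $\mathrm{i}=\sqrt{-1}$, $\{3\kappa_{\mathrm i}^{(1)},3\kappa_{\mathrm i}^{(2)},3\kappa_{\mathrm i}^{(3)}\}\equiv\{0,0,1\}\bmod 2$. (4) At the elliptic point $\rho=\frac{-1+\sqrt3\,\mathrm i}{2}$, $\kappa_\rho^{(j)}\in\mathbb{Z}$ for all $j$ and $\{\kappa_\rho^{(1)},\kappa_\rho^{(2)},\kappa_\rho^{(3)}\}\equiv\{0,1,2\}\bmod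 3$.
   Context: $\mathbb{H}$ is the upper half plane, $'=\frac{d}{dz}$. For $\gamma=\begin{pmatrix}a&b\\ c&d\end{pmatrix}$, $(f|_k\gamma)(z):=(cz+d)^{-k}f(\gamma z)$. A modular form of weight $k$ with character $\chi$ on $\Gamma$ is a holomorphic $f$ on $\mathbb{H}$ with $f|_k\gamma=\chi(\gamma)f$ for all $\gamma\in\Gamma$, holomorphic at all cusps; the space of these is $\mathfrak{M}_k(\Gamma,\chi)$. Fix a quasimodular form $\phi$ of weight 2 and depth 1: a holomorphic function on $\mathbb{H}$, holomorphic at the cusps, with $(\phi|_2\gamma)(z)=\phi(z)+\frac{\alpha c}{cz+d}$ for all $\gamma\in\Gamma$, for some nonzero constant $\alpha$. A quasimodular form of weight $k$ and depth $2$ with character $\chi$ is a function $f=f_0+f_1\phi+f_2\phi^2$ with $f_j\in\mathfrak{M}_{k-2j}(\Gamma,\chi)$ and $f_2\not\equiv0$. Put $$h_1=z^2f+\alpha z(f_1+2f_2\phi)+\alpha^2f_2,\quad h_2=2zf+\alpha(f_1+2f_2\phi),\quad h_3=f,$$ let $W_f=\det\begin{pmatrix} h_1&h_1'&h_1''\\ h_2&h_2'&h_2''\\ h_3&h_3'&h_3''\end{pmatrix}$, and $g_j=h_j/\sqrt[3]{W_f}$ (same branch of the cube root for all $j$; $Q_2,Q_3$ are single-valued). Local exponents. For an equation $y'''+Q_2y'+Q_3y=0$ on $\mathbb{H}$ the singular points are the poles of $Q_2,Q_3$. If $Q_j(z)=A_j(z-z_0)^{-j}+O((z-z_0)^{-j+1})$,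 $j=2,3$, the local exponents $\kappa_{z_0}^{(1)}\le\kappa_{z_0}^{(2)}\le\kappa_{z_0}^{(3)}$ at $z_0\in\mathbb{H}$ are the roots of $\kappa(\kappa-1)(\kappa-2)+A_2\kappa+A_3=0$ (so $0,1,2$ at a regular point). At the cusp $\infty$ of width $N$ they are the roots $\kappa_\infty^{(1)}\le\kappa_\infty^{(2)}\le\kappa_\infty^{(3)}$ of $\kappa^3+(\frac{N}{2\pi \mathrm i})^2Q_2(\infty)\kappa+(\frac{N}{2\pi \mathrm i})^3Q_3(\infty)=0$, i.e. the exponents at $q_N=e^{2\pi \mathrm i z/N}=0$; at another cusp $s=\sigma\infty$, $\sigma\in\mathrm{SL}(2,\mathbb{Z})$, they are the exponents at $\infty$ of the equation satisfied by the functions $y|_{-2}\sigma$, $y$ a solution. A singular point $z_0$ is apparent if no solution has a logarithmic singularity at $z_0$. The conditions are: (H1) The equation is Fuchsian on $\mathbb{H}\cup\{\text{cusps}\}$ (at points of $\mathbb{H}$, the pole order of $Q_j$ is at most $j$; at $\infty$, $Q_2,Q_3$ are holomorphic; similarly at other cusps). (H2) At any singular point $z_0\in\mathbb{H}$, $\kappa_{z_0}^{(1)}<\kappa_{z_0}^{(2)}<\kappa_{z_0}^{(3)}$ satisfy $\kappa_{z_0}^{(1)}\in\frac13\mathbb{Z}_{\le0}$ and $\kappa_{z_0}^{(j)}-\kappa_{z_0}^{(1)}\in\mathbb{Z}$ for $j=2,3$; furthermore $z_0$ is apparent. (H3) At any cusp $s$ of $\Gamma$, $\kappa_s^{(1)}\le\kappa_s^{(2)}\le\kappa_s^{(3)}$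 satisfy $\kappa_s^{(1)}\in\frac13\mathbb{Z}_{\le0}$ and $\kappa_s^{(j)}-\kappa_s^{(1)}\in\mathbb{Z}$ for $j=2,3$. Congruences between sets such as $\{a,b,c\}\equiv\{0,0,1\}\bmod 2$ are congruences of multisets (up to reordering), and in (3) include that the $3\kappa_{\mathrm i}^{(j)}$ are integers. *)

theory Defs
  imports "HOL-Complex_Analysis.Complex_Analysis" "HOL-Algebra.Coset"
    "HOL-Library.Landau_Symbols" "HOL-Library.Multiset"
begin

section \<open>Subgroups of the real special linear group and their cusps\<close>

abbreviation upper_half_plane :: "complex set" where
  "upper_half_plane \<equiv> {z. Im z > 0}"

definition mat2 :: "real \<Rightarrow> real \<Rightarrow> real \<Rightarrow> real \<Rightarrow> real^2^2" where
  "mat2 a b c d = vector [vector [a, b], vector [c, d]]"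

definition SL2R :: "(real^2^2) monoid" where
  "SL2R = \<lparr>carrier = {A. det A = 1}, mult = (**), one = mat 1\<rparr>"

definition SL2Z :: "(real^2^2) set" where
  "SL2Z = {A. det A = 1 \<and> (\<forall>i j. A $ i $ j \<in> \<int>)}"

definition finite_index :: "(real^2^2) set \<Rightarrow> (real^2^2) set \<Rightarrow> bool" where
  "finite_index H G \<longleftrightarrow> finite (rcosets\<^bsub>SL2R\<lparr>carrier := G\<rparr>\<^esub> H)"

definition commensurable :: "(real^2^2) set \<Rightarrow> (real^2^2) set \<Rightarrow> bool" where
  "commensurable G H \<longleftrightarrow> finite_index (G \<inter> H) G \<and> finite_index (G \<inter> H) H"

definition finite_order_character :: "(real^2^2) set \<Rightarrow> (real^2^2 \<Rightarrow> complex) \<Rightarrow> bool" where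
  "finite_order_character \<Gamma> chi \<longleftrightarrow>
     (\<forall>\<gamma>\<in>\<Gamma>. chi \<gamma> \<noteq> 0) \<and>
     (\<forall>\<gamma>\<in>\<Gamma>. \<forall>\<delta>\<in>\<Gamma>. chi (\<gamma> ** \<delta>) = chi \<gamma> * chi \<delta>) \<and>
     (\<exists>n::nat. n > 0 \<and> (\<forall>\<gamma>\<in>\<Gamma>. chi \<gamma> ^ n = 1))"

definition automorphy :: "real^2^2 \<Rightarrow> complex \<Rightarrow> complex" where
  "automorphy \<gamma> z = of_real (\<gamma> $ 2 $ 1) * z + of_real (\<gamma> $ 2 $ 2)"

definition moebius :: "real^2^2 \<Rightarrow> complex \<Rightarrow> complex" where
  "moebius \<gamma> z = (of_real (\<gamma> $ 1 $ 1) * z + of_real (\<gamma> $ 1 $ 2)) / automorphy \<gamma> z"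

definition slash :: "int \<Rightarrow> real^2^2 \<Rightarrow> (complex \<Rightarrow> complex) \<Rightarrow> complex \<Rightarrow> complex" where
  "slash k \<gamma> f z = automorphy \<gamma> z powi (- k) * f (moebius \<gamma> z)"

text \<open>
  A group commensurable with \<open>SL2Z\<close> has the rational numbers and infinity as its cusps, that is,
  the points \<open>\<sigma>\<infinity>\<close> with \<open>\<sigma>\<close> in \<open>SL2Z\<close>.  Conditions at a cusp are therefore imposed at infinity after
  slashing, for all \<open>\<sigma>\<close> in \<open>SL2Z\<close>; the identity matrix gives the cusp infinity itself.
  The width below is the smallest positive \<open>N\<close> such that plus or minus the translation by \<open>N\<close> lies
  in the conjugate of \<open>\<Gamma>\<close> by the inverse of \<open>\<sigma>\<close>.  For discrete \<open>\<Gamma>\<close> the infimum is attained.  It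
  need not be an integer, as \<open>\<Gamma>\<close> need not be contained in \<open>SL2Z\<close>.
\<close>

definition cusp_width :: "(real^2^2) set \<Rightarrow> real^2^2 \<Rightarrow> real" where
  "cusp_width \<Gamma> \<sigma> =
     Inf {N. N > 0 \<and> (\<sigma> ** mat2 1 N 0 1 ** matrix_inv \<sigma> \<in> \<Gamma> \<or>
                       - (\<sigma> ** mat2 1 N 0 1 ** matrix_inv \<sigma>) \<in> \<Gamma>)}"

definition nome :: "real \<Rightarrow> complex \<Rightarrow> complex" where
  "nome N z = exp (2 * of_real pi * \<i> * z / of_real N)"

text \<open>
  In the next two definitions, the nome maps the half plane \<open>Im z > Y\<close> onto the punctured disc of
  radius \<open>exp (-2 * pi * Y / N)\<close>.
\<close>

definition holomorphic_at_infty :: "real \<Rightarrow> (complex \<Rightarrow> complex) \<Rightarrow> bool" where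
  "holomorphic_at_infty N F \<longleftrightarrow>
     (\<exists>Y>0. \<exists>G. G holomorphic_on ball 0 (exp (- 2 * pi * Y / N)) \<and>
        (\<forall>z. Im z > Y \<longrightarrow> F z = G (nome N z)))"

definition meromorphic_at_infty :: "real \<Rightarrow> (complex \<Rightarrow> complex) \<Rightarrow> bool" where
  "meromorphic_at_infty N F \<longleftrightarrow>
     (\<exists>Y>0. \<exists>G. G meromorphic_on ball 0 (exp (- 2 * pi * Y / N)) \<and>
        (\<forall>\<^sub>\<approx>z\<in>{z. Im z > Y}. F z = G (nome N z)))"


section \<open>Modular and quasimodular forms\<close>

text \<open>
  The expansion at a cusp may be in any \<open>nome N\<close>: a nontrivial character or an irregular cusp makes
  the period of the slashed form a proper multiple of the width of the cusp.
\<close>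

definition modular_forms ::
  "(real^2^2) set \<Rightarrow> (real^2^2 \<Rightarrow> complex) \<Rightarrow> int \<Rightarrow> (complex \<Rightarrow> complex) set" where
  "modular_forms \<Gamma> chi k = {f.
     f holomorphic_on upper_half_plane \<and>
     (\<forall>\<gamma>\<in>\<Gamma>. \<forall>z\<in>upper_half_plane. slash k \<gamma> f z = chi \<gamma> * f z) \<and>
     (\<forall>\<sigma>\<in>SL2Z. \<exists>N>0. holomorphic_at_infty N (slash k \<sigma> f))}"

text \<open>Meromorphic functions are compared away from a sparse set.\<close>

definition meromorphic_modular_form :: "(real^2^2) set \<Rightarrow> int \<Rightarrow> (complex \<Rightarrow> complex) \<Rightarrow> bool" where
  "meromorphic_modular_form \<Gamma> k F \<longleftrightarrow>
     F meromorphic_on upper_half_plane \<and>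
     (\<forall>\<gamma>\<in>\<Gamma>. \<forall>\<^sub>\<approx>z\<in>upper_half_plane. slash k \<gamma> F z = F z) \<and>
     (\<forall>\<sigma>\<in>SL2Z. \<exists>N>0. meromorphic_at_infty N (slash k \<sigma> F))"

text \<open>
  The transformation law carries the term \<open>\<alpha> c / (c z + d)\<close>.  For \<open>\<sigma>\<close> in \<open>SL2Z\<close> outside \<open>\<Gamma>\<close> it is
  likewise the difference of \<open>\<phi>|\<sigma>\<close> and this term (which tends to 0 at infinity) that is periodic,
  by the cocycle relation, and holomorphy at the cusps refers to its expansion.
\<close>

definition quasimodular_weight2 ::
  "(real^2^2) set \<Rightarrow> complex \<Rightarrow> (complex \<Rightarrow> complex) \<Rightarrow> bool" where
  "quasimodular_weight2 \<Gamma> \<alpha> \<phi> \<longleftrightarrow>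
     \<alpha> \<noteq> 0 \<and> \<phi> holomorphic_on upper_half_plane \<and>
     (\<forall>\<gamma>\<in>\<Gamma>. \<forall>z\<in>upper_half_plane.
        slash 2 \<gamma> \<phi> z = \<phi> z + \<alpha> * of_real (\<gamma> $ 2 $ 1) / automorphy \<gamma> z) \<and>
     (\<forall>\<sigma>\<in>SL2Z. \<exists>N>0. holomorphic_at_infty N
        (\<lambda>z. slash 2 \<sigma> \<phi> z - \<alpha> * of_real (\<sigma> $ 2 $ 1) / automorphy \<sigma> z))"

definition quasimodular_depth2 ::
  "(real^2^2) set \<Rightarrow> (real^2^2 \<Rightarrow> complex) \<Rightarrow> (complex \<Rightarrow> complex) \<Rightarrow> int \<Rightarrow>
   (complex \<Rightarrow> complex) \<Rightarrow> (complex \<Rightarrow> complex) \<Rightarrow> (complex \<Rightarrow> complex) \<Rightarrow>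
   (complex \<Rightarrow> complex) \<Rightarrow> bool" where
  "quasimodular_depth2 \<Gamma> chi \<phi> k f f0 f1 f2 \<longleftrightarrow>
     f0 \<in> modular_forms \<Gamma> chi k \<and>
     f1 \<in> modular_forms \<Gamma> chi (k - 2) \<and>
     f2 \<in> modular_forms \<Gamma> chi (k - 4) \<and>
     (\<exists>z\<in>upper_half_plane. f2 z \<noteq> 0) \<and>
     (\<forall>z\<in>upper_half_plane. f z = f0 z + f1 z * \<phi> z + f2 z * \<phi> z ^ 2)"


section \<open>The equation attached to a quasimodular form\<close>

definition h1 :: "complex \<Rightarrow> (complex \<Rightarrow> complex) \<Rightarrow> (complex \<Rightarrow> complex) \<Rightarrow>
    (complex \<Rightarrow> complex) \<Rightarrow> (complex \<Rightarrow> complex) \<Rightarrow> complex \<Rightarrow> complex" where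
  "h1 \<alpha> \<phi> f f1 f2 z = z ^ 2 * f z + \<alpha> * z * (f1 z + 2 * f2 z * \<phi> z) + \<alpha> ^ 2 * f2 z"

definition h2 :: "complex \<Rightarrow> (complex \<Rightarrow> complex) \<Rightarrow> (complex \<Rightarrow> complex) \<Rightarrow>
    (complex \<Rightarrow> complex) \<Rightarrow> (complex \<Rightarrow> complex) \<Rightarrow> complex \<Rightarrow> complex" where
  "h2 \<alpha> \<phi> f f1 f2 z = 2 * z * f z + \<alpha> * (f1 z + 2 * f2 z * \<phi> z)"

definition wronskian3 :: "(complex \<Rightarrow> complex) \<Rightarrow> (complex \<Rightarrow> complex) \<Rightarrow> (complex \<Rightarrow> complex) \<Rightarrow>
    complex \<Rightarrow> complex" where
  "wronskian3 u v w z = det (vector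
     [vector [u z, deriv u z, (deriv ^^ 2) u z],
      vector [v z, deriv v z, (deriv ^^ 2) v z],
      vector [w z, deriv w z, (deriv ^^ 2) w z]] :: complex^3^3)"

text \<open>
  The cube root of \<open>W\<close> is only locally defined.  \<open>cbrt_branch W p\<close> is a cube root of \<open>W\<close> that is
  holomorphic near \<open>p\<close> when \<open>W\<close> is and \<open>W p \<noteq> 0\<close>.  Another local branch differs by a constant
  factor, which cancels in \<open>raw_Q2\<close> and \<open>raw_Q3\<close>.
\<close>

definition cbrt_branch :: "(complex \<Rightarrow> complex) \<Rightarrow> complex \<Rightarrow> complex \<Rightarrow> complex" where
  "cbrt_branch W p z = W p powr (1/3) * (W z / W p) powr (1/3)"

lemma cbrt_branch_cubed:
  assumes "W p \<noteq> 0"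
  shows "cbrt_branch W p z ^ 3 = W z"
proof -
  have cube: "(x powr (1/3)) ^ 3 = x" for x :: complex
  proof (cases "x = 0")
    case False
    then show ?thesis
      by (simp add: powr_def exp_of_nat_mult [symmetric])
  qed simp
  show ?thesis
    using assms by (simp add: cbrt_branch_def power_mult_distrib cube)
qed

lemma cbrt_branch_analytic:
  assumes "W analytic_on {p}" "W p \<noteq> 0"
  shows "cbrt_branch W p analytic_on {p}"
  unfolding cbrt_branch_def [abs_def] using assms
  by (auto intro!: analytic_intros)

text \<open>
  The value at \<open>z\<close> uses the branch based at \<open>z\<close>.  The formula degenerates at zeros of the Wronskian
  and of \<open>g1 g2' - g1' g2\<close>; the removable singularities this introduces are removed afterwards.
\<close>

definition raw_Q2 where
  "raw_Q2 W u v z = (let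
       g1 = (\<lambda>s. u s / cbrt_branch W z s);
       g2 = (\<lambda>s. v s / cbrt_branch W z s)
     in ((deriv ^^ 3) g1 z * g2 z - g1 z * (deriv ^^ 3) g2 z) /
        (g1 z * deriv g2 z - deriv g1 z * g2 z))"

definition raw_Q3 where
  "raw_Q3 W u v z = (let
       g1 = (\<lambda>s. u s / cbrt_branch W z s);
       g2 = (\<lambda>s. v s / cbrt_branch W z s)
     in (deriv g1 z * (deriv ^^ 3) g2 z - deriv g2 z * (deriv ^^ 3) g1 z) /
        (g1 z * deriv g2 z - deriv g1 z * g2 z))"

definition W_form where
  "W_form \<alpha> \<phi> f f1 f2 = wronskian3 (h1 \<alpha> \<phi> f f1 f2) (h2 \<alpha> \<phi> f f1 f2) f"

definition Q2_form where
  "Q2_form \<alpha> \<phi> f f1 f2 =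
     remove_sings (raw_Q2 (W_form \<alpha> \<phi> f f1 f2) (h1 \<alpha> \<phi> f f1 f2) (h2 \<alpha> \<phi> f f1 f2))"

definition Q3_form where
  "Q3_form \<alpha> \<phi> f f1 f2 =
     remove_sings (raw_Q3 (W_form \<alpha> \<phi> f f1 f2) (h1 \<alpha> \<phi> f f1 f2) (h2 \<alpha> \<phi> f f1 f2))"


section \<open>Third-order equations on the upper half plane\<close>

text \<open>An equation \<open>y''' + Q2 y' + Q3 y = 0\<close> is given by its coefficients \<open>Q2\<close> and \<open>Q3\<close>.\<close>

definition MODE :: "(real^2^2) set \<Rightarrow> (complex \<Rightarrow> complex) \<Rightarrow> (complex \<Rightarrow> complex) \<Rightarrow> bool" where
  "MODE \<Gamma> Q2 Q3 \<longleftrightarrow>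
     meromorphic_modular_form \<Gamma> 4 Q2 \<and>
     meromorphic_modular_form \<Gamma> 6 (\<lambda>z. Q3 z - 1/2 * deriv Q2 z)"

definition singular_point :: "(complex \<Rightarrow> complex) \<Rightarrow> (complex \<Rightarrow> complex) \<Rightarrow> complex \<Rightarrow> bool" where
  "singular_point Q2 Q3 z \<longleftrightarrow> is_pole Q2 z \<or> is_pole Q3 z"

definition solution_on ::
  "(complex \<Rightarrow> complex) \<Rightarrow> (complex \<Rightarrow> complex) \<Rightarrow> complex set \<Rightarrow> (complex \<Rightarrow> complex) \<Rightarrow> bool" where
  "solution_on Q2 Q3 V y \<longleftrightarrow>
     y holomorphic_on V \<and>
     (\<forall>z\<in>V. (deriv ^^ 3) y z + Q2 z * deriv y z + Q3 z * y z = 0)"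

text \<open>
  The exponents are the roots of the indicial polynomial with multiplicity, expressed by its
  factorisation.
\<close>

definition local_exponents ::
  "(complex \<Rightarrow> complex) \<Rightarrow> (complex \<Rightarrow> complex) \<Rightarrow> complex \<Rightarrow> real \<Rightarrow> real \<Rightarrow> real \<Rightarrow> bool" where
  "local_exponents Q2 Q3 z0 \<kappa>1 \<kappa>2 \<kappa>3 \<longleftrightarrow>
     \<kappa>1 \<le> \<kappa>2 \<and> \<kappa>2 \<le> \<kappa>3 \<and>
     (\<exists>A2 A3.
        (\<lambda>z. Q2 z - A2 * (z - z0) powi (-2)) \<in> O[at z0](\<lambda>z. (z - z0) powi (-1)) \<and>
        (\<lambda>z. Q3 z - A3 * (z - z0) powi (-3)) \<in> O[at z0](\<lambda>z. (z - z0) powi (-2)) \<and>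
        (\<forall>x::complex. x * (x - 1) * (x - 2) + A2 * x + A3 =
           (x - of_real \<kappa>1) * (x - of_real \<kappa>2) * (x - of_real \<kappa>3)))"

definition exponents_at_infty ::
  "real \<Rightarrow> (complex \<Rightarrow> complex) \<Rightarrow> (complex \<Rightarrow> complex) \<Rightarrow> real \<Rightarrow> real \<Rightarrow> real \<Rightarrow> bool" where
  "exponents_at_infty N Q2 Q3 \<kappa>1 \<kappa>2 \<kappa>3 \<longleftrightarrow>
     \<kappa>1 \<le> \<kappa>2 \<and> \<kappa>2 \<le> \<kappa>3 \<and>
     (\<exists>B2 B3.
        (Q2 \<longlongrightarrow> B2) (filtercomap Im at_top) \<and>
        (Q3 \<longlongrightarrow> B3) (filtercomap Im at_top) \<and>
        (\<forall>x::complex. x ^ 3 + (of_real N / (2 * of_real pi * \<i>)) ^ 2 * B2 * x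
                        + (of_real N / (2 * of_real pi * \<i>)) ^ 3 * B3 =
           (x - of_real \<kappa>1) * (x - of_real \<kappa>2) * (x - of_real \<kappa>3)))"

text \<open>
  \<open>R2, R3\<close> are the coefficients of the equation satisfied by \<open>y|\<sigma>\<close> (slash in weight \<open>-2\<close>) for the
  solutions \<open>y\<close> of the equation with coefficients \<open>Q2, Q3\<close>.  They are unique, since near a regular
  point there are three linearly independent solutions.
\<close>

definition slashed_equation ::
  "real^2^2 \<Rightarrow> (complex \<Rightarrow> complex) \<Rightarrow> (complex \<Rightarrow> complex) \<Rightarrow>
   (complex \<Rightarrow> complex) \<Rightarrow> (complex \<Rightarrow> complex) \<Rightarrow> bool" where
  "slashed_equation \<sigma> Q2 Q3 R2 R3 \<longleftrightarrow>
     R2 nicely_meromorphic_on upper_half_plane \<and>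
     R3 nicely_meromorphic_on upper_half_plane \<and>
     (\<forall>V y. open V \<longrightarrow> V \<subseteq> upper_half_plane \<longrightarrow> (\<forall>z\<in>V. \<not> singular_point Q2 Q3 z) \<longrightarrow>
        solution_on Q2 Q3 V y \<longrightarrow>
        solution_on R2 R3 {z \<in> upper_half_plane. moebius \<sigma> z \<in> V} (slash (-2) \<sigma> y))"

text \<open>
  Solutions near \<open>z0\<close> are multivalued in general; their branches live on a disc slit along the
  branch cut of \<open>powr\<close>.  By Frobenius, a branch is a sum of terms
  \<open>(z - z0) powr l * ln (z - z0) ^ m * G z\<close> with \<open>G\<close> holomorphic at \<open>z0\<close>; it has no logarithmic
  singularity if only \<open>m = 0\<close> is needed.
\<close>

definition apparent :: "(complex \<Rightarrow> complex) \<Rightarrow> (complex \<Rightarrow> complex) \<Rightarrow> complex \<Rightarrow> bool" where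
  "apparent Q2 Q3 z0 \<longleftrightarrow>
     (\<exists>r>0. ball z0 r \<subseteq> upper_half_plane \<and>
        (\<forall>z\<in>ball z0 r - {z0}. \<not> singular_point Q2 Q3 z) \<and>
        (\<forall>y. solution_on Q2 Q3 {z \<in> ball z0 r. z - z0 \<notin> \<real>\<^sub>\<le>\<^sub>0} y \<longrightarrow>
           (\<exists>(n::nat) l G. (\<forall>i<n. G i holomorphic_on ball z0 r) \<and>
              (\<forall>z\<in>ball z0 r. z - z0 \<notin> \<real>\<^sub>\<le>\<^sub>0 \<longrightarrow>
                 y z = (\<Sum>i<n. (z - z0) powr l i * G i z)))))"

definition cond_H1 :: "(real^2^2) set \<Rightarrow> (complex \<Rightarrow> complex) \<Rightarrow> (complex \<Rightarrow> complex) \<Rightarrow> bool" where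
  "cond_H1 \<Gamma> Q2 Q3 \<longleftrightarrow>
     Q2 meromorphic_on upper_half_plane \<and> Q3 meromorphic_on upper_half_plane \<and>
     (\<forall>z\<in>upper_half_plane.
        (is_pole Q2 z \<longrightarrow> zorder Q2 z \<ge> -2) \<and> (is_pole Q3 z \<longrightarrow> zorder Q3 z \<ge> -3)) \<and>
     (\<forall>\<sigma>\<in>SL2Z. \<exists>R2 R3. slashed_equation \<sigma> Q2 Q3 R2 R3 \<and>
        holomorphic_at_infty (cusp_width \<Gamma> \<sigma>) R2 \<and>
        holomorphic_at_infty (cusp_width \<Gamma> \<sigma>) R3)"

definition cond_H2 :: "(complex \<Rightarrow> complex) \<Rightarrow> (complex \<Rightarrow> complex) \<Rightarrow> bool" where
  "cond_H2 Q2 Q3 \<longleftrightarrow>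
     (\<forall>z0\<in>upper_half_plane. singular_point Q2 Q3 z0 \<longrightarrow>
        (\<exists>\<kappa>1 \<kappa>2 \<kappa>3. local_exponents Q2 Q3 z0 \<kappa>1 \<kappa>2 \<kappa>3 \<and>
           \<kappa>1 < \<kappa>2 \<and> \<kappa>2 < \<kappa>3 \<and>
           3 * \<kappa>1 \<in> \<int> \<and> \<kappa>1 \<le> 0 \<and> \<kappa>2 - \<kappa>1 \<in> \<int> \<and> \<kappa>3 - \<kappa>1 \<in> \<int>) \<and>
        apparent Q2 Q3 z0)"

definition cond_H3 :: "(real^2^2) set \<Rightarrow> (complex \<Rightarrow> complex) \<Rightarrow> (complex \<Rightarrow> complex) \<Rightarrow> bool" where
  "cond_H3 \<Gamma> Q2 Q3 \<longleftrightarrow>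
     (\<forall>\<sigma>\<in>SL2Z. \<exists>R2 R3 \<kappa>1 \<kappa>2 \<kappa>3. slashed_equation \<sigma> Q2 Q3 R2 R3 \<and>
        exponents_at_infty (cusp_width \<Gamma> \<sigma>) R2 R3 \<kappa>1 \<kappa>2 \<kappa>3 \<and>
        3 * \<kappa>1 \<in> \<int> \<and> \<kappa>1 \<le> 0 \<and> \<kappa>2 - \<kappa>1 \<in> \<int> \<and> \<kappa>3 - \<kappa>1 \<in> \<int>)"

end

theory Submission
  imports Defs
begin

text \<open>
  The idea of the proof is that everything depends only on the three-dimensional space spanned by
  \<open>h1\<close>, \<open>h2\<close> and \<open>h3 = f\<close>, and only up to multiplication by a common factor.  An equation
  \<open>y''' + Q2 y' + Q3 y = 0\<close> is determined by three independent solutions, and multiplying all of them by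
  a function that is not locally constant introduces a second-order term
  (\<open>scaled_solutions_determine_equation\<close>).  Dividing by the cube root of the Wronskian is one way to
  reach an equation without such a term; any other nowhere vanishing \<open>G\<close> for which the quotients
  \<open>h\<^sub>j / G\<close> solve such an equation gives the same \<open>Q2\<close> and \<open>Q3\<close> (\<open>raw_Q_eq\<close>).  At each point and at each
  cusp a convenient \<open>G\<close> is chosen.

  Modularity.  The transformation law of \<open>\<phi>\<close> makes \<open>(h1, h2, h3)\<close> transform under a matrix like the
  symmetric square of \<open>(z, 1)\<close>, up to a common factor (\<open>h_transform\<close>).  By Bol's identity (\<open>bol\<close>) the
  slash operator of weight \<open>-2\<close> maps solutions of an equation to solutions of a slashed equation, whose
  coefficients are \<open>Q2\<close> slashed in weight 4 and, after subtraction of half the derivative of the first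
  one, \<open>Q3 - Q2' / 2\<close> slashed in weight 6.  For an element of \<open>\<Gamma>\<close> the slashed equation has the same
  solutions up to a common factor, so it is the same equation (\<open>invariant_eventually\<close>).

  Points of the half plane.  The functions \<open>h1\<close>, \<open>h2\<close> and \<open>h3\<close> are independent (\<open>independent\<close>), so their
  span has a basis with distinct orders \<open>n1 < n2 < n3\<close> at a given point (\<open>adapted_basis\<close>).  In terms of this basis
  the operator splits into first-order factors with simple poles (\<open>chain_solutions\<close>), all solutions are
  a fixed power of \<open>z - z0\<close> times single-valued functions, and the exponents are
  \<open>n\<^sub>j - (n1 + n2 + n3 - 3) / 3\<close> (\<open>local_structure\<close>, \<open>equation_near\<close>).

  Cusps.  After slashing by \<open>\<sigma>\<close> the functions are \<open>F\<close>, \<open>2 z F + X\<close> and \<open>z\<^sup>2 F + z X + C\<close> with \<open>F\<close>, \<open>X\<close> and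
  \<open>C\<close> holomorphic in the nome \<open>q\<close> of a multiple of the width.  The same splitting into first-order factors
  yields coefficients that are holomorphic at \<open>q = 0\<close>, and exponents that are given by two orders at
  \<open>q = 0\<close> (\<open>cusp_structure\<close>).  The equation itself is invariant under translation by the width, and this
  turns the exponents into ones with respect to the width whose differences are integers.

  Elliptic points.  An element of the group that fixes \<open>z0\<close> acts on the span, and the eigenvalue of an
  eigenfunction determines its order at \<open>z0\<close> modulo the order of the derivative of the element
  (\<open>order_at_fixed_point\<close>).  At \<open>i\<close> one eigenvalue occurs once and its negative twice; at \<open>\<rho>\<close> the
  eigenvalues are the three cube roots of unity, up to a common factor.
\<close>

section \<open>Solutions of third-order equations\<close>

lemma upper_half_plane_open: "open upper_half_plane"
  by (simp add: open_halfspace_Im_gt)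

lemma upper_half_plane_connected: "connected upper_half_plane"
  by (simp add: convex_connected convex_halfspace_Im_gt)

lemma holomorphic_has_deriv:
  assumes "y holomorphic_on V" "open V" "z \<in> V"
  shows "(y has_field_derivative deriv y z) (at z)"
    "(deriv y has_field_derivative (deriv ^^ 2) y z) (at z)"
    "((deriv ^^ 2) y has_field_derivative (deriv ^^ 3) y z) (at z)"
proof -
  have 1: "deriv y holomorphic_on V"
    using assms by (intro holomorphic_deriv)
  then have 2: "(deriv ^^ 2) y holomorphic_on V"
    using assms by (auto simp: numeral_2_eq_2 intro: holomorphic_deriv)
  show "(y has_field_derivative deriv y z) (at z)"
    using assms by (intro holomorphic_derivI[of y V])
  show "(deriv y has_field_derivative (deriv ^^ 2) y z) (at z)"
    using holomorphic_derivI[OF 1 assms(2,3)] by (simp add: numeral_2_eq_2)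
  show "((deriv ^^ 2) y has_field_derivative (deriv ^^ 3) y z) (at z)"
    using holomorphic_derivI[OF 2 assms(2,3)] by (simp add: numeral_2_eq_2 numeral_3_eq_3)
qed

text \<open>
  Derivative rules yield explicit candidates \<open>y1\<close> and \<open>y2\<close>; this turns them into values of iterated
  \<open>deriv\<close>.
\<close>

lemma derivs_eqI:
  assumes "open V" "z \<in> V"
    and 1: "\<And>z. z \<in> V \<Longrightarrow> (y has_field_derivative y1 z) (at z)"
    and 2: "\<And>z. z \<in> V \<Longrightarrow> (y1 has_field_derivative y2 z) (at z)"
  shows "deriv y z = y1 z" "(deriv ^^ 2) y z = y2 z"
    "(y2 has_field_derivative d) (at z) \<Longrightarrow> (deriv ^^ 3) y z = d"
proof -
  have d1: "deriv y z = y1 z" if "z \<in> V" for z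
    using 1[OF that] by (rule DERIV_imp_deriv)
  have ev: "\<forall>\<^sub>F z in nhds z. deriv y z = y1 z" if "z \<in> V" for z
    using d1 that assms(1) eventually_nhds by blast
  have d2: "(deriv ^^ 2) y z = y2 z" if "z \<in> V" for z
    using deriv_cong_ev[OF ev[OF that] refl] DERIV_imp_deriv[OF 2[OF that]]
    by (simp add: numeral_2_eq_2)
  have "\<forall>\<^sub>F z in nhds z. (deriv ^^ 2) y z = y2 z"
    using d2 assms(1,2) eventually_nhds by blast
  from deriv_cong_ev[OF this refl]
  show "(y2 has_field_derivative d) (at z) \<Longrightarrow> (deriv ^^ 3) y z = d"
    using DERIV_imp_deriv by (fastforce simp: numeral_2_eq_2 numeral_3_eq_3)
  show "deriv y z = y1 z" "(deriv ^^ 2) y z = y2 z"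
    using d1 d2 assms by auto
qed

lemma solution_onI:
  assumes "open V"
    and "\<And>z. z \<in> V \<Longrightarrow> (y has_field_derivative y1 z) (at z)"
    and "\<And>z. z \<in> V \<Longrightarrow> (y1 has_field_derivative y2 z) (at z)"
    and "\<And>z. z \<in> V \<Longrightarrow> (y2 has_field_derivative y3 z) (at z)"
    and "\<And>z. z \<in> V \<Longrightarrow> y3 z + Q2 z * y1 z + Q3 z * y z = 0"
  shows "solution_on Q2 Q3 V y"
  unfolding solution_on_def
proof (intro conjI ballI)
  show "y holomorphic_on V"
    using assms(2) by (meson field_differentiable_at_within field_differentiable_def holomorphic_onI)
  fix z assume z: "z \<in> V"
  show "(deriv ^^ 3) y z + Q2 z * deriv y z + Q3 z * y z = 0"
    using derivs_eqI[OF assms(1) z assms(2,3)] assms(4,5)[OF z] by metis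
qed

lemma solution_on_deriv3:
  "solution_on Q2 Q3 V y \<Longrightarrow> z \<in> V \<Longrightarrow> (deriv ^^ 3) y z = - Q2 z * deriv y z - Q3 z * y z"
  unfolding solution_on_def by (auto simp: add_eq_0_iff2 algebra_simps)

lemma solution_on_subset:
  "solution_on Q2 Q3 V y \<Longrightarrow> U \<subseteq> V \<Longrightarrow> solution_on Q2 Q3 U y"
  unfolding solution_on_def by (meson holomorphic_on_subset subsetD)

lemma solution_on_cong:
  assumes "open V" "\<And>z. z \<in> V \<Longrightarrow> y z = x z" "\<And>z. z \<in> V \<Longrightarrow> Q2 z = R2 z"
    "\<And>z. z \<in> V \<Longrightarrow> Q3 z = R3 z"
  shows "solution_on Q2 Q3 V y \<longleftrightarrow> solution_on R2 R3 V x"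
proof -
  have ev: "\<forall>\<^sub>F w in nhds z. y w = x w" if "z \<in> V" for z
    using assms(1,2) that eventually_nhds by blast
  show ?thesis
    unfolding solution_on_def
    using assms higher_deriv_cong_ev[OF ev refl] deriv_cong_ev[OF ev refl]
    by (auto cong: holomorphic_cong)
qed

lemma solution_on_lincomb:
  assumes V: "open V" and s: "solution_on Q2 Q3 V x" "solution_on Q2 Q3 V y"
  shows "solution_on Q2 Q3 V (\<lambda>z. a * x z + b * y z)"
proof -
  have h: "x holomorphic_on V" "y holomorphic_on V"
    using s by (auto simp: solution_on_def)
  note dx = holomorphic_has_deriv[OF h(1) V] and dy = holomorphic_has_deriv[OF h(2) V]
  show ?thesis
  proof (rule solution_onI[OF V])
    fix z assume z: "z \<in> V"
    show "((\<lambda>z. a * x z + b * y z) has_field_derivative (a * deriv x z + b * deriv y z)) (at z)"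
      by (auto intro!: derivative_eq_intros dx dy z simp: algebra_simps)
    show "((\<lambda>z. a * deriv x z + b * deriv y z) has_field_derivative
       (a * (deriv ^^ 2) x z + b * (deriv ^^ 2) y z)) (at z)"
      by (auto intro!: derivative_eq_intros dx dy z simp: algebra_simps)
    show "((\<lambda>z. a * (deriv ^^ 2) x z + b * (deriv ^^ 2) y z) has_field_derivative
       (a * (deriv ^^ 3) x z + b * (deriv ^^ 3) y z)) (at z)"
      by (auto intro!: derivative_eq_intros dx dy z simp: algebra_simps)
    show "a * (deriv ^^ 3) x z + b * (deriv ^^ 3) y z + Q2 z * (a * deriv x z + b * deriv y z) +
        Q3 z * (a * x z + b * y z) = 0"
      by (simp add: solution_on_deriv3[OF s(1) z] solution_on_deriv3[OF s(2) z] algebra_simps)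
  qed
qed

lemma solution_on_lincomb3:
  assumes "open V" "solution_on Q2 Q3 V x" "solution_on Q2 Q3 V y" "solution_on Q2 Q3 V w"
  shows "solution_on Q2 Q3 V (\<lambda>z. a * x z + b * y z + c * w z)"
  using solution_on_lincomb[OF assms(1) solution_on_lincomb[OF assms(1-3), of a b] assms(4), of 1 c]
  by simp

section \<open>Wronskians and uniqueness of the equation\<close>

lemma wronskian3_expand:
  "wronskian3 u v w z =
     u z * (deriv v z * (deriv ^^ 2) w z - (deriv ^^ 2) v z * deriv w z)
   - v z * (deriv u z * (deriv ^^ 2) w z - (deriv ^^ 2) u z * deriv w z)
   + w z * (deriv u z * (deriv ^^ 2) v z - (deriv ^^ 2) u z * deriv v z)"
  by (simp add: wronskian3_def det_3 vector_3 algebra_simps)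

lemma wronskian3_cong:
  assumes "\<forall>\<^sub>F x in nhds z. u x = u' x" "\<forall>\<^sub>F x in nhds z. v x = v' x"
    "\<forall>\<^sub>F x in nhds z. w x = w' x"
  shows "wronskian3 u v w z = wronskian3 u' v' w' z"
  unfolding wronskian3_expand
    assms[THEN higher_deriv_cong_ev, OF refl] assms[THEN deriv_cong_ev, OF refl]
    assms[THEN eventually_nhds_x_imp_x]
  by (rule refl)

lemma derivs_mult:
  assumes V: "open V" "z \<in> V" and h: "r holomorphic_on V" "t holomorphic_on V"
  shows "deriv (\<lambda>z. r z * t z) z = deriv r z * t z + r z * deriv t z"
    "(deriv ^^ 2) (\<lambda>z. r z * t z) z =
       (deriv ^^ 2) r z * t z + 2 * deriv r z * deriv t z + r z * (deriv ^^ 2) t z"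
    "(deriv ^^ 3) (\<lambda>z. r z * t z) z =
       (deriv ^^ 3) r z * t z + 3 * (deriv ^^ 2) r z * deriv t z
        + 3 * deriv r z * (deriv ^^ 2) t z + r z * (deriv ^^ 3) t z"
proof -
  note dr = holomorphic_has_deriv[OF h(1) V(1)] and dt = holomorphic_has_deriv[OF h(2) V(1)]
  have 1: "((\<lambda>z. r z * t z) has_field_derivative (deriv r z * t z + r z * deriv t z)) (at z)"
    if "z \<in> V" for z
    by (auto intro!: derivative_eq_intros dr dt that simp: algebra_simps)
  have 2: "((\<lambda>z. deriv r z * t z + r z * deriv t z) has_field_derivative
     ((deriv ^^ 2) r z * t z + 2 * deriv r z * deriv t z + r z * (deriv ^^ 2) t z)) (at z)"
    if "z \<in> V" for z
    by (auto intro!: derivative_eq_intros dr dt that simp: algebra_simps)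
  have 3: "((\<lambda>z. (deriv ^^ 2) r z * t z + 2 * deriv r z * deriv t z + r z * (deriv ^^ 2) t z)
     has_field_derivative ((deriv ^^ 3) r z * t z + 3 * (deriv ^^ 2) r z * deriv t z
        + 3 * deriv r z * (deriv ^^ 2) t z + r z * (deriv ^^ 3) t z)) (at z)"
    by (auto intro!: derivative_eq_intros dr dt V(2) simp: algebra_simps)
  show "deriv (\<lambda>z. r z * t z) z = deriv r z * t z + r z * deriv t z"
    "(deriv ^^ 2) (\<lambda>z. r z * t z) z =
       (deriv ^^ 2) r z * t z + 2 * deriv r z * deriv t z + r z * (deriv ^^ 2) t z"
    by (rule derivs_eqI(1,2)[OF V 1 2]; assumption)+
  show "(deriv ^^ 3) (\<lambda>z. r z * t z) z =
       (deriv ^^ 3) r z * t z + 3 * (deriv ^^ 2) r z * deriv t z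
        + 3 * deriv r z * (deriv ^^ 2) t z + r z * (deriv ^^ 3) t z"
    by (rule derivs_eqI(3)[OF V 1 2 3]; assumption)
qed

lemma wronskian3_scale:
  assumes V: "open V" "z \<in> V"
    and h: "r holomorphic_on V" "t1 holomorphic_on V" "t2 holomorphic_on V" "t3 holomorphic_on V"
  shows "wronskian3 (\<lambda>z. r z * t1 z) (\<lambda>z. r z * t2 z) (\<lambda>z. r z * t3 z) z =
    r z ^ 3 * wronskian3 t1 t2 t3 z"
  unfolding wronskian3_expand derivs_mult[OF V h(1,2)] derivs_mult[OF V h(1,3)] derivs_mult[OF V h(1,4)]
  by (simp add: algebra_simps power3_eq_cube power2_eq_square)

text \<open>
  Cramer's rule: the vector \<open>(c, b, a)\<close> is annihilated by the Wronskian matrix.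
\<close>

lemma wronskian3_elim:
  fixes a b c :: complex
  assumes W: "wronskian3 t1 t2 t3 z \<noteq> 0"
    and e: "a * (deriv ^^ 2) t1 z + b * deriv t1 z + c * t1 z = 0"
      "a * (deriv ^^ 2) t2 z + b * deriv t2 z + c * t2 z = 0"
      "a * (deriv ^^ 2) t3 z + b * deriv t3 z + c * t3 z = 0"
  shows "a = 0" "b = 0" "c = 0"
proof -
  have "a * wronskian3 t1 t2 t3 z = 0" "b * wronskian3 t1 t2 t3 z = 0" "c * wronskian3 t1 t2 t3 z = 0"
    using e unfolding wronskian3_expand by algebra+
  with W show "a = 0" "b = 0" "c = 0" by auto
qed

text \<open>
  Subtracting \<open>r\<close> times the equation of \<open>t\<close> from that of \<open>r t\<close> leaves a relation of second order with
  coefficients \<open>3 r'\<close>, \<open>3 r'' + r (R2 - Q2)\<close> and \<open>r''' + R2 r' + r (R3 - Q3)\<close>.  Three independent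
  solutions satisfy it, so these coefficients vanish.  The absence of a second-order term thus leaves
  only locally constant factors \<open>r\<close>, and the projective class of the solutions determines the equation.
\<close>

lemma scaled_solutions_determine_equation:
  assumes V: "open V" and r: "r holomorphic_on V" "\<And>z. z \<in> V \<Longrightarrow> r z \<noteq> 0"
    and t: "solution_on Q2 Q3 V t1" "solution_on Q2 Q3 V t2" "solution_on Q2 Q3 V t3"
    and s: "solution_on R2 R3 V (\<lambda>z. r z * t1 z)" "solution_on R2 R3 V (\<lambda>z. r z * t2 z)"
      "solution_on R2 R3 V (\<lambda>z. r z * t3 z)"
    and W: "\<And>z. z \<in> V \<Longrightarrow> wronskian3 t1 t2 t3 z \<noteq> 0"
    and z: "z \<in> V"
  shows "R2 z = Q2 z" "R3 z = Q3 z"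
proof -
  have elim: "(3 * deriv r z) * (deriv ^^ 2) t z
      + (3 * (deriv ^^ 2) r z + r z * (R2 z - Q2 z)) * deriv t z
      + ((deriv ^^ 3) r z + R2 z * deriv r z + r z * (R3 z - Q3 z)) * t z = 0"
    if z: "z \<in> V" and t: "solution_on Q2 Q3 V t" and s: "solution_on R2 R3 V (\<lambda>z. r z * t z)" for z t
  proof -
    have h: "t holomorphic_on V" using t by (auto simp: solution_on_def)
    note 1 = solution_on_deriv3[OF t z]
    have "(deriv ^^ 3) (\<lambda>z. r z * t z) z + R2 z * deriv (\<lambda>z. r z * t z) z + R3 z * (r z * t z) = 0"
      using s z by (auto simp: solution_on_def)
    then show ?thesis
      unfolding derivs_mult[OF V z r(1) h] 1 by (simp add: algebra_simps)
  qed
  have e: "3 * deriv r z = 0" "3 * (deriv ^^ 2) r z + r z * (R2 z - Q2 z) = 0"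
      "(deriv ^^ 3) r z + R2 z * deriv r z + r z * (R3 z - Q3 z) = 0" if "z \<in> V" for z
    using wronskian3_elim[OF W[OF that] elim[OF that t(1) s(1)] elim[OF that t(2) s(2)]
      elim[OF that t(3) s(3)]] by auto
  have r1: "deriv r z = 0" if "z \<in> V" for z using e(1)[OF that] by simp
  have d: "(r has_field_derivative 0) (at z)" if "z \<in> V" for z
    using holomorphic_has_deriv(1)[OF r(1) V that] r1[OF that] by simp
  have "(deriv ^^ 2) r z = 0" "(deriv ^^ 3) r z = 0"
    using derivs_eqI(2)[OF V z d, of "\<lambda>_. 0"] derivs_eqI(3)[OF V z d, of "\<lambda>_. 0" 0]
    by auto
  then show "R2 z = Q2 z" "R3 z = Q3 z"
    using e(2,3)[OF z] r1[OF z] r(2)[OF z] by auto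
qed

lemma wronskian3_deriv:
  assumes V: "open V" "z \<in> V"
    and h: "t1 holomorphic_on V" "t2 holomorphic_on V" "t3 holomorphic_on V"
  shows "(wronskian3 t1 t2 t3 has_field_derivative
     t1 z * (deriv t2 z * (deriv ^^ 3) t3 z - (deriv ^^ 3) t2 z * deriv t3 z)
   - t2 z * (deriv t1 z * (deriv ^^ 3) t3 z - (deriv ^^ 3) t1 z * deriv t3 z)
   + t3 z * (deriv t1 z * (deriv ^^ 3) t2 z - (deriv ^^ 3) t1 z * deriv t2 z)) (at z)"
proof -
  note d = holomorphic_has_deriv[OF h(1) V] holomorphic_has_deriv[OF h(2) V]
    holomorphic_has_deriv[OF h(3) V]
  have "wronskian3 t1 t2 t3 = (\<lambda>z. t1 z * (deriv t2 z * (deriv ^^ 2) t3 z - (deriv ^^ 2) t2 z * deriv t3 z)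
   - t2 z * (deriv t1 z * (deriv ^^ 2) t3 z - (deriv ^^ 2) t1 z * deriv t3 z)
   + t3 z * (deriv t1 z * (deriv ^^ 2) t2 z - (deriv ^^ 2) t1 z * deriv t2 z))"
    by (simp add: wronskian3_expand fun_eq_iff)
  then show ?thesis
    by (simp only:) (auto intro!: derivative_eq_intros d simp: algebra_simps)
qed

text \<open>
  Abel's identity for an equation without second-order term.
\<close>

lemma wronskian3_solutions_deriv:
  assumes V: "open V" "z \<in> V"
    and t: "solution_on Q2 Q3 V t1" "solution_on Q2 Q3 V t2" "solution_on Q2 Q3 V t3"
  shows "(wronskian3 t1 t2 t3 has_field_derivative 0) (at z)"
proof -
  have h: "t1 holomorphic_on V" "t2 holomorphic_on V" "t3 holomorphic_on V"
    using t by (auto simp: solution_on_def)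
  note 3 = solution_on_deriv3[OF _ V(2)]
  show ?thesis
    using wronskian3_deriv[OF V h] unfolding 3[OF t(1)] 3[OF t(2)] 3[OF t(3)]
    by (rule DERIV_cong) (simp add: algebra_simps)
qed

text \<open>
  Wronskians of solutions are constant, so Cramer's rule expresses \<open>y\<close> with constant coefficients.
\<close>

lemma solutions_span:
  assumes V: "open V" "connected V"
    and t: "solution_on Q2 Q3 V t1" "solution_on Q2 Q3 V t2" "solution_on Q2 Q3 V t3"
    and W: "\<And>z. z \<in> V \<Longrightarrow> wronskian3 t1 t2 t3 z \<noteq> 0"
    and y: "solution_on Q2 Q3 V y"
  obtains a b c where "\<And>z. z \<in> V \<Longrightarrow> y z = a * t1 z + b * t2 z + c * t3 z"
proof -
  have const: "\<exists>c. \<forall>z\<in>V. wronskian3 x1 x2 x3 z = c"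
    if "solution_on Q2 Q3 V x1" "solution_on Q2 Q3 V x2" "solution_on Q2 Q3 V x3" for x1 x2 x3
  proof -
    have d: "(wronskian3 x1 x2 x3 has_field_derivative 0) (at z)" if "z \<in> V" for z
      using wronskian3_solutions_deriv[OF V(1) that] \<open>solution_on Q2 Q3 V x1\<close>
        \<open>solution_on Q2 Q3 V x2\<close> \<open>solution_on Q2 Q3 V x3\<close> .
    then have "continuous_on V (wronskian3 x1 x2 x3)"
      by (meson DERIV_continuous_on has_field_derivative_at_within)
    then obtain c where "\<And>z. z \<in> V \<Longrightarrow> wronskian3 x1 x2 x3 z = c"
      using DERIV_zero_connected_constant[OF V(2,1), of "{}" "wronskian3 x1 x2 x3"] d by blast
    then show ?thesis by blast
  qed
  obtain d where d: "\<And>z. z \<in> V \<Longrightarrow> wronskian3 t1 t2 t3 z = d"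
    using const[OF t] by auto
  obtain a where a: "\<And>z. z \<in> V \<Longrightarrow> wronskian3 y t2 t3 z = a"
    using const[OF y t(2,3)] by auto
  obtain b where b: "\<And>z. z \<in> V \<Longrightarrow> wronskian3 t1 y t3 z = b"
    using const[OF t(1) y t(3)] by auto
  obtain c where c: "\<And>z. z \<in> V \<Longrightarrow> wronskian3 t1 t2 y z = c"
    using const[OF t(1,2) y] by auto
  have "y z = (a / d) * t1 z + (b / d) * t2 z + (c / d) * t3 z" if z: "z \<in> V" for z
  proof -
    have "y z * wronskian3 t1 t2 t3 z = wronskian3 y t2 t3 z * t1 z + wronskian3 t1 y t3 z * t2 z
        + wronskian3 t1 t2 y z * t3 z"
      unfolding wronskian3_expand by algebra
    then have e: "y z * d = a * t1 z + b * t2 z + c * t3 z"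
      using a b c d z by simp
    have "d \<noteq> 0" using W[OF z] d[OF z] by simp
    with e show ?thesis by (simp add: field_simps)
  qed
  then show ?thesis using that by blast
qed

lemma solution_on_scale_locally_const:
  assumes V: "open V" and r: "r holomorphic_on V" "\<And>z. z \<in> V \<Longrightarrow> deriv r z = 0"
    and t: "solution_on Q2 Q3 V t"
  shows "solution_on Q2 Q3 V (\<lambda>z. r z * t z)"
proof -
  have h: "t holomorphic_on V" using t by (auto simp: solution_on_def)
  have d: "(r has_field_derivative 0) (at z)" if "z \<in> V" for z
    using holomorphic_has_deriv(1)[OF r(1) V that] r(2)[OF that] by simp
  have 23: "(deriv ^^ 2) r z = 0" "(deriv ^^ 3) r z = 0" if "z \<in> V" for z
    using derivs_eqI(2)[OF V that d, of "\<lambda>_. 0"] derivs_eqI(3)[OF V that d, of "\<lambda>_. 0" 0]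
    by auto
  show ?thesis
    unfolding solution_on_def
  proof (intro conjI ballI)
    show "(\<lambda>z. r z * t z) holomorphic_on V" by (intro holomorphic_intros r h)
    fix z assume z: "z \<in> V"
    show "(deriv ^^ 3) (\<lambda>z. r z * t z) z + Q2 z * deriv (\<lambda>z. r z * t z) z + Q3 z * (r z * t z) = 0"
      unfolding derivs_mult[OF V z r(1) h] solution_on_deriv3[OF t z] r(2)[OF z] 23[OF z]
      by (simp add: algebra_simps)
  qed
qed

text \<open>
  The cube root of the Wronskian may be replaced by any \<open>G\<close> that makes \<open>u\<close>, \<open>v\<close> and \<open>w\<close> solutions of an
  equation without second-order term: by Abel's identity \<open>W / G ^ 3\<close> is locally constant, so the two
  normalisations differ by a locally constant factor.  The formulas for the coefficients then solve
  the two linear equations that \<open>u / G\<close> and \<open>v / G\<close> impose on them.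
\<close>

lemma raw_Q_eq:
  assumes V: "open V" "z \<in> V" and G: "G holomorphic_on V" "\<And>z. z \<in> V \<Longrightarrow> G z \<noteq> 0"
    and h: "u holomorphic_on V" "v holomorphic_on V" "w holomorphic_on V"
    and s: "solution_on Q2 Q3 V (\<lambda>z. u z / G z)" "solution_on Q2 Q3 V (\<lambda>z. v z / G z)"
      "solution_on Q2 Q3 V (\<lambda>z. w z / G z)"
    and W: "W = wronskian3 u v w" "W z \<noteq> 0" and D: "u z * deriv v z - deriv u z * v z \<noteq> 0"
  shows "raw_Q2 W u v z = Q2 z" "raw_Q3 W u v z = Q3 z"
proof -
  define C where "C = cbrt_branch W z"
  have W_diff: "(W has_field_derivative deriv W x) (at x)" if "x \<in> V" for x
    unfolding W using wronskian3_deriv[OF V(1) that h] DERIV_deriv_iff_has_field_derivative by blast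
  then have "W analytic_on {z}"
    using V by (meson analytic_at field_differentiable_at_within field_differentiable_def holomorphic_onI)
  then have "C analytic_on {z}"
    unfolding C_def using W(2) by (intro cbrt_branch_analytic)
  then obtain V1 where V1: "open V1" "z \<in> V1" "C holomorphic_on V1"
    by (auto simp: analytic_at)
  have C3: "C x ^ 3 = W x" for x
    unfolding C_def by (rule cbrt_branch_cubed[where W = W and p = z, OF W(2)])
  have "isCont W z" using W_diff[OF V(2)] DERIV_isCont by blast
  then have "\<forall>\<^sub>F x in nhds z. W x \<noteq> 0"
    using tendsto_imp_eventually_ne[OF _ W(2)] by (simp add: isCont_def tendsto_at_iff_tendsto_nhds)
  then obtain V2 where V2: "open V2" "z \<in> V2" "\<And>x. x \<in> V2 \<Longrightarrow> W x \<noteq> 0"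
    by (auto simp: eventually_nhds)
  define U where "U = V \<inter> V1 \<inter> V2"
  have U: "open U" "z \<in> U" "U \<subseteq> V" "U \<subseteq> V1" "U \<subseteq> V2"
    using V V1 V2 by (auto simp: U_def)
  have C0: "C x \<noteq> 0" if "x \<in> U" for x
    using C3[of x] V2(3) U(5) that by auto
  have hC: "C holomorphic_on U" using V1 U holomorphic_on_subset by blast
  have hG: "G holomorphic_on U" using G U holomorphic_on_subset by blast
  have G0: "G x \<noteq> 0" if "x \<in> U" for x using G U that by auto
  have hU: "u holomorphic_on U" "v holomorphic_on U" "w holomorphic_on U"
    using h U holomorphic_on_subset by blast+
  define r where "r = (\<lambda>x. G x / C x)"
  have hr: "r holomorphic_on U" unfolding r_def by (intro holomorphic_intros hG hC C0)
  note sU = s[THEN solution_on_subset, OF U(3)]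
  define T where "T = wronskian3 (\<lambda>z. u z / G z) (\<lambda>z. v z / G z) (\<lambda>z. w z / G z)"
  have WT: "W x = G x ^ 3 * T x" if x: "x \<in> U" for x
  proof -
    have q: "(\<lambda>z. y z / G z) holomorphic_on U" if "y holomorphic_on U" for y
      by (intro holomorphic_intros hG that G0)
    have ev: "\<forall>\<^sub>F t in nhds x. y t = G t * (y t / G t)" for y
      using x U(1) G0 by (auto simp: eventually_nhds)
    have "W x = wronskian3 (\<lambda>z. G z * (u z / G z)) (\<lambda>z. G z * (v z / G z)) (\<lambda>z. G z * (w z / G z)) x"
      unfolding W by (intro wronskian3_cong ev)
    then show ?thesis
      unfolding T_def using wronskian3_scale[OF U(1) x hG q q q, OF hU] by simp
  qed
  \<comment> \<open>\<open>r ^ 3\<close> is the reciprocal of a Wronskian of solutions, which is locally constant\<close>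
  have dr: "deriv r x = 0" if x: "x \<in> U" for x
  proof -
    have e: "r y ^ 3 * T y = 1" if y: "y \<in> U" for y
    proof -
      have "r y ^ 3 * T y = (G y ^ 3 * T y) / C y ^ 3" by (simp add: r_def power_divide)
      also have "\<dots> = C y ^ 3 / C y ^ 3" using WT[OF y] C3[of y] by simp
      also have "\<dots> = 1" using C0[OF y] by simp
      finally show ?thesis .
    qed
    have "((\<lambda>y. r y ^ 3 * T y) has_field_derivative 3 * r x ^ 2 * deriv r x * T x) (at x)"
      using holomorphic_has_deriv(1)[OF hr U(1) x] wronskian3_solutions_deriv[OF U(1) x sU]
      unfolding T_def by (auto intro!: derivative_eq_intros)
    moreover have "((\<lambda>y. r y ^ 3 * T y) has_field_derivative 0) (at x)"
      by (rule has_field_derivative_transform_within_open[of "\<lambda>_. 1", OF _ U(1) x]) (use e in auto)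
    ultimately have "3 * r x ^ 2 * deriv r x * T x = 0" by (rule DERIV_unique)
    then show ?thesis using e[OF x] by auto
  qed
  have sol: "solution_on Q2 Q3 U (\<lambda>z. y z / C z)" if "solution_on Q2 Q3 U (\<lambda>z. y z / G z)" for y
    using solution_on_scale_locally_const[OF U(1) hr dr that]
    by (subst solution_on_cong[OF U(1), where x = "\<lambda>z. r z * (y z / G z)" and ?R2.0 = Q2 and ?R3.0 = Q3])
      (auto simp: r_def G0)
  define a where "a = (\<lambda>z. u z / C z)"
  define b where "b = (\<lambda>z. v z / C z)"
  have ab: "solution_on Q2 Q3 U a" "solution_on Q2 Q3 U b"
    unfolding a_def b_def using sol sU by blast+
  define k where "k = (\<lambda>x. inverse (C x))"
  have hk: "k holomorphic_on U" unfolding k_def by (intro holomorphic_intros hC C0)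
  have "a z * deriv b z - deriv a z * b z = k z ^ 2 * (u z * deriv v z - deriv u z * v z)"
  proof -
    have "a = (\<lambda>x. k x * u x)" "b = (\<lambda>x. k x * v x)"
      by (auto simp: a_def b_def k_def field_simps)
    then show ?thesis
      using derivs_mult(1)[OF U(1,2) hk hU(1)] derivs_mult(1)[OF U(1,2) hk hU(2)]
      by (simp add: algebra_simps power2_eq_square)
  qed
  then have D': "a z * deriv b z - deriv a z * b z \<noteq> 0"
    using D C0[OF U(2)] by (simp add: k_def)
  note e = solution_on_deriv3[OF ab(1) U(2)] solution_on_deriv3[OF ab(2) U(2)]
  show "raw_Q2 W u v z = Q2 z"
    unfolding raw_Q2_def C_def[symmetric] Let_def a_def[symmetric] b_def[symmetric] e
    using D' by (simp add: divide_eq_eq) (simp add: algebra_simps)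
  show "raw_Q3 W u v z = Q3 z"
    unfolding raw_Q3_def C_def[symmetric] Let_def a_def[symmetric] b_def[symmetric] e
    using D' by (simp add: divide_eq_eq) (simp add: algebra_simps)
qed

section \<open>Equations that split into first-order factors\<close>

text \<open>
  The coefficients of the equation with operator \<open>(d + a1 + a2) (d - a2) (d - a1)\<close>, where \<open>d\<close> is the
  derivation.  The three factors are chosen so that no second-order term arises.
\<close>

definition factored_Q2 :: "(complex \<Rightarrow> complex) \<Rightarrow> (complex \<Rightarrow> complex) \<Rightarrow> complex \<Rightarrow> complex" where
  "factored_Q2 a1 a2 z = - 2 * deriv a1 z - deriv a2 z - (a1 z ^ 2 + a1 z * a2 z + a2 z ^ 2)"

definition factored_Q3 :: "(complex \<Rightarrow> complex) \<Rightarrow> (complex \<Rightarrow> complex) \<Rightarrow> complex \<Rightarrow> complex" where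
  "factored_Q3 a1 a2 z = - (deriv ^^ 2) a1 z + a1 z * deriv a2 z - a1 z * deriv a1 z
     + a1 z * a2 z * (a1 z + a2 z)"

text \<open>
  The assumptions are the factored equation, written one factor at a time.
\<close>

lemma solution_on_factored:
  assumes V: "open V" and a: "a1 holomorphic_on V" "a2 holomorphic_on V"
    and y: "\<And>z. z \<in> V \<Longrightarrow> (y has_field_derivative a1 z * y z + x z) (at z)"
    and x: "\<And>z. z \<in> V \<Longrightarrow> (x has_field_derivative a2 z * x z + w z) (at z)"
    and w: "\<And>z. z \<in> V \<Longrightarrow> (w has_field_derivative - (a1 z + a2 z) * w z) (at z)"
  shows "solution_on (factored_Q2 a1 a2) (factored_Q3 a1 a2) V y"
proof (rule solution_onI[OF V])
  fix z assume z: "z \<in> V"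
  note d = holomorphic_has_deriv[OF a(1) V z] holomorphic_has_deriv[OF a(2) V z] y[OF z] x[OF z] w[OF z]
  show "(y has_field_derivative a1 z * y z + x z) (at z)" by (rule d)
  show "((\<lambda>z. a1 z * y z + x z) has_field_derivative
      deriv a1 z * y z + a1 z * (a1 z * y z + x z) + (a2 z * x z + w z)) (at z)"
    by (auto intro!: derivative_eq_intros d simp: algebra_simps)
  show "((\<lambda>z. deriv a1 z * y z + a1 z * (a1 z * y z + x z) + (a2 z * x z + w z)) has_field_derivative
      (deriv ^^ 2) a1 z * y z + 2 * deriv a1 z * (a1 z * y z + x z)
       + a1 z * (deriv a1 z * y z + a1 z * (a1 z * y z + x z) + (a2 z * x z + w z))
       + deriv a2 z * x z + a2 z * (a2 z * x z + w z) - (a1 z + a2 z) * w z) (at z)"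
    by (auto intro!: derivative_eq_intros d simp: algebra_simps)
  show "(deriv ^^ 2) a1 z * y z + 2 * deriv a1 z * (a1 z * y z + x z)
       + a1 z * (deriv a1 z * y z + a1 z * (a1 z * y z + x z) + (a2 z * x z + w z))
       + deriv a2 z * x z + a2 z * (a2 z * x z + w z) - (a1 z + a2 z) * w z
      + factored_Q2 a1 a2 z * (a1 z * y z + x z) + factored_Q3 a1 a2 z * y z = 0"
    unfolding factored_Q2_def factored_Q3_def by algebra
qed

text \<open>
  The computation common to the points of the half plane and to the cusps.  Three functions are, up
  to a common factor, \<open>1\<close>, \<open>u\<close> and \<open>p\<close>.  With \<open>v = u'\<close>, \<open>s = p' / u'\<close> and \<open>w = s'\<close> they are annihilated by
  \<open>d (1/w) d (1/v) d\<close>.  Conjugation by \<open>g\<close> removes the second-order term if the logarithmic derivative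
  \<open>a1\<close> of \<open>g\<close> is as stated, and then the operator is the one with factors given by \<open>a1\<close> and \<open>a2\<close>.
\<close>

lemma chain_solutions:
  assumes V: "open V"
    and v: "v holomorphic_on V" "\<And>z. z \<in> V \<Longrightarrow> v z \<noteq> 0"
    and w: "w holomorphic_on V" "\<And>z. z \<in> V \<Longrightarrow> w z \<noteq> 0"
    and a1: "\<And>z. z \<in> V \<Longrightarrow> a1 z = - (2 * (deriv v z / v z) + deriv w z / w z) / 3"
    and a2: "\<And>z. z \<in> V \<Longrightarrow> a2 z = (deriv v z / v z - deriv w z / w z) / 3"
    and g: "\<And>z. z \<in> V \<Longrightarrow> (g has_field_derivative a1 z * g z) (at z)"
    and u: "\<And>z. z \<in> V \<Longrightarrow> (u has_field_derivative v z) (at z)"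
    and p: "\<And>z. z \<in> V \<Longrightarrow> (p has_field_derivative v z * s z) (at z)"
    and s: "\<And>z. z \<in> V \<Longrightarrow> (s has_field_derivative w z) (at z)"
  shows "solution_on (factored_Q2 a1 a2) (factored_Q3 a1 a2) V g"
    "solution_on (factored_Q2 a1 a2) (factored_Q3 a1 a2) V (\<lambda>z. g z * u z)"
    "solution_on (factored_Q2 a1 a2) (factored_Q3 a1 a2) V (\<lambda>z. g z * p z)"
    "\<And>z. z \<in> V \<Longrightarrow> wronskian3 g (\<lambda>z. g z * u z) (\<lambda>z. g z * p z) z = g z ^ 3 * v z ^ 2 * w z"
proof -
  have hd: "deriv v holomorphic_on V" "deriv w holomorphic_on V"
    using v w V by (auto intro: holomorphic_deriv)
  have ha: "a1 holomorphic_on V"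
    by (rule holomorphic_transform[of "\<lambda>z. - (2 * (deriv v z / v z) + deriv w z / w z) / 3"])
      (intro holomorphic_intros v w hd, auto simp: a1)
  have hb: "a2 holomorphic_on V"
    by (rule holomorphic_transform[of "\<lambda>z. (deriv v z / v z - deriv w z / w z) / 3"])
      (intro holomorphic_intros v w hd, auto simp: a2)
  note dv = holomorphic_has_deriv(1)[OF v(1) V] and dw = holomorphic_has_deriv(1)[OF w(1) V]
  note sol = solution_on_factored[OF V ha hb]
  have A: "deriv v z = (a2 z - a1 z) * v z" if "z \<in> V" for z
    unfolding a1[OF that] a2[OF that] using v(2)[OF that] w(2)[OF that] by (simp add: field_simps)
  have B: "deriv w z = - (a1 z + 2 * a2 z) * w z" if "z \<in> V" for z
    unfolding a1[OF that] a2[OF that] using v(2)[OF that] w(2)[OF that] by (simp add: field_simps)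
  show "solution_on (factored_Q2 a1 a2) (factored_Q3 a1 a2) V g"
    by (rule sol[where x = "\<lambda>_. 0" and w = "\<lambda>_. 0"]) (auto intro!: derivative_eq_intros g)
  show "solution_on (factored_Q2 a1 a2) (factored_Q3 a1 a2) V (\<lambda>z. g z * u z)"
  proof (rule sol[where x = "\<lambda>z. g z * v z" and w = "\<lambda>_. 0"])
    fix z assume z: "z \<in> V"
    show "((\<lambda>z. g z * u z) has_field_derivative a1 z * (g z * u z) + g z * v z) (at z)"
      by (rule derivative_eq_intros g[OF z] u[OF z] refl)+ (simp add: algebra_simps)
    show "((\<lambda>z. g z * v z) has_field_derivative a2 z * (g z * v z) + 0) (at z)"
      by (rule derivative_eq_intros g[OF z] dv[OF z] refl)+ (simp add: A[OF z] algebra_simps)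
  qed (auto intro!: derivative_eq_intros)
  show "solution_on (factored_Q2 a1 a2) (factored_Q3 a1 a2) V (\<lambda>z. g z * p z)"
  proof (rule sol[where x = "\<lambda>z. g z * v z * s z" and w = "\<lambda>z. g z * v z * w z"])
    fix z assume z: "z \<in> V"
    show "((\<lambda>z. g z * p z) has_field_derivative a1 z * (g z * p z) + g z * v z * s z) (at z)"
      by (rule derivative_eq_intros g[OF z] p[OF z] refl)+ (simp add: algebra_simps)
    show "((\<lambda>z. g z * v z * s z) has_field_derivative a2 z * (g z * v z * s z) + g z * v z * w z) (at z)"
      by (rule derivative_eq_intros g[OF z] dv[OF z] s[OF z] refl)+ (simp add: A[OF z] algebra_simps)
    show "((\<lambda>z. g z * v z * w z) has_field_derivative - (a1 z + a2 z) * (g z * v z * w z)) (at z)"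
      by (rule derivative_eq_intros g[OF z] dv[OF z] dw[OF z] refl)+
        (simp add: A[OF z] B[OF z] algebra_simps)
  qed
  fix z assume z: "z \<in> V"
  have hg: "g holomorphic_on V" and hu: "u holomorphic_on V" and hp: "p holomorphic_on V"
    and h1: "(\<lambda>_. 1::complex) holomorphic_on V"
    using g u p by (meson field_differentiable_at_within field_differentiable_def holomorphic_onI, meson field_differentiable_at_within field_differentiable_def holomorphic_onI, meson field_differentiable_at_within field_differentiable_def holomorphic_onI, simp)
  have "wronskian3 g (\<lambda>z. g z * u z) (\<lambda>z. g z * p z) z
     = g z ^ 3 * wronskian3 (\<lambda>_. 1) u p z"
    using wronskian3_scale[OF V z hg h1 hu hp] by simp
  also have "wronskian3 (\<lambda>_. 1) u p z = v z ^ 2 * w z"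
  proof -
    have u2: "deriv u z = v z" "(deriv ^^ 2) u z = deriv v z"
      using derivs_eqI(1,2)[OF V z u dv] by auto
    have p': "((\<lambda>z. v z * s z) has_field_derivative deriv v z * s z + v z * w z) (at z)" if "z \<in> V" for z
      by (rule derivative_eq_intros dv[OF that] s[OF that] refl)+ simp
    have p2: "deriv p z = v z * s z" "(deriv ^^ 2) p z = deriv v z * s z + v z * w z"
      using derivs_eqI(1,2)[OF V z p p'] by auto
    have "(deriv ^^ 2) (\<lambda>_. 1) z = (0::complex)" by (simp add: numeral_2_eq_2)
    then show ?thesis
      unfolding wronskian3_expand u2 p2 by (simp add: algebra_simps power2_eq_square)
  qed
  finally show "wronskian3 g (\<lambda>z. g z * u z) (\<lambda>z. g z * p z) z = g z ^ 3 * v z ^ 2 * w z" by simp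
qed

section \<open>Exponents at a point\<close>

lemma deriv_power_mult:
  fixes U :: "complex \<Rightarrow> complex"
  assumes "(U has_field_derivative U') (at z)" "n > 0"
  shows "((\<lambda>z. (z - z0) ^ n * U z) has_field_derivative
     (z - z0) ^ (n - 1) * (of_nat n * U z + (z - z0) * U')) (at z)"
proof -
  have "((\<lambda>z. (z - z0) ^ n * U z) has_field_derivative
     of_nat n * (z - z0) ^ (n - 1) * U z + (z - z0) ^ n * U') (at z)"
    by (rule derivative_eq_intros assms refl)+ simp
  moreover have "(z - z0) ^ n = (z - z0) ^ (n - 1) * (z - z0)"
    using assms(2) by (metis power_minus_mult)
  ultimately show ?thesis by (simp add: algebra_simps)
qed

lemma holomorphic_nonzero_ball:
  fixes f :: "complex \<Rightarrow> complex"
  assumes "f holomorphic_on ball z0 r" "r > 0" "f z0 \<noteq> 0"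
  obtains R where "0 < R" "R \<le> r" "\<And>z. z \<in> ball z0 R \<Longrightarrow> f z \<noteq> 0"
proof -
  have "continuous_on (ball z0 r) f" using assms holomorphic_on_imp_continuous_on by blast
  then obtain e where e: "e > 0" "\<And>z. z \<in> ball z0 r \<Longrightarrow> dist z0 z < e \<Longrightarrow> f z \<noteq> 0"
    using continuous_on_avoid[of "ball z0 r" f z0 0] assms by auto
  show ?thesis by (rule that[of "min e r"]) (use e assms in auto)
qed

lemma log_deriv_exists_ball:
  fixes f :: "complex \<Rightarrow> complex"
  assumes "f holomorphic_on ball z0 r" "\<And>z. z \<in> ball z0 r \<Longrightarrow> f z \<noteq> 0" "r > 0"
  obtains L where "L holomorphic_on ball z0 r"
    "\<And>z. z \<in> ball z0 r \<Longrightarrow> (L has_field_derivative deriv f z / f z) (at z)"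
proof -
  obtain L where L: "L holomorphic_on ball z0 r" "\<And>z. z \<in> ball z0 r \<Longrightarrow> exp (L z) = f z"
    using holomorphic_logarithm_exists[of "ball z0 r" f z0] assms by auto
  have "(L has_field_derivative deriv f z / f z) (at z)" if z: "z \<in> ball z0 r" for z
  proof -
    have d: "(L has_field_derivative deriv L z) (at z)"
      using holomorphic_has_deriv(1)[OF L(1) _ z] by simp
    then have "((\<lambda>z. exp (L z)) has_field_derivative exp (L z) * deriv L z) (at z)"
      by (auto intro!: derivative_eq_intros)
    then have "(f has_field_derivative exp (L z) * deriv L z) (at z)"
      by (rule has_field_derivative_transform_within_open[OF _ _ z]) (use L in auto)
    then have "deriv f z = f z * deriv L z"
      using DERIV_imp_deriv L(2)[OF z] by fastforce
    with d assms(2)[OF z] show ?thesis by simp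
  qed
  with L(1) show ?thesis by (rule that)
qed

text \<open>
  Rational identities with \<open>t\<close> in the role of \<open>z - z0\<close>: the second derivative of \<open>E / t\<close>, the factored
  coefficients over the denominators \<open>t ^ 2\<close> and \<open>t ^ 3\<close>, and logarithmic derivatives of products with
  a power of \<open>t\<close>.
\<close>

lemma factor_algebra:
  fixes t :: complex
  assumes "t \<noteq> 0"
  shows "(t * e2 * t ^ 2 - (t * e1 - e0) * (2 * t)) / (t ^ 2 * t ^ 2) = (t ^ 2 * e2 - 2 * t * e1 + 2 * e0) / t ^ 3"
    "- 2 * ((t * e1 - e0) / t ^ 2) - (t * f1 - f0) / t ^ 2 - ((e0 / t) ^ 2 + e0 / t * (f0 / t) + (f0 / t) ^ 2)
      = (- 2 * (t * e1 - e0) - (t * f1 - f0) - (e0 ^ 2 + e0 * f0 + f0 ^ 2)) / t ^ 2"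
    "- ((t ^ 2 * e2 - 2 * t * e1 + 2 * e0) / t ^ 3) + e0 / t * ((t * f1 - f0) / t ^ 2) - e0 / t * ((t * e1 - e0) / t ^ 2)
        + e0 / t * (f0 / t) * (e0 / t + f0 / t)
      = (- (t ^ 2 * e2 - 2 * t * e1 + 2 * e0) + e0 * (t * f1 - f0) - e0 * (t * e1 - e0) + e0 * f0 * (e0 + f0)) / t ^ 3"
    "X \<noteq> 0 \<Longrightarrow> f0 \<noteq> 0 \<Longrightarrow> (e0 * (X / t) * f0 + X * f1) / (X * f0) = (e0 + t * (f1 / f0)) / t"
    "- (2 * e0 + f0) / 3 / t = - (2 * (e0 / t) + f0 / t) / 3"
    "(e0 - f0) / 3 / t = (e0 / t - f0 / t) / 3"
  using assms by (simp_all add: field_simps power2_eq_square power3_eq_cube)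

text \<open>
  Dividing by the function of lowest order turns the triple into \<open>1\<close>, \<open>u\<close>, \<open>p\<close>, to which
  \<open>chain_solutions\<close> applies.  The functions \<open>v\<close> and \<open>w\<close> there vanish to orders \<open>n2 - n1 - 1\<close> and
  \<open>n3 - n2 - 1\<close>, so \<open>a1\<close> and \<open>a2\<close> have at most simple poles and the equation has a regular singularity.
  Its exponents are the orders \<open>n\<^sub>j\<close> diminished by a third of \<open>n1 + n2 + n3 - 3\<close>.  The only multivalued
  factor is a power of \<open>z - z0\<close>, kept apart as the exponential of a branch \<open>L\<close> of the logarithm; this
  is why no logarithms occur in the solutions.
\<close>

lemma local_structure:
  fixes z0 :: complex and n1 n2 n3 :: nat
  assumes n: "n1 < n2" "n2 < n3" and r: "r > 0"
    and Y: "Y1 holomorphic_on ball z0 r" "Y2 holomorphic_on ball z0 r" "Y3 holomorphic_on ball z0 r"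
    and Y0: "Y1 z0 \<noteq> 0" "Y2 z0 \<noteq> 0" "Y3 z0 \<noteq> 0"
  defines "e \<equiv> (of_nat n2 + of_nat n3 - 2 * of_nat n1 - 3) / 3 :: complex"
  obtains R G C2 C3 P1 P2 P3 where "0 < R" "R \<le> r"
    "G holomorphic_on ball z0 R" "C2 holomorphic_on ball z0 R" "C3 holomorphic_on ball z0 R"
    "P1 holomorphic_on ball z0 R" "P2 holomorphic_on ball z0 R" "P3 holomorphic_on ball z0 R"
    "\<And>x::complex. x * (x - 1) * (x - 2) + C2 z0 * x + C3 z0 =
      (x + e) * (x - (2 * of_nat n2 - of_nat n1 - of_nat n3 + 3) / 3)
         * (x - (2 * of_nat n3 - of_nat n1 - of_nat n2 + 3) / 3)"
    "\<And>z. z \<in> ball z0 R - {z0} \<Longrightarrow> G z \<noteq> 0"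
    "\<And>z. z \<in> ball z0 R \<Longrightarrow> (z - z0) ^ n1 * Y1 z = G z * P1 z"
    "\<And>z. z \<in> ball z0 R \<Longrightarrow> (z - z0) ^ n2 * Y2 z = G z * P2 z"
    "\<And>z. z \<in> ball z0 R \<Longrightarrow> (z - z0) ^ n3 * Y3 z = G z * P3 z"
    "\<And>V L. open V \<Longrightarrow> V \<subseteq> ball z0 R - {z0} \<Longrightarrow> L holomorphic_on V \<Longrightarrow>
       (\<And>z. z \<in> V \<Longrightarrow> exp (L z) = z - z0) \<Longrightarrow>
       solution_on (\<lambda>z. C2 z / (z - z0) ^ 2) (\<lambda>z. C3 z / (z - z0) ^ 3) V (\<lambda>z. exp (- e * L z) * P1 z) \<and>
       solution_on (\<lambda>z. C2 z / (z - z0) ^ 2) (\<lambda>z. C3 z / (z - z0) ^ 3) V (\<lambda>z. exp (- e * L z) * P2 z) \<and>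
       solution_on (\<lambda>z. C2 z / (z - z0) ^ 2) (\<lambda>z. C3 z / (z - z0) ^ 3) V (\<lambda>z. exp (- e * L z) * P3 z) \<and>
       (\<forall>z\<in>V. wronskian3 (\<lambda>z. exp (- e * L z) * P1 z) (\<lambda>z. exp (- e * L z) * P2 z)
          (\<lambda>z. exp (- e * L z) * P3 z) z \<noteq> 0)"
proof -
  define d where "d = n2 - n1"
  define k where "k = n3 - n2"
  have dk: "d > 0" "k > 0" using n by (auto simp: d_def k_def)
  have n23: "n2 = n1 + d" "n3 = n1 + d + k" using n by (auto simp: d_def k_def)
  obtain R1 where R1: "0 < R1" "R1 \<le> r" "\<And>z. z \<in> ball z0 R1 \<Longrightarrow> Y1 z \<noteq> 0"
    using holomorphic_nonzero_ball[OF Y(1) r Y0(1)] by blast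
  \<comment> \<open>in the notation of \<open>chain_solutions\<close>: \<open>u = (z - z0) ^ d * U2\<close> and \<open>p = (z - z0) ^ (d + k) * U3\<close>,
    and then \<open>v0\<close>, \<open>s0\<close> and \<open>w0\<close> are \<open>v\<close>, \<open>s\<close> and \<open>w\<close> without their powers of \<open>z - z0\<close>\<close>
  define U2 where "U2 = (\<lambda>z. Y2 z / Y1 z)"
  define U3 where "U3 = (\<lambda>z. Y3 z / Y1 z)"
  have sub: "ball z0 R1 \<subseteq> ball z0 r" using R1 by auto
  have hU: "U2 holomorphic_on ball z0 R1" "U3 holomorphic_on ball z0 R1"
    unfolding U2_def U3_def
    by (intro holomorphic_on_divide holomorphic_on_subset[OF _ sub] Y R1(3); assumption)+
  have hU': "deriv U2 holomorphic_on ball z0 R1" "deriv U3 holomorphic_on ball z0 R1"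
    using hU by (auto intro: holomorphic_deriv)
  define v0 where "v0 = (\<lambda>z. of_nat d * U2 z + (z - z0) * deriv U2 z)"
  define p0 where "p0 = (\<lambda>z. of_nat (d + k) * U3 z + (z - z0) * deriv U3 z)"
  have hv0: "v0 holomorphic_on ball z0 R1" and hp0: "p0 holomorphic_on ball z0 R1"
    unfolding v0_def p0_def by (intro holomorphic_intros hU hU')+
  have "v0 z0 \<noteq> 0" using dk Y0 by (simp add: v0_def U2_def)
  then obtain R2 where R2: "0 < R2" "R2 \<le> R1" "\<And>z. z \<in> ball z0 R2 \<Longrightarrow> v0 z \<noteq> 0"
    using holomorphic_nonzero_ball[OF hv0 R1(1)] by blast
  define s0 where "s0 = (\<lambda>z. p0 z / v0 z)"
  have sub2: "ball z0 R2 \<subseteq> ball z0 R1" using R2 by auto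
  have hs0: "s0 holomorphic_on ball z0 R2"
    unfolding s0_def
    by (intro holomorphic_on_divide holomorphic_on_subset[OF _ sub2] hv0 hp0 R2(3))
  then have hs0': "deriv s0 holomorphic_on ball z0 R2" by (auto intro: holomorphic_deriv)
  define w0 where "w0 = (\<lambda>z. of_nat k * s0 z + (z - z0) * deriv s0 z)"
  have hw0: "w0 holomorphic_on ball z0 R2"
    unfolding w0_def by (intro holomorphic_intros hs0 hs0')
  have "p0 z0 \<noteq> 0" using dk Y0 of_nat_eq_0_iff[of "d + k", where 'a = complex]
    by (simp add: p0_def U3_def del: of_nat_add)
  then have "w0 z0 \<noteq> 0" using dk R2 by (simp add: w0_def s0_def)
  then obtain R where R: "0 < R" "R \<le> R2" "\<And>z. z \<in> ball z0 R \<Longrightarrow> w0 z \<noteq> 0"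
    using holomorphic_nonzero_ball[OF hw0 R2(1)] by blast
  have Rsub: "ball z0 R \<subseteq> ball z0 R2" "ball z0 R \<subseteq> ball z0 R1" "ball z0 R \<subseteq> ball z0 r"
    using R R1 R2 by auto
  have nz: "Y1 z \<noteq> 0" "v0 z \<noteq> 0" "w0 z \<noteq> 0" if "z \<in> ball z0 R" for z
    using R1(3) R2(3) R(3) Rsub that by blast+
  note hv = holomorphic_on_subset[OF hv0 Rsub(2)] and hw = holomorphic_on_subset[OF hw0 Rsub(1)]
  note hYR = Y[THEN holomorphic_on_subset, OF Rsub(3)]
  have hv': "deriv v0 holomorphic_on ball z0 R" and hw': "deriv w0 holomorphic_on ball z0 R"
    using hv hw by (auto intro: holomorphic_deriv)
  obtain Lv where Lv: "Lv holomorphic_on ball z0 R"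
    "\<And>z. z \<in> ball z0 R \<Longrightarrow> (Lv has_field_derivative deriv v0 z / v0 z) (at z)"
    using log_deriv_exists_ball[OF hv nz(2) R(1)] by blast
  obtain Lw where Lw: "Lw holomorphic_on ball z0 R"
    "\<And>z. z \<in> ball z0 R \<Longrightarrow> (Lw has_field_derivative deriv w0 z / w0 z) (at z)"
    using log_deriv_exists_ball[OF hw nz(3) R(1)] by blast
  \<comment> \<open>a cube root of \<open>v0 ^ 2 * w0\<close>, up to a constant\<close>
  define K where "K = (\<lambda>z. exp ((2 * Lv z + Lw z) / 3))"
  have hK: "K holomorphic_on ball z0 R" unfolding K_def by (intro holomorphic_intros Lv Lw) auto
  \<comment> \<open>\<open>M\<close> and \<open>N\<close> are \<open>z - z0\<close> times the logarithmic derivatives of \<open>v\<close> and \<open>w\<close>\<close>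
  define M where "M = (\<lambda>z. of_nat (d - 1) + (z - z0) * (deriv v0 z / v0 z))"
  define N where "N = (\<lambda>z. of_nat (k - 1) + (z - z0) * (deriv w0 z / w0 z))"
  \<comment> \<open>\<open>a1 = E1 / (z - z0)\<close> and \<open>a2 = E2 / (z - z0)\<close>\<close>
  define E1 where "E1 = (\<lambda>z. - (2 * M z + N z) / 3)"
  define E2 where "E2 = (\<lambda>z. (M z - N z) / 3)"
  have hE: "E1 holomorphic_on ball z0 R" "E2 holomorphic_on ball z0 R"
    unfolding E1_def E2_def M_def N_def
    by (intro holomorphic_intros hv hw hv' hw' nz; simp)+
  have hE': "deriv E1 holomorphic_on ball z0 R" "deriv E2 holomorphic_on ball z0 R"
    "(deriv ^^ 2) E1 holomorphic_on ball z0 R"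
    using hE by (auto intro: holomorphic_deriv holomorphic_higher_deriv)
  define C2 where "C2 = (\<lambda>z. - 2 * ((z - z0) * deriv E1 z - E1 z) - ((z - z0) * deriv E2 z - E2 z)
     - (E1 z ^ 2 + E1 z * E2 z + E2 z ^ 2))"
  define C3 where "C3 = (\<lambda>z. - ((z - z0) ^ 2 * (deriv ^^ 2) E1 z - 2 * (z - z0) * deriv E1 z + 2 * E1 z)
     + E1 z * ((z - z0) * deriv E2 z - E2 z) - E1 z * ((z - z0) * deriv E1 z - E1 z)
     + E1 z * E2 z * (E1 z + E2 z))"
  define G where "G = (\<lambda>z. (z - z0) ^ n1 * Y1 z * K z)"
  define P1 where "P1 = (\<lambda>z. 1 / K z)"
  define P2 where "P2 = (\<lambda>z. 1 / K z * ((z - z0) ^ d * U2 z))"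
  define P3 where "P3 = (\<lambda>z. 1 / K z * ((z - z0) ^ (d + k) * U3 z))"
  have K0: "K z \<noteq> 0" for z by (simp add: K_def)
  show ?thesis
  proof (rule that[of R G C2 C3 P1 P2 P3])
    show "0 < R" "R \<le> r" using R R1 R2 by auto
    show "G holomorphic_on ball z0 R" unfolding G_def by (intro holomorphic_intros hK hYR)
    show "C2 holomorphic_on ball z0 R" "C3 holomorphic_on ball z0 R"
      unfolding C2_def C3_def by (intro holomorphic_intros hE hE')+
    show "P1 holomorphic_on ball z0 R" "P2 holomorphic_on ball z0 R" "P3 holomorphic_on ball z0 R"
      unfolding P1_def P2_def P3_def
      by (intro holomorphic_intros hK K0 hU[THEN holomorphic_on_subset] Rsub)+
    show "G z \<noteq> 0" if "z \<in> ball z0 R - {z0}" for z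
      using that nz(1) K0 by (auto simp: G_def)
    show "(z - z0) ^ n1 * Y1 z = G z * P1 z" if "z \<in> ball z0 R" for z
      using K0[of z] by (simp add: G_def P1_def)
    show "(z - z0) ^ n2 * Y2 z = G z * P2 z" if "z \<in> ball z0 R" for z
      using K0[of z] nz(1)[OF that] by (simp add: G_def P2_def U2_def n23 power_add)
    show "(z - z0) ^ n3 * Y3 z = G z * P3 z" if "z \<in> ball z0 R" for z
      using K0[of z] nz(1)[OF that] by (simp add: G_def P3_def U3_def n23 power_add)
    have d1: "of_nat (d - 1) = (of_nat d - 1 :: complex)" "of_nat (k - 1) = (of_nat k - 1 :: complex)"
      using dk by (auto simp: of_nat_diff)
    show "x * (x - 1) * (x - 2) + C2 z0 * x + C3 z0 =
      (x + e) * (x - (2 * of_nat n2 - of_nat n1 - of_nat n3 + 3) / 3)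
         * (x - (2 * of_nat n3 - of_nat n1 - of_nat n2 + 3) / 3)" for x
      unfolding C2_def C3_def E1_def E2_def M_def N_def e_def n23 d1
      by (simp add: field_simps power2_eq_square power3_eq_cube)
    fix V L assume V: "open V" "V \<subseteq> ball z0 R - {z0}" and L: "L holomorphic_on V"
      "\<And>z. z \<in> V \<Longrightarrow> exp (L z) = z - z0"
    have VR: "V \<subseteq> ball z0 R" and z0: "\<And>z. z \<in> V \<Longrightarrow> z - z0 \<noteq> 0" using V(2) by auto
    define a1 where "a1 = (\<lambda>z. E1 z / (z - z0))"
    define a2 where "a2 = (\<lambda>z. E2 z / (z - z0))"
    have dE: "(E1 has_field_derivative deriv E1 z) (at z)"
      "(deriv E1 has_field_derivative (deriv ^^ 2) E1 z) (at z)"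
      "(E2 has_field_derivative deriv E2 z) (at z)" if "z \<in> V" for z
      using holomorphic_has_deriv[OF hE(1) _ subsetD[OF VR that]]
        holomorphic_has_deriv[OF hE(2) _ subsetD[OF VR that]] by auto
    have da1: "(a1 has_field_derivative ((z - z0) * deriv E1 z - E1 z) / (z - z0) ^ 2) (at z)"
      and da2: "(a2 has_field_derivative ((z - z0) * deriv E2 z - E2 z) / (z - z0) ^ 2) (at z)"
      if "z \<in> V" for z
      unfolding a1_def a2_def using z0[OF that]
      by (auto intro!: derivative_eq_intros dE that simp: power2_eq_square field_simps)
    have dda1: "((\<lambda>z. ((z - z0) * deriv E1 z - E1 z) / (z - z0) ^ 2) has_field_derivative
        ((z - z0) ^ 2 * (deriv ^^ 2) E1 z - 2 * (z - z0) * deriv E1 z + 2 * E1 z) / (z - z0) ^ 3) (at z)"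
      if "z \<in> V" for z
      unfolding factor_algebra(1)[OF z0[OF that], symmetric]
      by (rule DERIV_cong[OF DERIV_divide]) (use z0[OF that] in \<open>auto intro!: derivative_eq_intros dE that\<close>)
    have Q2: "factored_Q2 a1 a2 z = C2 z / (z - z0) ^ 2" if "z \<in> V" for z
      unfolding factored_Q2_def DERIV_imp_deriv[OF da1[OF that]] DERIV_imp_deriv[OF da2[OF that]]
      unfolding a1_def a2_def C2_def by (rule factor_algebra(2)[OF z0[OF that]])
    have dd: "(deriv ^^ 2) a1 z =
        ((z - z0) ^ 2 * (deriv ^^ 2) E1 z - 2 * (z - z0) * deriv E1 z + 2 * E1 z) / (z - z0) ^ 3"
      if "z \<in> V" for z
      by (rule derivs_eqI(2)[OF V(1) that da1 dda1])
    have Q3: "factored_Q3 a1 a2 z = C3 z / (z - z0) ^ 3" if "z \<in> V" for z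
      unfolding factored_Q3_def DERIV_imp_deriv[OF da1[OF that]] DERIV_imp_deriv[OF da2[OF that]] dd[OF that]
      unfolding a1_def a2_def C3_def by (rule factor_algebra(3)[OF z0[OF that]])
    define v where "v = (\<lambda>z. (z - z0) ^ (d - 1) * v0 z)"
    define w where "w = (\<lambda>z. (z - z0) ^ (k - 1) * w0 z)"
    define g where "g = (\<lambda>z. exp (- e * L z) * P1 z)"
    have hvw: "v holomorphic_on V" "w holomorphic_on V"
      unfolding v_def w_def
      by (intro holomorphic_intros hv[THEN holomorphic_on_subset] hw[THEN holomorphic_on_subset] VR)+
    have vw0: "v z \<noteq> 0" "w z \<noteq> 0" if "z \<in> V" for z
      using nz z0[OF that] subsetD[OF VR that] by (auto simp: v_def w_def)
    have ld: "deriv (\<lambda>z. (z - z0) ^ j * f z) z / ((z - z0) ^ j * f z)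
        = (of_nat j + (z - z0) * (deriv f z / f z)) / (z - z0)"
      if z: "z \<in> V" and f: "f holomorphic_on ball z0 R" "f z \<noteq> 0" for z f j
    proof -
      have df: "(f has_field_derivative deriv f z) (at z)"
        using holomorphic_has_deriv(1)[OF f(1) _ subsetD[OF VR z]] by simp
      have "((\<lambda>z. (z - z0) ^ j * f z) has_field_derivative
         of_nat j * (z - z0) ^ (j - 1) * f z + (z - z0) ^ j * deriv f z) (at z)"
        by (rule derivative_eq_intros df refl)+ simp
      moreover have "of_nat j * (z - z0) ^ (j - 1) = of_nat j * ((z - z0) ^ j / (z - z0))"
        using z0[OF z] by (cases j) auto
      ultimately have "deriv (\<lambda>z. (z - z0) ^ j * f z) z
          = of_nat j * ((z - z0) ^ j / (z - z0)) * f z + (z - z0) ^ j * deriv f z"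
        by (simp add: DERIV_imp_deriv)
      then show ?thesis
        using factor_algebra(4)[OF z0[OF z], of "(z - z0) ^ j"] z0[OF z] f(2) by simp
    qed
    have A: "deriv v z / v z = M z / (z - z0)" and B: "deriv w z / w z = N z / (z - z0)" if "z \<in> V" for z
      using ld[OF that hv nz(2)] ld[OF that hw nz(3)] subsetD[OF VR that]
      unfolding v_def w_def M_def N_def by auto
    have e_eq: "e = (2 * of_nat (d - 1) + of_nat (k - 1)) / 3"
      unfolding e_def n23 d1 by (simp add: field_simps)
    have a1_eq: "a1 z = - (2 * (deriv v z / v z) + deriv w z / w z) / 3" if z: "z \<in> V" for z
      unfolding A[OF z] B[OF z] a1_def E1_def by (rule factor_algebra(5)[OF z0[OF z]])
    have a2_eq: "a2 z = (deriv v z / v z - deriv w z / w z) / 3" if z: "z \<in> V" for z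
      unfolding A[OF z] B[OF z] a2_def E2_def by (rule factor_algebra(6)[OF z0[OF z]])
    have dL: "(L has_field_derivative 1 / (z - z0)) (at z)" if z: "z \<in> V" for z
    proof -
      have d: "(L has_field_derivative deriv L z) (at z)"
        using holomorphic_has_deriv(1)[OF L(1) V(1) z] .
      then have "((\<lambda>z. exp (L z)) has_field_derivative exp (L z) * deriv L z) (at z)"
        by (auto intro!: derivative_eq_intros)
      then have "((\<lambda>z. z - z0) has_field_derivative exp (L z) * deriv L z) (at z)"
        by (rule has_field_derivative_transform_within_open[OF _ V(1) z]) (use L in auto)
      moreover have "((\<lambda>z. z - z0) has_field_derivative 1) (at z)"
        by (auto intro!: derivative_eq_intros)
      ultimately have "(z - z0) * deriv L z = 1"
        using DERIV_unique L(2)[OF z] by fastforce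
      with d z0[OF z] show ?thesis by (metis nonzero_mult_div_cancel_left)
    qed
    have dg: "(g has_field_derivative a1 z * g z) (at z)" if z: "z \<in> V" for z
    proof -
      have g_eq: "g = (\<lambda>z. exp (- e * L z - (2 * Lv z + Lw z) / 3))"
        by (simp add: g_def P1_def K_def fun_eq_iff exp_diff)
      have "(g has_field_derivative (- e * (1 / (z - z0))
          - (2 * (deriv v0 z / v0 z) + deriv w0 z / w0 z) / 3) * g z) (at z)"
        unfolding g_eq using subsetD[OF VR z]
        by (auto intro!: derivative_eq_intros dL[OF z] Lv(2) Lw(2))
      moreover have "- e * (1 / (z - z0)) - (2 * (deriv v0 z / v0 z) + deriv w0 z / w0 z) / 3 = a1 z"
        unfolding a1_def E1_def M_def N_def e_eq using z0[OF z] nz[OF subsetD[OF VR z]]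
        by (simp add: field_simps)
      ultimately show ?thesis by simp
    qed
    have dU: "(U2 has_field_derivative deriv U2 z) (at z)"
      "(U3 has_field_derivative deriv U3 z) (at z)"
      "(s0 has_field_derivative deriv s0 z) (at z)" if "z \<in> V" for z
      using holomorphic_has_deriv(1)[OF hU(1)] holomorphic_has_deriv(1)[OF hU(2)]
        holomorphic_has_deriv(1)[OF hs0] that VR Rsub by blast+
    have du: "((\<lambda>z. (z - z0) ^ d * U2 z) has_field_derivative v z) (at z)" if z: "z \<in> V" for z
      using deriv_power_mult[OF dU(1)[OF z] dk(1)] by (simp add: v_def v0_def)
    have ds: "((\<lambda>z. (z - z0) ^ k * s0 z) has_field_derivative w z) (at z)" if z: "z \<in> V" for z
      using deriv_power_mult[OF dU(3)[OF z] dk(2)] by (simp add: w_def w0_def)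
    have dp: "((\<lambda>z. (z - z0) ^ (d + k) * U3 z) has_field_derivative v z * ((z - z0) ^ k * s0 z)) (at z)"
      if z: "z \<in> V" for z
    proof -
      have "d + k > 0" "d + k - 1 = (d - 1) + k" using dk by auto
      then show ?thesis
        using deriv_power_mult[OF dU(2)[OF z], of "d + k"] nz(2)[OF subsetD[OF VR z]]
        by (simp add: v_def s0_def p0_def power_add mult.assoc del: of_nat_add)
    qed
    note ch = chain_solutions[OF V(1) hvw(1) vw0(1) hvw(2) vw0(2) a1_eq a2_eq dg du dp ds, simplified]
    have P: "g = (\<lambda>z. exp (- e * L z) * P1 z)"
      "(\<lambda>z. g z * ((z - z0) ^ d * U2 z)) = (\<lambda>z. exp (- e * L z) * P2 z)"
      "(\<lambda>z. g z * ((z - z0) ^ (d + k) * U3 z)) = (\<lambda>z. exp (- e * L z) * P3 z)"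
      unfolding g_def P1_def P2_def P3_def by (auto simp: fun_eq_iff mult.assoc)
    have sol: "solution_on (factored_Q2 a1 a2) (factored_Q3 a1 a2) V y \<longleftrightarrow>
       solution_on (\<lambda>z. C2 z / (z - z0) ^ 2) (\<lambda>z. C3 z / (z - z0) ^ 3) V y" for y
      by (rule solution_on_cong[OF V(1) refl Q2 Q3])
    have g0: "g z \<noteq> 0" for z using K0[of z] by (simp add: g_def P1_def)
    show "solution_on (\<lambda>z. C2 z / (z - z0) ^ 2) (\<lambda>z. C3 z / (z - z0) ^ 3) V (\<lambda>z. exp (- e * L z) * P1 z) \<and>
       solution_on (\<lambda>z. C2 z / (z - z0) ^ 2) (\<lambda>z. C3 z / (z - z0) ^ 3) V (\<lambda>z. exp (- e * L z) * P2 z) \<and>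
       solution_on (\<lambda>z. C2 z / (z - z0) ^ 2) (\<lambda>z. C3 z / (z - z0) ^ 3) V (\<lambda>z. exp (- e * L z) * P3 z) \<and>
       (\<forall>z\<in>V. wronskian3 (\<lambda>z. exp (- e * L z) * P1 z) (\<lambda>z. exp (- e * L z) * P2 z)
          (\<lambda>z. exp (- e * L z) * P3 z) z \<noteq> 0)"
      using ch(1)[unfolded sol] ch(2,3)[unfolded sol P(2,3)] ch(4)[unfolded P(2,3)] g0 vw0
      unfolding P(1) by simp
  qed
qed

section \<open>Orders of vanishing and adapted bases\<close>

definition vanishes_to_order :: "(complex \<Rightarrow> complex) \<Rightarrow> complex \<Rightarrow> nat \<Rightarrow> bool" where
  "vanishes_to_order f z0 n \<longleftrightarrow> (\<exists>R>0. \<exists>F. F holomorphic_on ball z0 R \<and> F z0 \<noteq> 0 \<and>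
     (\<forall>z\<in>ball z0 R. f z = (z - z0) ^ n * F z))"

definition span3 :: "(complex \<Rightarrow> complex) \<Rightarrow> (complex \<Rightarrow> complex) \<Rightarrow> (complex \<Rightarrow> complex) \<Rightarrow>
    (complex \<Rightarrow> complex) set" where
  "span3 f g h = {y. \<exists>a b c. y = (\<lambda>z. a * f z + b * g z + c * h z)}"

lemma span3_mono:
  assumes "f \<in> span3 f' g' h'" "g \<in> span3 f' g' h'" "h \<in> span3 f' g' h'"
  shows "span3 f g h \<subseteq> span3 f' g' h'"
proof
  fix y assume "y \<in> span3 f g h"
  then obtain a b c where y: "y = (\<lambda>z. a * f z + b * g z + c * h z)" by (auto simp: span3_def)
  obtain a1 b1 c1 where f: "f = (\<lambda>z. a1 * f' z + b1 * g' z + c1 * h' z)"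
    using assms(1) by (auto simp: span3_def)
  obtain a2 b2 c2 where g: "g = (\<lambda>z. a2 * f' z + b2 * g' z + c2 * h' z)"
    using assms(2) by (auto simp: span3_def)
  obtain a3 b3 c3 where h: "h = (\<lambda>z. a3 * f' z + b3 * g' z + c3 * h' z)"
    using assms(3) by (auto simp: span3_def)
  have "y = (\<lambda>z. (a * a1 + b * a2 + c * a3) * f' z + (a * b1 + b * b2 + c * b3) * g' z
      + (a * c1 + b * c2 + c * c3) * h' z)"
    unfolding y by (subst f, subst g, subst h) (simp add: fun_eq_iff algebra_simps)
  then show "y \<in> span3 f' g' h'" unfolding span3_def by blast
qed

lemma span3_base: "f \<in> span3 f g h" "g \<in> span3 f g h" "h \<in> span3 f g h"
proof -
  have "f = (\<lambda>z. 1 * f z + 0 * g z + 0 * h z)" "g = (\<lambda>z. 0 * f z + 1 * g z + 0 * h z)"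
    "h = (\<lambda>z. 0 * f z + 0 * g z + 1 * h z)" by simp_all
  then show "f \<in> span3 f g h" "g \<in> span3 f g h" "h \<in> span3 f g h"
    unfolding span3_def by blast+
qed

lemma span3_swap: "span3 g f h = span3 f g h" "span3 f h g = span3 f g h"
  by (intro equalityI span3_mono span3_base)+

lemma span3_sub: "span3 f (\<lambda>z. g z - c * f z) h = span3 f g h"
proof (intro equalityI span3_mono span3_base)
  have "(\<lambda>z. g z - c * f z) = (\<lambda>z. - c * f z + 1 * g z + 0 * h z)" by (simp add: fun_eq_iff)
  then show "(\<lambda>z. g z - c * f z) \<in> span3 f g h" unfolding span3_def by blast
  have "g = (\<lambda>z. c * f z + 1 * (g z - c * f z) + 0 * h z)" by (simp add: fun_eq_iff)
  then show "g \<in> span3 f (\<lambda>z. g z - c * f z) h" unfolding span3_def by blast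
qed

lemma vanishes_to_order_exists:
  assumes "f holomorphic_on ball z0 r" "r > 0" "z1 \<in> ball z0 r" "f z1 \<noteq> 0"
  obtains n where "vanishes_to_order f z0 n"
proof (cases "f z0 = 0")
  case True
  have "\<not> f constant_on ball z0 r"
    using assms True unfolding constant_on_def by (metis centre_in_ball)
  then obtain g s n where "0 < n" "0 < s" "ball z0 s \<subseteq> ball z0 r" "g holomorphic_on ball z0 s"
    "\<And>w. w \<in> ball z0 s \<Longrightarrow> f w = (w - z0) ^ n * g w" "\<And>w. w \<in> ball z0 s \<Longrightarrow> g w \<noteq> 0"
    using holomorphic_factor_zero_nonconstant[OF assms(1) open_ball connected_ball _ True] assms(2)
    by (metis centre_in_ball)
  then show ?thesis using that unfolding vanishes_to_order_def by (metis centre_in_ball)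
next
  case False
  then have "vanishes_to_order f z0 0"
    unfolding vanishes_to_order_def using assms by (intro exI[of _ r] conjI exI[of _ f]) auto
  then show ?thesis by (rule that)
qed

lemma vanishes_to_order_limit:
  assumes "vanishes_to_order f z0 n"
  obtains c where "c \<noteq> 0" "((\<lambda>z. f z / (z - z0) ^ n) \<longlongrightarrow> c) (at z0)"
proof -
  obtain R F where R: "R > 0" "F holomorphic_on ball z0 R" "F z0 \<noteq> 0"
    "\<forall>z\<in>ball z0 R. f z = (z - z0) ^ n * F z"
    using assms by (auto simp: vanishes_to_order_def)
  have "isCont F z0"
    using R holomorphic_on_imp_continuous_on[OF R(2)] by (simp add: continuous_on_eq_continuous_at)
  then have "(F \<longlongrightarrow> F z0) (at z0)" by (simp add: isCont_def)
  moreover have "\<forall>\<^sub>F z in at z0. F z = f z / (z - z0) ^ n"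
    unfolding eventually_at using R by (intro exI[of _ R]) (auto simp: dist_commute)
  ultimately have "((\<lambda>z. f z / (z - z0) ^ n) \<longlongrightarrow> F z0) (at z0)"
    by (rule Lim_transform_eventually)
  then show ?thesis using that R(3) by blast
qed

text \<open>
  If the orders agree, \<open>c\<close> is the quotient of the leading coefficients, and otherwise \<open>0\<close>.  The order
  of the difference occurs as a variable because the difference may vanish identically.
\<close>

lemma vanishes_to_order_diff:
  assumes "vanishes_to_order f z0 n" "vanishes_to_order g z0 m" "n \<le> m"
  obtains c where "\<And>k. vanishes_to_order (\<lambda>z. g z - c * f z) z0 k \<Longrightarrow> n < k"
proof -
  obtain a where a: "a \<noteq> 0" "((\<lambda>z. f z / (z - z0) ^ n) \<longlongrightarrow> a) (at z0)"
    using vanishes_to_order_limit[OF assms(1)] .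
  obtain b where b: "b \<noteq> 0" "((\<lambda>z. g z / (z - z0) ^ m) \<longlongrightarrow> b) (at z0)"
    using vanishes_to_order_limit[OF assms(2)] .
  have ev: "\<forall>\<^sub>F z in at z0. z - z0 \<noteq> 0" by (simp add: eventually_at_filter)
  have z: "((\<lambda>z. z - z0) \<longlongrightarrow> 0) (at z0)" by (auto intro!: tendsto_eq_intros)
  have "((\<lambda>z. (z - z0) ^ (m - n) * (g z / (z - z0) ^ m)) \<longlongrightarrow> 0 ^ (m - n) * b) (at z0)"
    by (intro tendsto_intros z b)
  moreover have "\<forall>\<^sub>F z in at z0. (z - z0) ^ (m - n) * (g z / (z - z0) ^ m) = g z / (z - z0) ^ n"
    using ev by eventually_elim (use assms(3) in \<open>simp add: power_diff\<close>)
  ultimately have g: "((\<lambda>z. g z / (z - z0) ^ n) \<longlongrightarrow> 0 ^ (m - n) * b) (at z0)"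
    by (rule Lim_transform_eventually)
  define c where "c = 0 ^ (m - n) * b / a"
  have l: "((\<lambda>z. (g z - c * f z) / (z - z0) ^ n) \<longlongrightarrow> 0) (at z0)"
    using tendsto_diff[OF g tendsto_mult_left[OF a(2), of c]] a(1)
    by (simp add: c_def diff_divide_distrib)
  show ?thesis
  proof (rule that[of c], rule ccontr)
    fix k assume k: "vanishes_to_order (\<lambda>z. g z - c * f z) z0 k" and "\<not> n < k"
    then have "k \<le> n" by simp
    obtain d where d: "d \<noteq> 0" "((\<lambda>z. (g z - c * f z) / (z - z0) ^ k) \<longlongrightarrow> d) (at z0)"
      using vanishes_to_order_limit[OF k] .
    have "((\<lambda>z. (z - z0) ^ (n - k) * ((g z - c * f z) / (z - z0) ^ n)) \<longlongrightarrow> 0 ^ (n - k) * 0) (at z0)"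
      by (intro tendsto_intros z l)
    moreover have "\<forall>\<^sub>F z in at z0. (z - z0) ^ (n - k) * ((g z - c * f z) / (z - z0) ^ n)
         = (g z - c * f z) / (z - z0) ^ k"
      using ev by eventually_elim (use \<open>k \<le> n\<close> in \<open>simp add: power_diff\<close>)
    ultimately have "((\<lambda>z. (g z - c * f z) / (z - z0) ^ k) \<longlongrightarrow> 0 ^ (n - k) * 0) (at z0)"
      by (rule Lim_transform_eventually)
    then have "d = 0" using tendsto_unique[OF _ d(2)] by auto
    with d(1) show False by simp
  qed
qed

text \<open>
  Gaussian elimination with respect to the order of vanishing: a suitable multiple of a function of
  lowest order is subtracted from the other two, and then the same is done with these.
\<close>

lemma adapted_basis:
  assumes r: "r > 0" and hol: "u1 holomorphic_on ball z0 r" "u2 holomorphic_on ball z0 r"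
      "u3 holomorphic_on ball z0 r"
    and ind: "\<And>a b c. (\<And>z. z \<in> ball z0 r \<Longrightarrow> a * u1 z + b * u2 z + c * u3 z = 0) \<Longrightarrow>
       a = 0 \<and> b = 0 \<and> c = 0"
  obtains y1 y2 y3 n1 n2 n3 where "n1 < n2" "n2 < n3" "span3 y1 y2 y3 = span3 u1 u2 u3"
    "vanishes_to_order y1 z0 n1" "vanishes_to_order y2 z0 n2" "vanishes_to_order y3 z0 n3"
proof -
  define Res where "Res \<longleftrightarrow> (\<exists>y1 y2 y3 n1 n2 n3. n1 < n2 \<and> n2 < n3 \<and> span3 y1 y2 y3 = span3 u1 u2 u3 \<and>
    vanishes_to_order y1 z0 n1 \<and> vanishes_to_order y2 z0 n2 \<and> vanishes_to_order y3 z0 n3)"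
  define Ind where "Ind = (\<lambda>f g h. \<forall>a b c. (\<forall>z\<in>ball z0 r. a * f z + b * g z + c * h z = 0) \<longrightarrow>
       a = 0 \<and> b = 0 \<and> c = (0::complex))"
  define Hol where "Hol = (\<lambda>f g h. f holomorphic_on ball z0 r \<and> g holomorphic_on ball z0 r \<and> h holomorphic_on ball z0 r)"
  have Ind_swap: "Ind g f h" "Ind f h g" if I: "Ind f g h" for f g h
  proof -
    show "Ind g f h" unfolding Ind_def
    proof (intro allI impI)
      fix a b c assume "\<forall>z\<in>ball z0 r. a * g z + b * f z + c * h z = 0"
      then have "\<forall>z\<in>ball z0 r. b * f z + a * g z + c * h z = 0" by (simp add: algebra_simps)
      with I show "a = 0 \<and> b = 0 \<and> c = 0" unfolding Ind_def by blast
    qed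
    show "Ind f h g" unfolding Ind_def
    proof (intro allI impI)
      fix a b c assume "\<forall>z\<in>ball z0 r. a * f z + b * h z + c * g z = 0"
      then have "\<forall>z\<in>ball z0 r. a * f z + c * g z + b * h z = 0" by (simp add: algebra_simps)
      with I show "a = 0 \<and> b = 0 \<and> c = 0" unfolding Ind_def by blast
    qed
  qed
  have Ind_sub: "Ind f (\<lambda>z. g z - k * f z) h" if I: "Ind f g h" for f g h k
    unfolding Ind_def
  proof (intro allI impI)
    fix a b c assume "\<forall>z\<in>ball z0 r. a * f z + b * (g z - k * f z) + c * h z = 0"
    then have "\<forall>z\<in>ball z0 r. (a - b * k) * f z + b * g z + c * h z = 0" by (simp add: algebra_simps)
    with I have "a - b * k = 0 \<and> b = 0 \<and> c = 0" unfolding Ind_def by blast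
    then show "a = 0 \<and> b = 0 \<and> c = 0" by auto
  qed
  have Hol_swap: "Hol g f h" "Hol f h g" if "Hol f g h" for f g h
    using that by (auto simp: Hol_def)
  have Hol_sub: "Hol f (\<lambda>z. g z - k * f z) h" if "Hol f g h" for f g h k
    using that by (auto simp: Hol_def intro!: holomorphic_intros)
  have order1: "\<exists>n. vanishes_to_order f z0 n" if I: "Ind f g h" and H: "Hol f g h" for f g h
  proof -
    have "\<exists>z\<in>ball z0 r. f z \<noteq> 0"
    proof (rule ccontr)
      assume "\<not> ?thesis"
      then have "\<forall>z\<in>ball z0 r. 1 * f z + 0 * g z + 0 * h z = 0" by auto
      with I have "(1::complex) = 0" unfolding Ind_def by blast
      then show False by simp
    qed
    then show ?thesis
      using vanishes_to_order_exists[of f z0 r] H r unfolding Hol_def by blast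
  qed
  have orders: "\<exists>n. vanishes_to_order f z0 n" "\<exists>n. vanishes_to_order g z0 n" "\<exists>n. vanishes_to_order h z0 n"
    if I: "Ind f g h" and H: "Hol f g h" for f g h
    using order1[OF I H] order1[OF Ind_swap(1)[OF I] Hol_swap(1)[OF H]]
      order1[OF Ind_swap(1)[OF Ind_swap(2)[OF I]] Hol_swap(1)[OF Hol_swap(2)[OF H]]] by auto
  \<comment> \<open>sort the second and third function, given that both vanish to higher order than the first\<close>
  have step2: Res
    if I: "Ind f g h" and H: "Hol f g h" and S: "span3 f g h = span3 u1 u2 u3"
      and n: "vanishes_to_order f z0 n" "vanishes_to_order g z0 m" "vanishes_to_order h z0 k" "n < m" "m \<le> k"
    for f g h n m k
  proof -
    obtain c where c: "\<And>j. vanishes_to_order (\<lambda>z. h z - c * g z) z0 j \<Longrightarrow> m < j"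
      using vanishes_to_order_diff[OF n(2,3,5)] by blast
    have I': "Ind g (\<lambda>z. h z - c * g z) f" and H': "Hol g (\<lambda>z. h z - c * g z) f"
      using Ind_sub[OF Ind_swap(2)[OF Ind_swap(1)[OF I]]] Hol_sub[OF Hol_swap(2)[OF Hol_swap(1)[OF H]]]
      by blast+
    obtain j where j: "vanishes_to_order (\<lambda>z. h z - c * g z) z0 j" using orders(2)[OF I' H'] by blast
    have "span3 f g (\<lambda>z. h z - c * g z) = span3 g (\<lambda>z. h z - c * g z) f"
      using span3_swap by metis
    also have "\<dots> = span3 g h f" by (rule span3_sub)
    also have "\<dots> = span3 f g h" using span3_swap by metis
    finally show Res
      unfolding Res_def using n(1,2,4) j c[OF j] S by metis
  qed
  have step1: Res
    if I: "Ind f g h" and H: "Hol f g h" and S: "span3 f g h = span3 u1 u2 u3"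
      and n: "vanishes_to_order f z0 n" "vanishes_to_order g z0 m" "vanishes_to_order h z0 k" "n \<le> m" "n \<le> k"
    for f g h n m k
  proof -
    obtain c where c: "\<And>j. vanishes_to_order (\<lambda>z. g z - c * f z) z0 j \<Longrightarrow> n < j"
      using vanishes_to_order_diff[OF n(1,2,4)] by blast
    obtain c' where c': "\<And>j. vanishes_to_order (\<lambda>z. h z - c' * f z) z0 j \<Longrightarrow> n < j"
      using vanishes_to_order_diff[OF n(1,3,5)] by blast
    define g' where "g' = (\<lambda>z. g z - c * f z)"
    define h' where "h' = (\<lambda>z. h z - c' * f z)"
    have I': "Ind f g' h'" "Ind f h' g'" and H': "Hol f g' h'" "Hol f h' g'"
      unfolding g'_def h'_def
      using Ind_sub[OF Ind_swap(2)[OF Ind_sub[OF I]]] Hol_sub[OF Hol_swap(2)[OF Hol_sub[OF H]]]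
        Ind_swap(2) Hol_swap(2) by blast+
    have S1: "span3 f g' h' = span3 u1 u2 u3" "span3 f h' g' = span3 u1 u2 u3"
      unfolding g'_def h'_def S[symmetric] using span3_swap span3_sub by metis+
    obtain m' k' where "vanishes_to_order g' z0 m'" "vanishes_to_order h' z0 k'"
      using orders[OF I'(1) H'(1)] by blast
    moreover from this have "n < m'" "n < k'" using c c' unfolding g'_def h'_def by blast+
    ultimately show Res
      using step2[OF I'(1) H'(1) S1(1) n(1)] step2[OF I'(2) H'(2) S1(2) n(1)]
      by (metis nat_le_linear)
  qed
  have I: "Ind u1 u2 u3" unfolding Ind_def using ind by blast
  have H: "Hol u1 u2 u3" unfolding Hol_def using hol by blast
  obtain n m k where n: "vanishes_to_order u1 z0 n" "vanishes_to_order u2 z0 m" "vanishes_to_order u3 z0 k"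
    using orders[OF I H] by blast
  consider "n \<le> m" "n \<le> k" | "m \<le> n" "m \<le> k" | "k \<le> n" "k \<le> m" by linarith
  then have Res
  proof cases
    case 1 then show ?thesis using step1[OF I H refl n] by blast
  next
    case 2 then show ?thesis
      using step1[OF Ind_swap(1)[OF I] Hol_swap(1)[OF H] span3_swap(1) n(2,1,3)] by blast
  next
    case 3
    have "span3 u3 u1 u2 = span3 u1 u2 u3" using span3_swap by metis
    with 3 show ?thesis
      using step1[OF Ind_swap(1)[OF Ind_swap(2)[OF I]] Hol_swap(1)[OF Hol_swap(2)[OF H]] _ n(3,1,2)] by blast
  qed
  then show ?thesis unfolding Res_def using that by blast
qed

section \<open>The equation of three functions near a point\<close>

lemma wronskian3_lincomb_eq_0:
  assumes V: "open V" "z \<in> V" and h: "u1 holomorphic_on V" "u2 holomorphic_on V" "u3 holomorphic_on V"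
    and y: "y1 \<in> span3 u1 u2 u3" "y2 \<in> span3 u1 u2 u3" "y3 \<in> span3 u1 u2 u3"
    and W: "wronskian3 u1 u2 u3 z = 0"
  shows "wronskian3 y1 y2 y3 z = 0"
proof -
  have d: "deriv (\<lambda>z. a * u1 z + b * u2 z + c * u3 z) z = a * deriv u1 z + b * deriv u2 z + c * deriv u3 z"
    "(deriv ^^ 2) (\<lambda>z. a * u1 z + b * u2 z + c * u3 z) z
       = a * (deriv ^^ 2) u1 z + b * (deriv ^^ 2) u2 z + c * (deriv ^^ 2) u3 z" for a b c
  proof -
    note dh = holomorphic_has_deriv[OF h(1) V(1)] holomorphic_has_deriv[OF h(2) V(1)]
      holomorphic_has_deriv[OF h(3) V(1)]
    have 1: "((\<lambda>z. a * u1 z + b * u2 z + c * u3 z) has_field_derivative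
        (a * deriv u1 z + b * deriv u2 z + c * deriv u3 z)) (at z)" if "z \<in> V" for z
      by (rule derivative_eq_intros dh that refl)+ simp
    have 2: "((\<lambda>z. a * deriv u1 z + b * deriv u2 z + c * deriv u3 z) has_field_derivative
        (a * (deriv ^^ 2) u1 z + b * (deriv ^^ 2) u2 z + c * (deriv ^^ 2) u3 z)) (at z)" if "z \<in> V" for z
      by (rule derivative_eq_intros dh that refl)+ simp
    show "deriv (\<lambda>z. a * u1 z + b * u2 z + c * u3 z) z = a * deriv u1 z + b * deriv u2 z + c * deriv u3 z"
      by (rule derivs_eqI(1)[OF V 1 2])
    show "(deriv ^^ 2) (\<lambda>z. a * u1 z + b * u2 z + c * u3 z) z
       = a * (deriv ^^ 2) u1 z + b * (deriv ^^ 2) u2 z + c * (deriv ^^ 2) u3 z"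
      by (rule derivs_eqI(2)[OF V 1 2])
  qed
  obtain a1 b1 c1 where y1: "y1 = (\<lambda>z. a1 * u1 z + b1 * u2 z + c1 * u3 z)"
    using y(1) by (auto simp: span3_def)
  obtain a2 b2 c2 where y2: "y2 = (\<lambda>z. a2 * u1 z + b2 * u2 z + c2 * u3 z)"
    using y(2) by (auto simp: span3_def)
  obtain a3 b3 c3 where y3: "y3 = (\<lambda>z. a3 * u1 z + b3 * u2 z + c3 * u3 z)"
    using y(3) by (auto simp: span3_def)
  have "wronskian3 y1 y2 y3 z = (a1 * (b2 * c3 - c2 * b3) - b1 * (a2 * c3 - c2 * a3) + c1 * (a2 * b3 - b2 * a3))
     * wronskian3 u1 u2 u3 z"
    unfolding y1 y2 y3 wronskian3_expand d by algebra
  with W show ?thesis by simp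
qed

text \<open>
  Up to translation, the slit disc is the image of a half strip under the exponential function.
\<close>

lemma slit_ball_open_connected:
  fixes z0 :: complex
  assumes "R > 0"
  shows "open {z \<in> ball z0 R. z - z0 \<notin> \<real>\<^sub>\<le>\<^sub>0}" "connected {z \<in> ball z0 R. z - z0 \<notin> \<real>\<^sub>\<le>\<^sub>0}"
proof -
  have "{z \<in> ball z0 R. z - z0 \<notin> \<real>\<^sub>\<le>\<^sub>0} = ball z0 R \<inter> (\<lambda>z. z - z0) -` (- \<real>\<^sub>\<le>\<^sub>0)" by auto
  then show "open {z \<in> ball z0 R. z - z0 \<notin> \<real>\<^sub>\<le>\<^sub>0}"
    by (auto intro!: open_Int open_vimage continuous_intros simp: open_Compl)
  define S where "S = {w. Re w < ln R} \<inter> {w. Im w < pi} \<inter> {w. Im w > - pi}"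
  have "convex S" unfolding S_def
    by (intro convex_Int convex_halfspace_Re_lt convex_halfspace_Im_lt convex_halfspace_Im_gt)
  then have "connected ((\<lambda>w. z0 + exp w) ` S)"
    by (intro connected_continuous_image continuous_intros convex_connected)
  also have "(\<lambda>w. z0 + exp w) ` S = {z \<in> ball z0 R. z - z0 \<notin> \<real>\<^sub>\<le>\<^sub>0}"
  proof (intro equalityI subsetI)
    fix z assume "z \<in> (\<lambda>w. z0 + exp w) ` S"
    then obtain w where w: "w \<in> S" "z = z0 + exp w" by auto
    have "exp (Re w) < R" using w assms by (simp add: S_def) (metis exp_less_cancel_iff exp_ln)
    moreover have "exp w \<notin> \<real>\<^sub>\<le>\<^sub>0"
    proof
      assume "exp w \<in> \<real>\<^sub>\<le>\<^sub>0"
      moreover have "Ln (exp w) = w" using w by (intro Ln_exp) (auto simp: S_def)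
      ultimately have "Im w = pi"
        using Im_Ln_eq_pi[of "exp w"] exp_not_eq_zero[of w]
        by (auto simp: complex_nonpos_Reals_iff less_le complex_eq_iff simp del: exp_not_eq_zero)
      with w show False by (simp add: S_def)
    qed
    ultimately show "z \<in> {z \<in> ball z0 R. z - z0 \<notin> \<real>\<^sub>\<le>\<^sub>0}"
      using w by (simp add: dist_norm)
  next
    fix z assume z: "z \<in> {z \<in> ball z0 R. z - z0 \<notin> \<real>\<^sub>\<le>\<^sub>0}"
    then have nz: "z - z0 \<noteq> 0" by auto
    have "Re (Ln (z - z0)) < ln R"
      using z nz assms by (simp add: dist_norm norm_minus_commute)
    moreover have "Im (Ln (z - z0)) \<noteq> pi"
      using z Im_Ln_eq_pi[OF nz] by (auto simp: complex_nonpos_Reals_iff)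
    ultimately have "Ln (z - z0) \<in> S"
      unfolding S_def using mpi_less_Im_Ln[OF nz] Im_Ln_le_pi[OF nz] by auto
    moreover have "z = z0 + exp (Ln (z - z0))" using nz by simp
    ultimately show "z \<in> (\<lambda>w. z0 + exp w) ` S" by blast
  qed
  finally show "connected {z \<in> ball z0 R. z - z0 \<notin> \<real>\<^sub>\<le>\<^sub>0}" .
qed

text \<open>
  This keeps the denominator in the formulas for the coefficients from vanishing identically.
\<close>

lemma wronskian3_minor_eq_0:
  assumes V: "open V" "connected V" and h: "u holomorphic_on V" "v holomorphic_on V" "w holomorphic_on V"
    and D: "\<And>z. z \<in> V \<Longrightarrow> u z * deriv v z - deriv u z * v z = 0"
    and z: "z \<in> V"
  shows "wronskian3 u v w z = 0"
proof -
  have D': "u z * (deriv ^^ 2) v z - (deriv ^^ 2) u z * v z = 0" if z: "z \<in> V" for z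
  proof -
    note d = holomorphic_has_deriv[OF h(1) V(1) z] holomorphic_has_deriv[OF h(2) V(1) z]
    have "((\<lambda>z. u z * deriv v z - deriv u z * v z) has_field_derivative
        (u z * (deriv ^^ 2) v z - (deriv ^^ 2) u z * v z)) (at z)"
      by (rule derivative_eq_intros d refl)+ simp
    moreover have "((\<lambda>z. u z * deriv v z - deriv u z * v z) has_field_derivative 0) (at z)"
      by (rule has_field_derivative_transform_within_open[of "\<lambda>_. 0", OF _ V(1) z]) (use D in auto)
    ultimately show ?thesis by (rule DERIV_unique)
  qed
  have uW: "u z * wronskian3 u v w z = 0" if z: "z \<in> V" for z
    unfolding wronskian3_expand using D[OF z] D'[OF z] by algebra
  show ?thesis
  proof (rule ccontr)
    assume W: "wronskian3 u v w z \<noteq> 0"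
    have "isCont (wronskian3 u v w) z"
      using wronskian3_deriv[OF V(1) z h] DERIV_isCont by blast
    then have "\<forall>\<^sub>F x in nhds z. wronskian3 u v w x \<noteq> 0"
      using tendsto_imp_eventually_ne[OF _ W] by (simp add: isCont_def tendsto_at_iff_tendsto_nhds)
    then obtain U where U: "open U" "z \<in> U" "\<And>x. x \<in> U \<Longrightarrow> wronskian3 u v w x \<noteq> 0"
      by (auto simp: eventually_nhds)
    have u0: "u x = 0" if "x \<in> U \<inter> V" for x using uW[of x] U(3)[of x] that by auto
    have "\<forall>\<^sub>F x in nhds z. u x = 0"
      unfolding eventually_nhds using u0 U z V(1) by (intro exI[of _ "U \<inter> V"]) auto
    then have "deriv u z = 0" "(deriv ^^ 2) u z = 0" "u z = 0"
      using deriv_cong_ev[of u "\<lambda>_. 0" z z] higher_deriv_cong_ev[of u "\<lambda>_. 0" z z 2]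
      by (auto simp: numeral_2_eq_2 dest: eventually_nhds_x_imp_x)
    with W show False by (simp add: wronskian3_expand)
  qed
qed

text \<open>
  The equation of \<open>local_structure\<close> for an adapted basis is the one given by the explicit formulas:
  they agree by \<open>raw_Q_eq\<close> wherever the denominator does not vanish, which excludes only isolated
  points.  Passing to a smaller ball removes all of these except \<open>z0\<close> itself.  The number \<open>- e\<close> is the
  smallest exponent, and the last clause says that every branch on the slit disc is a power with this
  exponent times a single-valued function.
\<close>

lemma equation_near:
  fixes u1 u2 u3 y1 y2 y3 :: "complex \<Rightarrow> complex" and n1 n2 n3 :: nat
  assumes r: "r > 0" and hol: "u1 holomorphic_on ball z0 r" "u2 holomorphic_on ball z0 r"
      "u3 holomorphic_on ball z0 r"
    and n: "n1 < n2" "n2 < n3" and span: "span3 y1 y2 y3 = span3 u1 u2 u3"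
    and ord: "vanishes_to_order y1 z0 n1" "vanishes_to_order y2 z0 n2" "vanishes_to_order y3 z0 n3"
  defines "W \<equiv> wronskian3 u1 u2 u3"
  defines "Q2 \<equiv> remove_sings (raw_Q2 W u1 u2)" and "Q3 \<equiv> remove_sings (raw_Q3 W u1 u2)"
    and "e \<equiv> (of_nat n2 + of_nat n3 - 2 * of_nat n1 - 3) / 3 :: complex"
  obtains R C2 C3 where "0 < R" "R \<le> r" "C2 holomorphic_on ball z0 R" "C3 holomorphic_on ball z0 R"
    "\<And>x::complex. x * (x - 1) * (x - 2) + C2 z0 * x + C3 z0 =
      (x + e) * (x - (2 * of_nat n2 - of_nat n1 - of_nat n3 + 3) / 3)
         * (x - (2 * of_nat n3 - of_nat n1 - of_nat n2 + 3) / 3)"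
    "\<And>z. z \<in> ball z0 R - {z0} \<Longrightarrow> Q2 z = C2 z / (z - z0) ^ 2"
    "\<And>z. z \<in> ball z0 R - {z0} \<Longrightarrow> Q3 z = C3 z / (z - z0) ^ 3"
    "\<And>z. z \<in> ball z0 R - {z0} \<Longrightarrow> raw_Q2 W u1 u2 z = C2 z / (z - z0) ^ 2"
    "\<And>z. z \<in> ball z0 R - {z0} \<Longrightarrow> raw_Q3 W u1 u2 z = C3 z / (z - z0) ^ 3"
    "\<And>z. z \<in> ball z0 R - {z0} \<Longrightarrow> \<exists>V G. open V \<and> z \<in> V \<and> V \<subseteq> ball z0 R - {z0} \<and>
        G holomorphic_on V \<and> (\<forall>x\<in>V. G x \<noteq> 0) \<and>
        solution_on Q2 Q3 V (\<lambda>x. u1 x / G x) \<and> solution_on Q2 Q3 V (\<lambda>x. u2 x / G x) \<and>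
        solution_on Q2 Q3 V (\<lambda>x. u3 x / G x) \<and>
        (\<forall>x\<in>V. W x \<noteq> 0)"
    "\<And>y. solution_on Q2 Q3 {z \<in> ball z0 R. z - z0 \<notin> \<real>\<^sub>\<le>\<^sub>0} y \<Longrightarrow>
        \<exists>F. F holomorphic_on ball z0 R \<and>
          (\<forall>z\<in>ball z0 R. z - z0 \<notin> \<real>\<^sub>\<le>\<^sub>0 \<longrightarrow> y z = (z - z0) powr (- e) * F z)"
proof -
  obtain r1 Y1 where Y1: "r1 > 0" "Y1 holomorphic_on ball z0 r1" "Y1 z0 \<noteq> 0"
    "\<And>z. z \<in> ball z0 r1 \<Longrightarrow> y1 z = (z - z0) ^ n1 * Y1 z"
    using ord(1) unfolding vanishes_to_order_def by blast
  obtain r2 Y2 where Y2: "r2 > 0" "Y2 holomorphic_on ball z0 r2" "Y2 z0 \<noteq> 0"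
    "\<And>z. z \<in> ball z0 r2 \<Longrightarrow> y2 z = (z - z0) ^ n2 * Y2 z"
    using ord(2) unfolding vanishes_to_order_def by blast
  obtain r3 Y3 where Y3: "r3 > 0" "Y3 holomorphic_on ball z0 r3" "Y3 z0 \<noteq> 0"
    "\<And>z. z \<in> ball z0 r3 \<Longrightarrow> y3 z = (z - z0) ^ n3 * Y3 z"
    using ord(3) unfolding vanishes_to_order_def by blast
  define s where "s = min r (min r1 (min r2 r3))"
  have s: "s > 0" "s \<le> r" using r Y1 Y2 Y3 by (auto simp: s_def)
  have ss: "ball z0 s \<subseteq> ball z0 r1" "ball z0 s \<subseteq> ball z0 r2" "ball z0 s \<subseteq> ball z0 r3" "ball z0 s \<subseteq> ball z0 r"
    by (auto simp: s_def)
  obtain R0 G C2 C3 P1 P2 P3 where R0: "0 < R0" "R0 \<le> s"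
    and hol0: "G holomorphic_on ball z0 R0" "C2 holomorphic_on ball z0 R0" "C3 holomorphic_on ball z0 R0"
    "P1 holomorphic_on ball z0 R0" "P2 holomorphic_on ball z0 R0" "P3 holomorphic_on ball z0 R0"
    and indicial: "\<And>x::complex. x * (x - 1) * (x - 2) + C2 z0 * x + C3 z0 =
      (x + e) * (x - (2 * of_nat n2 - of_nat n1 - of_nat n3 + 3) / 3)
         * (x - (2 * of_nat n3 - of_nat n1 - of_nat n2 + 3) / 3)"
    and G0: "\<And>z. z \<in> ball z0 R0 - {z0} \<Longrightarrow> G z \<noteq> 0"
    and GP: "\<And>z. z \<in> ball z0 R0 \<Longrightarrow> (z - z0) ^ n1 * Y1 z = G z * P1 z"
    "\<And>z. z \<in> ball z0 R0 \<Longrightarrow> (z - z0) ^ n2 * Y2 z = G z * P2 z"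
    "\<And>z. z \<in> ball z0 R0 \<Longrightarrow> (z - z0) ^ n3 * Y3 z = G z * P3 z"
    and sol: "\<And>V L. open V \<Longrightarrow> V \<subseteq> ball z0 R0 - {z0} \<Longrightarrow> L holomorphic_on V \<Longrightarrow>
       (\<And>z. z \<in> V \<Longrightarrow> exp (L z) = z - z0) \<Longrightarrow>
       solution_on (\<lambda>z. C2 z / (z - z0) ^ 2) (\<lambda>z. C3 z / (z - z0) ^ 3) V (\<lambda>z. exp (- e * L z) * P1 z) \<and>
       solution_on (\<lambda>z. C2 z / (z - z0) ^ 2) (\<lambda>z. C3 z / (z - z0) ^ 3) V (\<lambda>z. exp (- e * L z) * P2 z) \<and>
       solution_on (\<lambda>z. C2 z / (z - z0) ^ 2) (\<lambda>z. C3 z / (z - z0) ^ 3) V (\<lambda>z. exp (- e * L z) * P3 z) \<and>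
       (\<forall>z\<in>V. wronskian3 (\<lambda>z. exp (- e * L z) * P1 z) (\<lambda>z. exp (- e * L z) * P2 z)
          (\<lambda>z. exp (- e * L z) * P3 z) z \<noteq> 0)"
    using local_structure[OF n s(1) Y1(2)[THEN holomorphic_on_subset, OF ss(1)]
      Y2(2)[THEN holomorphic_on_subset, OF ss(2)] Y3(2)[THEN holomorphic_on_subset, OF ss(3)]
      Y1(3) Y2(3) Y3(3), folded e_def] by blast
  define q2 where "q2 = (\<lambda>z. C2 z / (z - z0) ^ 2)"
  define q3 where "q3 = (\<lambda>z. C3 z / (z - z0) ^ 3)"
  note sol = sol[folded q2_def q3_def]
  have y_eq: "y1 z = G z * P1 z" "y2 z = G z * P2 z" "y3 z = G z * P3 z" if "z \<in> ball z0 R0" for z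
    using GP[OF that] Y1(4) Y2(4) Y3(4) ss that R0(2) by (metis mem_ball order_less_le_trans subsetD)+
  have R0r: "ball z0 R0 \<subseteq> ball z0 r" using R0 s by auto
  have solu: "solution_on q2 q3 V (\<lambda>z. u z / (G z * exp (e * L z)))"
    if V: "open V" "V \<subseteq> ball z0 R0 - {z0}" "L holomorphic_on V" "\<And>z. z \<in> V \<Longrightarrow> exp (L z) = z - z0"
      and u: "u \<in> span3 u1 u2 u3" for V L u
  proof -
    have "u \<in> span3 y1 y2 y3" using u span by simp
    then obtain a b c where u: "u = (\<lambda>z. a * y1 z + b * y2 z + c * y3 z)"
      unfolding span3_def by blast
    have "solution_on q2 q3 V (\<lambda>z. a * (exp (- e * L z) * P1 z) + b * (exp (- e * L z) * P2 z)
        + c * (exp (- e * L z) * P3 z))"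
      using sol[OF V] by (intro solution_on_lincomb3 V) auto
    then show ?thesis
    proof (subst solution_on_cong[OF V(1) _ refl refl])
      fix z assume z: "z \<in> V"
      then have zR: "z \<in> ball z0 R0" and g0: "G z \<noteq> 0"
        using subsetD[OF V(2) z] G0[of z] by auto
      show "u z / (G z * exp (e * L z)) = a * (exp (- e * L z) * P1 z) + b * (exp (- e * L z) * P2 z)
        + c * (exp (- e * L z) * P3 z)"
        unfolding u y_eq[OF zR] using g0 by (simp add: exp_minus field_simps)
    qed
  qed
  have loc: "\<exists>V L. open V \<and> z \<in> V \<and> V \<subseteq> ball z0 R - {z0} \<and> L holomorphic_on V \<and>
      (\<forall>z\<in>V. exp (L z) = z - z0)" if z: "z \<in> ball z0 R - {z0}" for z R
  proof -
    have "open (ball z0 R - {z0})" by (auto intro: open_delete)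
    then obtain t where t: "t > 0" "ball z t \<subseteq> ball z0 R - {z0}" using z by (meson open_contains_ball)
    have hz: "(\<lambda>x. x - z0) holomorphic_on ball z t" by (intro holomorphic_intros)
    from t have "\<And>x. x \<in> ball z t \<Longrightarrow> x - z0 \<noteq> 0" by auto
    then obtain L where "L holomorphic_on ball z t" "\<And>x. x \<in> ball z t \<Longrightarrow> exp (L x) = x - z0"
      using holomorphic_logarithm_exists[OF convex_ball open_ball hz, of z] t(1) by auto
    with t show ?thesis by (intro exI[of _ "ball z t"] exI[of _ L]) auto
  qed
  have Wne: "W z \<noteq> 0" if z: "z \<in> ball z0 R0 - {z0}" for z
  proof
    assume W: "W z = 0"
    obtain V L where V: "open V" "z \<in> V" "V \<subseteq> ball z0 R0 - {z0}" "L holomorphic_on V"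
      "\<And>z. z \<in> V \<Longrightarrow> exp (L z) = z - z0" using loc[OF z] by blast
    have VR: "V \<subseteq> ball z0 R0" using V by auto
    have hu: "u1 holomorphic_on V" "u2 holomorphic_on V" "u3 holomorphic_on V"
      using hol VR R0r by (meson holomorphic_on_subset)+
    have "y1 \<in> span3 u1 u2 u3" "y2 \<in> span3 u1 u2 u3" "y3 \<in> span3 u1 u2 u3"
      unfolding span[symmetric] by (rule span3_base)+
    then have "wronskian3 y1 y2 y3 z = 0"
      using wronskian3_lincomb_eq_0[OF V(1,2) hu _ _ _ W[unfolded W_def]] by blast
    moreover have "wronskian3 y1 y2 y3 z = wronskian3 (\<lambda>z. (G z * exp (e * L z)) * (exp (- e * L z) * P1 z))
       (\<lambda>z. (G z * exp (e * L z)) * (exp (- e * L z) * P2 z))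
       (\<lambda>z. (G z * exp (e * L z)) * (exp (- e * L z) * P3 z)) z"
      by (rule wronskian3_cong; rule eventually_nhds_in_open[OF V(1,2), THEN eventually_mono])
        (use y_eq VR in \<open>auto simp: exp_minus\<close>)
    moreover have "\<dots> = (G z * exp (e * L z)) ^ 3 * wronskian3 (\<lambda>z. exp (- e * L z) * P1 z)
       (\<lambda>z. exp (- e * L z) * P2 z) (\<lambda>z. exp (- e * L z) * P3 z) z"
      by (rule wronskian3_scale[OF V(1,2)]) (intro holomorphic_intros V hol0[THEN holomorphic_on_subset] VR)+
    ultimately show False
      using G0[of z] z sol[OF V(1,3,4,5)] V(2) by auto
  qed
  define D where "D = (\<lambda>z. u1 z * deriv u2 z - deriv u1 z * u2 z)"
  have hu0: "u1 holomorphic_on ball z0 R0" "u2 holomorphic_on ball z0 R0" "u3 holomorphic_on ball z0 R0"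
    using hol R0r holomorphic_on_subset by blast+
  have hD: "D holomorphic_on ball z0 R0"
    unfolding D_def using hu0 by (intro holomorphic_intros holomorphic_deriv open_ball)
  have "\<exists>z\<in>ball z0 R0. D z \<noteq> 0"
  proof (rule ccontr)
    assume "\<not> ?thesis"
    then have D: "\<And>z. z \<in> ball z0 R0 \<Longrightarrow> u1 z * deriv u2 z - deriv u1 z * u2 z = 0"
      by (auto simp: D_def)
    define x where "x = z0 + of_real (R0 / 2)"
    have "x \<in> ball z0 R0 - {z0}" using R0 by (auto simp: x_def dist_norm)
    then show False
      using wronskian3_minor_eq_0[OF open_ball connected_ball hu0 D] Wne by (auto simp: W_def)
  qed
  then obtain x where x: "x \<in> ball z0 R0" "D x \<noteq> 0" by blast
  obtain nD where "vanishes_to_order D z0 nD"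
    using vanishes_to_order_exists[OF hD R0(1) x] by blast
  then obtain R1 F1 where R1: "R1 > 0" "F1 holomorphic_on ball z0 R1" "F1 z0 \<noteq> 0"
    "\<And>z. z \<in> ball z0 R1 \<Longrightarrow> D z = (z - z0) ^ nD * F1 z"
    unfolding vanishes_to_order_def by blast
  obtain R2 where R2: "0 < R2" "R2 \<le> R1" "\<And>z. z \<in> ball z0 R2 \<Longrightarrow> F1 z \<noteq> 0"
    using holomorphic_nonzero_ball[OF R1(2,1,3)] by blast
  define R where "R = min R0 R2"
  have R: "0 < R" "R \<le> R0" "ball z0 R \<subseteq> ball z0 R0" using R0 R2 by (auto simp: R_def)
  have D0: "D z \<noteq> 0" if "z \<in> ball z0 R - {z0}" for z
    using that R1(4)[of z] R2 by (auto simp: R_def)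
  have raw: "raw_Q2 W u1 u2 z = q2 z \<and> raw_Q3 W u1 u2 z = q3 z" if z: "z \<in> ball z0 R - {z0}" for z
  proof -
    obtain V L where V: "open V" "z \<in> V" "V \<subseteq> ball z0 R - {z0}" "L holomorphic_on V"
      "\<And>z. z \<in> V \<Longrightarrow> exp (L z) = z - z0" using loc[OF z] by blast
    have VR: "V \<subseteq> ball z0 R0 - {z0}" "V \<subseteq> ball z0 R0" using V R by auto
    have hu: "u1 holomorphic_on V" "u2 holomorphic_on V" "u3 holomorphic_on V"
      using hu0 VR by (meson holomorphic_on_subset)+
    have hG: "(\<lambda>z. G z * exp (e * L z)) holomorphic_on V"
      by (intro holomorphic_intros V hol0[THEN holomorphic_on_subset] VR)
    have su: "solution_on q2 q3 V (\<lambda>z. u z / (G z * exp (e * L z)))" if "u \<in> span3 u1 u2 u3" for u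
      by (rule solu) (use V VR that in auto)
    have G1: "G x * exp (e * L x) \<noteq> 0" if "x \<in> V" for x
      using G0[OF subsetD[OF VR(1) that]] by simp
    have W1: "W z \<noteq> 0" using Wne z R by auto
    note * = V(1,2) hG G1 hu su[OF span3_base(1)] su[OF span3_base(2)] su[OF span3_base(3)]
      W_def[THEN meta_eq_to_obj_eq] W1 D0[OF z, unfolded D_def]
    show ?thesis using raw_Q_eq[OF *] by blast
  qed
  have Q_eq: "Q2 z = q2 z" "Q3 z = q3 z" if z: "z \<in> ball z0 R - {z0}" for z
  proof -
    have o: "open (ball z0 R - {z0})" by (auto intro: open_delete)
    have ev: "\<forall>\<^sub>F x in at z. raw_Q2 W u1 u2 x = q2 x" "\<forall>\<^sub>F x in at z. raw_Q3 W u1 u2 x = q3 x"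
      using eventually_at_in_open'[OF o z] raw by (auto elim!: eventually_mono)
    have "q2 holomorphic_on (ball z0 R - {z0})" "q3 holomorphic_on (ball z0 R - {z0})"
      unfolding q2_def q3_def using R
      by (auto intro!: holomorphic_intros hol0(2,3)[THEN holomorphic_on_subset])
    then have "q2 analytic_on {z}" "q3 analytic_on {z}"
      using o z analytic_at by blast+
    then show "Q2 z = q2 z" "Q3 z = q3 z"
      unfolding Q2_def Q3_def using remove_sings_cong[OF ev(1) refl] remove_sings_cong[OF ev(2) refl]
        remove_sings_at_analytic by simp_all
  qed
  have Qsol: "solution_on Q2 Q3 V y \<longleftrightarrow> solution_on q2 q3 V y" if "open V" "V \<subseteq> ball z0 R - {z0}" for V y
    by (rule solution_on_cong[OF that(1) refl]; rule Q_eq; use that(2) in blast)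
  show ?thesis
  proof (rule that[of R C2 C3])
    show "0 < R" "R \<le> r" using R R0 s by auto
    show "C2 holomorphic_on ball z0 R" "C3 holomorphic_on ball z0 R"
      using hol0 R(3) holomorphic_on_subset by blast+
    show "x * (x - 1) * (x - 2) + C2 z0 * x + C3 z0 =
      (x + e) * (x - (2 * of_nat n2 - of_nat n1 - of_nat n3 + 3) / 3)
         * (x - (2 * of_nat n3 - of_nat n1 - of_nat n2 + 3) / 3)" for x by (rule indicial)
    show "Q2 z = C2 z / (z - z0) ^ 2" "Q3 z = C3 z / (z - z0) ^ 3" if "z \<in> ball z0 R - {z0}" for z
      using Q_eq[OF that] by (simp_all add: q2_def q3_def)
    show "raw_Q2 W u1 u2 z = C2 z / (z - z0) ^ 2" "raw_Q3 W u1 u2 z = C3 z / (z - z0) ^ 3"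
      if "z \<in> ball z0 R - {z0}" for z
      using raw[OF that] by (simp_all add: q2_def q3_def)
    show "\<exists>V G. open V \<and> z \<in> V \<and> V \<subseteq> ball z0 R - {z0} \<and>
        G holomorphic_on V \<and> (\<forall>x\<in>V. G x \<noteq> 0) \<and>
        solution_on Q2 Q3 V (\<lambda>x. u1 x / G x) \<and> solution_on Q2 Q3 V (\<lambda>x. u2 x / G x) \<and>
        solution_on Q2 Q3 V (\<lambda>x. u3 x / G x) \<and> (\<forall>x\<in>V. W x \<noteq> 0)"
      if z: "z \<in> ball z0 R - {z0}" for z
    proof -
      obtain V L where V: "open V" "z \<in> V" "V \<subseteq> ball z0 R - {z0}" "L holomorphic_on V"
        "\<And>z. z \<in> V \<Longrightarrow> exp (L z) = z - z0" using loc[OF z] by blast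
      have VR: "V \<subseteq> ball z0 R0 - {z0}" "V \<subseteq> ball z0 R0" using V R by auto
      have hG: "(\<lambda>z. G z * exp (e * L z)) holomorphic_on V"
        by (intro holomorphic_intros V hol0[THEN holomorphic_on_subset] VR)
      have su: "solution_on Q2 Q3 V (\<lambda>z. u z / (G z * exp (e * L z)))" if "u \<in> span3 u1 u2 u3" for u
        unfolding Qsol[OF V(1,3)] by (rule solu) (use V VR that in auto)
      have GW: "G x * exp (e * L x) \<noteq> 0" "W x \<noteq> 0" if "x \<in> V" for x
        using G0[OF subsetD[OF VR(1) that]] Wne[OF subsetD[OF VR(1) that]] by auto
      show ?thesis
        by (intro exI[of _ V] exI[of _ "\<lambda>z. G z * exp (e * L z)"] conjI V hG su span3_base ballI GW)
    qed
    fix y assume y: "solution_on Q2 Q3 {z \<in> ball z0 R. z - z0 \<notin> \<real>\<^sub>\<le>\<^sub>0} y"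
    define S where "S = {z \<in> ball z0 R. z - z0 \<notin> \<real>\<^sub>\<le>\<^sub>0}"
    have S: "open S" "connected S" using slit_ball_open_connected[OF R(1)] unfolding S_def by auto
    have SR: "S \<subseteq> ball z0 R - {z0}" "S \<subseteq> ball z0 R0 - {z0}" unfolding S_def using R(3) by auto
    have L: "(\<lambda>z. Ln (z - z0)) holomorphic_on S" "\<And>z. z \<in> S \<Longrightarrow> exp (Ln (z - z0)) = z - z0"
    proof -
      show "(\<lambda>z. Ln (z - z0)) holomorphic_on S" by (auto intro!: holomorphic_intros simp: S_def)
      show "exp (Ln (z - z0)) = z - z0" if "z \<in> S" for z
        using subsetD[OF SR(1) that] by simp
    qed
    have sy: "solution_on q2 q3 S y" using y Qsol[OF S(1) SR(1)] by (simp add: S_def)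
    note sP = sol[OF S(1) SR(2) L]
    obtain a b c where abc: "\<And>z. z \<in> S \<Longrightarrow> y z = a * (exp (- e * Ln (z - z0)) * P1 z)
       + b * (exp (- e * Ln (z - z0)) * P2 z) + c * (exp (- e * Ln (z - z0)) * P3 z)"
      using solutions_span[OF S _ _ _ _ sy] sP by blast
    show "\<exists>F. F holomorphic_on ball z0 R \<and>
          (\<forall>z\<in>ball z0 R. z - z0 \<notin> \<real>\<^sub>\<le>\<^sub>0 \<longrightarrow> y z = (z - z0) powr (- e) * F z)"
    proof (intro exI[of _ "\<lambda>z. a * P1 z + b * P2 z + c * P3 z"] conjI ballI impI)
      show "(\<lambda>z. a * P1 z + b * P2 z + c * P3 z) holomorphic_on ball z0 R"
        by (intro holomorphic_intros hol0[THEN holomorphic_on_subset] R)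
      fix z assume z: "z \<in> ball z0 R" "z - z0 \<notin> \<real>\<^sub>\<le>\<^sub>0"
      then have "z \<in> S" by (simp add: S_def)
      moreover from this have "z \<noteq> z0" using SR(1) by blast
      ultimately show "y z = (z - z0) powr (- e) * (a * P1 z + b * P2 z + c * P3 z)"
        using abc[of z] by (simp add: powr_def algebra_simps)
    qed
  qed
qed

section \<open>Moebius transformations\<close>

abbreviation mA :: "real^2^2 \<Rightarrow> real" where "mA \<sigma> \<equiv> \<sigma> $ 1 $ 1"
abbreviation mB :: "real^2^2 \<Rightarrow> real" where "mB \<sigma> \<equiv> \<sigma> $ 1 $ 2"
abbreviation mC :: "real^2^2 \<Rightarrow> real" where "mC \<sigma> \<equiv> \<sigma> $ 2 $ 1"
abbreviation mD :: "real^2^2 \<Rightarrow> real" where "mD \<sigma> \<equiv> \<sigma> $ 2 $ 2"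

lemma det_eq_1D: "det (\<sigma> :: real^2^2) = 1 \<Longrightarrow> mA \<sigma> * mD \<sigma> - mB \<sigma> * mC \<sigma> = 1"
  by (simp add: det_2)

lemma det_eq_1D_complex:
  assumes "det (\<sigma> :: real^2^2) = 1"
  shows "complex_of_real (mA \<sigma>) * of_real (mD \<sigma>) - of_real (mB \<sigma>) * of_real (mC \<sigma>) = 1"
  using arg_cong[OF det_eq_1D[OF assms], of complex_of_real] by simp

lemma automorphy_nonzero:
  assumes "det \<sigma> = 1" "Im z > 0"
  shows "automorphy \<sigma> z \<noteq> 0"
proof
  assume 0: "automorphy \<sigma> z = 0"
  then have "Im (automorphy \<sigma> z) = 0" "Re (automorphy \<sigma> z) = 0" by auto
  then have "mC \<sigma> = 0" "mD \<sigma> = 0" using assms(2) by (auto simp: automorphy_def)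
  then show False using det_eq_1D[OF assms(1)] by simp
qed

lemma Im_moebius_pos:
  assumes "det \<sigma> = 1" "Im z > 0"
  shows "Im (moebius \<sigma> z) > 0"
proof -
  define a b c d where "a = mA \<sigma>" "b = mB \<sigma>" "c = mC \<sigma>" "d = mD \<sigma>"
  have det: "a * d - b * c = 1" using det_eq_1D[OF assms(1)] by (simp add: a_b_c_d_def)
  define j where "j = automorphy \<sigma> z"
  have j: "j = of_real c * z + of_real d" by (simp add: j_def automorphy_def a_b_c_d_def)
  have j0: "j \<noteq> 0" using automorphy_nonzero[OF assms] by (simp add: j_def)
  have "moebius \<sigma> z = (of_real a * z + of_real b) / j"
    by (simp add: moebius_def j_def a_b_c_d_def)
  also have "\<dots> = (of_real a * z + of_real b) * cnj j / of_real (cmod j ^ 2)"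
    by (subst complex_div_cnj) simp
  finally have "Im (moebius \<sigma> z) = Im ((of_real a * z + of_real b) * cnj j) / cmod j ^ 2"
    by (simp del: of_real_power)
  also have "Im ((of_real a * z + of_real b) * cnj j) = (a * d - b * c) * Im z"
    by (simp add: j algebra_simps)
  finally show ?thesis using det assms(2) j0 by simp
qed

lemma automorphy_mult:
  assumes "det \<delta> = 1" "Im z > 0"
  shows "automorphy (\<gamma> ** \<delta>) z = automorphy \<gamma> (moebius \<delta> z) * automorphy \<delta> z"
proof -
  have "moebius \<delta> z * automorphy \<delta> z = of_real (mA \<delta>) * z + of_real (mB \<delta>)"
    using automorphy_nonzero[OF assms] by (simp add: moebius_def)
  then have "automorphy \<gamma> (moebius \<delta> z) * automorphy \<delta> z
     = of_real (mC \<gamma>) * (of_real (mA \<delta>) * z + of_real (mB \<delta>)) + of_real (mD \<gamma>) * automorphy \<delta> z"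
    unfolding automorphy_def[of \<gamma>] by algebra
  also have "\<dots> = automorphy (\<gamma> ** \<delta>) z"
    by (simp add: automorphy_def matrix_matrix_mult_def sum_2 algebra_simps)
  finally show ?thesis by simp
qed

lemma moebius_mult:
  assumes "det \<gamma> = 1" "det \<delta> = 1" "Im z > 0"
  shows "moebius (\<gamma> ** \<delta>) z = moebius \<gamma> (moebius \<delta> z)"
proof -
  define j where "j = automorphy \<delta> z"
  define i where "i = automorphy \<gamma> (moebius \<delta> z)"
  have j0: "j \<noteq> 0" and i0: "i \<noteq> 0"
    using automorphy_nonzero Im_moebius_pos assms by (simp_all add: j_def i_def)
  have "moebius (\<gamma> ** \<delta>) z = (of_real (mA (\<gamma> ** \<delta>)) * z + of_real (mB (\<gamma> ** \<delta>))) / (i * j)"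
    by (simp add: moebius_def automorphy_mult[OF assms(2,3)] i_def j_def)
  also have "of_real (mA (\<gamma> ** \<delta>)) * z + of_real (mB (\<gamma> ** \<delta>))
      = (of_real (mA \<gamma>) * moebius \<delta> z + of_real (mB \<gamma>)) * j"
    using j0 by (simp add: moebius_def matrix_matrix_mult_def sum_2 j_def[symmetric] field_simps)
      (simp add: j_def automorphy_def algebra_simps)
  finally show ?thesis
    using j0 i0 by (simp add: moebius_def[of \<gamma>] i_def)
qed

lemma slash_mult:
  assumes "det \<gamma> = 1" "det \<delta> = 1" "Im z > 0"
  shows "slash k (\<gamma> ** \<delta>) f z = slash k \<delta> (slash k \<gamma> f) z"
  unfolding slash_def automorphy_mult[OF assms(2,3)] moebius_mult[OF assms] power_int_mult_distrib
  by (simp only: mult_ac)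

lemma moebius_deriv:
  assumes "det \<sigma> = 1" "Im z > 0"
  shows "(moebius \<sigma> has_field_derivative 1 / automorphy \<sigma> z ^ 2) (at z)"
proof -
  have "complex_of_real (mA \<sigma>) * of_real (mD \<sigma>) - of_real (mB \<sigma>) * of_real (mC \<sigma>) = 1"
    by (rule det_eq_1D_complex[OF assms(1)])
  then show ?thesis
    unfolding moebius_def [abs_def] automorphy_def
    using automorphy_nonzero[OF assms]
    by (auto intro!: derivative_eq_intros simp: automorphy_def power2_eq_square)
      (simp add: algebra_simps)
qed

lemma automorphy_deriv: "(automorphy \<sigma> has_field_derivative of_real (mC \<sigma>)) (at z)"
  unfolding automorphy_def [abs_def] by (auto intro!: derivative_eq_intros)

lemma moebius_holomorphic: "det \<sigma> = 1 \<Longrightarrow> moebius \<sigma> holomorphic_on upper_half_plane"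
  unfolding holomorphic_on_def field_differentiable_def
  using moebius_deriv has_field_derivative_at_within by blast

lemma automorphy_holomorphic: "automorphy \<sigma> holomorphic_on A"
  unfolding automorphy_def [abs_def] by (intro holomorphic_intros)

lemma slash_holomorphic:
  assumes "det \<sigma> = 1" "f holomorphic_on upper_half_plane"
  shows "slash k \<sigma> f holomorphic_on upper_half_plane"
proof -
  have "f \<circ> moebius \<sigma> holomorphic_on upper_half_plane"
    using assms Im_moebius_pos by (intro holomorphic_on_compose_gen[OF moebius_holomorphic]) auto
  then show ?thesis
    unfolding slash_def [abs_def] comp_def
    by (intro holomorphic_intros automorphy_holomorphic) (use automorphy_nonzero assms in auto)
qed

lemma moebius_inj:
  assumes "det \<sigma> = 1" "Im z > 0" "Im w > 0" "moebius \<sigma> z = moebius \<sigma> w"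
  shows "z = w"
proof -
  have "complex_of_real (mA \<sigma>) * of_real (mD \<sigma>) - of_real (mB \<sigma>) * of_real (mC \<sigma>) = 1"
    by (rule det_eq_1D_complex[OF assms(1)])
  moreover have "(of_real (mA \<sigma>) * z + of_real (mB \<sigma>)) * automorphy \<sigma> w
     = (of_real (mA \<sigma>) * w + of_real (mB \<sigma>)) * automorphy \<sigma> z"
    using assms(4) automorphy_nonzero[OF assms(1,2)] automorphy_nonzero[OF assms(1,3)]
    by (simp add: moebius_def frac_eq_eq)
  ultimately show ?thesis unfolding automorphy_def by algebra
qed

lemma moebius_at_filterlim:
  assumes "det \<sigma> = 1" "Im z > 0"
  shows "filterlim (moebius \<sigma>) (at (moebius \<sigma> z)) (at z)"
proof (rule filterlim_atI)
  show "(moebius \<sigma> \<longlongrightarrow> moebius \<sigma> z) (at z)"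
    using DERIV_isCont[OF moebius_deriv[OF assms]] by (simp add: isCont_def)
  have "\<forall>\<^sub>F w in at z. w \<in> upper_half_plane - {z}"
    using assms(2) by (intro eventually_at_in_open upper_half_plane_open) simp
  then show "\<forall>\<^sub>F w in at z. moebius \<sigma> w \<noteq> moebius \<sigma> z"
    by eventually_elim (use moebius_inj[OF assms(1) _ assms(2)] in auto)
qed

section \<open>Bol's identity\<close>

text \<open>
  The coefficients of the equation satisfied by the functions \<open>y|\<sigma>\<close> of weight \<open>-2\<close> if the functions \<open>y\<close>
  satisfy the one with coefficients \<open>Q2\<close> and \<open>Q3\<close>.  The second one is not a slash of \<open>Q3\<close>; its extra
  term is that of half the derivative of \<open>Q2\<close>.
\<close>

definition slashed_Q2 :: "real^2^2 \<Rightarrow> (complex \<Rightarrow> complex) \<Rightarrow> complex \<Rightarrow> complex" where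
  "slashed_Q2 \<sigma> Q2 z = Q2 (moebius \<sigma> z) / automorphy \<sigma> z ^ 4"

definition slashed_Q3 :: "real^2^2 \<Rightarrow> (complex \<Rightarrow> complex) \<Rightarrow> (complex \<Rightarrow> complex) \<Rightarrow> complex \<Rightarrow> complex" where
  "slashed_Q3 \<sigma> Q2 Q3 z = Q3 (moebius \<sigma> z) / automorphy \<sigma> z ^ 6
     - 2 * of_real (mC \<sigma>) * Q2 (moebius \<sigma> z) / automorphy \<sigma> z ^ 5"

lemma slash_4_eq: "slash 4 \<sigma> Q2 = slashed_Q2 \<sigma> Q2"
proof (rule ext)
  fix z
  have "j powi (- 4) * A = A / j ^ 4" for j A :: complex
    by (simp add: power_int_minus divide_inverse mult.commute)
  then show "slash 4 \<sigma> Q2 z = slashed_Q2 \<sigma> Q2 z" by (simp only: slash_def slashed_Q2_def)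
qed

text \<open>
  In the third derivative of \<open>(c z + d) ^ 2 * y (\<sigma> z)\<close> all terms with lower derivatives of \<open>y\<close> cancel,
  and \<open>(c z + d) ^ (- 4) * y''' (\<sigma> z)\<close> remains.
\<close>

lemma bol:
  assumes \<sigma>: "det \<sigma> = 1" and V: "open V" and y: "solution_on Q2 Q3 V y"
  shows "solution_on (slashed_Q2 \<sigma> Q2) (slashed_Q3 \<sigma> Q2 Q3)
     {z \<in> upper_half_plane. moebius \<sigma> z \<in> V} (slash (-2) \<sigma> y)"
proof -
  define S where "S = {z \<in> upper_half_plane. moebius \<sigma> z \<in> V}"
  define m where "m = moebius \<sigma>"
  define j where "j = automorphy \<sigma>"
  define c where "c = complex_of_real (mC \<sigma>)"
  have S_eq: "S = upper_half_plane \<inter> moebius \<sigma> -` V" by (auto simp: S_def)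
  have "open S"
    unfolding S_eq
    by (intro continuous_open_preimage holomorphic_on_imp_continuous_on moebius_holomorphic \<sigma>
        upper_half_plane_open V)
  have hy: "y holomorphic_on V" using y by (auto simp: solution_on_def)
  have dj: "(j has_field_derivative c) (at z)" for z unfolding j_def c_def by (rule automorphy_deriv)
  have j0: "j z \<noteq> 0" if "z \<in> S" for z
    using that automorphy_nonzero[OF \<sigma>] by (simp add: S_def j_def)
  have dm: "(m has_field_derivative 1 / j z ^ 2) (at z)" if "z \<in> S" for z
    unfolding m_def j_def using moebius_deriv[OF \<sigma>] that by (simp add: S_def)
  have mV: "m z \<in> V" if "z \<in> S" for z using that by (simp add: S_def m_def)
  have d0: "((\<lambda>z. y (m z)) has_field_derivative deriv y (m z) / j z ^ 2) (at z)"
    and d1: "((\<lambda>z. deriv y (m z)) has_field_derivative (deriv ^^ 2) y (m z) / j z ^ 2) (at z)"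
    and d2: "((\<lambda>z. (deriv ^^ 2) y (m z)) has_field_derivative (deriv ^^ 3) y (m z) / j z ^ 2) (at z)"
    if z: "z \<in> S" for z
    using DERIV_chain2[OF holomorphic_has_deriv(1)[OF hy V mV[OF z]] dm[OF z]]
      DERIV_chain2[OF holomorphic_has_deriv(2)[OF hy V mV[OF z]] dm[OF z]]
      DERIV_chain2[OF holomorphic_has_deriv(3)[OF hy V mV[OF z]] dm[OF z]] by simp_all
  have slash: "slash (-2) \<sigma> y = (\<lambda>z. j z ^ 2 * y (m z))"
    by (simp add: slash_def j_def m_def fun_eq_iff)
  show ?thesis
    unfolding S_def[symmetric] slash
  proof (rule solution_onI[OF \<open>open S\<close>])
    fix z assume z: "z \<in> S"
    note * = d0[OF z] d1[OF z] d2[OF z] dj j0[OF z]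
    show "((\<lambda>z. j z ^ 2 * y (m z)) has_field_derivative
       2 * c * j z * y (m z) + deriv y (m z)) (at z)"
      by (rule derivative_eq_intros * refl)+ (use j0[OF z] in \<open>simp add: field_simps power2_eq_square\<close>)
    show "((\<lambda>z. 2 * c * j z * y (m z) + deriv y (m z)) has_field_derivative
       2 * c ^ 2 * y (m z) + 2 * c * deriv y (m z) / j z + (deriv ^^ 2) y (m z) / j z ^ 2) (at z)"
      by (rule derivative_eq_intros * refl)+ (use j0[OF z] in \<open>simp add: field_simps power2_eq_square\<close>)
    show "((\<lambda>z. 2 * c ^ 2 * y (m z) + 2 * c * deriv y (m z) / j z + (deriv ^^ 2) y (m z) / j z ^ 2)
      has_field_derivative (deriv ^^ 3) y (m z) / j z ^ 4) (at z)"
    proof -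
      have "((\<lambda>z. 2 * c ^ 2 * y (m z) + 2 * c * deriv y (m z) / j z + (deriv ^^ 2) y (m z) / j z ^ 2)
        has_field_derivative (2 * c ^ 2 * (deriv y (m z) / j z ^ 2)
         + (2 * c * ((deriv ^^ 2) y (m z) / j z ^ 2) * j z - 2 * c * deriv y (m z) * c) / (j z * j z)
         + ((deriv ^^ 3) y (m z) / j z ^ 2 * j z ^ 2 - (deriv ^^ 2) y (m z) * (2 * j z * c)) / (j z ^ 2 * j z ^ 2))) (at z)"
        by (rule derivative_eq_intros * refl power_not_zero)+ (simp add: algebra_simps)
      moreover have "2 * c ^ 2 * (A / J ^ 2) + (2 * c * (B / J ^ 2) * J - 2 * c * A * c) / (J * J)
         + (C / J ^ 2 * J ^ 2 - B * (2 * J * c)) / (J ^ 2 * J ^ 2) = C / J ^ 4" if "J \<noteq> 0" for A B C J :: complex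
        using that by (simp add: field_simps power2_eq_square power4_eq_xxxx)
      ultimately show ?thesis using j0[OF z] by simp
    qed
    have 3: "(deriv ^^ 3) y (m z) = - Q2 (m z) * deriv y (m z) - Q3 (m z) * y (m z)"
      by (rule solution_on_deriv3[OF y mV[OF z]])
    have "(- A * B' - C * B) / J ^ 4 + A / J ^ 4 * (2 * c * J * B + B')
       + (C / J ^ 6 - 2 * c * A / J ^ 5) * (J ^ 2 * B) = 0" if "J \<noteq> 0" for A B B' C J :: complex
      using that by (simp add: field_simps power_numeral_reduce)
    then show "(deriv ^^ 3) y (m z) / j z ^ 4 + slashed_Q2 \<sigma> Q2 z * (2 * c * j z * y (m z) + deriv y (m z))
        + slashed_Q3 \<sigma> Q2 Q3 z * (j z ^ 2 * y (m z)) = 0"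
      unfolding 3 slashed_Q2_def slashed_Q3_def m_def[symmetric] j_def[symmetric] c_def[symmetric]
      using j0[OF z] by blast
  qed
qed

text \<open>
  Differentiating the factor \<open>(c z + d) ^ (- 4)\<close> of \<open>slashed_Q2\<close> produces twice the extra term of
  \<open>slashed_Q3\<close>, so that it cancels.
\<close>

lemma slash6_slashed:
  assumes \<sigma>: "det \<sigma> = 1" "Im z > 0" and Q2: "Q2 field_differentiable (at (moebius \<sigma> z))"
  shows "slash 6 \<sigma> (\<lambda>z. Q3 z - 1/2 * deriv Q2 z) z
     = slashed_Q3 \<sigma> Q2 Q3 z - 1/2 * deriv (slashed_Q2 \<sigma> Q2) z"
proof -
  define m where "m = moebius \<sigma> z"
  define j where "j = automorphy \<sigma> z"
  define c where "c = complex_of_real (mC \<sigma>)"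
  have j0: "j \<noteq> 0" unfolding j_def by (rule automorphy_nonzero[OF \<sigma>])
  have "(Q2 has_field_derivative deriv Q2 m) (at (moebius \<sigma> z))"
    using Q2 field_differentiable_derivI by (auto simp: m_def)
  from DERIV_chain2[OF this moebius_deriv[OF \<sigma>]]
  have d: "((\<lambda>z. Q2 (moebius \<sigma> z)) has_field_derivative deriv Q2 m * (1 / j ^ 2)) (at z)"
    by (simp add: j_def)
  have "(slashed_Q2 \<sigma> Q2 has_field_derivative
     (deriv Q2 m * (1 / j ^ 2) * j ^ 4 - Q2 m * (4 * j ^ 3 * c)) / (j ^ 4 * j ^ 4)) (at z)"
    unfolding slashed_Q2_def [abs_def]
    by (rule derivative_eq_intros d automorphy_deriv refl)+
      (use j0 in \<open>auto simp: j_def m_def c_def\<close>)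
  then have e: "deriv (slashed_Q2 \<sigma> Q2) z
     = (deriv Q2 m * (1 / j ^ 2) * j ^ 4 - Q2 m * (4 * j ^ 3 * c)) / (j ^ 4 * j ^ 4)"
    by (rule DERIV_imp_deriv)
  have "(A - 1/2 * B) / j ^ 6 = A / j ^ 6 - 2 * c * C / j ^ 5
     - 1/2 * ((B * (1 / j ^ 2) * j ^ 4 - C * (4 * j ^ 3 * c)) / (j ^ 4 * j ^ 4))" for A B C :: complex
    using j0 by (simp add: field_simps power_numeral_reduce)
  moreover have "j powi (- 6) * A = A / j ^ 6" for A
    by (simp add: power_int_minus divide_inverse mult.commute)
  ultimately show ?thesis
    unfolding e slash_def slashed_Q3_def m_def[symmetric] j_def[symmetric] c_def[symmetric]
    by simp
qed

section \<open>Projective equations\<close>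

text \<open>
  Near \<open>z\<close> the functions become solutions after division by a common factor \<open>G\<close> without zeros.  Leaving
  \<open>G\<close> unspecified avoids carrying a branch of the cube root of the Wronskian through
  transformations.
\<close>

definition projective_equation where
  "projective_equation u1 u2 u3 Q2 Q3 z \<longleftrightarrow> (\<exists>V G. open V \<and> z \<in> V \<and> G holomorphic_on V \<and>
     (\<forall>x\<in>V. G x \<noteq> (0::complex)) \<and> solution_on Q2 Q3 V (\<lambda>x. u1 x / G x) \<and>
     solution_on Q2 Q3 V (\<lambda>x. u2 x / G x) \<and> solution_on Q2 Q3 V (\<lambda>x. u3 x / G x))"

text \<open>
  The two common factors have a holomorphic quotient without zeros, so
  \<open>scaled_solutions_determine_equation\<close> applies.
\<close>

lemma projective_equation_unique:
  assumes Q: "projective_equation u1 u2 u3 Q2 Q3 z" and R: "projective_equation u1 u2 u3 R2 R3 z"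
    and W: "wronskian3 u1 u2 u3 z \<noteq> 0"
  shows "R2 z = Q2 z" "R3 z = Q3 z"
proof -
  obtain V G where V: "open V" "z \<in> V" "G holomorphic_on V" "\<And>x. x \<in> V \<Longrightarrow> G x \<noteq> 0"
    and sV: "solution_on Q2 Q3 V (\<lambda>x. u1 x / G x)" "solution_on Q2 Q3 V (\<lambda>x. u2 x / G x)"
      "solution_on Q2 Q3 V (\<lambda>x. u3 x / G x)"
    using Q unfolding projective_equation_def by blast
  obtain U K where U: "open U" "z \<in> U" "K holomorphic_on U" "\<And>x. x \<in> U \<Longrightarrow> K x \<noteq> 0"
    and sU: "solution_on R2 R3 U (\<lambda>x. u1 x / K x)" "solution_on R2 R3 U (\<lambda>x. u2 x / K x)"
      "solution_on R2 R3 U (\<lambda>x. u3 x / K x)"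
    using R unfolding projective_equation_def by blast
  have hu: "u holomorphic_on V" if "solution_on Q2 Q3 V (\<lambda>x. u x / G x)" for u
  proof -
    have "(\<lambda>x. G x * (u x / G x)) holomorphic_on V"
      using that V(3) by (intro holomorphic_on_mult) (simp_all add: solution_on_def)
    then show ?thesis by (rule holomorphic_transform) (use V(4) in auto)
  qed
  note hu = hu[OF sV(1)] hu[OF sV(2)] hu[OF sV(3)]
  have "isCont (wronskian3 u1 u2 u3) z"
    using wronskian3_deriv[OF V(1,2) hu] DERIV_isCont by blast
  then have "\<forall>\<^sub>F x in nhds z. wronskian3 u1 u2 u3 x \<noteq> 0"
    using tendsto_imp_eventually_ne[OF _ W] by (simp add: isCont_def tendsto_at_iff_tendsto_nhds)
  then obtain T where T: "open T" "z \<in> T" "\<And>x. x \<in> T \<Longrightarrow> wronskian3 u1 u2 u3 x \<noteq> 0"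
    by (auto simp: eventually_nhds)
  define S where "S = V \<inter> U \<inter> T"
  have S: "open S" "z \<in> S" "S \<subseteq> V" "S \<subseteq> U" "S \<subseteq> T" using V U T by (auto simp: S_def)
  define r where "r = (\<lambda>x. G x / K x)"
  have nz: "G x \<noteq> 0" "K x \<noteq> 0" "wronskian3 u1 u2 u3 x \<noteq> 0" if "x \<in> S" for x
    using V U T S that by auto
  have hS: "G holomorphic_on S" "K holomorphic_on S" "u1 holomorphic_on S" "u2 holomorphic_on S" "u3 holomorphic_on S"
    using V U S hu by (meson holomorphic_on_subset)+
  have r: "r holomorphic_on S" "\<And>x. x \<in> S \<Longrightarrow> r x \<noteq> 0"
    unfolding r_def using nz by (auto intro!: holomorphic_on_divide hS)
  note s1 = sV[THEN solution_on_subset, OF S(3)]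
  have s2: "solution_on R2 R3 S (\<lambda>x. r x * (u x / G x))" if "solution_on R2 R3 U (\<lambda>x. u x / K x)" for u
    using solution_on_subset[OF that S(4)]
    by (rule iffD1[OF solution_on_cong[OF S(1)], rotated -1]) (use nz in \<open>auto simp: r_def\<close>)
  have W': "wronskian3 (\<lambda>x. u1 x / G x) (\<lambda>x. u2 x / G x) (\<lambda>x. u3 x / G x) x \<noteq> 0" if x: "x \<in> S" for x
  proof -
    have "wronskian3 (\<lambda>x. inverse (G x) * u1 x) (\<lambda>x. inverse (G x) * u2 x) (\<lambda>x. inverse (G x) * u3 x) x
       = inverse (G x) ^ 3 * wronskian3 u1 u2 u3 x"
      using nz hS by (intro wronskian3_scale[OF S(1) x] holomorphic_on_inverse) auto
    then show ?thesis using nz[OF x] by (simp add: divide_inverse mult.commute)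
  qed
  show "R2 z = Q2 z" "R3 z = Q3 z"
    using scaled_solutions_determine_equation[OF S(1) r s1 s2[OF sU(1)] s2[OF sU(2)] s2[OF sU(3)] W' S(2)]
    by auto
qed

lemma projective_equation_scale:
  assumes Q: "projective_equation u1 u2 u3 Q2 Q3 z" and U: "open U" "z \<in> U" and c: "c \<noteq> 0"
    and e: "\<And>x. x \<in> U \<Longrightarrow> u1 x = c * v1 x" "\<And>x. x \<in> U \<Longrightarrow> u2 x = c * v2 x" "\<And>x. x \<in> U \<Longrightarrow> u3 x = c * v3 x"
  shows "projective_equation v1 v2 v3 Q2 Q3 z"
proof -
  obtain V G where V: "open V" "z \<in> V" "G holomorphic_on V" "\<And>x. x \<in> V \<Longrightarrow> G x \<noteq> 0"
    and s: "solution_on Q2 Q3 V (\<lambda>x. u1 x / G x)"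
      "solution_on Q2 Q3 V (\<lambda>x. u2 x / G x)" "solution_on Q2 Q3 V (\<lambda>x. u3 x / G x)"
    using Q unfolding projective_equation_def by blast
  define S where "S = V \<inter> U"
  have S: "open S" "z \<in> S" "S \<subseteq> V" "S \<subseteq> U" using V U by (auto simp: S_def)
  have key: "solution_on Q2 Q3 S (\<lambda>x. v x / (G x / c))"
    if "solution_on Q2 Q3 V (\<lambda>x. u x / G x)" "\<And>x. x \<in> U \<Longrightarrow> u x = c * v x" for u v
    by (rule iffD1[OF solution_on_cong[OF S(1)] solution_on_subset[OF that(1) S(3)]])
      (use that(2) S(4) in auto)
  show ?thesis
    unfolding projective_equation_def
    by (intro exI[of _ S] exI[of _ "\<lambda>x. G x / c"] conjI S ballI key[OF s(1) e(1)] key[OF s(2) e(2)] key[OF s(3) e(3)])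
      (use V(3,4) S(3) c in \<open>auto intro!: holomorphic_intros intro: holomorphic_on_subset\<close>)
qed

section \<open>Two-by-two matrices and unipotent elements\<close>

lemma mat2_entries [simp]:
  "mA (mat2 a b c d) = a" "mB (mat2 a b c d) = b" "mC (mat2 a b c d) = c" "mD (mat2 a b c d) = d"
  by (simp_all add: mat2_def)

lemma mult_entries:
  "mA (\<gamma> ** \<delta>) = mA \<gamma> * mA \<delta> + mB \<gamma> * mC \<delta>" "mB (\<gamma> ** \<delta>) = mA \<gamma> * mB \<delta> + mB \<gamma> * mD \<delta>"
  "mC (\<gamma> ** \<delta>) = mC \<gamma> * mA \<delta> + mD \<gamma> * mC \<delta>" "mD (\<gamma> ** \<delta>) = mC \<gamma> * mB \<delta> + mD \<gamma> * mD \<delta>"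
  by (simp_all add: matrix_matrix_mult_def sum_2)

lemma uminus_entries:
  "mA (- \<gamma>) = - mA \<gamma>" "mB (- \<gamma>) = - mB \<gamma>" "mC (- \<gamma>) = - mC \<gamma>" "mD (- \<gamma>) = - mD \<gamma>"
  by simp_all

lemma mat_1_entries: "mA (mat 1) = 1" "mB (mat 1) = 0" "mC (mat 1) = 0" "mD (mat 1) = 1"
  by (simp_all add: mat_def)

lemma mat_eqI:
  fixes \<gamma> \<delta> :: "real^2^2"
  assumes "mA \<gamma> = mA \<delta>" "mB \<gamma> = mB \<delta>" "mC \<gamma> = mC \<delta>" "mD \<gamma> = mD \<delta>"
  shows "\<gamma> = \<delta>"
  using assms by (simp add: vec_eq_iff forall_2)

lemma det_entries: "det (\<gamma> :: real^2^2) = mA \<gamma> * mD \<gamma> - mB \<gamma> * mC \<gamma>"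
  by (simp add: det_2)

lemma SL2Z_iff: "\<sigma> \<in> SL2Z \<longleftrightarrow> det \<sigma> = 1 \<and> mA \<sigma> \<in> \<int> \<and> mB \<sigma> \<in> \<int> \<and> mC \<sigma> \<in> \<int> \<and> mD \<sigma> \<in> \<int>"
  by (auto simp: SL2Z_def forall_2)

lemma matrix_inv_det_1:
  fixes \<sigma> :: "real^2^2"
  assumes "det \<sigma> = 1"
  shows "matrix_inv \<sigma> = mat2 (mD \<sigma>) (- mB \<sigma>) (- mC \<sigma>) (mA \<sigma>)"
    "\<sigma> ** matrix_inv \<sigma> = mat 1" "matrix_inv \<sigma> ** \<sigma> = mat 1"
proof -
  let ?adj = "mat2 (mD \<sigma>) (- mB \<sigma>) (- mC \<sigma>) (mA \<sigma>)"
  have e: "mA \<sigma> * mD \<sigma> - mB \<sigma> * mC \<sigma> = 1" using assms by (rule det_eq_1D)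
  have adj: "\<sigma> ** ?adj = mat 1" "?adj ** \<sigma> = mat 1"
    using e by (auto intro!: mat_eqI simp: mult_entries mat_1_entries algebra_simps)
  then have "\<sigma> ** matrix_inv \<sigma> = mat 1 \<and> matrix_inv \<sigma> ** \<sigma> = mat 1"
    unfolding matrix_inv_def by (intro someI[where P = "\<lambda>A'. \<sigma> ** A' = mat 1 \<and> A' ** \<sigma> = mat 1"]) blast
  then show inv: "\<sigma> ** matrix_inv \<sigma> = mat 1" "matrix_inv \<sigma> ** \<sigma> = mat 1" by auto
  have "matrix_inv \<sigma> = (?adj ** \<sigma>) ** matrix_inv \<sigma>" unfolding adj by (simp add: matrix_mul_lid)
  also have "\<dots> = ?adj" unfolding matrix_mul_assoc[symmetric] inv by (simp add: matrix_mul_rid)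
  finally show "matrix_inv \<sigma> = ?adj" .
qed

definition unipotent :: "real^2^2 \<Rightarrow> real \<Rightarrow> real^2^2" where
  "unipotent \<sigma> N = \<sigma> ** mat2 1 N 0 1 ** matrix_inv \<sigma>"

lemma unipotent_eq:
  assumes "det \<sigma> = 1"
  shows "unipotent \<sigma> N = mat2 (1 - N * mA \<sigma> * mC \<sigma>) (N * mA \<sigma> ^ 2) (- N * mC \<sigma> ^ 2) (1 + N * mA \<sigma> * mC \<sigma>)"
proof -
  have "mA \<sigma> * mD \<sigma> = 1 + mB \<sigma> * mC \<sigma>" using det_eq_1D[OF assms] by simp
  then show ?thesis
    unfolding unipotent_def matrix_inv_det_1(1)[OF assms]
    by (intro mat_eqI) (simp_all add: mult_entries power2_eq_square algebra_simps)
qed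

lemma unipotent_det: "det \<sigma> = 1 \<Longrightarrow> det (unipotent \<sigma> N) = 1"
  by (simp add: unipotent_eq det_entries power2_eq_square algebra_simps)

lemma unipotent_add: "det \<sigma> = 1 \<Longrightarrow> unipotent \<sigma> N ** unipotent \<sigma> M = unipotent \<sigma> (N + M)"
  by (intro mat_eqI) (simp_all add: unipotent_eq mult_entries power2_eq_square algebra_simps)

lemma unipotent_0: "det \<sigma> = 1 \<Longrightarrow> unipotent \<sigma> 0 = mat 1"
  by (intro mat_eqI) (simp_all add: unipotent_eq mat_1_entries)

lemma unipotent_mult: "det \<sigma> = 1 \<Longrightarrow> unipotent \<sigma> N ** \<sigma> = \<sigma> ** mat2 1 N 0 1"
  unfolding unipotent_def by (simp only: matrix_mul_assoc[symmetric] matrix_inv_det_1(3) matrix_mul_rid)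

lemma unipotent_SL2Z: "\<sigma> \<in> SL2Z \<Longrightarrow> N \<in> \<int> \<Longrightarrow> unipotent \<sigma> N \<in> SL2Z"
  using unipotent_det by (auto simp: SL2Z_iff unipotent_eq power2_eq_square)

lemma moebius_uminus: "moebius (- \<gamma>) z = moebius \<gamma> z" "automorphy (- \<gamma>) z = - automorphy \<gamma> z"
proof -
  show a: "automorphy (- \<gamma>) z = - automorphy \<gamma> z" by (simp add: automorphy_def)
  have "moebius (- \<gamma>) z = (- (of_real (mA \<gamma>) * z + of_real (mB \<gamma>))) / (- automorphy \<gamma> z)"
    by (simp add: moebius_def a)
  also have "\<dots> = moebius \<gamma> z" unfolding moebius_def by (rule minus_divide_divide)
  finally show "moebius (- \<gamma>) z = moebius \<gamma> z" .
qed

section \<open>The symmetric square transformation law\<close>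

text \<open>
  The action under which \<open>\<phi>\<close> is invariant for the elements of \<open>\<Gamma>\<close>.  The expansion of \<open>\<phi>\<close> at a cusp is
  that of this function.
\<close>

definition phi_slash :: "complex \<Rightarrow> real^2^2 \<Rightarrow> (complex \<Rightarrow> complex) \<Rightarrow> complex \<Rightarrow> complex" where
  "phi_slash \<alpha> \<sigma> \<phi> z = slash 2 \<sigma> \<phi> z - \<alpha> * of_real (mC \<sigma>) / automorphy \<sigma> z"

text \<open>
  The quasimodular form whose components are the slashed ones, and below the functions \<open>h1\<close> and \<open>h2\<close>
  belonging to it.
\<close>

definition form_slash :: "complex \<Rightarrow> real^2^2 \<Rightarrow> int \<Rightarrow> (complex \<Rightarrow> complex) \<Rightarrow> (complex \<Rightarrow> complex) \<Rightarrow>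
    (complex \<Rightarrow> complex) \<Rightarrow> (complex \<Rightarrow> complex) \<Rightarrow> complex \<Rightarrow> complex" where
  "form_slash \<alpha> \<sigma> k \<phi> f0 f1 f2 z = slash k \<sigma> f0 z + slash (k - 2) \<sigma> f1 z * phi_slash \<alpha> \<sigma> \<phi> z
     + slash (k - 4) \<sigma> f2 z * phi_slash \<alpha> \<sigma> \<phi> z ^ 2"

definition h1_slash where
  "h1_slash \<alpha> \<sigma> k \<phi> f0 f1 f2 = h1 \<alpha> (phi_slash \<alpha> \<sigma> \<phi>) (form_slash \<alpha> \<sigma> k \<phi> f0 f1 f2)
     (slash (k - 2) \<sigma> f1) (slash (k - 4) \<sigma> f2)"

definition h2_slash where
  "h2_slash \<alpha> \<sigma> k \<phi> f0 f1 f2 = h2 \<alpha> (phi_slash \<alpha> \<sigma> \<phi>) (form_slash \<alpha> \<sigma> k \<phi> f0 f1 f2)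
     (slash (k - 2) \<sigma> f1) (slash (k - 4) \<sigma> f2)"

text \<open>
  The form \<open>f\<close> is the value of the binary quadratic form \<open>f0 X\<^sup>2 + f1 X Y + f2 Y\<^sup>2\<close> at \<open>(1, \<phi>)\<close>, the
  function \<open>h1\<close> is its value at \<open>(z, z \<phi> + \<alpha>)\<close>, and \<open>h2\<close> comes from the polarisation of these two
  values.
\<close>

lemma h_quadratic:
  assumes "f z = f0 z + f1 z * \<phi> z + f2 z * \<phi> z ^ 2"
  shows "h1 \<alpha> \<phi> f f1 f2 z = f0 z * z ^ 2 + f1 z * (z * (\<phi> z * z + \<alpha>)) + f2 z * (\<phi> z * z + \<alpha>) ^ 2"
    "h2 \<alpha> \<phi> f f1 f2 z = f0 z * (2 * z) + f1 z * (\<phi> z * z + \<alpha> + z * \<phi> z) + f2 z * (2 * \<phi> z * (\<phi> z * z + \<alpha>))"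
  unfolding h1_def h2_def assms by algebra+

text \<open>
  Up to scalars, the transformation laws say that \<open>\<sigma>\<close> acts on the vectors \<open>(z, z \<phi> + \<alpha>)\<close> and
  \<open>(1, \<phi>)\<close> by its matrix entries.  Values of a quadratic form at them therefore transform under the
  symmetric square of \<open>\<sigma>\<close>.
\<close>

lemma h_transform:
  fixes \<alpha> :: complex and k :: int
  assumes \<sigma>: "det \<sigma> = 1" and z: "Im z > 0"
    and f: "\<forall>w. Im w > 0 \<longrightarrow> f w = f0 w + f1 w * \<phi> w + f2 w * \<phi> w ^ 2"
  defines "H1 \<equiv> h1_slash \<alpha> \<sigma> k \<phi> f0 f1 f2 z" and "H2 \<equiv> h2_slash \<alpha> \<sigma> k \<phi> f0 f1 f2 z"
    and "H3 \<equiv> form_slash \<alpha> \<sigma> k \<phi> f0 f1 f2 z"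
    and "a \<equiv> complex_of_real (mA \<sigma>)" and "b \<equiv> complex_of_real (mB \<sigma>)"
    and "c \<equiv> complex_of_real (mC \<sigma>)" and "d \<equiv> complex_of_real (mD \<sigma>)"
  shows "h1 \<alpha> \<phi> f f1 f2 (moebius \<sigma> z) = automorphy \<sigma> z powi (k - 2) * (a ^ 2 * H1 + a * b * H2 + b ^ 2 * H3)"
    "h2 \<alpha> \<phi> f f1 f2 (moebius \<sigma> z) = automorphy \<sigma> z powi (k - 2) *
       (2 * a * c * H1 + (a * d + b * c) * H2 + 2 * b * d * H3)"
    "f (moebius \<sigma> z) = automorphy \<sigma> z powi (k - 2) * (c ^ 2 * H1 + c * d * H2 + d ^ 2 * H3)"
proof -
  define m where "m = moebius \<sigma> z"
  define j where "j = automorphy \<sigma> z"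
  define J where "J = j powi (k - 4)"
  define L where "L = a * z + b"
  define P where "P = phi_slash \<alpha> \<sigma> \<phi> z"
  define F0 where "F0 = slash k \<sigma> f0 z"
  define F1 where "F1 = slash (k - 2) \<sigma> f1 z"
  define F2 where "F2 = slash (k - 4) \<sigma> f2 z"
  have det: "a * d - b * c = 1" unfolding a_def b_def c_def d_def by (rule det_eq_1D_complex[OF \<sigma>])
  have j: "j = c * z + d" by (simp add: j_def automorphy_def c_def d_def)
  have j0: "j \<noteq> 0" unfolding j_def by (rule automorphy_nonzero[OF \<sigma> z])
  have mj: "m * j = L" using j0 by (simp add: m_def moebius_def L_def a_def b_def j_def)
  have k2: "j powi (k - 2) = J * j ^ 2"
    using power_int_add[of j "k - 4" 2] j0 by (simp add: J_def)
  have k4: "j powi k = J * j ^ 4"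
    using power_int_add[of j "k - 4" 4] j0 by (simp add: J_def)
  have inv: "j powi n * (j powi (- n) * x) = x" for n x
    using j0 by (simp add: power_int_minus)
  have f0: "f0 m = J * j ^ 4 * F0" and f1: "f1 m = J * j ^ 2 * F1" and f2: "f2 m = J * F2"
    using inv[of k "f0 m"] inv[of "k - 2" "f1 m"] inv[of "k - 4" "f2 m"]
    unfolding F0_def F1_def F2_def slash_def j_def[symmetric] m_def[symmetric] k4 k2 J_def[symmetric]
    by simp_all
  have \<phi>: "\<phi> m = j * (j * P + \<alpha> * c)"
  proof -
    have "P = j powi (- 2) * \<phi> m - \<alpha> * c / j"
      by (simp add: P_def phi_slash_def slash_def j_def m_def c_def)
    then show ?thesis using j0 by (simp add: power_int_minus field_simps power2_eq_square)
  qed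
  have \<phi>m: "\<phi> m * m + \<alpha> = j * (P * L + \<alpha> * a)"
  proof -
    have "\<phi> m * m = (j * P + \<alpha> * c) * L" unfolding \<phi> mj[symmetric] by (simp add: ac_simps)
    then show ?thesis unfolding L_def j using det by algebra
  qed
  have H: "H1 = F0 * z ^ 2 + F1 * (z * (P * z + \<alpha>)) + F2 * (P * z + \<alpha>) ^ 2"
    "H2 = F0 * (2 * z) + F1 * (P * z + \<alpha> + z * P) + F2 * (2 * P * (P * z + \<alpha>))"
    "H3 = F0 + F1 * P + F2 * P ^ 2"
    unfolding H1_def H2_def H3_def h1_slash_def h2_slash_def F0_def F1_def F2_def P_def
    using h_quadratic[of "form_slash \<alpha> \<sigma> k \<phi> f0 f1 f2" z "slash k \<sigma> f0" "slash (k - 2) \<sigma> f1"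
      "phi_slash \<alpha> \<sigma> \<phi>" "slash (k - 4) \<sigma> f2" \<alpha>]
    by (simp_all add: form_slash_def)
  have e: "P * L + \<alpha> * a = a * (P * z + \<alpha>) + b * P" "j * P + \<alpha> * c = c * (P * z + \<alpha>) + d * P"
    unfolding L_def j by algebra+
  have f': "f m = f0 m + f1 m * \<phi> m + f2 m * \<phi> m ^ 2" using f[rule_format, OF Im_moebius_pos[OF \<sigma> z]] by (simp add: m_def)
  show "h1 \<alpha> \<phi> f f1 f2 (moebius \<sigma> z) = automorphy \<sigma> z powi (k - 2) * (a ^ 2 * H1 + a * b * H2 + b ^ 2 * H3)"
  proof -
    have "h1 \<alpha> \<phi> f f1 f2 m = f0 m * m ^ 2 + f1 m * (m * (\<phi> m * m + \<alpha>)) + f2 m * (\<phi> m * m + \<alpha>) ^ 2"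
      by (rule h_quadratic(1)[of f m f0 f1 \<phi> f2 \<alpha>, OF f'])
    also have "\<dots> = J * j ^ 2 * (F0 * (m * j) ^ 2 + F1 * ((m * j) * (P * L + \<alpha> * a)) + F2 * (P * L + \<alpha> * a) ^ 2)"
      unfolding f0 f1 f2 \<phi>m by algebra
    also have "\<dots> = J * j ^ 2 * (a ^ 2 * H1 + a * b * H2 + b ^ 2 * H3)"
      unfolding mj e H L_def by algebra
    finally show ?thesis by (simp add: m_def k2[unfolded j_def] j_def)
  qed
  show "h2 \<alpha> \<phi> f f1 f2 (moebius \<sigma> z) = automorphy \<sigma> z powi (k - 2) *
       (2 * a * c * H1 + (a * d + b * c) * H2 + 2 * b * d * H3)"
  proof -
    have "h2 \<alpha> \<phi> f f1 f2 m = f0 m * (2 * m) + f1 m * (\<phi> m * m + \<alpha> + m * \<phi> m) + f2 m * (2 * \<phi> m * (\<phi> m * m + \<alpha>))"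
      by (rule h_quadratic(2)[of f m f0 f1 \<phi> f2 \<alpha>, OF f'])
    also have "\<dots> = J * j ^ 2 * (F0 * (2 * (m * j) * j) + F1 * (j * (P * L + \<alpha> * a) + (m * j) * (j * P + \<alpha> * c))
        + F2 * (2 * (j * P + \<alpha> * c) * (P * L + \<alpha> * a)))"
      unfolding f0 f1 f2 \<phi>m unfolding \<phi> by algebra
    also have "\<dots> = J * j ^ 2 * (2 * a * c * H1 + (a * d + b * c) * H2 + 2 * b * d * H3)"
      unfolding mj e H unfolding L_def j by algebra
    finally show ?thesis by (simp add: m_def k2[unfolded j_def] j_def)
  qed
  show "f (moebius \<sigma> z) = automorphy \<sigma> z powi (k - 2) * (c ^ 2 * H1 + c * d * H2 + d ^ 2 * H3)"
  proof -
    have "f m = J * j ^ 2 * (F0 * j ^ 2 + F1 * (j * (j * P + \<alpha> * c)) + F2 * (j * P + \<alpha> * c) ^ 2)"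
      unfolding f' f0 f1 f2 \<phi> by algebra
    also have "\<dots> = J * j ^ 2 * (c ^ 2 * H1 + c * d * H2 + d ^ 2 * H3)"
      unfolding e H j by algebra
    finally show ?thesis by (simp add: m_def k2[unfolded j_def] j_def)
  qed
qed

lemma h_transform_inverse:
  fixes \<alpha> :: complex and k :: int
  assumes \<sigma>: "det \<sigma> = 1" and z: "Im z > 0"
    and f: "\<forall>w. Im w > 0 \<longrightarrow> f w = f0 w + f1 w * \<phi> w + f2 w * \<phi> w ^ 2"
  defines "X1 \<equiv> h1 \<alpha> \<phi> f f1 f2 (moebius \<sigma> z)" and "X2 \<equiv> h2 \<alpha> \<phi> f f1 f2 (moebius \<sigma> z)"
    and "X3 \<equiv> f (moebius \<sigma> z)"
    and "a \<equiv> complex_of_real (mA \<sigma>)" and "b \<equiv> complex_of_real (mB \<sigma>)"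
    and "c \<equiv> complex_of_real (mC \<sigma>)" and "d \<equiv> complex_of_real (mD \<sigma>)"
  shows "automorphy \<sigma> z powi (k - 2) * h1_slash \<alpha> \<sigma> k \<phi> f0 f1 f2 z = d ^ 2 * X1 - b * d * X2 + b ^ 2 * X3"
    "automorphy \<sigma> z powi (k - 2) * h2_slash \<alpha> \<sigma> k \<phi> f0 f1 f2 z = - 2 * c * d * X1 + (a * d + b * c) * X2 - 2 * a * b * X3"
    "automorphy \<sigma> z powi (k - 2) * form_slash \<alpha> \<sigma> k \<phi> f0 f1 f2 z = c ^ 2 * X1 - a * c * X2 + a ^ 2 * X3"
proof -
  define H1 H2 H3 J where "H1 = h1_slash \<alpha> \<sigma> k \<phi> f0 f1 f2 z" "H2 = h2_slash \<alpha> \<sigma> k \<phi> f0 f1 f2 z"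
    "H3 = form_slash \<alpha> \<sigma> k \<phi> f0 f1 f2 z" "J = automorphy \<sigma> z powi (k - 2)"
  note defs = H1_H2_H3_J_def
  have det: "a * d - b * c = 1" unfolding a_def b_def c_def d_def by (rule det_eq_1D_complex[OF \<sigma>])
  have X: "X1 = J * (a ^ 2 * H1 + a * b * H2 + b ^ 2 * H3)"
    "X2 = J * (2 * a * c * H1 + (a * d + b * c) * H2 + 2 * b * d * H3)"
    "X3 = J * (c ^ 2 * H1 + c * d * H2 + d ^ 2 * H3)"
    unfolding X1_def X2_def X3_def a_def b_def c_def d_def defs
    by (rule h_transform(1)[OF \<sigma> z f] h_transform(2)[OF \<sigma> z f] h_transform(3)[OF \<sigma> z f]; assumption)+
  show "automorphy \<sigma> z powi (k - 2) * h1_slash \<alpha> \<sigma> k \<phi> f0 f1 f2 z = d ^ 2 * X1 - b * d * X2 + b ^ 2 * X3"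
    unfolding X defs[symmetric] using det by algebra
  show "automorphy \<sigma> z powi (k - 2) * h2_slash \<alpha> \<sigma> k \<phi> f0 f1 f2 z = - 2 * c * d * X1 + (a * d + b * c) * X2 - 2 * a * b * X3"
    unfolding X defs[symmetric] using det by algebra
  show "automorphy \<sigma> z powi (k - 2) * form_slash \<alpha> \<sigma> k \<phi> f0 f1 f2 z = c ^ 2 * X1 - a * c * X2 + a ^ 2 * X3"
    unfolding X defs[symmetric] using det by algebra
qed

text \<open>
  By Bol's identity, the functions \<open>(h\<^sub>j / G)|\<sigma>\<close> of weight \<open>-2\<close> solve the slashed equation, and the
  slashed functions are constant combinations of them up to a common factor.
\<close>

lemma projective_equation_slash:
  assumes \<sigma>: "det \<sigma> = 1" and z: "Im z > 0"
    and f: "\<forall>w. Im w > 0 \<longrightarrow> f w = f0 w + f1 w * \<phi> w + f2 w * \<phi> w ^ 2"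
    and Q: "projective_equation (h1 \<alpha> \<phi> f f1 f2) (h2 \<alpha> \<phi> f f1 f2) f Q2 Q3 (moebius \<sigma> z)"
  shows "projective_equation (h1_slash \<alpha> \<sigma> k \<phi> f0 f1 f2) (h2_slash \<alpha> \<sigma> k \<phi> f0 f1 f2)
    (form_slash \<alpha> \<sigma> k \<phi> f0 f1 f2) (slashed_Q2 \<sigma> Q2) (slashed_Q3 \<sigma> Q2 Q3) z"
proof -
  obtain V G where V: "open V" "moebius \<sigma> z \<in> V" "G holomorphic_on V" "\<And>x. x \<in> V \<Longrightarrow> G x \<noteq> 0"
    and s: "solution_on Q2 Q3 V (\<lambda>x. h1 \<alpha> \<phi> f f1 f2 x / G x)"
      "solution_on Q2 Q3 V (\<lambda>x. h2 \<alpha> \<phi> f f1 f2 x / G x)" "solution_on Q2 Q3 V (\<lambda>x. f x / G x)"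
    using Q unfolding projective_equation_def by blast
  define S where "S = {z \<in> upper_half_plane. moebius \<sigma> z \<in> V}"
  have S_eq: "S = upper_half_plane \<inter> moebius \<sigma> -` V" by (auto simp: S_def)
  have S: "open S" "z \<in> S"
    unfolding S_eq using z V(2)
    by (auto intro!: continuous_open_preimage holomorphic_on_imp_continuous_on moebius_holomorphic \<sigma>
        upper_half_plane_open V)
  define j where "j = automorphy \<sigma>"
  have j0: "j x \<noteq> 0" if "x \<in> S" for x
    using that automorphy_nonzero[OF \<sigma>] by (simp add: S_def j_def)
  define K where "K = (\<lambda>x. j x powi (- k) * G (moebius \<sigma> x))"
  have "(\<lambda>x. G (moebius \<sigma> x)) holomorphic_on S"
    using holomorphic_on_compose_gen[OF holomorphic_on_subset[OF moebius_holomorphic[OF \<sigma>]] V(3), of S]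
    by (auto simp: S_def comp_def)
  then have hK: "K holomorphic_on S"
    unfolding K_def using j0
    by (intro holomorphic_intros) (auto simp: j_def intro: automorphy_holomorphic)
  have K0: "K x \<noteq> 0" if "x \<in> S" for x
    using j0[OF that] V(4) that by (simp add: K_def S_def)
  note b = bol[OF \<sigma> V(1), folded S_def]
  have key: "solution_on (slashed_Q2 \<sigma> Q2) (slashed_Q3 \<sigma> Q2 Q3) S (\<lambda>x. u x / K x)"
    if u: "\<And>x. Im x > 0 \<Longrightarrow> j x powi (k - 2) * u x =
      p * h1 \<alpha> \<phi> f f1 f2 (moebius \<sigma> x) + q * h2 \<alpha> \<phi> f f1 f2 (moebius \<sigma> x) + r * f (moebius \<sigma> x)" for u p q r
  proof -
    have "solution_on (slashed_Q2 \<sigma> Q2) (slashed_Q3 \<sigma> Q2 Q3) S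
      (\<lambda>x. p * slash (-2) \<sigma> (\<lambda>x. h1 \<alpha> \<phi> f f1 f2 x / G x) x + q * slash (-2) \<sigma> (\<lambda>x. h2 \<alpha> \<phi> f f1 f2 x / G x) x
       + r * slash (-2) \<sigma> (\<lambda>x. f x / G x) x)"
      by (intro solution_on_lincomb3 S b s)
    then show ?thesis
    proof (subst solution_on_cong[OF S(1) _ refl refl])
      fix x assume x: "x \<in> S"
      then have x0: "Im x > 0" by (simp add: S_def)
      have J: "j x powi (k - 2) * j x ^ 2 = j x powi k"
        using power_int_add[of "j x" "k - 2" 2] j0[OF x] by simp
      have "u x / K x = u x * j x powi k / G (moebius \<sigma> x)"
        using j0[OF x] by (simp add: K_def power_int_minus field_simps)
      also have "\<dots> = j x ^ 2 * (j x powi (k - 2) * u x) / G (moebius \<sigma> x)"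
        unfolding J[symmetric] by (simp add: mult_ac)
      also have "\<dots> = p * slash (-2) \<sigma> (\<lambda>x. h1 \<alpha> \<phi> f f1 f2 x / G x) x + q * slash (-2) \<sigma> (\<lambda>x. h2 \<alpha> \<phi> f f1 f2 x / G x) x
       + r * slash (-2) \<sigma> (\<lambda>x. f x / G x) x"
        unfolding u[OF x0] slash_def j_def[symmetric] by (simp add: add_divide_distrib algebra_simps)
      finally show "u x / K x = p * slash (-2) \<sigma> (\<lambda>x. h1 \<alpha> \<phi> f f1 f2 x / G x) x
        + q * slash (-2) \<sigma> (\<lambda>x. h2 \<alpha> \<phi> f f1 f2 x / G x) x + r * slash (-2) \<sigma> (\<lambda>x. f x / G x) x" .
    qed
  qed
  note inv = h_transform_inverse[OF \<sigma> _ f, folded j_def]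
  show ?thesis
    unfolding projective_equation_def
  proof (intro exI[of _ S] exI[of _ K] conjI S hK ballI K0)
    show "solution_on (slashed_Q2 \<sigma> Q2) (slashed_Q3 \<sigma> Q2 Q3) S (\<lambda>x. h1_slash \<alpha> \<sigma> k \<phi> f0 f1 f2 x / K x)"
      by (rule key[where p = "of_real (mD \<sigma>) ^ 2" and q = "- of_real (mB \<sigma>) * of_real (mD \<sigma>)" and r = "of_real (mB \<sigma>) ^ 2"])
        (subst inv(1), auto)
    show "solution_on (slashed_Q2 \<sigma> Q2) (slashed_Q3 \<sigma> Q2 Q3) S (\<lambda>x. h2_slash \<alpha> \<sigma> k \<phi> f0 f1 f2 x / K x)"
      by (rule key[where p = "- 2 * of_real (mC \<sigma>) * of_real (mD \<sigma>)"
            and q = "of_real (mA \<sigma>) * of_real (mD \<sigma>) + of_real (mB \<sigma>) * of_real (mC \<sigma>)"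
            and r = "- 2 * of_real (mA \<sigma>) * of_real (mB \<sigma>)"])
        (subst inv(2), auto)
    show "solution_on (slashed_Q2 \<sigma> Q2) (slashed_Q3 \<sigma> Q2 Q3) S (\<lambda>x. form_slash \<alpha> \<sigma> k \<phi> f0 f1 f2 x / K x)"
      by (rule key[where p = "of_real (mC \<sigma>) ^ 2" and q = "- of_real (mA \<sigma>) * of_real (mC \<sigma>)" and r = "of_real (mA \<sigma>) ^ 2"])
        (subst inv(3), auto)
  qed
qed

section \<open>Unipotent elements of commensurable groups\<close>

text \<open>
  The pigeonhole principle, applied to the cosets of the powers of a unipotent element.
\<close>

lemma finite_index_power:
  assumes fin: "finite_index (\<Gamma> \<inter> SL2Z) SL2Z" and one: "mat 1 \<in> \<Gamma>" and \<sigma>: "\<sigma> \<in> SL2Z"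
  obtains n :: nat where "n > 0" "unipotent \<sigma> (real n) \<in> \<Gamma>"
proof -
  have d: "det \<sigma> = 1" using \<sigma> by (simp add: SL2Z_iff)
  define u where "u = (\<lambda>n::nat. unipotent \<sigma> (real n))"
  have u: "u n \<in> SL2Z" for n unfolding u_def by (intro unipotent_SL2Z \<sigma>) simp
  define co where "co = (\<lambda>a::real^2^2. (\<lambda>h. h ** a) ` (\<Gamma> \<inter> SL2Z))"
  have "rcosets\<^bsub>SL2R\<lparr>carrier := SL2Z\<rparr>\<^esub> (\<Gamma> \<inter> SL2Z) = co ` SL2Z"
    by (auto simp: RCOSETS_def r_coset_def co_def SL2R_def)
  then have "finite (co ` SL2Z)" using fin by (simp add: finite_index_def)
  moreover have "range (\<lambda>n. co (u n)) \<subseteq> co ` SL2Z" using u by auto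
  ultimately have "finite (range (\<lambda>n. co (u n)))" by (rule finite_subset[rotated])
  then have "\<not> inj (\<lambda>n. co (u n))" using finite_imageD by blast
  then obtain n m where nm: "n < m" "co (u n) = co (u m)"
    unfolding inj_def by (metis linorder_neqE_nat)
  have "mat 1 \<in> \<Gamma> \<inter> SL2Z" using one by (auto simp: SL2Z_iff mat_1_entries)
  then have "mat 1 ** u m \<in> co (u m)" unfolding co_def by (rule imageI)
  then have "u m \<in> co (u n)" using nm(2) by (simp add: matrix_mul_lid)
  then obtain h where h: "h \<in> \<Gamma>" "u m = h ** u n" unfolding co_def by auto
  have "unipotent \<sigma> (real (m - n)) = u m ** unipotent \<sigma> (- real n)"
    unfolding u_def unipotent_add[OF d] using nm(1) by (simp add: of_nat_diff)
  also have "\<dots> = h ** (u n ** unipotent \<sigma> (- real n))" unfolding h(2) by (simp add: matrix_mul_assoc)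
  also have "u n ** unipotent \<sigma> (- real n) = mat 1" unfolding u_def unipotent_add[OF d] by (simp add: unipotent_0[OF d])
  finally have "unipotent \<sigma> (real (m - n)) \<in> \<Gamma>" using h by (simp add: matrix_mul_rid)
  then show ?thesis using that[of "m - n"] nm(1) by simp
qed

text \<open>
  If the infimum were not attained, elements close to it would have a positive difference less than
  \<open>e\<close>.
\<close>

lemma discrete_additive_Inf:
  fixes A :: "real set"
  assumes pos: "a \<in> A" "a > 0" and diff: "\<And>x y. x \<in> A \<Longrightarrow> y \<in> A \<Longrightarrow> x - y \<in> A"
    and e: "e > 0" "\<And>x. x \<in> A \<Longrightarrow> 0 < x \<Longrightarrow> e \<le> x"
  shows "Inf {x. x > 0 \<and> x \<in> A} \<in> A" "Inf {x. x > 0 \<and> x \<in> A} > 0"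
proof -
  define B where "B = {x. x > 0 \<and> x \<in> A}"
  have ne: "B \<noteq> {}" using pos by (auto simp: B_def)
  have bdd: "bdd_below B" unfolding B_def by (rule bdd_belowI[of _ 0]) auto
  have "e \<le> Inf B" using e by (intro cInf_greatest ne) (auto simp: B_def)
  then show pos: "Inf {x. x > 0 \<and> x \<in> A} > 0" using e by (simp add: B_def)
  have "Inf B \<in> B"
  proof (rule ccontr)
    assume not: "Inf B \<notin> B"
    obtain x where x: "x \<in> B" "x < Inf B + e" using cInf_lessD[OF ne, of "Inf B + e"] e by auto
    have "Inf B < x" using cInf_lower[OF x(1) bdd] not x(1) by (metis less_le)
    then obtain y where y: "y \<in> B" "y < x" using cInf_lessD[OF ne] by blast
    have "Inf B \<le> y" by (rule cInf_lower[OF y(1) bdd])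
    then have "x - y < e" "x - y > 0" using x y by auto
    moreover have "x - y \<in> A" using x y diff by (auto simp: B_def)
    ultimately show False using e(2) by fastforce
  qed
  then show "Inf {x. x > 0 \<and> x \<in> A} \<in> A" by (simp add: B_def)
qed

text \<open>
  The map \<open>N \<mapsto> unipotent \<sigma> N\<close> is continuous and injective, so an open set that separates the identity
  from the rest of \<open>\<Gamma>\<close> pulls back to a neighbourhood of \<open>0\<close>.
\<close>

lemma discrete_unipotent:
  fixes \<Gamma> :: "(real^2^2) set"
  assumes disc: "discrete \<Gamma>" and one: "mat 1 \<in> \<Gamma>" and \<sigma>: "det \<sigma> = 1"
  obtains e where "e > 0" "\<And>N. N > 0 \<Longrightarrow> unipotent \<sigma> N \<in> \<Gamma> \<Longrightarrow> e \<le> N"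
proof -
  obtain T where T: "open T" "T \<inter> \<Gamma> = {mat 1}"
    using disc one unfolding discrete_def isolated_in_def by blast
  define E0 where "E0 = mat2 (- (mA \<sigma> * mC \<sigma>)) ((mA \<sigma>)^2) (- ((mC \<sigma>)^2)) (mA \<sigma> * mC \<sigma>)"
  have u: "unipotent \<sigma> N = mat 1 + N *\<^sub>R E0" for N
    unfolding unipotent_eq[OF \<sigma>] by (intro mat_eqI) (simp_all add: E0_def mat_1_entries)
  have "continuous_on UNIV (\<lambda>N. unipotent \<sigma> N)" unfolding u by (intro continuous_intros)
  then have "open ((\<lambda>N. unipotent \<sigma> N) -` T)" using T(1) by (auto intro: open_vimage)
  moreover have "0 \<in> (\<lambda>N. unipotent \<sigma> N) -` T" using T(2) by (auto simp: unipotent_0[OF \<sigma>])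
  ultimately obtain e where e: "e > 0" "ball 0 e \<subseteq> (\<lambda>N. unipotent \<sigma> N) -` T"
    by (meson open_contains_ball)
  show ?thesis
  proof (rule that[OF e(1)], rule ccontr)
    fix N assume N: "N > 0" "unipotent \<sigma> N \<in> \<Gamma>" "\<not> e \<le> N"
    then have "N \<in> ball 0 e" by simp
    then have "unipotent \<sigma> N = mat 1" using e(2) T(2) N(2) by blast
    then have "mB (unipotent \<sigma> N) = 0" "mC (unipotent \<sigma> N) = 0"
      by (simp_all only: mat_1_entries)
    then have "N * mA \<sigma> ^ 2 = 0" "N * mC \<sigma> ^ 2 = 0"
      unfolding unipotent_eq[OF \<sigma>] by simp_all
    then have "mA \<sigma> = 0" "mC \<sigma> = 0" using N(1) by auto
    then show False using det_eq_1D[OF \<sigma>] by simp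
  qed
qed

section \<open>Quasimodular forms of depth two\<close>

locale quasimodular_setup =
  fixes \<Gamma> :: "(real^2^2) set" and chi :: "real^2^2 \<Rightarrow> complex"
    and \<phi> f f0 f1 f2 :: "complex \<Rightarrow> complex" and \<alpha> :: complex and k :: int
  assumes subgroup: "subgroup \<Gamma> SL2R" and disc: "discrete \<Gamma>" and comm: "commensurable \<Gamma> SL2Z"
    and char: "finite_order_character \<Gamma> chi" and wt2: "quasimodular_weight2 \<Gamma> \<alpha> \<phi>"
    and depth2: "quasimodular_depth2 \<Gamma> chi \<phi> k f f0 f1 f2"
begin

abbreviation "w1 \<equiv> h1 \<alpha> \<phi> f f1 f2"
abbreviation "w2 \<equiv> h2 \<alpha> \<phi> f f1 f2"

lemma \<alpha>_nonzero: "\<alpha> \<noteq> 0" using wt2 by (simp add: quasimodular_weight2_def)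

lemma det_\<Gamma>: "\<gamma> \<in> \<Gamma> \<Longrightarrow> det \<gamma> = 1"
  using subgroup.subset[OF subgroup] by (auto simp: SL2R_def)

lemma one_\<Gamma>: "mat 1 \<in> \<Gamma>"
  using subgroup.one_closed[OF subgroup] by (simp add: SL2R_def)

lemma mult_\<Gamma>: "\<gamma> \<in> \<Gamma> \<Longrightarrow> \<delta> \<in> \<Gamma> \<Longrightarrow> \<gamma> ** \<delta> \<in> \<Gamma>"
  using subgroup.m_closed[OF subgroup] by (simp add: SL2R_def)

lemma inverse_\<Gamma>: "\<gamma> \<in> \<Gamma> \<Longrightarrow> matrix_inv \<gamma> \<in> \<Gamma>"
proof -
  assume g: "\<gamma> \<in> \<Gamma>"
  have d: "det \<gamma> = 1" by (rule det_\<Gamma>[OF g])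
  note inv = matrix_inv_det_1[OF d]
  have "inv\<^bsub>SL2R\<^esub> \<gamma> = matrix_inv \<gamma>"
    unfolding m_inv_def
  proof (rule the_equality)
    show "matrix_inv \<gamma> \<in> carrier SL2R \<and> \<gamma> \<otimes>\<^bsub>SL2R\<^esub> matrix_inv \<gamma> = \<one>\<^bsub>SL2R\<^esub> \<and> matrix_inv \<gamma> \<otimes>\<^bsub>SL2R\<^esub> \<gamma> = \<one>\<^bsub>SL2R\<^esub>"
      using inv det_eq_1D[OF d] by (simp add: SL2R_def det_entries algebra_simps)
    fix y assume y: "y \<in> carrier SL2R \<and> \<gamma> \<otimes>\<^bsub>SL2R\<^esub> y = \<one>\<^bsub>SL2R\<^esub> \<and> y \<otimes>\<^bsub>SL2R\<^esub> \<gamma> = \<one>\<^bsub>SL2R\<^esub>"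
    then have "y ** \<gamma> = mat 1" by (simp add: SL2R_def)
    then have "(y ** \<gamma>) ** matrix_inv \<gamma> = matrix_inv \<gamma>" by (simp only: matrix_mul_lid)
    then show "y = matrix_inv \<gamma>" by (simp only: matrix_mul_assoc[symmetric] inv(2,3) matrix_mul_rid)
  qed
  then show "matrix_inv \<gamma> \<in> \<Gamma>" using subgroup.m_inv_closed[OF subgroup g] by simp
qed

lemma chi_nonzero: "\<gamma> \<in> \<Gamma> \<Longrightarrow> chi \<gamma> \<noteq> 0"
  using char by (simp add: finite_order_character_def)

lemma f_eq: "Im z > 0 \<Longrightarrow> f z = f0 z + f1 z * \<phi> z + f2 z * \<phi> z ^ 2"
  using depth2 by (simp add: quasimodular_depth2_def)

lemma f_eq_all: "\<forall>w. Im w > 0 \<longrightarrow> f w = f0 w + f1 w * \<phi> w + f2 w * \<phi> w ^ 2"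
  using f_eq by blast

lemmas transform = h_transform[where f = f and ?f0.0 = f0 and ?f1.0 = f1 and ?f2.0 = f2 and \<phi> = \<phi>
    and \<alpha> = \<alpha> and k = k, OF _ _ f_eq_all]
lemmas transform_inverse = h_transform_inverse[where f = f and ?f0.0 = f0 and ?f1.0 = f1 and ?f2.0 = f2
    and \<phi> = \<phi> and \<alpha> = \<alpha> and k = k, OF _ _ f_eq_all]

lemma forms:
  "f0 \<in> modular_forms \<Gamma> chi k" "f1 \<in> modular_forms \<Gamma> chi (k - 2)" "f2 \<in> modular_forms \<Gamma> chi (k - 4)"
  using depth2 by (simp_all add: quasimodular_depth2_def)

lemma holomorphic:
  "\<phi> holomorphic_on upper_half_plane" "f0 holomorphic_on upper_half_plane"
  "f1 holomorphic_on upper_half_plane" "f2 holomorphic_on upper_half_plane"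
  "f holomorphic_on upper_half_plane" "w1 holomorphic_on upper_half_plane" "w2 holomorphic_on upper_half_plane"
proof -
  show \<phi>: "\<phi> holomorphic_on upper_half_plane" using wt2 by (simp add: quasimodular_weight2_def)
  show f012: "f0 holomorphic_on upper_half_plane" "f1 holomorphic_on upper_half_plane"
    "f2 holomorphic_on upper_half_plane" using forms by (simp_all add: modular_forms_def)
  have "(\<lambda>z. f0 z + f1 z * \<phi> z + f2 z * \<phi> z ^ 2) holomorphic_on upper_half_plane"
    by (intro holomorphic_intros \<phi> f012)
  then show f: "f holomorphic_on upper_half_plane"
    by (rule holomorphic_transform) (simp add: f_eq)
  show "w1 holomorphic_on upper_half_plane" "w2 holomorphic_on upper_half_plane"
    unfolding h1_def [abs_def] h2_def [abs_def] by (intro holomorphic_intros \<phi> f012 f)+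
qed

lemma slash_\<Gamma>:
  assumes "\<gamma> \<in> \<Gamma>" "Im z > 0"
  shows "slash k \<gamma> f0 z = chi \<gamma> * f0 z" "slash (k - 2) \<gamma> f1 z = chi \<gamma> * f1 z"
    "slash (k - 4) \<gamma> f2 z = chi \<gamma> * f2 z" "phi_slash \<alpha> \<gamma> \<phi> z = \<phi> z"
    "form_slash \<alpha> \<gamma> k \<phi> f0 f1 f2 z = chi \<gamma> * f z"
    "h1_slash \<alpha> \<gamma> k \<phi> f0 f1 f2 z = chi \<gamma> * w1 z" "h2_slash \<alpha> \<gamma> k \<phi> f0 f1 f2 z = chi \<gamma> * w2 z"
proof -
  show s: "slash k \<gamma> f0 z = chi \<gamma> * f0 z" "slash (k - 2) \<gamma> f1 z = chi \<gamma> * f1 z"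
    "slash (k - 4) \<gamma> f2 z = chi \<gamma> * f2 z" using forms assms by (simp_all add: modular_forms_def)
  show p: "phi_slash \<alpha> \<gamma> \<phi> z = \<phi> z"
    using wt2 assms by (simp add: quasimodular_weight2_def phi_slash_def)
  show F: "form_slash \<alpha> \<gamma> k \<phi> f0 f1 f2 z = chi \<gamma> * f z"
    by (simp add: form_slash_def s p f_eq assms algebra_simps)
  show "h1_slash \<alpha> \<gamma> k \<phi> f0 f1 f2 z = chi \<gamma> * w1 z" "h2_slash \<alpha> \<gamma> k \<phi> f0 f1 f2 z = chi \<gamma> * w2 z"
    unfolding h1_slash_def h2_slash_def h1_def h2_def F p s by (simp_all add: algebra_simps)
qed

lemma transform_\<Gamma>:
  assumes g: "\<gamma> \<in> \<Gamma>" and z: "Im z > 0"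
  defines "a \<equiv> complex_of_real (mA \<gamma>)" and "b \<equiv> complex_of_real (mB \<gamma>)"
    and "c \<equiv> complex_of_real (mC \<gamma>)" and "d \<equiv> complex_of_real (mD \<gamma>)"
  shows "w1 (moebius \<gamma> z) = automorphy \<gamma> z powi (k - 2) * chi \<gamma> * (a ^ 2 * w1 z + a * b * w2 z + b ^ 2 * f z)"
    "w2 (moebius \<gamma> z) = automorphy \<gamma> z powi (k - 2) * chi \<gamma> * (2 * a * c * w1 z + (a * d + b * c) * w2 z + 2 * b * d * f z)"
    "f (moebius \<gamma> z) = automorphy \<gamma> z powi (k - 2) * chi \<gamma> * (c ^ 2 * w1 z + c * d * w2 z + d ^ 2 * f z)"
  unfolding transform[OF det_\<Gamma>[OF g] z] slash_\<Gamma>[OF g z] a_def b_def c_def d_def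
  by (simp_all add: algebra_simps)

lemma unipotent_\<Gamma>: "\<sigma> \<in> SL2Z \<Longrightarrow> \<exists>n::nat. n > 0 \<and> unipotent \<sigma> (real n) \<in> \<Gamma>"
  using finite_index_power[OF _ one_\<Gamma>] comm unfolding commensurable_def by blast

text \<open>
  The group contains a translation by some \<open>N\<close>.  Comparing a relation at \<open>z\<close> and \<open>z + N\<close> lowers its degree
  in \<open>z\<close>, and two such steps show that a nontrivial relation forces \<open>f = 0\<close>.  The group also contains
  lower triangular unipotent matrices, under which \<open>f\<close> is carried to a combination of \<open>h1\<close>, \<open>h2\<close> and \<open>f\<close>
  with coefficients \<open>c\<^sup>2\<close>, \<open>c\<close> and \<open>1\<close>.  Two values of \<open>c\<close> then give \<open>h1 = h2 = 0\<close> and hence \<open>f2 = 0\<close>.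
\<close>

lemma independent:
  assumes rel: "\<And>z. Im z > 0 \<Longrightarrow> p * w1 z + q * w2 z + r * f z = 0"
  shows "p = 0 \<and> q = 0 \<and> r = 0"
proof (rule ccontr)
  assume nz: "\<not> ?thesis"
  have one: "(mat 1 :: real^2^2) \<in> SL2Z" by (simp add: SL2Z_iff mat_1_entries)
  obtain n :: nat where n: "n > 0" "unipotent (mat 1) (real n) \<in> \<Gamma>" using unipotent_\<Gamma>[OF one] by blast
  define N where "N = complex_of_nat n"
  have N: "N \<noteq> 0" using n by (simp add: N_def)
  have uE: "unipotent (mat 1) (real n) = mat2 1 (real n) 0 1"
    by (simp add: unipotent_eq mat_1_entries)
  define C where "C = chi (unipotent (mat 1) (real n))"
  have C0: "C \<noteq> 0" unfolding C_def by (rule chi_nonzero[OF n(2)])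
  have T: "w1 (z + N) = C * (w1 z + N * w2 z + N ^ 2 * f z)" "w2 (z + N) = C * (w2 z + 2 * N * f z)"
    "f (z + N) = C * f z" if "Im z > 0" for z
    using transform_\<Gamma>[OF n(2) that] unfolding C_def[symmetric]
    unfolding uE by (simp_all add: moebius_def automorphy_def N_def)
  have ImN: "Im (z + N) > 0" if "Im z > 0" for z using that by (simp add: N_def)
  have 1: "p * (w2 z + N * f z) + 2 * q * f z = 0" if z: "Im z > 0" for z
  proof -
    have "C * (p * (w1 z + N * w2 z + N ^ 2 * f z) + q * (w2 z + 2 * N * f z) + r * f z) = 0"
      using rel[OF ImN[OF z]] unfolding T[OF z] by (simp add: algebra_simps)
    then have "p * (w1 z + N * w2 z + N ^ 2 * f z) + q * (w2 z + 2 * N * f z) + r * f z = 0"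
      using C0 by simp
    then have "N * (p * (w2 z + N * f z) + 2 * q * f z) = 0"
      using rel[OF z] by algebra
    then show ?thesis using N by simp
  qed
  have 2: "p * f z = 0" if z: "Im z > 0" for z
  proof -
    have "C * (p * (w2 z + 2 * N * f z + N * f z) + 2 * q * f z) = 0"
      using 1[OF ImN[OF z]] unfolding T[OF z] by (simp add: algebra_simps)
    then have "p * (w2 z + 2 * N * f z + N * f z) + 2 * q * f z = 0" using C0 by simp
    then have "2 * N * (p * f z) = 0" using 1[OF z] by algebra
    then show ?thesis using N by simp
  qed
  have f0: "f z = 0" if z: "Im z > 0" for z
    using nz 1[OF z] 2[OF z] rel[OF z] by auto
  have S: "mat2 0 (-1) 1 0 \<in> SL2Z" by (simp add: SL2Z_iff det_entries)
  obtain m :: nat where m: "m > 0" "unipotent (mat2 0 (-1) 1 0) (real m) \<in> \<Gamma>" using unipotent_\<Gamma>[OF S] by blast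
  have dS: "det (mat2 0 (-1) 1 0) = 1" by (simp add: det_entries)
  have lower: "x * w1 z = w2 z" if z: "Im z > 0" and g: "unipotent (mat2 0 (-1) 1 0) x \<in> \<Gamma>" and x: "x \<noteq> 0" for x z
  proof -
    let ?g = "unipotent (mat2 0 (-1) 1 0) x"
    have e: "mC ?g = - x" "mD ?g = 1" by (simp_all add: unipotent_eq[OF dS])
    have "f (moebius ?g z) = 0" by (intro f0 Im_moebius_pos det_\<Gamma> g z)
    then have "automorphy ?g z powi (k - 2) * chi ?g * (of_real x * (of_real x * w1 z - w2 z)) = 0"
      using transform_\<Gamma>(3)[OF g z] unfolding e by (simp add: f0[OF z] algebra_simps power2_eq_square)
    moreover have "automorphy ?g z powi (k - 2) \<noteq> 0"
      using automorphy_nonzero[OF det_\<Gamma>[OF g] z] by simp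
    ultimately show ?thesis using chi_nonzero[OF g] x by auto
  qed
  have g2: "unipotent (mat2 0 (-1) 1 0) (2 * real m) \<in> \<Gamma>"
    using mult_\<Gamma>[OF m(2) m(2)] unfolding unipotent_add[OF dS] by simp
  have w: "w1 z = 0" "w2 z = 0" if z: "Im z > 0" for z
  proof -
    have e: "of_real (real m) * w1 z = w2 z" "of_real (2 * real m) * w1 z = w2 z"
      using lower[OF z m(2)] lower[OF z g2] m(1) by auto
    define X where "X = complex_of_real (real m) * w1 z"
    have "X = w2 z" "2 * X = w2 z" using e by (simp_all add: X_def mult.assoc)
    then have "X = 0" by simp
    then have "of_real (real m) * w1 z = 0" by (simp only: X_def)
    then show "w1 z = 0" "w2 z = 0" using e(1) m(1) by auto
  qed
  have "f2 z = 0" if z: "Im z > 0" for z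
  proof -
    have "\<alpha> ^ 2 * f2 z = w1 z - z * w2 z + z ^ 2 * f z"
      unfolding h1_def h2_def by algebra
    then show ?thesis using w[OF z] f0[OF z] \<alpha>_nonzero by simp
  qed
  then show False using depth2 by (auto simp: quasimodular_depth2_def)
qed

lemma independent_open:
  assumes U: "open U" "U \<noteq> {}" "U \<subseteq> upper_half_plane"
    and rel: "\<And>z. z \<in> U \<Longrightarrow> p * w1 z + q * w2 z + r * f z = 0"
  shows "p = 0 \<and> q = 0 \<and> r = 0"
proof (rule independent)
  fix z :: complex assume z: "Im z > 0"
  have "(\<lambda>z. p * w1 z + q * w2 z + r * f z) holomorphic_on upper_half_plane"
    by (intro holomorphic_intros holomorphic)
  then show "p * w1 z + q * w2 z + r * f z = 0"
    by (rule analytic_continuation_open[OF U(1) upper_half_plane_open U(2) upper_half_plane_connected U(3),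
        of _ "\<lambda>_. 0"]) (use rel z in auto)
qed

text \<open>
  Up to a factor without zeros, the slashed form is \<open>c\<^sup>2 h1 - a c h2 + a\<^sup>2 f\<close> at \<open>\<sigma> z\<close>, where \<open>(a, c)\<close> is the
  first column of \<open>\<sigma>\<close>; this is a nontrivial combination of independent functions.
\<close>

lemma form_slash_nonzero:
  assumes \<sigma>: "det \<sigma> = 1" and U: "open U" "U \<noteq> {}" "U \<subseteq> upper_half_plane"
  shows "\<exists>z\<in>U. form_slash \<alpha> \<sigma> k \<phi> f0 f1 f2 z \<noteq> 0"
proof (rule ccontr)
  assume "\<not> ?thesis"
  then have z0: "form_slash \<alpha> \<sigma> k \<phi> f0 f1 f2 z = 0" if "z \<in> U" for z using that by blast
  define V where "V = moebius \<sigma> ` U"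
  define a c where "a = complex_of_real (mA \<sigma>)" and "c = complex_of_real (mC \<sigma>)"
  have "open V" unfolding V_def
  proof (rule open_mapping_thm3)
    show "moebius \<sigma> holomorphic_on U" using moebius_holomorphic[OF \<sigma>] U(3) holomorphic_on_subset by blast
    show "inj_on (moebius \<sigma>) U" using moebius_inj[OF \<sigma>] U(3) by (auto simp: inj_on_def)
  qed (rule U)
  moreover have "V \<noteq> {}" "V \<subseteq> upper_half_plane" using U Im_moebius_pos[OF \<sigma>] by (auto simp: V_def)
  moreover have "c ^ 2 * w1 z + (- a * c) * w2 z + a ^ 2 * f z = 0" if zV: "z \<in> V" for z
  proof -
    obtain x where x: "x \<in> U" "z = moebius \<sigma> x" using zV by (auto simp: V_def)
    have "Im x > 0" using x U by auto
    from transform_inverse(3)[OF \<sigma> this] z0[OF x(1)] show ?thesis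
      by (simp add: x(2) a_def c_def)
  qed
  ultimately have "c ^ 2 = 0 \<and> - a * c = 0 \<and> a ^ 2 = 0" by (rule independent_open)
  then have "mA \<sigma> = 0" "mC \<sigma> = 0" by (simp_all add: a_def c_def)
  then show False using det_eq_1D[OF \<sigma>] by simp
qed

text \<open>
  The \<open>N\<close> that are admissible in the definition of the width form an additive group together with
  their negatives and \<open>0\<close>.  Doubling removes the sign, so they stay away from \<open>0\<close> by discreteness.
\<close>

lemma cusp_width_in:
  assumes \<sigma>: "\<sigma> \<in> SL2Z"
  shows "cusp_width \<Gamma> \<sigma> > 0"
    "unipotent \<sigma> (cusp_width \<Gamma> \<sigma>) \<in> \<Gamma> \<or> - unipotent \<sigma> (cusp_width \<Gamma> \<sigma>) \<in> \<Gamma>"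
proof -
  have d: "det \<sigma> = 1" using \<sigma> by (simp add: SL2Z_iff)
  define A where "A = {N. unipotent \<sigma> N \<in> \<Gamma> \<or> - unipotent \<sigma> N \<in> \<Gamma>}"
  have cw: "cusp_width \<Gamma> \<sigma> = Inf {x. x > 0 \<and> x \<in> A}"
    by (simp add: cusp_width_def A_def unipotent_def)
  obtain n :: nat where n: "n > 0" "unipotent \<sigma> (real n) \<in> \<Gamma>" using unipotent_\<Gamma>[OF \<sigma>] by blast
  obtain e where e: "e > 0" "\<And>N. N > 0 \<Longrightarrow> unipotent \<sigma> N \<in> \<Gamma> \<Longrightarrow> e \<le> N"
    using discrete_unipotent[OF disc one_\<Gamma> d] by blast
  have neg: "(- \<gamma>) ** \<delta> = - (\<gamma> ** \<delta>)" "\<gamma> ** (- \<delta>) = - (\<gamma> ** \<delta>)" for \<gamma> \<delta> :: "real^2^2"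
    by (intro mat_eqI; simp only: mult_entries uminus_entries; simp)+
  have minus: "unipotent \<sigma> (- N) \<in> \<Gamma>" if "unipotent \<sigma> N \<in> \<Gamma>" for N
  proof -
    have "matrix_inv (unipotent \<sigma> N) = unipotent \<sigma> (- N)"
      unfolding matrix_inv_det_1(1)[OF unipotent_det[OF d]]
      by (intro mat_eqI) (simp_all add: unipotent_eq[OF d])
    then show ?thesis using inverse_\<Gamma>[OF that] by simp
  qed
  have minus': "- unipotent \<sigma> (- N) \<in> \<Gamma>" if "- unipotent \<sigma> N \<in> \<Gamma>" for N
  proof -
    have "matrix_inv (- unipotent \<sigma> N) = - unipotent \<sigma> (- N)"
      unfolding matrix_inv_det_1(1)[OF det_\<Gamma>[OF that]]
      by (intro mat_eqI) (simp_all add: unipotent_eq[OF d])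
    then show ?thesis using inverse_\<Gamma>[OF that] by simp
  qed
  have diff: "x - y \<in> A" if "x \<in> A" "y \<in> A" for x y
  proof -
    have y: "unipotent \<sigma> (- y) \<in> \<Gamma> \<or> - unipotent \<sigma> (- y) \<in> \<Gamma>"
      using that(2) minus minus' by (auto simp: A_def)
    have x: "unipotent \<sigma> x \<in> \<Gamma> \<or> - unipotent \<sigma> x \<in> \<Gamma>" using that(1) by (auto simp: A_def)
    have "unipotent \<sigma> (x - y) = unipotent \<sigma> x ** unipotent \<sigma> (- y)" by (simp add: unipotent_add[OF d])
    then show ?thesis
      using x y mult_\<Gamma>[of "unipotent \<sigma> x" "unipotent \<sigma> (- y)"] mult_\<Gamma>[of "- unipotent \<sigma> x" "unipotent \<sigma> (- y)"]
        mult_\<Gamma>[of "unipotent \<sigma> x" "- unipotent \<sigma> (- y)"] mult_\<Gamma>[of "- unipotent \<sigma> x" "- unipotent \<sigma> (- y)"]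
      unfolding A_def neg by auto
  qed
  have lb: "e / 2 \<le> x" if "x \<in> A" "x > 0" for x
  proof -
    have "unipotent \<sigma> (2 * x) = unipotent \<sigma> x ** unipotent \<sigma> x" by (simp add: unipotent_add[OF d])
    also have "\<dots> \<in> \<Gamma>"
      using that(1) mult_\<Gamma>[of "unipotent \<sigma> x" "unipotent \<sigma> x"] mult_\<Gamma>[of "- unipotent \<sigma> x" "- unipotent \<sigma> x"]
      unfolding A_def neg by auto
    finally show ?thesis using e(2)[of "2 * x"] that(2) by simp
  qed
  have "Inf {x. x > 0 \<and> x \<in> A} \<in> A" "Inf {x. x > 0 \<and> x \<in> A} > 0"
    using discrete_additive_Inf[of "real n" A "e / 2"] n diff lb e(1) by (auto simp: A_def)
  then show "cusp_width \<Gamma> \<sigma> > 0"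
    "unipotent \<sigma> (cusp_width \<Gamma> \<sigma>) \<in> \<Gamma> \<or> - unipotent \<sigma> (cusp_width \<Gamma> \<sigma>) \<in> \<Gamma>"
    unfolding cw by (auto simp: A_def)
qed

text \<open>
  The root of unity \<open>\<epsilon>\<close> combines the value of the character with the sign of the group element that
  realises the width.  It is the same for all three components because their weights have the same
  parity.
\<close>

lemma slash_period_width:
  assumes \<sigma>: "\<sigma> \<in> SL2Z"
  defines "N \<equiv> complex_of_real (cusp_width \<Gamma> \<sigma>)"
  obtains \<epsilon> n where "\<epsilon> ^ n = 1" "n > 0"
    "\<And>z. Im z > 0 \<Longrightarrow> slash k \<sigma> f0 (z + N) = \<epsilon> * slash k \<sigma> f0 z"
    "\<And>z. Im z > 0 \<Longrightarrow> slash (k - 2) \<sigma> f1 (z + N) = \<epsilon> * slash (k - 2) \<sigma> f1 z"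
    "\<And>z. Im z > 0 \<Longrightarrow> slash (k - 4) \<sigma> f2 (z + N) = \<epsilon> * slash (k - 4) \<sigma> f2 z"
    "\<And>z. Im z > 0 \<Longrightarrow> phi_slash \<alpha> \<sigma> \<phi> (z + N) = phi_slash \<alpha> \<sigma> \<phi> z"
proof -
  have d: "det \<sigma> = 1" using \<sigma> by (simp add: SL2Z_iff)
  define R where "R = cusp_width \<Gamma> \<sigma>"
  have N: "N = of_real R" by (simp add: N_def R_def)
  define T where "T = mat2 1 R 0 1"
  have dT: "det T = 1" by (simp add: T_def det_entries)
  have mT: "moebius T z = z + N" "automorphy T z = 1" for z
    by (simp_all add: T_def moebius_def automorphy_def N)
  have slT: "slash j (\<sigma> ** T) g z = slash j \<sigma> g (z + N)" if "Im z > 0" for j g z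
    unfolding slash_mult[OF d dT that] by (simp add: slash_def[of _ T] mT)
  obtain n :: nat where n: "n > 0" "\<And>\<gamma>. \<gamma> \<in> \<Gamma> \<Longrightarrow> chi \<gamma> ^ n = 1"
    using char unfolding finite_order_character_def by blast
  \<comment> \<open>\<open>s\<close> is the sign for which \<open>s\<close> times the unipotent matrix lies in the group\<close>
  obtain s :: real where s: "s = 1 \<or> s = - 1" and g: "s *\<^sub>R unipotent \<sigma> R \<in> \<Gamma>"
    using cusp_width_in(2)[OF \<sigma>] unfolding R_def by (metis scaleR_one scaleR_minus1_left)
  define \<gamma> where "\<gamma> = s *\<^sub>R unipotent \<sigma> R"
  have g: "\<gamma> \<in> \<Gamma>" using g by (simp add: \<gamma>_def)
  have ent: "mA (s *\<^sub>R \<delta>) = s * mA \<delta>" "mB (s *\<^sub>R \<delta>) = s * mB \<delta>" "mC (s *\<^sub>R \<delta>) = s * mC \<delta>"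
     "mD (s *\<^sub>R \<delta>) = s * mD \<delta>" for \<delta> :: "real^2^2"
    by simp_all
  have gs: "\<gamma> ** \<sigma> = s *\<^sub>R (\<sigma> ** T)"
    unfolding \<gamma>_def T_def unipotent_mult[OF d, symmetric]
    by (intro mat_eqI; simp only: mult_entries ent; simp add: algebra_simps)
  have s2: "s * s = 1" using s by auto
  have aut: "automorphy (s *\<^sub>R \<delta>) z = of_real s * automorphy \<delta> z" for \<delta> z
    by (simp add: automorphy_def algebra_simps)
  have moe: "moebius (s *\<^sub>R \<delta>) z = moebius \<delta> z" for \<delta> z
    using s moebius_uminus(1) by auto
  have sl: "slash j (s *\<^sub>R \<delta>) g z = of_real s powi j * slash j \<delta> g z" for j \<delta> g z
  proof -
    have "complex_of_real s powi (- j) = of_real s powi j" using s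
      by (auto simp: power_int_minus power_int_minus_left)
    then show ?thesis unfolding slash_def aut moe power_int_mult_distrib by (simp add: mult_ac)
  qed
  define \<epsilon> where "\<epsilon> = complex_of_real s powi k * chi \<gamma>"
  have sk: "complex_of_real s powi (k - 2) = of_real s powi k" "complex_of_real s powi (k - 4) = of_real s powi k"
    using s by (auto simp: power_int_minus_left)
  have inv: "complex_of_real s powi k * complex_of_real s powi k = 1"
    using s by (auto simp: power_int_minus_left)
  have key: "slash j \<sigma> g (z + N) = \<epsilon> * slash j \<sigma> g z"
    if z: "Im z > 0" and j: "complex_of_real s powi j = of_real s powi k"
      and sg: "\<And>w. Im w > 0 \<Longrightarrow> slash j \<gamma> g w = chi \<gamma> * g w" for j g z
  proof -
    have "of_real s powi k * slash j \<sigma> g (z + N) = slash j (\<gamma> ** \<sigma>) g z"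
      unfolding gs sl slT[OF z] j ..
    also have "\<dots> = slash j \<sigma> (slash j \<gamma> g) z" by (rule slash_mult[OF det_\<Gamma>[OF g] d z])
    also have "\<dots> = chi \<gamma> * slash j \<sigma> g z"
      by (simp add: slash_def[of j \<sigma>] sg[OF Im_moebius_pos[OF d z]])
    finally have "(of_real s powi k * of_real s powi k) * slash j \<sigma> g (z + N) = \<epsilon> * slash j \<sigma> g z"
      by (simp add: \<epsilon>_def mult_ac)
    then show ?thesis unfolding inv by simp
  qed
  have ph: "phi_slash \<alpha> \<sigma> \<phi> (z + N) = phi_slash \<alpha> \<sigma> \<phi> z" if z: "Im z > 0" for z
  proof -
    define w where "w = moebius \<sigma> z"
    have w: "Im w > 0" unfolding w_def by (rule Im_moebius_pos[OF d z])
    have j0: "automorphy \<sigma> z \<noteq> 0" "automorphy \<gamma> w \<noteq> 0" "automorphy \<sigma> (z + N) \<noteq> 0"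
      using automorphy_nonzero[OF d z] automorphy_nonzero[OF det_\<Gamma>[OF g] w] automorphy_nonzero[OF d, of "z + N"] z
      by (auto simp: N)
    have s0: "complex_of_real s \<noteq> 0" using s by auto
    have "slash 2 \<sigma> \<phi> (z + N) = slash 2 (\<gamma> ** \<sigma>) \<phi> z"
      unfolding gs sl slT[OF z] using s by auto
    also have "\<dots> = slash 2 \<sigma> (slash 2 \<gamma> \<phi>) z" by (rule slash_mult[OF det_\<Gamma>[OF g] d z])
    also have "\<dots> = slash 2 \<sigma> \<phi> z + \<alpha> * of_real (mC \<gamma>) / (automorphy \<gamma> w * automorphy \<sigma> z ^ 2)"
    proof -
      have "slash 2 \<gamma> \<phi> w = \<phi> w + \<alpha> * of_real (mC \<gamma>) / automorphy \<gamma> w"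
        using wt2 g w by (simp add: quasimodular_weight2_def)
      then show ?thesis
        using j0 by (simp add: slash_def[of 2 \<sigma>] w_def[symmetric] power_int_minus field_simps)
    qed
    finally have 1: "slash 2 \<sigma> \<phi> (z + N) = slash 2 \<sigma> \<phi> z + \<alpha> * of_real (mC \<gamma>) / (automorphy \<gamma> w * automorphy \<sigma> z ^ 2)" .
    have c: "s * mC \<sigma> = mC \<gamma> * mA \<sigma> + mD \<gamma> * mC \<sigma>"
      using arg_cong[OF gs, of mC] by (simp only: mult_entries ent) (simp add: T_def)
    have j: "of_real s * automorphy \<sigma> (z + N) = automorphy \<gamma> w * automorphy \<sigma> z"
      using automorphy_mult[OF d z, of \<gamma>] automorphy_mult[OF dT z, of \<sigma>]
      unfolding gs aut mT w_def by simp
    have jw: "automorphy \<gamma> w * automorphy \<sigma> z = of_real (mC \<gamma>) * (of_real (mA \<sigma>) * z + of_real (mB \<sigma>)) + of_real (mD \<gamma>) * automorphy \<sigma> z"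
      using j0 by (simp add: automorphy_def[of \<gamma>] w_def moebius_def field_simps)
    have det: "complex_of_real (mA \<sigma>) * of_real (mD \<sigma>) - of_real (mB \<sigma>) * of_real (mC \<sigma>) = 1"
      by (rule det_eq_1D_complex[OF d])
    have cc: "complex_of_real s * of_real (mC \<sigma>) = of_real (mC \<gamma>) * of_real (mA \<sigma>) + of_real (mD \<gamma>) * of_real (mC \<sigma>)"
      using arg_cong[OF c, of complex_of_real] by simp
    have key: "of_real (mC \<sigma>) / automorphy \<sigma> (z + N) = of_real (mC \<gamma>) / (automorphy \<gamma> w * automorphy \<sigma> z ^ 2)
        + of_real (mC \<sigma>) / automorphy \<sigma> z"
    proof -
      have "of_real (mC \<sigma>) / automorphy \<sigma> (z + N) = (of_real s * of_real (mC \<sigma>)) / (automorphy \<gamma> w * automorphy \<sigma> z)"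
        unfolding j[symmetric] using s0 j0 by simp
      moreover have "(of_real s * of_real (mC \<sigma>)) * automorphy \<sigma> z = of_real (mC \<gamma>) + of_real (mC \<sigma>) * (automorphy \<gamma> w * automorphy \<sigma> z)"
        unfolding jw cc using det unfolding automorphy_def by algebra
      then have "of_real s * of_real (mC \<sigma>) = (of_real (mC \<gamma>) + of_real (mC \<sigma>) * (automorphy \<gamma> w * automorphy \<sigma> z)) / automorphy \<sigma> z"
        using j0 by (simp add: eq_divide_eq)
      ultimately show ?thesis
        using j0 by (simp add: add_divide_distrib power2_eq_square mult_ac)
    qed
    show ?thesis
      unfolding phi_slash_def 1 using key by (simp add: algebra_simps flip: times_divide_eq_right)
  qed
  have "\<epsilon> ^ (2 * n) = (of_real s powi k * of_real s powi k) ^ n * (chi \<gamma> ^ n) ^ 2"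
    unfolding \<epsilon>_def by (simp add: power_mult_distrib power_mult[symmetric] power2_eq_square[symmetric] mult.commute)
  then have "\<epsilon> ^ (2 * n) = 1" unfolding inv n(2)[OF g] by simp
  then show ?thesis
    by (rule that[of \<epsilon> "2 * n"]) (use n(1) key[OF _ refl] key[OF _ sk(1)] key[OF _ sk(2)] slash_\<Gamma>[OF g] ph in auto)
qed

end

section \<open>Expansions in the nome\<close>

lemma nome_add: "nome M (z + w) = nome M z * nome M w"
  by (simp add: nome_def exp_add[symmetric] algebra_simps add_divide_distrib)

lemma norm_nome: "norm (nome M z) = exp (- 2 * pi * Im z / M)"
  by (simp add: nome_def)

lemma nome_nonzero [simp]: "nome M z \<noteq> 0"
  by (simp add: nome_def)

lemma nome_deriv: "(nome M has_field_derivative 2 * of_real pi * \<i> / of_real M * nome M z) (at z)"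
proof -
  define \<kappa> where "\<kappa> = 2 * of_real pi * \<i> / of_real M"
  have "nome M = (\<lambda>z. exp (\<kappa> * z))" by (simp add: nome_def \<kappa>_def fun_eq_iff)
  then show ?thesis unfolding \<kappa>_def[symmetric] by (auto intro!: derivative_eq_intros)
qed

lemma nome_in_ball_iff:
  assumes "M > 0" "r > 0"
  shows "nome M z \<in> ball 0 r \<longleftrightarrow> Im z > - M * ln r / (2 * pi)"
proof -
  have "nome M z \<in> ball 0 r \<longleftrightarrow> exp (- 2 * pi * Im z / M) < exp (ln r)"
    using assms by (simp add: norm_nome)
  also have "\<dots> \<longleftrightarrow> - 2 * pi * Im z / M < ln r" by (rule exp_less_cancel_iff)
  also have "\<dots> \<longleftrightarrow> Im z > - M * ln r / (2 * pi)"
    using assms by (simp add: field_simps) linarith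
  finally show ?thesis .
qed

lemma nome_surj:
  assumes "M > 0" "q \<noteq> 0"
  obtains z where "nome M z = q"
proof -
  have "nome M (of_real M / (2 * of_real pi * \<i>) * Ln q) = q"
    using assms by (simp add: nome_def)
  then show ?thesis by (rule that)
qed

lemma nome_eq_imp:
  assumes "M > 0" "nome M z = nome M w"
  obtains n :: int where "z = w + of_int n * of_real M"
proof -
  obtain n :: int where "2 * of_real pi * \<i> * z / of_real M = 2 * of_real pi * \<i> * w / of_real M + of_real (real_of_int (2 * n) * pi) * \<i>"
    using assms(2) unfolding nome_def exp_eq by blast
  then have "(2 * of_real pi * \<i>) * (z - (w + of_int n * of_real M)) = 0"
    using assms(1) by (simp add: field_simps)
  then have "z = w + of_int n * of_real M" by simp
  then show ?thesis by (rule that)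
qed

lemma periodic_int:
  assumes per: "\<And>z. Im z > Y \<Longrightarrow> F (z + of_real N) = F z" and z: "Im z > Y"
  shows "F (z + of_int n * of_real N) = F z"
proof -
  have nat: "F (w + of_nat m * of_real N) = F w" if "Im w > Y" for m :: nat and w
  proof (induction m)
    case (Suc m)
    have "F (w + of_nat (Suc m) * of_real N) = F ((w + of_nat m * of_real N) + of_real N)"
      by (simp add: algebra_simps)
    also have "\<dots> = F (w + of_nat m * of_real N)" by (rule per) (use that in simp)
    finally show ?case using Suc by simp
  qed simp
  show ?thesis
  proof (cases "n \<ge> 0")
    case True
    then show ?thesis using nat[OF z, of "nat n"] by (simp add: of_nat_nat)
  next
    case False
    have "F z = F ((z + of_int n * of_real N) + of_nat (nat (- n)) * of_real N)"
      using False by (simp add: algebra_simps)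
    also have "\<dots> = F (z + of_int n * of_real N)" by (rule nat) (use z in simp)
    finally show ?thesis by simp
  qed
qed

text \<open>
  A periodic function is a function of \<open>q\<close> on a punctured disc, and boundedness makes the singularity
  at \<open>q = 0\<close> removable.
\<close>

lemma periodic_bounded_holomorphic_at_infty:
  assumes N: "N > 0" and hol: "F holomorphic_on {z. Im z > Y}"
    and per: "\<And>z. Im z > Y \<Longrightarrow> F (z + of_real N) = F z"
    and bound: "\<And>z. Im z > Y \<Longrightarrow> norm (F z) \<le> B"
  shows "holomorphic_at_infty N F"
proof -
  define Y' where "Y' = max Y 1"
  define \<rho> where "\<rho> = exp (- 2 * pi * Y' / N)"
  have \<rho>: "\<rho> > 0" by (simp add: \<rho>_def)
  define \<kappa> where "\<kappa> = complex_of_real N / (2 * of_real pi * \<i>)"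
  have nome_\<kappa>: "nome N (\<kappa> * w) = exp w" for w using N by (simp add: nome_def \<kappa>_def)
  have ball: "nome N z \<in> ball 0 \<rho> \<longleftrightarrow> Im z > Y'" for z
    using nome_in_ball_iff[OF N \<rho>] N by (simp add: \<rho>_def)
  define G where "G = (\<lambda>q. F (\<kappa> * Ln q))"
  have G: "G (nome N z) = F z" if z: "Im z > Y'" for z
  proof -
    have e: "nome N (\<kappa> * Ln (nome N z)) = nome N z" by (simp add: nome_\<kappa>)
    then obtain n :: int where n: "\<kappa> * Ln (nome N z) = z + of_int n * of_real N"
      using nome_eq_imp[OF N] by blast
    show ?thesis unfolding G_def n by (rule periodic_int[of Y F N z n, OF per]) (use z in \<open>auto simp: Y'_def\<close>)
  qed
  have "G field_differentiable (at q)" if q: "q \<in> ball 0 \<rho> - {0}" for q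
  proof -
    \<comment> \<open>a branch of the logarithm near \<open>q\<close>, also if \<open>q\<close> lies on the branch cut of \<open>Ln\<close>\<close>
    define L where "L = (\<lambda>x. Ln (x / q) + Ln q)"
    have q0: "q \<noteq> 0" using q by simp
    have expL: "exp (L x) = x" if "x \<noteq> 0" for x using that q0 by (simp add: L_def exp_add)
    have dL: "L field_differentiable (at q)"
    proof -
      have "((\<lambda>x. Ln (x / q)) has_field_derivative inverse (q / q) * (1 / q)) (at q)"
        by (rule DERIV_chain2[where g = "\<lambda>x. x / q"])
          (use q0 in \<open>auto intro!: has_field_derivative_Ln derivative_eq_intros\<close>)
      then have "(L has_field_derivative inverse (q / q) * (1 / q) + 0) (at q)"
        unfolding L_def by (rule DERIV_add) (rule DERIV_const)
      then show ?thesis unfolding field_differentiable_def by blast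
    qed
    have o: "open (ball 0 \<rho> - {0::complex})" by (auto intro: open_delete)
    have eq: "F (\<kappa> * L x) = G x" if "x \<in> ball 0 \<rho> - {0}" for x
    proof -
      have e: "nome N (\<kappa> * L x) = x" using that by (simp add: nome_\<kappa> expL)
      then have "Im (\<kappa> * L x) > Y'" using ball[of "\<kappa> * L x"] that by simp
      from G[OF this] e show ?thesis by simp
    qed
    have "nome N (\<kappa> * L q) = q" using q0 by (simp add: nome_\<kappa> expL)
    then have "Im (\<kappa> * L q) > Y" using ball[of "\<kappa> * L q"] q by (auto simp: Y'_def)
    then have "F field_differentiable (at (\<kappa> * L q))"
      using hol by (intro holomorphic_on_imp_differentiable_at[OF hol open_halfspace_Im_gt]) auto
    moreover have "(\<lambda>x. \<kappa> * L x) field_differentiable (at q)"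
      by (intro derivative_intros dL)
    ultimately have "(F \<circ> (\<lambda>x. \<kappa> * L x)) field_differentiable (at q)"
      by (intro field_differentiable_compose)
    then obtain D where D: "(F \<circ> (\<lambda>x. \<kappa> * L x) has_field_derivative D) (at q)"
      unfolding field_differentiable_def by blast
    have "(G has_field_derivative D) (at q)"
      by (rule has_field_derivative_transform_within_open[OF D o q]) (simp add: eq)
    then show ?thesis unfolding field_differentiable_def by blast
  qed
  then have "G holomorphic_on ball 0 \<rho> - {0}"
    by (simp add: holomorphic_on_def field_differentiable_at_within)
  moreover have "\<forall>\<^sub>F q in at 0. norm (G q) \<le> B"
  proof -
    have "\<forall>\<^sub>F q in at (0::complex). q \<in> ball 0 \<rho> - {0}" using \<rho> by (intro eventually_at_in_open) auto
    then show ?thesis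
    proof eventually_elim
      case (elim q)
      then obtain z where z: "nome N z = q" using nome_surj[OF N] by blast
      then have "Im z > Y'" using elim ball[of z] by simp
      then show ?case using G[of z] z bound[of z] by (auto simp: Y'_def)
    qed
  qed
  ultimately obtain g where g: "g holomorphic_on ball 0 \<rho>" "\<And>q. q \<in> ball 0 \<rho> - {0} \<Longrightarrow> g q = G q"
    using holomorphic_on_extend_bounded[of G "ball 0 \<rho>" 0] \<rho> by auto
  show ?thesis
    unfolding holomorphic_at_infty_def
  proof (intro exI[of _ Y'] conjI exI[of _ g] allI impI)
    show "Y' > 0" by (simp add: Y'_def)
    show "g holomorphic_on ball 0 (exp (- 2 * pi * Y' / N))" using g(1) by (simp add: \<rho>_def)
    fix z :: complex assume z: "Im z > Y'"
    show "F z = g (nome N z)" using g(2)[of "nome N z"] ball[of z] z G[OF z] by simp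
  qed
qed

lemma holomorphic_at_infty_bounded:
  assumes N: "N > 0" and F: "holomorphic_at_infty N F"
  obtains Y B where "Y > 0" "\<And>z. Im z > Y \<Longrightarrow> norm (F z) \<le> B"
proof -
  obtain Y G where YG: "Y > 0" "G holomorphic_on ball 0 (exp (- 2 * pi * Y / N))"
    "\<And>z. Im z > Y \<Longrightarrow> F z = G (nome N z)"
    using F unfolding holomorphic_at_infty_def by blast
  define \<rho> where "\<rho> = exp (- 2 * pi * (Y + 1) / N)"
  have "\<rho> < exp (- 2 * pi * Y / N)" using N by (simp add: \<rho>_def divide_strict_right_mono)
  then have "cball 0 \<rho> \<subseteq> ball 0 (exp (- 2 * pi * Y / N))" by auto
  then have "continuous_on (cball 0 \<rho>) G"
    using YG(2) holomorphic_on_imp_continuous_on continuous_on_subset by blast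
  then have "compact (G ` cball 0 \<rho>)" by (intro compact_continuous_image) auto
  then obtain B where B: "\<And>x. x \<in> G ` cball 0 \<rho> \<Longrightarrow> norm x \<le> B"
    using compact_imp_bounded bounded_iff by metis
  have "norm (F z) \<le> B" if "Im z > Y + 1" for z
  proof -
    have "norm (nome N z) \<le> \<rho>" unfolding norm_nome \<rho>_def using that N
      by (simp add: divide_right_mono)
    then show ?thesis using YG(3)[of z] that B[of "G (nome N z)"] by simp
  qed
  then show ?thesis using YG(1) by (intro that[of "Y + 1" B]) simp_all
qed

lemma nome_ball_height:
  assumes M: "M > 0" and R: "R > 0"
  obtains Y where "Y > 0" "exp (- 2 * pi * Y / M) \<le> R" "\<And>z. Im z > Y \<Longrightarrow> nome M z \<in> ball 0 R"
proof
  define Y where "Y = max 1 (- M * ln R / (2 * pi))"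
  show "Y > 0" by (simp add: Y_def)
  have "- M * ln R / (2 * pi) \<le> Y" by (simp add: Y_def)
  then have "- 2 * pi * Y / M \<le> ln R" using M by (simp add: field_simps)
  then have "exp (- 2 * pi * Y / M) \<le> exp (ln R)" by (subst exp_le_cancel_iff)
  then show "exp (- 2 * pi * Y / M) \<le> R" using R by simp
  show "nome M z \<in> ball 0 R" if "Im z > Y" for z
    unfolding nome_in_ball_iff[OF M R] using that by (simp add: Y_def)
qed

lemma holomorphic_at_inftyE:
  assumes M: "M > 0" and F: "holomorphic_at_infty M F"
  obtains R P where "R > 0" "P holomorphic_on ball 0 R"
    "\<And>z. nome M z \<in> ball 0 R \<Longrightarrow> Im z > 0 \<and> F z = P (nome M z)"
proof -
  obtain Y P where Y: "Y > 0" and P: "P holomorphic_on ball 0 (exp (- 2 * pi * Y / M))"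
    "\<And>z. Im z > Y \<Longrightarrow> F z = P (nome M z)"
    using F unfolding holomorphic_at_infty_def by blast
  show ?thesis
  proof (rule that[OF _ P(1)])
    fix z assume "nome M z \<in> ball 0 (exp (- 2 * pi * Y / M))"
    then have "Im z > Y" using M by (simp only: nome_in_ball_iff exp_gt_zero) simp
    then show "Im z > 0 \<and> F z = P (nome M z)" using Y P(2) by simp
  qed simp
qed

text \<open>
  Boundedness near infinity does not depend on the nome in which it is expressed.
\<close>

lemma holomorphic_at_infty_change_period:
  assumes M: "M > 0" and hol: "F holomorphic_on upper_half_plane"
    and per: "\<And>z. Im z > 0 \<Longrightarrow> F (z + of_real M) = F z" and ex: "\<exists>N>0. holomorphic_at_infty N F"
  shows "holomorphic_at_infty M F"
proof -
  obtain N where N: "N > 0" "holomorphic_at_infty N F" using ex by blast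
  obtain Y B where Y: "Y > 0" and B: "\<And>z. Im z > Y \<Longrightarrow> norm (F z) \<le> B"
    using holomorphic_at_infty_bounded[OF N] by blast
  show ?thesis
  proof (rule periodic_bounded_holomorphic_at_infty[OF M _ _ B])
    show "F holomorphic_on {z. Im z > Y}" using Y by (intro holomorphic_on_subset[OF hol]) auto
    show "F (z + of_real M) = F z" if "Im z > Y" for z using per[of z] that Y by simp
  qed
qed

lemma nome_holomorphic: "nome M holomorphic_on S"
  unfolding nome_def [abs_def] by (cases "M = 0") (auto intro!: holomorphic_intros)

lemma nome_eventually_in_ball:
  assumes "nome M z0 \<in> ball 0 R"
  shows "\<forall>\<^sub>F z in nhds z0. nome M z \<in> ball 0 R"
proof -
  have "open (nome M -` ball 0 R)"
    by (intro open_vimage open_ball holomorphic_on_imp_continuous_on nome_holomorphic)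
  then show ?thesis using assms unfolding eventually_nhds by blast
qed

lemma nome_comp_analytic:
  assumes "A holomorphic_on ball 0 R" "nome M z \<in> ball 0 R"
  shows "(\<lambda>z. A (nome M z)) analytic_on {z}"
proof -
  have "A analytic_on {nome M z}" using assms by (meson analytic_at open_ball)
  moreover have "nome M analytic_on {z}" by (meson analytic_at nome_holomorphic open_UNIV UNIV_I)
  ultimately show ?thesis using analytic_on_compose[of "nome M" "{z}" A] by (simp add: comp_def)
qed

text \<open>
  Invariance under the rotation by \<open>nome M N\<close> means that \<open>F\<close>, given as a function of \<open>nome M\<close>, has period
  \<open>N\<close>.
\<close>

lemma holomorphic_at_infty_width:
  assumes M: "M > 0" and N: "N > 0" and R: "R > 0" and A: "A holomorphic_on ball 0 R"
    and inv: "\<And>q. q \<in> ball 0 R - {0} \<Longrightarrow> A (nome M (of_real N) * q) = A q"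
    and F: "\<And>z. nome M z \<in> ball 0 R \<Longrightarrow> F z = A (nome M z)"
  shows "holomorphic_at_infty N F"
proof -
  obtain Y where Y: "Y > 0" "exp (- 2 * pi * Y / M) \<le> R" "\<And>z. Im z > Y \<Longrightarrow> nome M z \<in> ball 0 R"
    using nome_ball_height[OF M R] by blast
  have "holomorphic_at_infty M F"
    unfolding holomorphic_at_infty_def
    using Y F holomorphic_on_subset[OF A subset_ball[OF Y(2)]] by (intro exI[of _ Y] exI[of _ A] conjI) auto
  then obtain Y' B where B: "Y' > 0" "\<And>z. Im z > Y' \<Longrightarrow> norm (F z) \<le> B"
    using holomorphic_at_infty_bounded[OF M] by blast
  define Z where "Z = max Y Y'"
  show ?thesis
  proof (rule periodic_bounded_holomorphic_at_infty[OF N, of F Z B])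
    have o: "open {z. Im z > Z}" by (simp add: open_halfspace_Im_gt)
    have "F analytic_on {z}" if "Im z > Z" for z
    proof -
      have n: "nome M z \<in> ball 0 R" using that Y(3) by (simp add: Z_def)
      have "\<forall>\<^sub>F w in nhds z. F w = A (nome M w)"
        using nome_eventually_in_ball[OF n] by eventually_elim (rule F)
      from analytic_at_cong[OF this refl] nome_comp_analytic[OF A n] show ?thesis by blast
    qed
    then have "F analytic_on {z. Im z > Z}" by (subst analytic_on_analytic_at) blast
    then show "F holomorphic_on {z. Im z > Z}" by (rule analytic_imp_holomorphic)
    show "F (z + of_real N) = F z" if z: "Im z > Z" for z
    proof -
      have "nome M z \<in> ball 0 R" "nome M (z + of_real N) \<in> ball 0 R"
        using z Y(3) by (simp_all add: Z_def)
      then have "F z = A (nome M z)" "F (z + of_real N) = A (nome M (of_real N) * nome M z)"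
        "nome M z \<in> ball 0 R - {0}"
        using F by (simp_all add: nome_add mult.commute)
      then show ?thesis using inv by simp
    qed
  qed (use B(2) in \<open>simp add: Z_def\<close>)
qed

lemma nome_comp_tendsto:
  assumes M: "M > 0" and R: "R > 0" and A: "A holomorphic_on ball 0 R"
    and F: "\<And>z. nome M z \<in> ball 0 R \<Longrightarrow> F z = A (nome M z)"
  shows "(F \<longlongrightarrow> A 0) (filtercomap Im at_top)"
proof -
  have "(nome M \<longlongrightarrow> 0) (filtercomap Im at_top)"
  proof (rule tendstoI)
    fix e :: real assume "e > 0"
    then obtain Y where "\<And>z. Im z > Y \<Longrightarrow> nome M z \<in> ball 0 e" using nome_ball_height[OF M] by blast
    then show "\<forall>\<^sub>F z in filtercomap Im at_top. dist (nome M z) 0 < e"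
      unfolding eventually_filtercomap_at_top_dense by (auto simp: dist_norm)
  qed
  moreover have "isCont A 0" using holomorphic_on_imp_continuous_on[OF A] R by (simp add: continuous_on_eq_continuous_at)
  ultimately have "((\<lambda>z. A (nome M z)) \<longlongrightarrow> A 0) (filtercomap Im at_top)" by (rule isCont_tendsto_compose[rotated])
  moreover obtain Y where "\<And>z. Im z > Y \<Longrightarrow> nome M z \<in> ball 0 R" using nome_ball_height[OF M R] by blast
  then have "\<forall>\<^sub>F z in filtercomap Im at_top. A (nome M z) = F z"
    unfolding eventually_filtercomap_at_top_dense using F by metis
  ultimately show ?thesis by (rule Lim_transform_eventually)
qed

lemma nome_comp_meromorphic_at_infty:
  assumes M: "M > 0" and R: "R > 0" and A: "A holomorphic_on ball 0 R"
    and F: "\<And>z. nome M z \<in> ball 0 R \<Longrightarrow> \<forall>\<^sub>F w in at z. F w = A (nome M w)"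
  shows "meromorphic_at_infty M F"
proof -
  obtain Y where Y: "Y > 0" "exp (- 2 * pi * Y / M) \<le> R" "\<And>z. Im z > Y \<Longrightarrow> nome M z \<in> ball 0 R"
    using nome_ball_height[OF M R] by blast
  have "A analytic_on ball 0 R" using A by (simp add: analytic_on_open)
  then have "A meromorphic_on ball 0 (exp (- 2 * pi * Y / M))"
    by (intro analytic_on_imp_meromorphic_on analytic_on_subset[OF _ subset_ball[OF Y(2)]])
  moreover have "\<forall>\<^sub>\<approx>z\<in>{z. Im z > Y}. F z = A (nome M z)"
    unfolding eventually_cosparse_open_eq[OF open_halfspace_Im_gt] using F Y(3) by simp
  ultimately show ?thesis unfolding meromorphic_at_infty_def using Y(1) by blast
qed

text \<open>
  The number \<open>nome (n N) N\<close> is the primitive root of unity \<open>exp (2 pi i / n)\<close>.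
\<close>

lemma nome_power_one_imp_multiple:
  assumes n: "n > 0" and N: "N > 0" and m: "nome (real n * N) (of_real N) powi m = 1"
  shows "\<exists>a::int. m = int n * a"
proof -
  have e: "nome (real n * N) (of_real N) powi m = exp (of_int m * (2 * of_real pi * \<i> / of_nat n))"
    using N by (simp add: nome_def exp_power_int mult_ac)
  then obtain a :: int where "Im (of_int m * (2 * of_real pi * \<i> / of_nat n)) = of_int (2 * a) * pi"
    using m exp_eq_1 by metis
  then have "real_of_int m * 2 * pi / real n = 2 * real_of_int a * pi" by (simp add: mult_ac Im_divide_of_nat)
  then have "real_of_int m = real n * real_of_int a" using n by (simp add: field_simps)
  then have "real_of_int m = real_of_int (int n * a)" by simp
  then have "m = int n * a" by linarith
  then show ?thesis by blast
qed

section \<open>Solutions quadratic in z with periodic coefficients\<close>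

lemma meromorphic_factor:
  assumes mero: "f meromorphic_on {0}" and freq: "\<exists>\<^sub>F q in at 0. f q \<noteq> 0"
  obtains n \<rho> g where "\<rho> > 0" "g holomorphic_on ball 0 \<rho>" "\<And>q. q \<in> ball 0 \<rho> \<Longrightarrow> g q \<noteq> 0"
    "\<And>q. q \<in> ball 0 \<rho> - {0} \<Longrightarrow> f q = q powi n * g q"
proof -
  have "isolated_singularity_at f 0" "not_essential f 0" using mero by (auto simp: meromorphic_at_iff)
  from zorder_exist[OF this freq] obtain r where r: "zor_poly f 0 0 \<noteq> 0" "r > 0"
    "zor_poly f 0 holomorphic_on cball 0 r"
    "\<And>w. w \<in> cball 0 r - {0} \<Longrightarrow> f w = zor_poly f 0 w * (w - 0) powi zorder f 0 \<and> zor_poly f 0 w \<noteq> 0"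
    by blast
  show ?thesis
  proof (rule that[of r "zor_poly f 0" "zorder f 0"])
    show "zor_poly f 0 holomorphic_on ball 0 r" using r(3) ball_subset_cball holomorphic_on_subset by blast
    show "zor_poly f 0 q \<noteq> 0" if "q \<in> ball 0 r" for q using r(1) r(4)[of q] that by (cases "q = 0") auto
    show "f q = q powi zorder f 0 * zor_poly f 0 q" if "q \<in> ball 0 r - {0}" for q
      using r(4)[of q] that by auto
  qed (rule r(2))
qed

lemma log_derivative_factor:
  assumes g: "g holomorphic_on ball 0 \<rho>" "\<And>q. q \<in> ball 0 \<rho> \<Longrightarrow> g q \<noteq> 0"
    and f: "\<And>q. q \<in> ball 0 \<rho> - {0} \<Longrightarrow> f q = q powi n * g q"
    and q: "q \<in> ball 0 \<rho> - {0::complex}"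
  shows "q * deriv f q / f q = of_int n + q * (deriv g q / g q)"
proof -
  have q0: "q \<noteq> 0" and qb: "q \<in> ball 0 \<rho>" using q by auto
  have dg: "(g has_field_derivative deriv g q) (at q)"
    using holomorphic_has_deriv(1)[OF g(1) _ qb] by simp
  have "((\<lambda>q. q powi n * g q) has_field_derivative
     (of_int n * q powi (n - 1)) * g q + q powi n * deriv g q) (at q)"
    by (rule derivative_eq_intros dg refl | simp add: q0)+
  moreover have "q powi (n - 1) = q powi n / q" using q0 by (simp add: power_int_diff)
  ultimately have "((\<lambda>q. q powi n * g q) has_field_derivative
     (of_int n * (q powi n / q)) * g q + q powi n * deriv g q) (at q)" by simp
  moreover have "open (ball 0 \<rho> - {0::complex})" by (auto intro: open_delete)
  ultimately have "(f has_field_derivative (of_int n * (q powi n / q)) * g q + q powi n * deriv g q) (at q)"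
    by (rule has_field_derivative_transform_within_open[OF _ _ q]) (use f in auto)
  then have "deriv f q = (of_int n * (q powi n / q)) * g q + q powi n * deriv g q" by (rule DERIV_imp_deriv)
  then show ?thesis
    using q0 g(2)[OF qb] f[OF q] by (simp add: field_simps)
qed

text \<open>
  The Euler operator \<open>q d/dq\<close> commutes with rotations.
\<close>

lemma rotation_invariant_theta:
  assumes \<zeta>: "norm \<zeta> = 1" and f: "f holomorphic_on ball 0 \<rho> - {0}"
    and inv: "\<And>q. q \<in> ball 0 \<rho> - {0} \<Longrightarrow> f (\<zeta> * q) = f q" and q: "q \<in> ball 0 \<rho> - {0::complex}"
  shows "\<zeta> * q * deriv f (\<zeta> * q) = q * deriv f q"
proof -
  have o: "open (ball 0 \<rho> - {0::complex})" by (auto intro: open_delete)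
  have \<zeta>q: "\<zeta> * q \<in> ball 0 \<rho> - {0}" using q \<zeta> by (auto simp: norm_mult)
  have d: "(f has_field_derivative deriv f (\<zeta> * q)) (at (\<zeta> * q))"
    by (rule holomorphic_derivI[OF f o \<zeta>q])
  have "((\<lambda>q. f (\<zeta> * q)) has_field_derivative deriv f (\<zeta> * q) * \<zeta>) (at q)"
    by (rule DERIV_chain2[where g = "\<lambda>q. \<zeta> * q", OF d]) (rule DERIV_cmult_Id)
  then have "(f has_field_derivative deriv f (\<zeta> * q) * \<zeta>) (at q)"
    by (rule has_field_derivative_transform_within_open[OF _ o q]) (use inv in auto)
  then show ?thesis by (simp add: DERIV_imp_deriv)
qed

text \<open>
  Otherwise \<open>b z + x (nome M z)\<close> would be constant, although it changes by \<open>b M\<close> from \<open>z\<close> to \<open>z + M\<close>.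
\<close>

lemma theta_not_constant:
  assumes M: "M > 0" and \<rho>: "\<rho> > 0" and x: "x holomorphic_on ball 0 \<rho> - {0}" and b: "b \<noteq> 0"
  shows "\<exists>q\<in>ball 0 \<rho> - {0}. b + 2 * of_real pi * \<i> / of_real M * (q * deriv x q) \<noteq> 0"
proof (rule ccontr)
  assume "\<not> ?thesis"
  then have 0: "b + 2 * of_real pi * \<i> / of_real M * (q * deriv x q) = 0" if "q \<in> ball 0 \<rho> - {0}" for q
    using that by blast
  define S where "S = {z. Im z > - M * ln \<rho> / (2 * pi)}"
  have S: "nome M z \<in> ball 0 \<rho> \<longleftrightarrow> z \<in> S" for z using nome_in_ball_iff[OF M \<rho>] by (simp add: S_def)
  have o: "open (ball 0 \<rho> - {0::complex})" by (auto intro: open_delete)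
  have d: "((\<lambda>z. b * z + x (nome M z)) has_field_derivative 0) (at z)" if z: "z \<in> S" for z
  proof -
    have q: "nome M z \<in> ball 0 \<rho> - {0}" using S z by simp
    have "((\<lambda>z. x (nome M z)) has_field_derivative deriv x (nome M z) * (2 * of_real pi * \<i> / of_real M * nome M z)) (at z)"
      by (rule DERIV_chain2[OF holomorphic_derivI[OF x o q] nome_deriv])
    then have "((\<lambda>z. b * z + x (nome M z)) has_field_derivative
       b + deriv x (nome M z) * (2 * of_real pi * \<i> / of_real M * nome M z)) (at z)"
      by (auto intro!: derivative_eq_intros)
    then show ?thesis using 0[OF q] by (simp add: mult_ac)
  qed
  have "convex S" unfolding S_def by (rule convex_halfspace_Im_gt)
  then obtain c where c: "\<And>z. z \<in> S \<Longrightarrow> b * z + x (nome M z) = c"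
    using has_field_derivative_zero_constant[of S "\<lambda>z. b * z + x (nome M z)"] d
    by (metis has_field_derivative_at_within)
  define z where "z = \<i> * of_real (- M * ln \<rho> / (2 * pi) + 1)"
  have z: "z \<in> S" "z + of_real M \<in> S" by (simp_all add: z_def S_def)
  have "nome M (z + of_real M) = nome M z" using M by (simp add: nome_add) (simp add: nome_def exp_eq_1)
  then have "b * of_real M = (b * (z + of_real M) + x (nome M (z + of_real M))) - (b * z + x (nome M z))"
    by (simp add: algebra_simps)
  also have "\<dots> = 0" unfolding c[OF z(1)] c[OF z(2)] by simp
  finally have "b * of_real M = 0" .
  then show False using b M by simp
qed

lemma nonzero_frequently:
  assumes "f holomorphic_on ball 0 \<rho> - {0::complex}"
    and "\<And>r. 0 < r \<Longrightarrow> r \<le> \<rho> \<Longrightarrow> \<exists>q\<in>ball 0 r - {0}. f q \<noteq> 0" and "\<rho> > 0"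
  shows "\<exists>\<^sub>F q in at 0. f q \<noteq> 0"
  unfolding frequently_def
proof
  assume "\<forall>\<^sub>F q in at 0. \<not> f q \<noteq> 0"
  then obtain d where d: "d > 0" "\<And>q. q \<noteq> 0 \<Longrightarrow> norm q < d \<Longrightarrow> f q = 0"
    by (auto simp: eventually_at)
  then show False using assms(2)[of "min d \<rho>"] assms(3) by auto
qed

text \<open>
  Comparison of the leading coefficients of \<open>f (\<zeta> q)\<close> and \<open>f q\<close>.
\<close>

lemma rotation_exponent:
  assumes \<zeta>: "norm \<zeta> = 1" and \<rho>: "\<rho> > 0"
    and g: "g holomorphic_on ball 0 \<rho>" "\<And>q. q \<in> ball 0 \<rho> \<Longrightarrow> g q \<noteq> 0"
    and f: "\<And>q. q \<in> ball 0 \<rho> - {0} \<Longrightarrow> f q = q powi n * g q"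
    and inv: "\<And>q. q \<in> ball 0 \<rho> - {0} \<Longrightarrow> f (\<zeta> * q) = f q"
  shows "\<zeta> powi n = 1"
proof -
  have \<zeta>0: "\<zeta> \<noteq> 0" using \<zeta> by auto
  have cont: "isCont g 0"
    using g(1) \<rho> by (simp add: holomorphic_on_imp_continuous_on continuous_on_interior interior_open
      continuous_on_eq_continuous_at[symmetric] field_differentiable_imp_continuous_at
      holomorphic_on_imp_differentiable_at)
  have l1: "(g \<longlongrightarrow> g 0) (at 0)" using cont by (simp add: isCont_def)
  have "((\<lambda>q. g (\<zeta> * q)) \<longlongrightarrow> g 0) (at 0)"
  proof -
    have "isCont (\<lambda>q. g (\<zeta> * q)) 0"
      by (rule isCont_o2[where g = g]) (use cont in \<open>auto intro!: continuous_intros\<close>)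
    then show ?thesis by (simp add: isCont_def)
  qed
  then have "((\<lambda>q. \<zeta> powi n * g (\<zeta> * q)) \<longlongrightarrow> \<zeta> powi n * g 0) (at 0)" by (rule tendsto_mult_left)
  moreover have "\<forall>\<^sub>F q in at 0. \<zeta> powi n * g (\<zeta> * q) = g q"
  proof -
    have "\<forall>\<^sub>F q in at (0::complex). q \<in> ball 0 \<rho> - {0}" using \<rho> by (intro eventually_at_in_open) auto
    then show ?thesis
    proof eventually_elim
      case (elim q)
      then have "\<zeta> * q \<in> ball 0 \<rho> - {0}" using \<zeta> \<zeta>0 by (auto simp: norm_mult)
      then have "(\<zeta> * q) powi n * g (\<zeta> * q) = q powi n * g q" using f inv elim by metis
      then show ?case using elim by (auto simp: power_int_mult_distrib)
    qed
  qed
  ultimately have "(g \<longlongrightarrow> \<zeta> powi n * g 0) (at 0)" by (rule Lim_transform_eventually)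
  then have "\<zeta> powi n * g 0 = g 0" using l1 by (intro tendsto_unique[of "at 0"]) auto
  then show ?thesis using g(2)[of 0] \<rho> by simp
qed

text \<open>
  The chain of \<open>chain_solutions\<close> for \<open>1\<close>, \<open>2 z + x\<close> and \<open>z\<^sup>2 + z x + c\<close> with \<open>x\<close> and \<open>c\<close> functions of
  \<open>q = nome M z\<close>.  The derivative of the third function is \<open>z + S\<close> times the derivative \<open>V\<close> of the second,
  and \<open>W\<close> is the derivative of \<open>z + S\<close>.  The point is that \<open>V\<close>, \<open>S\<close> and \<open>W\<close> are functions of \<open>q\<close> alone.  By
  \<open>theta_not_constant\<close> neither \<open>V\<close> nor \<open>W\<close> vanishes identically, and \<open>m\<close> and \<open>l\<close> are their orders at
  \<open>q = 0\<close>.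
\<close>

lemma cusp_reduction:
  fixes x c :: "complex \<Rightarrow> complex"
  assumes M: "M > 0" and \<rho>: "\<rho> > 0"
    and hol: "x holomorphic_on ball 0 \<rho> - {0}" "c holomorphic_on ball 0 \<rho> - {0}"
    and mero: "x meromorphic_on {0}" "c meromorphic_on {0}"
    and \<zeta>: "norm \<zeta> = 1"
    and inv: "\<And>q. q \<in> ball 0 \<rho> - {0} \<Longrightarrow> x (\<zeta> * q) = x q" "\<And>q. q \<in> ball 0 \<rho> - {0} \<Longrightarrow> c (\<zeta> * q) = c q"
  defines "\<kappa> \<equiv> 2 * of_real pi * \<i> / of_real M"
  obtains R V S W V0 W0 m l where "0 < R" "R \<le> \<rho>"
    "V holomorphic_on ball 0 R - {0}" "S holomorphic_on ball 0 R - {0}" "W holomorphic_on ball 0 R - {0}"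
    "\<And>q. q \<in> ball 0 R - {0} \<Longrightarrow> V q = 2 + \<kappa> * (q * deriv x q)"
    "\<And>q. q \<in> ball 0 R - {0} \<Longrightarrow> V q * S q = x q + \<kappa> * (q * deriv c q)"
    "\<And>q. q \<in> ball 0 R - {0} \<Longrightarrow> W q = 1 + \<kappa> * (q * deriv S q)"
    "V0 holomorphic_on ball 0 R" "\<And>q. q \<in> ball 0 R \<Longrightarrow> V0 q \<noteq> 0"
    "W0 holomorphic_on ball 0 R" "\<And>q. q \<in> ball 0 R \<Longrightarrow> W0 q \<noteq> 0"
    "\<And>q. q \<in> ball 0 R - {0} \<Longrightarrow> V q = q powi m * V0 q"
    "\<And>q. q \<in> ball 0 R - {0} \<Longrightarrow> W q = q powi l * W0 q"
    "\<And>q. q \<in> ball 0 R - {0} \<Longrightarrow> V (\<zeta> * q) = V q" "\<And>q. q \<in> ball 0 R - {0} \<Longrightarrow> W (\<zeta> * q) = W q"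
    "\<zeta> powi m = 1" "\<zeta> powi l = 1"
proof -
  have \<zeta>0: "\<zeta> \<noteq> 0" using \<zeta> by auto
  have o: "open (ball 0 r - {0::complex})" for r by (auto intro: open_delete)
  have rot: "\<zeta> * q \<in> ball 0 r - {0}" if "q \<in> ball 0 r - {0}" for q r
    using that \<zeta> \<zeta>0 by (auto simp: norm_mult)
  define V where "V = (\<lambda>q. 2 + \<kappa> * (q * deriv x q))"
  have hd: "deriv x holomorphic_on ball 0 \<rho> - {0}" "deriv c holomorphic_on ball 0 \<rho> - {0}"
    using hol o by (auto intro: holomorphic_deriv)
  have hV: "V holomorphic_on ball 0 \<rho> - {0}" unfolding V_def by (intro holomorphic_intros hd)
  have mV: "V meromorphic_on {0}" unfolding V_def by (intro meromorphic_intros mero)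
  have "\<exists>\<^sub>F q in at 0. V q \<noteq> 0"
  proof (rule nonzero_frequently[OF hV _ \<rho>])
    fix r :: real assume r: "0 < r" "r \<le> \<rho>"
    then have "x holomorphic_on ball 0 r - {0}" using hol(1) by (rule_tac holomorphic_on_subset) auto
    from theta_not_constant[OF M r(1) this, of 2] show "\<exists>q\<in>ball 0 r - {0}. V q \<noteq> 0"
      by (simp add: V_def \<kappa>_def)
  qed
  from meromorphic_factor[OF mV this] obtain m r1 V0 where r1: "r1 > 0" "V0 holomorphic_on ball 0 r1"
    "\<And>q. q \<in> ball 0 r1 \<Longrightarrow> V0 q \<noteq> 0" "\<And>q. q \<in> ball 0 r1 - {0} \<Longrightarrow> V q = q powi m * V0 q" by metis
  define \<rho>1 where "\<rho>1 = min \<rho> r1"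
  have \<rho>1: "\<rho>1 > 0" "\<rho>1 \<le> \<rho>" "\<rho>1 \<le> r1" using \<rho> r1(1) by (auto simp: \<rho>1_def)
  have V_ne: "V q \<noteq> 0" if "q \<in> ball 0 \<rho>1 - {0}" for q
    using r1(3,4)[of q] that \<rho>1 by (auto simp: power_int_eq_0_iff)
  define S where "S = (\<lambda>q. (x q + \<kappa> * (q * deriv c q)) / V q)"
  have sub1: "ball 0 \<rho>1 - {0} \<subseteq> ball 0 \<rho> - {0::complex}" using \<rho>1 by auto
  have hS: "S holomorphic_on ball 0 \<rho>1 - {0}"
    unfolding S_def using V_ne
    by (intro holomorphic_intros holomorphic_on_subset[OF _ sub1] hd hol hV)
  have mS: "S meromorphic_on {0}" unfolding S_def by (intro meromorphic_intros mero mV)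
  define W where "W = (\<lambda>q. 1 + \<kappa> * (q * deriv S q))"
  have hS': "deriv S holomorphic_on ball 0 \<rho>1 - {0}" using hS o by (auto intro: holomorphic_deriv)
  have hW: "W holomorphic_on ball 0 \<rho>1 - {0}" unfolding W_def by (intro holomorphic_intros hS')
  have mW: "W meromorphic_on {0}" unfolding W_def by (intro meromorphic_intros mS)
  have "\<exists>\<^sub>F q in at 0. W q \<noteq> 0"
  proof (rule nonzero_frequently[OF hW _ \<rho>1(1)])
    fix r :: real assume r: "0 < r" "r \<le> \<rho>1"
    then have "S holomorphic_on ball 0 r - {0}" using hS by (rule_tac holomorphic_on_subset) auto
    from theta_not_constant[OF M r(1) this, of 1] show "\<exists>q\<in>ball 0 r - {0}. W q \<noteq> 0"
      by (simp add: W_def \<kappa>_def)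
  qed
  from meromorphic_factor[OF mW this] obtain l r2 W0 where r2: "r2 > 0" "W0 holomorphic_on ball 0 r2"
    "\<And>q. q \<in> ball 0 r2 \<Longrightarrow> W0 q \<noteq> 0" "\<And>q. q \<in> ball 0 r2 - {0} \<Longrightarrow> W q = q powi l * W0 q" by metis
  define R where "R = min \<rho>1 r2"
  have R: "R > 0" "R \<le> \<rho>1" "R \<le> r2" using \<rho>1 r2(1) by (auto simp: R_def)
  have subs: "ball 0 R - {0} \<subseteq> ball 0 \<rho>1 - {0::complex}" "ball 0 R - {0} \<subseteq> ball 0 \<rho> - {0::complex}"
    "ball 0 R \<subseteq> ball (0::complex) r1" "ball 0 R \<subseteq> ball (0::complex) r2"
    "ball 0 R - {0} \<subseteq> ball (0::complex) r1 - {0}" "ball 0 R - {0} \<subseteq> ball (0::complex) r2 - {0}"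
    using R \<rho>1 by auto
  have iV: "V (\<zeta> * q) = V q" if q: "q \<in> ball 0 \<rho> - {0}" for q
    using rotation_invariant_theta[OF \<zeta> hol(1) inv(1) q] by (simp add: V_def)
  have iS: "S (\<zeta> * q) = S q" if q: "q \<in> ball 0 \<rho> - {0}" for q
    using rotation_invariant_theta[OF \<zeta> hol(2) inv(2) q] iV[OF q] inv(1)[OF q] by (simp add: S_def)
  have iW: "W (\<zeta> * q) = W q" if q: "q \<in> ball 0 \<rho>1 - {0}" for q
  proof -
    have "S (\<zeta> * q) = S q" if "q \<in> ball 0 \<rho>1 - {0}" for q using iS that sub1 by blast
    from rotation_invariant_theta[OF \<zeta> hS this q] show ?thesis by (simp add: W_def)
  qed
  show ?thesis
  proof (rule that[of R V S W V0 W0 m l])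
    show "0 < R" "R \<le> \<rho>" using R \<rho>1 by auto
    show "V holomorphic_on ball 0 R - {0}" "S holomorphic_on ball 0 R - {0}" "W holomorphic_on ball 0 R - {0}"
      using hV hS hW subs by (meson holomorphic_on_subset)+
    show V0: "V0 holomorphic_on ball 0 R" and W0: "W0 holomorphic_on ball 0 R"
      using r1(2) r2(2) subs by (meson holomorphic_on_subset)+
    show V0n: "V0 q \<noteq> 0" and W0n: "W0 q \<noteq> 0" if "q \<in> ball 0 R" for q
      by (rule r1(3)[OF subsetD[OF subs(3) that]] r2(3)[OF subsetD[OF subs(4) that]])+
    show Vf: "V q = q powi m * V0 q" and Wf: "W q = q powi l * W0 q" if "q \<in> ball 0 R - {0}" for q
      by (rule r1(4)[OF subsetD[OF subs(5) that]] r2(4)[OF subsetD[OF subs(6) that]])+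
    show iV': "V (\<zeta> * q) = V q" and iW': "W (\<zeta> * q) = W q" if "q \<in> ball 0 R - {0}" for q
      by (rule iV[OF subsetD[OF subs(2) that]] iW[OF subsetD[OF subs(1) that]])+
    show "\<zeta> powi m = 1" by (rule rotation_exponent[OF \<zeta> R(1) V0 V0n Vf iV'])
    show "\<zeta> powi l = 1" by (rule rotation_exponent[OF \<zeta> R(1) W0 W0n Wf iW'])
    show "V q * S q = x q + \<kappa> * (q * deriv c q)" if "q \<in> ball 0 R - {0}" for q
      using V_ne[OF subsetD[OF subs(1) that]] by (simp add: S_def)
  qed (simp_all add: V_def W_def)
qed

lemma wronskian3_reverse: "wronskian3 u v w z = - wronskian3 w v u z"
  unfolding wronskian3_expand by algebra

text \<open>
  Since \<open>a1\<close> and \<open>a2\<close> are logarithmic derivatives of functions of \<open>q\<close> with respect to \<open>z\<close>, they are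
  holomorphic at \<open>q = 0\<close>, with values given by the orders \<open>m\<close> and \<open>l\<close>; hence so are the coefficients of
  the equation.  The rotation by \<open>\<zeta>\<close> and the multiplier \<open>\<epsilon>\<close> express a period finer than \<open>M\<close> up to a
  constant factor.  This factor is lost in the equation, and the conditions on the powers of \<open>\<zeta>\<close> recover
  integrality with respect to the finer period, to which the parameter \<open>t\<close> rescales the exponents.
\<close>

lemma cusp_structure:
  fixes u1 u2 u3 F X C :: "complex \<Rightarrow> complex"
  assumes M: "M > 0" and \<rho>: "\<rho> > 0"
    and hol: "F holomorphic_on ball 0 \<rho>" "X holomorphic_on ball 0 \<rho>" "C holomorphic_on ball 0 \<rho>"
    and F0: "\<exists>\<^sub>F q in at 0. F q \<noteq> 0"
    and u3: "\<And>z. nome M z \<in> ball 0 \<rho> \<Longrightarrow> u3 z = F (nome M z)"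
    and u2: "\<And>z. nome M z \<in> ball 0 \<rho> \<Longrightarrow> u2 z = 2 * z * F (nome M z) + X (nome M z)"
    and u1: "\<And>z. nome M z \<in> ball 0 \<rho> \<Longrightarrow> u1 z = z ^ 2 * F (nome M z) + z * X (nome M z) + C (nome M z)"
    and \<zeta>: "norm \<zeta> = 1" and \<epsilon>: "\<epsilon> \<noteq> 0"
    and inv: "\<And>q. q \<in> ball 0 \<rho> - {0} \<Longrightarrow> F (\<zeta> * q) = \<epsilon> * F q" "\<And>q. q \<in> ball 0 \<rho> - {0} \<Longrightarrow> X (\<zeta> * q) = \<epsilon> * X q"
      "\<And>q. q \<in> ball 0 \<rho> - {0} \<Longrightarrow> C (\<zeta> * q) = \<epsilon> * C q"
  defines "\<kappa> \<equiv> 2 * of_real pi * \<i> / of_real M"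
  obtains R A2 A3 and m l :: int where "0 < R" "R \<le> \<rho>" "A2 holomorphic_on ball 0 R" "A3 holomorphic_on ball 0 R"
    "\<And>z. nome M z \<in> ball 0 R \<Longrightarrow> wronskian3 u1 u2 u3 z \<noteq> 0 \<and>
       projective_equation u1 u2 u3 (\<lambda>z. A2 (nome M z)) (\<lambda>z. A3 (nome M z)) z"
    "\<And>q. q \<in> ball 0 R - {0} \<Longrightarrow> A2 (\<zeta> * q) = A2 q" "\<And>q. q \<in> ball 0 R - {0} \<Longrightarrow> A3 (\<zeta> * q) = A3 q"
    "\<And>t x::complex. x ^ 3 + (t / \<kappa>) ^ 2 * A2 0 * x + (t / \<kappa>) ^ 3 * A3 0
       = (x + t * (2 * of_int m + of_int l) / 3) * (x - t * (of_int m - of_int l) / 3)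
          * (x - t * (of_int m + 2 * of_int l) / 3)"
    "\<zeta> powi m = 1" "\<zeta> powi l = 1"
proof -
  have \<kappa>0: "\<kappa> \<noteq> 0" using M by (simp add: \<kappa>_def)
  have \<zeta>0: "\<zeta> \<noteq> 0" using \<zeta> by auto
  have o: "open (ball 0 r - {0::complex})" for r by (auto intro: open_delete)
  have mer: "F meromorphic_on {0}" "X meromorphic_on {0}" "C meromorphic_on {0}"
  proof -
    have "g meromorphic_on {0}" if "g holomorphic_on ball 0 \<rho>" for g
    proof (rule analytic_on_imp_meromorphic_on)
      show "g analytic_on {0}" unfolding analytic_at using that \<rho> by (intro exI[of _ "ball 0 \<rho>"]) auto
    qed
    then show "F meromorphic_on {0}" "X meromorphic_on {0}" "C meromorphic_on {0}" using hol by blast+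
  qed
  obtain n r0 F' where r0: "r0 > 0" "F' holomorphic_on ball 0 r0" "\<And>q. q \<in> ball 0 r0 \<Longrightarrow> F' q \<noteq> 0"
    "\<And>q. q \<in> ball 0 r0 - {0} \<Longrightarrow> F q = q powi n * F' q"
    using meromorphic_factor[OF mer(1) F0] by metis
  define \<rho>0 where "\<rho>0 = min \<rho> r0"
  have \<rho>0: "\<rho>0 > 0" "\<rho>0 \<le> \<rho>" "\<rho>0 \<le> r0" using \<rho> r0(1) by (auto simp: \<rho>0_def)
  have F_ne: "F q \<noteq> 0" if "q \<in> ball 0 \<rho>0 - {0}" for q
    using r0(3,4)[of q] that \<rho>0 by (auto simp: power_int_eq_0_iff)
  define x where "x = (\<lambda>q. X q / F q)"
  define c where "c = (\<lambda>q. C q / F q)"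
  have sub0: "ball 0 \<rho>0 - {0} \<subseteq> ball (0::complex) \<rho>" using \<rho>0 by auto
  have hx: "x holomorphic_on ball 0 \<rho>0 - {0}" "c holomorphic_on ball 0 \<rho>0 - {0}"
    unfolding x_def c_def by (intro holomorphic_intros holomorphic_on_subset[OF _ sub0] hol F_ne; assumption)+
  have mx: "x meromorphic_on {0}" "c meromorphic_on {0}"
    unfolding x_def c_def by (intro meromorphic_intros mer)+
  have ix: "x (\<zeta> * q) = x q" "c (\<zeta> * q) = c q" if "q \<in> ball 0 \<rho>0 - {0}" for q
    using inv(1-3)[of q] that sub0 \<epsilon> by (auto simp: x_def c_def)
  obtain R V S W V0 W0 m l where R: "0 < R" "R \<le> \<rho>0"
    and hR: "V holomorphic_on ball 0 R - {0}" "S holomorphic_on ball 0 R - {0}" "W holomorphic_on ball 0 R - {0}"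
    and V: "\<And>q. q \<in> ball 0 R - {0} \<Longrightarrow> V q = 2 + \<kappa> * (q * deriv x q)"
    and VS: "\<And>q. q \<in> ball 0 R - {0} \<Longrightarrow> V q * S q = x q + \<kappa> * (q * deriv c q)"
    and W: "\<And>q. q \<in> ball 0 R - {0} \<Longrightarrow> W q = 1 + \<kappa> * (q * deriv S q)"
    and V0: "V0 holomorphic_on ball 0 R" "\<And>q. q \<in> ball 0 R \<Longrightarrow> V0 q \<noteq> 0"
    and W0: "W0 holomorphic_on ball 0 R" "\<And>q. q \<in> ball 0 R \<Longrightarrow> W0 q \<noteq> 0"
    and Vf: "\<And>q. q \<in> ball 0 R - {0} \<Longrightarrow> V q = q powi m * V0 q"
    and Wf: "\<And>q. q \<in> ball 0 R - {0} \<Longrightarrow> W q = q powi l * W0 q"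
    and iV: "\<And>q. q \<in> ball 0 R - {0} \<Longrightarrow> V (\<zeta> * q) = V q"
    and iW: "\<And>q. q \<in> ball 0 R - {0} \<Longrightarrow> W (\<zeta> * q) = W q"
    and \<zeta>ml: "\<zeta> powi m = 1" "\<zeta> powi l = 1"
  proof (rule cusp_reduction[OF M \<rho>0(1) hx mx \<zeta>, folded \<kappa>_def], goal_cases)
    case (1 q) show ?case by (rule ix(1)[OF 1(2)])
  next
    case (2 q) show ?case by (rule ix(2)[OF 2(2)])
  next
    case (3 R V S W V0 W0 m l)
    show ?case by (rule 3(1)) (erule 3 | rule 3)+
  qed
  define E1 where "E1 = (\<lambda>q. - (2 * (of_int m + q * (deriv V0 q / V0 q)) + (of_int l + q * (deriv W0 q / W0 q))) / 3)"
  define E2 where "E2 = (\<lambda>q. ((of_int m + q * (deriv V0 q / V0 q)) - (of_int l + q * (deriv W0 q / W0 q))) / 3)"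
  have hE: "E1 holomorphic_on ball 0 R" "E2 holomorphic_on ball 0 R"
    unfolding E1_def E2_def
    by (intro holomorphic_intros V0 W0 holomorphic_deriv open_ball; simp)+
  define th where "th = (\<lambda>(g::complex\<Rightarrow>complex) q. q * deriv g q)"
  have hth: "th g holomorphic_on ball 0 R" if "g holomorphic_on ball 0 R" for g
    unfolding th_def by (intro holomorphic_intros holomorphic_deriv that open_ball)
  define A2 where "A2 = (\<lambda>q. \<kappa> ^ 2 * (- 2 * th E1 q - th E2 q - (E1 q ^ 2 + E1 q * E2 q + E2 q ^ 2)))"
  define A3 where "A3 = (\<lambda>q. \<kappa> ^ 3 * (- th (th E1) q + E1 q * th E2 q - E1 q * th E1 q + E1 q * E2 q * (E1 q + E2 q)))"
  have ldV: "q * deriv V q / V q = of_int m + q * (deriv V0 q / V0 q)"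
    and ldW: "q * deriv W q / W q = of_int l + q * (deriv W0 q / W0 q)" if "q \<in> ball 0 R - {0}" for q
    by (rule log_derivative_factor[OF V0(1) _ _ that] log_derivative_factor[OF W0(1) _ _ that],
        erule V0(2) W0(2), erule Vf Wf)+
  have iE: "E1 (\<zeta> * q) = E1 q" "E2 (\<zeta> * q) = E2 q" if q: "q \<in> ball 0 R - {0}" for q
  proof -
    have rq: "\<zeta> * q \<in> ball 0 R - {0}" using q \<zeta> \<zeta>0 by (auto simp: norm_mult)
    note ld = ldV ldW
    have "\<zeta> * q * deriv V (\<zeta> * q) / V (\<zeta> * q) = q * deriv V q / V q"
      using rotation_invariant_theta[OF \<zeta> hR(1) iV q] iV[OF q] by simp
    then have 1: "of_int m + \<zeta> * q * (deriv V0 (\<zeta> * q) / V0 (\<zeta> * q)) = of_int m + q * (deriv V0 q / V0 q)"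
      unfolding ld(1)[OF rq] ld(1)[OF q] .
    have "\<zeta> * q * deriv W (\<zeta> * q) / W (\<zeta> * q) = q * deriv W q / W q"
      using rotation_invariant_theta[OF \<zeta> hR(3) iW q] iW[OF q] by simp
    then have 2: "of_int l + \<zeta> * q * (deriv W0 (\<zeta> * q) / W0 (\<zeta> * q)) = of_int l + q * (deriv W0 q / W0 q)"
      unfolding ld(2)[OF rq] ld(2)[OF q] .
    show "E1 (\<zeta> * q) = E1 q" "E2 (\<zeta> * q) = E2 q" unfolding E1_def E2_def 1 2 by (rule refl)+
  qed
  have ith: "th g (\<zeta> * q) = th g q"
    if g: "g holomorphic_on ball 0 R" "\<And>q. q \<in> ball 0 R - {0} \<Longrightarrow> g (\<zeta> * q) = g q" and q: "q \<in> ball 0 R - {0}" for g q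
  proof -
    have "g holomorphic_on ball 0 R - {0}" using g(1) by (rule holomorphic_on_subset) auto
    from rotation_invariant_theta[OF \<zeta> this g(2) q] show ?thesis by (simp add: th_def)
  qed
  show ?thesis
  proof (rule that[of R A2 A3 m l])
    show "0 < R" "R \<le> \<rho>" using R \<rho>0 by auto
    show "A2 holomorphic_on ball 0 R" "A3 holomorphic_on ball 0 R"
      unfolding A2_def A3_def by (intro holomorphic_intros hth hE)+
    show "\<zeta> powi m = 1" "\<zeta> powi l = 1" by (rule \<zeta>ml)+
    have th1: "th E1 (\<zeta> * q) = th E1 q" if q: "q \<in> ball 0 R - {0}" for q
      by (rule ith[OF hE(1) _ q]) (rule iE)
    have th2: "th E2 (\<zeta> * q) = th E2 q" if q: "q \<in> ball 0 R - {0}" for q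
      by (rule ith[OF hE(2) _ q]) (rule iE)
    have th3: "th (th E1) (\<zeta> * q) = th (th E1) q" if q: "q \<in> ball 0 R - {0}" for q
      by (rule ith[OF hth[OF hE(1)] _ q]) (rule th1)
    show "A2 (\<zeta> * q) = A2 q" "A3 (\<zeta> * q) = A3 q" if q: "q \<in> ball 0 R - {0}" for q
      unfolding A2_def A3_def iE[OF q] th1[OF q] th2[OF q] th3[OF q] by (rule refl)+
    have A0: "A2 0 = \<kappa> ^ 2 * (- (E1 0 ^ 2 + E1 0 * E2 0 + E2 0 ^ 2))" "A3 0 = \<kappa> ^ 3 * (E1 0 * E2 0 * (E1 0 + E2 0))"
      by (simp_all add: A2_def A3_def th_def)
    show "y ^ 3 + (t / \<kappa>) ^ 2 * A2 0 * y + (t / \<kappa>) ^ 3 * A3 0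
       = (y + t * (2 * of_int m + of_int l) / 3) * (y - t * (of_int m - of_int l) / 3)
          * (y - t * (of_int m + 2 * of_int l) / 3)" for t y :: complex
    proof -
      have e: "(t / \<kappa>) ^ 2 * A2 0 = t ^ 2 * (- (E1 0 ^ 2 + E1 0 * E2 0 + E2 0 ^ 2))"
        "(t / \<kappa>) ^ 3 * A3 0 = t ^ 3 * (E1 0 * E2 0 * (E1 0 + E2 0))"
        unfolding A0 using \<kappa>0 by (simp_all add: power_divide)
      show ?thesis
        unfolding e by (simp add: E1_def E2_def field_simps power2_eq_square power3_eq_cube)
    qed
    define P where "P = {z. Im z > - M * ln R / (2 * pi)}"
    have P: "nome M z \<in> ball 0 R \<longleftrightarrow> z \<in> P" for z using nome_in_ball_iff[OF M R(1)] by (simp add: P_def)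
    have oP: "open P" and cP: "convex P" unfolding P_def by (auto simp: open_halfspace_Im_gt convex_halfspace_Im_gt)
    have qP: "nome M z \<in> ball 0 R - {0}" if "z \<in> P" for z using P that by simp
    have chain: "((\<lambda>z. g (nome M z)) has_field_derivative \<kappa> * th g (nome M z)) (at z)"
      if g: "g holomorphic_on ball 0 R - {0}" and z: "z \<in> P" for g z
      using DERIV_chain2[OF holomorphic_derivI[OF g o qP[OF z]] nome_deriv]
      by (simp add: th_def \<kappa>_def mult_ac)
    have hE': "E1 holomorphic_on ball 0 R - {0}" "E2 holomorphic_on ball 0 R - {0}"
      "th E1 holomorphic_on ball 0 R - {0}"
      using hE hth by (meson Diff_subset holomorphic_on_subset)+
    have holc: "(\<lambda>z. g (nome M z)) holomorphic_on P" if "g holomorphic_on ball 0 R - {0}" for g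
      using chain[OF that] unfolding holomorphic_on_def field_differentiable_def
      using has_field_derivative_at_within by blast
    define a1 where "a1 = (\<lambda>z. \<kappa> * E1 (nome M z))"
    define a2 where "a2 = (\<lambda>z. \<kappa> * E2 (nome M z))"
    have ha: "a1 holomorphic_on P" unfolding a1_def by (intro holomorphic_intros holc hE')
    have da: "(a1 has_field_derivative \<kappa> ^ 2 * th E1 (nome M z)) (at z)"
      "(a2 has_field_derivative \<kappa> ^ 2 * th E2 (nome M z)) (at z)"
      "((\<lambda>z. \<kappa> ^ 2 * th E1 (nome M z)) has_field_derivative \<kappa> ^ 3 * th (th E1) (nome M z)) (at z)" if z: "z \<in> P" for z
      unfolding a1_def a2_def
      by (rule DERIV_cong[OF DERIV_cmult[OF chain]], (rule hE' z)+, simp add: power2_eq_square power3_eq_cube)+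
    have dda: "(deriv ^^ 2) a1 z = \<kappa> ^ 3 * th (th E1) (nome M z)" if z: "z \<in> P" for z
      by (rule derivs_eqI(2)[OF oP z da(1) da(3)])
    have Q: "factored_Q2 a1 a2 z = A2 (nome M z)" "factored_Q3 a1 a2 z = A3 (nome M z)" if z: "z \<in> P" for z
      unfolding factored_Q2_def factored_Q3_def dda[OF z]
        DERIV_imp_deriv[OF da(1)[OF z]] DERIV_imp_deriv[OF da(2)[OF z]]
      unfolding a1_def a2_def A2_def A3_def by algebra+
    obtain L where L: "\<And>z. z \<in> P \<Longrightarrow> (L has_field_derivative a1 z) (at z within P)"
      using holomorphic_convex_primitive'[OF cP oP ha] by blast
    \<comment> \<open>\<open>g\<close> is a constant multiple of a branch of \<open>(V ^ 2 * W) powr (- 1/3)\<close>\<close>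
    define g where "g = (\<lambda>z. exp (L z))"
    have dg: "(g has_field_derivative a1 z * g z) (at z)" if z: "z \<in> P" for z
    proof -
      have "(L has_field_derivative a1 z) (at z)" using L[OF z] unfolding at_within_open[OF z oP] .
      then show ?thesis unfolding g_def by (auto intro!: derivative_eq_intros)
    qed
    have hg: "g holomorphic_on P"
      using dg unfolding holomorphic_on_def field_differentiable_def using has_field_derivative_at_within by blast
    have hxR: "x holomorphic_on ball 0 R - {0}" "c holomorphic_on ball 0 R - {0}"
      using hx R by (auto intro: holomorphic_on_subset)
    have dx: "((\<lambda>z. x (nome M z)) has_field_derivative \<kappa> * th x (nome M z)) (at z)"
      and dc: "((\<lambda>z. c (nome M z)) has_field_derivative \<kappa> * th c (nome M z)) (at z)"
      and dS: "((\<lambda>z. S (nome M z)) has_field_derivative \<kappa> * th S (nome M z)) (at z)" if "z \<in> P" for z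
      by (rule chain[OF hxR(1) that] chain[OF hxR(2) that] chain[OF hR(2) that])+
    have vne: "V (nome M z) \<noteq> 0" "W (nome M z) \<noteq> 0" if z: "z \<in> P" for z
      using Vf[OF qP[OF z]] Wf[OF qP[OF z]] V0(2)[of "nome M z"] W0(2)[of "nome M z"] P z by auto
    have ld: "deriv (\<lambda>z. V (nome M z)) z / V (nome M z) = \<kappa> * (of_int m + nome M z * (deriv V0 (nome M z) / V0 (nome M z)))"
      "deriv (\<lambda>z. W (nome M z)) z / W (nome M z) = \<kappa> * (of_int l + nome M z * (deriv W0 (nome M z) / W0 (nome M z)))"
      if z: "z \<in> P" for z
      unfolding DERIV_imp_deriv[OF chain[OF hR(1) z]] DERIV_imp_deriv[OF chain[OF hR(3) z]] th_def
        ldV[OF qP[OF z], symmetric] ldW[OF qP[OF z], symmetric]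
      by simp_all
    have a1_eq: "a1 z = - (2 * (deriv (\<lambda>z. V (nome M z)) z / V (nome M z)) + deriv (\<lambda>z. W (nome M z)) z / W (nome M z)) / 3"
      and a2_eq: "a2 z = (deriv (\<lambda>z. V (nome M z)) z / V (nome M z) - deriv (\<lambda>z. W (nome M z)) z / W (nome M z)) / 3"
      if z: "z \<in> P" for z
      unfolding ld[OF z] a1_def a2_def E1_def E2_def by (simp_all add: algebra_simps)
    have du: "((\<lambda>z. 2 * z + x (nome M z)) has_field_derivative V (nome M z)) (at z)" if z: "z \<in> P" for z
      unfolding V[OF qP[OF z]] using dx[OF z] by (auto intro!: derivative_eq_intros simp: th_def)
    have dp: "((\<lambda>z. z ^ 2 + z * x (nome M z) + c (nome M z)) has_field_derivative V (nome M z) * (z + S (nome M z))) (at z)"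
      if z: "z \<in> P" for z
    proof -
      have "((\<lambda>z. z ^ 2 + z * x (nome M z) + c (nome M z)) has_field_derivative
         2 * z + (x (nome M z) + z * (\<kappa> * th x (nome M z))) + \<kappa> * th c (nome M z)) (at z)"
        by (rule derivative_eq_intros dx[OF z] dc[OF z] refl)+ simp
      moreover have "V (nome M z) * (z + S (nome M z)) = z * V (nome M z) + V (nome M z) * S (nome M z)"
        by (simp add: algebra_simps)
      ultimately show ?thesis
        unfolding V[OF qP[OF z]] VS[OF qP[OF z], unfolded V[OF qP[OF z]]] by (simp add: th_def algebra_simps)
    qed
    have ds: "((\<lambda>z. z + S (nome M z)) has_field_derivative W (nome M z)) (at z)" if z: "z \<in> P" for z
      unfolding W[OF qP[OF z]] using dS[OF z] by (auto intro!: derivative_eq_intros simp: th_def)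
    note ch = chain_solutions[OF oP holc[OF hR(1)] vne(1) holc[OF hR(3)] vne(2) a1_eq a2_eq dg du dp ds, simplified]
    have qP\<rho>: "nome M z \<in> ball 0 \<rho>" "F (nome M z) \<noteq> 0" if "z \<in> P" for z
      using qP[OF that] R \<rho>0 F_ne[of "nome M z"] by auto
    define K where "K = (\<lambda>z. F (nome M z) / g z)"
    have g0: "g z \<noteq> 0" for z by (simp add: g_def)
    have hF: "F holomorphic_on ball 0 R - {0}"
      using hol(1) R \<rho>0 by (auto intro: holomorphic_on_subset)
    have hK: "K holomorphic_on P" unfolding K_def by (intro holomorphic_intros holc hF hg g0)
    have K0: "K z \<noteq> 0" if "z \<in> P" for z using qP\<rho>[OF that] g0 by (simp add: K_def)
    have uK: "u3 z = K z * g z" "u2 z = K z * (g z * (2 * z + x (nome M z)))"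
      "u1 z = K z * (g z * (z ^ 2 + z * x (nome M z) + c (nome M z)))" if z: "z \<in> P" for z
      unfolding u1[OF qP\<rho>(1)[OF z]] u2[OF qP\<rho>(1)[OF z]] u3[OF qP\<rho>(1)[OF z]] K_def x_def c_def
      using qP\<rho>(2)[OF z] g0[of z] by (simp_all add: field_simps)
    have sol: "solution_on (\<lambda>z. A2 (nome M z)) (\<lambda>z. A3 (nome M z)) P (\<lambda>z. u z / K z)"
      if s: "solution_on (factored_Q2 a1 a2) (factored_Q3 a1 a2) P y" and e: "\<And>z. z \<in> P \<Longrightarrow> u z = K z * y z" for u y
      by (rule iffD1[OF solution_on_cong[OF oP] s]) (use e K0 Q in auto)
    fix z assume "nome M z \<in> ball 0 R"
    then have z: "z \<in> P" using P by simp
    have "projective_equation u1 u2 u3 (\<lambda>z. A2 (nome M z)) (\<lambda>z. A3 (nome M z)) z"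
      unfolding projective_equation_def
      using oP z hK K0 sol[OF ch(1) uK(1)] sol[OF ch(2) uK(2)] sol[OF ch(3) uK(3)] by blast
    moreover have "wronskian3 u1 u2 u3 z \<noteq> 0"
    proof -
      have hyp: "g holomorphic_on P" "(\<lambda>z. g z * (2 * z + x (nome M z))) holomorphic_on P"
        "(\<lambda>z. g z * (z ^ 2 + z * x (nome M z) + c (nome M z))) holomorphic_on P"
        by (intro holomorphic_intros hg holc hxR)+
      have "wronskian3 u3 u2 u1 z = wronskian3 (\<lambda>z. K z * g z) (\<lambda>z. K z * (g z * (2 * z + x (nome M z))))
         (\<lambda>z. K z * (g z * (z ^ 2 + z * x (nome M z) + c (nome M z)))) z"
        by (rule wronskian3_cong; rule eventually_mono[OF eventually_nhds_in_open[OF oP z]]; rule uK)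
      also have "\<dots> = K z ^ 3 * (g z ^ 3 * V (nome M z) ^ 2 * W (nome M z))"
        unfolding wronskian3_scale[OF oP z hK hyp] using ch(4)[OF z] by simp
      also have "\<dots> \<noteq> 0" using K0[OF z] g0 vne[OF z] by simp
      finally show ?thesis by (subst wronskian3_reverse) simp
    qed
    ultimately show "wronskian3 u1 u2 u3 z \<noteq> 0 \<and>
       projective_equation u1 u2 u3 (\<lambda>z. A2 (nome M z)) (\<lambda>z. A3 (nome M z)) z" by simp
  qed
qed

section \<open>Poles and growth near a point\<close>

lemma eventually_at_imp_eventually_nhds:
  fixes z0 :: complex
  assumes "\<forall>\<^sub>F z in at z0. P z"
  shows "\<forall>\<^sub>F z in at z0. \<forall>\<^sub>F w in nhds z. P w"
proof -
  obtain S where S: "open S" "z0 \<in> S" "\<And>x. x \<in> S \<Longrightarrow> x \<noteq> z0 \<Longrightarrow> P x"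
    using assms unfolding eventually_at_topological by blast
  have "\<forall>\<^sub>F w in nhds z. P w" if "z \<in> S" "z \<noteq> z0" for z
    unfolding eventually_nhds using S that by (intro exI[of _ "S - {z0}"]) (auto intro: open_delete)
  then show ?thesis unfolding eventually_at_topological using S by blast
qed

lemma zorder_pole_ge:
  assumes R: "R > 0" and C: "C holomorphic_on ball z0 R"
    and f: "\<And>z. z \<in> ball z0 R - {z0} \<Longrightarrow> f z = C z / (z - z0) ^ p" and pole: "is_pole f z0"
  shows "zorder f z0 \<ge> - int p"
proof -
  have "\<exists>z\<in>ball z0 R. C z \<noteq> 0"
  proof (rule ccontr)
    assume "\<not> ?thesis"
    then have 0: "f z = 0" if "z \<in> ball z0 R - {z0}" for z using f[OF that] that by auto
    have "\<forall>\<^sub>F z in at z0. z \<in> ball z0 R - {z0}" using R by (intro eventually_at_in_open) auto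
    then have "\<forall>\<^sub>F z in at z0. f z = 0" by eventually_elim (rule 0)
    then have "f \<midarrow>z0\<rightarrow> 0" by (rule tendsto_eventually)
    with pole show False unfolding is_pole_def
      using not_tendsto_and_filterlim_at_infinity[of "at z0" f 0] by simp
  qed
  then obtain z1 where "z1 \<in> ball z0 R" "C z1 \<noteq> 0" by blast
  from vanishes_to_order_exists[OF C R this] obtain n where "vanishes_to_order C z0 n" .
  then obtain r F where r: "r > 0" "F holomorphic_on ball z0 r" "F z0 \<noteq> 0"
    "\<And>z. z \<in> ball z0 r \<Longrightarrow> C z = (z - z0) ^ n * F z"
    unfolding vanishes_to_order_def by blast
  define s where "s = min r R"
  have s: "s > 0" "ball z0 s \<subseteq> ball z0 r" "ball z0 s \<subseteq> ball z0 R" using r R by (auto simp: s_def)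
  have "zorder f z0 = int n - int p"
  proof (rule zorder_eqI[of "ball z0 s" z0 F])
    show "F holomorphic_on ball z0 s" using r(2) s(2) holomorphic_on_subset by blast
    fix w assume w: "w \<in> ball z0 s" "w \<noteq> z0"
    have "w \<in> ball z0 r" "w \<in> ball z0 R - {z0}" using w s by blast+
    then have "f w = (w - z0) ^ n * F w / (w - z0) ^ p" using f[of w] r(4)[of w] by simp
    also have "\<dots> = F w * (w - z0) powi (int n - int p)"
      using w by (simp add: power_int_diff)
    finally show "f w = F w * (w - z0) powi (int n - int p)" .
  qed (use s r in auto)
  then show ?thesis by simp
qed

lemma bigo_quotient:
  assumes R: "R > 0" and C: "C holomorphic_on ball z0 R"
    and f: "\<And>z. z \<in> ball z0 R - {z0} \<Longrightarrow> f z = C z / (z - z0) ^ Suc p"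
  shows "(\<lambda>z. f z - C z0 * (z - z0) powi (- int (Suc p))) \<in> O[at z0](\<lambda>z. (z - z0) powi (- int p))"
proof -
  have "(C has_field_derivative deriv C z0) (at z0)"
    using C R by (intro holomorphic_derivI[of C "ball z0 R"]) auto
  then have lim: "((\<lambda>z. (C z - C z0) / (z - z0)) \<longlongrightarrow> deriv C z0) (at z0)"
    by (simp add: has_field_derivative_iff)
  show ?thesis
  proof (rule bigoI_tendsto[where c = "deriv C z0"])
    have ev: "\<forall>\<^sub>F z in at z0. z \<in> ball z0 R - {z0}" using R by (intro eventually_at_in_open) auto
    then show "\<forall>\<^sub>F z in at z0. (z - z0) powi (- int p) \<noteq> 0" by eventually_elim auto
    from ev have "\<forall>\<^sub>F z in at z0. (C z - C z0) / (z - z0)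
       = (f z - C z0 * (z - z0) powi (- int (Suc p))) / (z - z0) powi (- int p)"
    proof eventually_elim
      case (elim z)
      have z: "z - z0 \<noteq> 0" using elim by auto
      have "f z = C z / (z - z0) ^ Suc p" by (rule f[OF elim])
      then show ?case using z by (simp add: power_int_minus field_simps del: of_nat_Suc)
    qed
    then show "((\<lambda>z. (f z - C z0 * (z - z0) powi (- int (Suc p))) / (z - z0) powi (- int p)) \<longlongrightarrow> deriv C z0) (at z0)"
      using lim by (rule Lim_transform_eventually[rotated])
  qed
qed

text \<open>
  For exponents whose order depends on unknown integers: a symmetric property is shown for one
  arrangement and sorted afterwards.
\<close>

lemma sort3:
  fixes x1 x2 x3 :: real
  assumes "P x1 x2 x3" "\<And>a b c. P a b c \<Longrightarrow> P b a c" "\<And>a b c. P a b c \<Longrightarrow> P a c b"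
  shows "\<exists>a b c. P a b c \<and> a \<le> b \<and> b \<le> c"
proof (cases "x1 \<le> x2")
  case True
  show ?thesis
  proof (cases "x2 \<le> x3")
    case False
    then show ?thesis using True assms by (cases "x1 \<le> x3") (meson linear le_less_trans not_le less_imp_le)+
  qed (use True assms in blast)
next
  case False
  show ?thesis
  proof (cases "x1 \<le> x3")
    case False
    then show ?thesis using \<open>\<not> x1 \<le> x2\<close> assms by (cases "x2 \<le> x3") (meson linear le_less_trans not_le less_imp_le)+
  qed (use False assms in \<open>meson linear\<close>)
qed

section \<open>The equation on the upper half plane\<close>

context quasimodular_setup
begin

abbreviation "W \<equiv> W_form \<alpha> \<phi> f f1 f2"
abbreviation "Q2 \<equiv> Q2_form \<alpha> \<phi> f f1 f2"
abbreviation "Q3 \<equiv> Q3_form \<alpha> \<phi> f f1 f2"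

text \<open>
  The consequences of \<open>equation_near\<close> for a basis with orders \<open>n1\<close>, \<open>n2\<close> and \<open>n3\<close> at \<open>z0\<close>.  The raw
  coefficients are included because meromorphy of \<open>Q2\<close> and \<open>Q3\<close> at \<open>z0\<close> itself is inferred from that
  of the functions before the removal of singularities.
\<close>

definition local_data :: "complex \<Rightarrow> nat \<Rightarrow> nat \<Rightarrow> nat \<Rightarrow> bool" where
  "local_data z0 n1 n2 n3 \<longleftrightarrow> n1 < n2 \<and> n2 < n3 \<and> (\<exists>R C2 C3. 0 < R \<and> ball z0 R \<subseteq> upper_half_plane \<and>
     C2 holomorphic_on ball z0 R \<and> C3 holomorphic_on ball z0 R \<and>
     (\<forall>x::complex. x * (x - 1) * (x - 2) + C2 z0 * x + C3 z0 =
      (x + (of_nat n2 + of_nat n3 - 2 * of_nat n1 - 3) / 3) * (x - (2 * of_nat n2 - of_nat n1 - of_nat n3 + 3) / 3)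
         * (x - (2 * of_nat n3 - of_nat n1 - of_nat n2 + 3) / 3)) \<and>
     (\<forall>z\<in>ball z0 R - {z0}. Q2 z = C2 z / (z - z0) ^ 2 \<and> Q3 z = C3 z / (z - z0) ^ 3 \<and>
        raw_Q2 W w1 w2 z = C2 z / (z - z0) ^ 2 \<and> raw_Q3 W w1 w2 z = C3 z / (z - z0) ^ 3 \<and>
        projective_equation w1 w2 f Q2 Q3 z \<and> W z \<noteq> 0) \<and>
     (\<forall>y. solution_on Q2 Q3 {z \<in> ball z0 R. z - z0 \<notin> \<real>\<^sub>\<le>\<^sub>0} y \<longrightarrow>
        (\<exists>e F. F holomorphic_on ball z0 R \<and>
          (\<forall>z\<in>ball z0 R. z - z0 \<notin> \<real>\<^sub>\<le>\<^sub>0 \<longrightarrow> y z = (z - z0) powr e * F z))))"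

lemma local_dataI:
  assumes z0: "Im z0 > 0" and n: "n1 < n2" "n2 < n3" and span: "span3 y1 y2 y3 = span3 w1 w2 f"
    and ord: "vanishes_to_order y1 z0 n1" "vanishes_to_order y2 z0 n2" "vanishes_to_order y3 z0 n3"
  shows "local_data z0 n1 n2 n3"
proof -
  obtain r where r: "r > 0" "ball z0 r \<subseteq> upper_half_plane"
    using z0 upper_half_plane_open by (metis (mono_tags) mem_Collect_eq open_contains_ball)
  have hol: "w1 holomorphic_on ball z0 r" "w2 holomorphic_on ball z0 r" "f holomorphic_on ball z0 r"
    using holomorphic r(2) holomorphic_on_subset by blast+
  obtain R C2 C3 where R: "0 < R" "R \<le> r" "C2 holomorphic_on ball z0 R" "C3 holomorphic_on ball z0 R"
    and ind: "\<And>x::complex. x * (x - 1) * (x - 2) + C2 z0 * x + C3 z0 =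
      (x + (of_nat n2 + of_nat n3 - 2 * of_nat n1 - 3) / 3) * (x - (2 * of_nat n2 - of_nat n1 - of_nat n3 + 3) / 3)
         * (x - (2 * of_nat n3 - of_nat n1 - of_nat n2 + 3) / 3)"
    and Q: "\<And>z. z \<in> ball z0 R - {z0} \<Longrightarrow> Q2 z = C2 z / (z - z0) ^ 2"
    "\<And>z. z \<in> ball z0 R - {z0} \<Longrightarrow> Q3 z = C3 z / (z - z0) ^ 3"
    "\<And>z. z \<in> ball z0 R - {z0} \<Longrightarrow> raw_Q2 W w1 w2 z = C2 z / (z - z0) ^ 2"
    "\<And>z. z \<in> ball z0 R - {z0} \<Longrightarrow> raw_Q3 W w1 w2 z = C3 z / (z - z0) ^ 3"
    and sol: "\<And>z. z \<in> ball z0 R - {z0} \<Longrightarrow> \<exists>V G. open V \<and> z \<in> V \<and> V \<subseteq> ball z0 R - {z0} \<and>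
        G holomorphic_on V \<and> (\<forall>x\<in>V. G x \<noteq> 0) \<and>
        solution_on Q2 Q3 V (\<lambda>x. w1 x / G x) \<and> solution_on Q2 Q3 V (\<lambda>x. w2 x / G x) \<and>
        solution_on Q2 Q3 V (\<lambda>x. f x / G x) \<and> (\<forall>x\<in>V. W x \<noteq> 0)"
    and app: "\<And>y. solution_on Q2 Q3 {z \<in> ball z0 R. z - z0 \<notin> \<real>\<^sub>\<le>\<^sub>0} y \<Longrightarrow>
        \<exists>F. F holomorphic_on ball z0 R \<and>
          (\<forall>z\<in>ball z0 R. z - z0 \<notin> \<real>\<^sub>\<le>\<^sub>0 \<longrightarrow> y z = (z - z0) powr (- ((of_nat n2 + of_nat n3 - 2 * of_nat n1 - 3) / 3)) * F z)"
    using equation_near[OF r(1) hol n span ord, folded W_form_def, folded Q2_form_def Q3_form_def] by blast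
  have pr: "projective_equation w1 w2 f Q2 Q3 z \<and> W z \<noteq> 0" if "z \<in> ball z0 R - {z0}" for z
    using sol[OF that] unfolding projective_equation_def by blast
  have sub: "ball z0 R \<subseteq> upper_half_plane" using R r by (meson order_trans subset_ball)
  have app': "\<exists>e F. F holomorphic_on ball z0 R \<and>
          (\<forall>z\<in>ball z0 R. z - z0 \<notin> \<real>\<^sub>\<le>\<^sub>0 \<longrightarrow> y z = (z - z0) powr e * F z)"
    if "solution_on Q2 Q3 {z \<in> ball z0 R. z - z0 \<notin> \<real>\<^sub>\<le>\<^sub>0} y" for y
    by (rule exI) (rule app[OF that])
  show ?thesis
    unfolding local_data_def
    by (rule conjI[OF n(1)], rule conjI[OF n(2)], rule exI[of _ R], rule exI[of _ C2], rule exI[of _ C3],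
        intro conjI allI ballI impI R sub ind Q app'; (use pr in blast)?)
qed

lemma local_data_exists:
  assumes z0: "Im z0 > 0"
  obtains n1 n2 n3 where "local_data z0 n1 n2 n3"
proof -
  obtain r where r: "r > 0" "ball z0 r \<subseteq> upper_half_plane"
    using z0 upper_half_plane_open by (metis (mono_tags) mem_Collect_eq open_contains_ball)
  have hol: "w1 holomorphic_on ball z0 r" "w2 holomorphic_on ball z0 r" "f holomorphic_on ball z0 r"
    using holomorphic r(2) holomorphic_on_subset by blast+
  have ne: "ball z0 r \<noteq> {}" using r(1) by simp
  have "p = 0 \<and> q = 0 \<and> s = 0" if "\<And>z. z \<in> ball z0 r \<Longrightarrow> p * w1 z + q * w2 z + s * f z = 0" for p q s
    by (rule independent_open[OF open_ball ne r(2)]) (rule that)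
  note ab = adapted_basis[OF r(1) hol this]
  show ?thesis
    by (rule ab, assumption, rule that, rule local_dataI[OF z0])
qed

lemma local_data_eventually:
  assumes "local_data z0 n1 n2 n3"
  shows "\<forall>\<^sub>F z in at z0. Q2 analytic_on {z} \<and> Q3 analytic_on {z} \<and> projective_equation w1 w2 f Q2 Q3 z \<and> W z \<noteq> 0"
    "Q2 nicely_meromorphic_on {z0}" "Q3 nicely_meromorphic_on {z0}"
proof -
  obtain R C2 C3 where R: "0 < R" "C2 holomorphic_on ball z0 R" "C3 holomorphic_on ball z0 R"
    and Q: "\<And>z. z \<in> ball z0 R - {z0} \<Longrightarrow> Q2 z = C2 z / (z - z0) ^ 2 \<and> Q3 z = C3 z / (z - z0) ^ 3 \<and>
        raw_Q2 W w1 w2 z = C2 z / (z - z0) ^ 2 \<and> raw_Q3 W w1 w2 z = C3 z / (z - z0) ^ 3 \<and>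
        projective_equation w1 w2 f Q2 Q3 z \<and> W z \<noteq> 0"
    using assms unfolding local_data_def by blast
  have o: "open (ball z0 R - {z0})" by (auto intro: open_delete)
  have hol: "(\<lambda>z. C2 z / (z - z0) ^ 2) holomorphic_on ball z0 R - {z0}"
    "(\<lambda>z. C3 z / (z - z0) ^ 3) holomorphic_on ball z0 R - {z0}"
    by (intro holomorphic_intros holomorphic_on_subset[OF R(2)] holomorphic_on_subset[OF R(3)]; auto)+
  have hQ: "Q2 holomorphic_on ball z0 R - {z0}" "Q3 holomorphic_on ball z0 R - {z0}"
    by (rule holomorphic_transform[OF hol(1)], use Q in simp)
      (rule holomorphic_transform[OF hol(2)], use Q in simp)
  have ev: "\<forall>\<^sub>F z in at z0. z \<in> ball z0 R - {z0}" using R by (intro eventually_at_in_open) auto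
  then show "\<forall>\<^sub>F z in at z0. Q2 analytic_on {z} \<and> Q3 analytic_on {z} \<and> projective_equation w1 w2 f Q2 Q3 z \<and> W z \<noteq> 0"
  proof eventually_elim
    case (elim z)
    have "Q2 analytic_on {z}" "Q3 analytic_on {z}"
      using elim hQ o unfolding analytic_at by blast+
    then show ?case using Q[OF elim] by blast
  qed
  have an: "C2 analytic_on {z0}" "C3 analytic_on {z0}"
    using R unfolding analytic_at by (meson centre_in_ball open_ball)+
  have m: "(\<lambda>z. C2 z / (z - z0) ^ 2) meromorphic_on {z0}" "(\<lambda>z. C3 z / (z - z0) ^ 3) meromorphic_on {z0}"
    by (intro meromorphic_intros analytic_on_imp_meromorphic_on an)+
  have e: "\<forall>\<^sub>F z in at z0. raw_Q2 W w1 w2 z = C2 z / (z - z0) ^ 2"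
    "\<forall>\<^sub>F z in at z0. raw_Q3 W w1 w2 z = C3 z / (z - z0) ^ 3"
    using ev by (eventually_elim, use Q in blast)+
  have "raw_Q2 W w1 w2 meromorphic_on {z0}"
    by (rule iffD2[OF meromorphic_on_cong[OF _ refl] m(1)]) (use e in simp)
  then show "Q2 nicely_meromorphic_on {z0}"
    unfolding Q2_form_def by (rule remove_sings_nicely_meromorphic)
  have "raw_Q3 W w1 w2 meromorphic_on {z0}"
    by (rule iffD2[OF meromorphic_on_cong[OF _ refl] m(2)]) (use e in simp)
  then show "Q3 nicely_meromorphic_on {z0}"
    unfolding Q3_form_def by (rule remove_sings_nicely_meromorphic)
qed

lemma good_eventually:
  assumes "Im z0 > 0"
  shows "\<forall>\<^sub>F z in at z0. Q2 analytic_on {z} \<and> Q3 analytic_on {z} \<and> projective_equation w1 w2 f Q2 Q3 z \<and> W z \<noteq> 0"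
proof -
  obtain n1 n2 n3 where "local_data z0 n1 n2 n3" using local_data_exists[OF assms] by blast
  then show ?thesis by (rule local_data_eventually(1))
qed

lemma Q_nicely_meromorphic:
  assumes "Im z0 > 0"
  shows "Q2 nicely_meromorphic_on {z0}" "Q3 nicely_meromorphic_on {z0}"
proof -
  obtain n1 n2 n3 where ld: "local_data z0 n1 n2 n3" using local_data_exists[OF assms] by blast
  show "Q2 nicely_meromorphic_on {z0}" "Q3 nicely_meromorphic_on {z0}"
    by (rule local_data_eventually(2)[OF ld] local_data_eventually(3)[OF ld])+
qed

lemma Q_meromorphic: "Q2 meromorphic_on upper_half_plane" "Q3 meromorphic_on upper_half_plane"
proof -
  have "Q2 meromorphic_on {z} \<and> Q3 meromorphic_on {z}" if "Im z > 0" for z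
    using Q_nicely_meromorphic[OF that] unfolding nicely_meromorphic_on_def by blast
  then show "Q2 meromorphic_on upper_half_plane" "Q3 meromorphic_on upper_half_plane"
    unfolding meromorphic_on_meromorphic_at[of _ upper_half_plane] by blast+
qed

lemma Q_analytic:
  assumes "Im z > 0" "\<not> singular_point Q2 Q3 z"
  shows "Q2 analytic_on {z}" "Q3 analytic_on {z}"
proof -
  have "\<not> is_pole Q2 z" "\<not> is_pole Q3 z" using assms(2) unfolding singular_point_def by blast+
  then show "Q2 analytic_on {z}" "Q3 analytic_on {z}"
    using nicely_meromorphic_on_imp_analytic_at[OF Q_nicely_meromorphic(1)[OF assms(1)], of z]
      nicely_meromorphic_on_imp_analytic_at[OF Q_nicely_meromorphic(2)[OF assms(1)], of z] by blast+
qed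

lemma local_data_exponents:
  assumes "local_data z0 n1 n2 n3"
  shows "local_exponents Q2 Q3 z0 ((2 * real n1 - real n2 - real n3 + 3) / 3)
     ((2 * real n2 - real n1 - real n3 + 3) / 3) ((2 * real n3 - real n1 - real n2 + 3) / 3)"
proof -
  obtain R C2 C3 where R: "0 < R" "C2 holomorphic_on ball z0 R" "C3 holomorphic_on ball z0 R"
    and ind: "\<And>x::complex. x * (x - 1) * (x - 2) + C2 z0 * x + C3 z0 =
      (x + (of_nat n2 + of_nat n3 - 2 * of_nat n1 - 3) / 3) * (x - (2 * of_nat n2 - of_nat n1 - of_nat n3 + 3) / 3)
         * (x - (2 * of_nat n3 - of_nat n1 - of_nat n2 + 3) / 3)"
    and Q: "\<And>z. z \<in> ball z0 R - {z0} \<Longrightarrow> Q2 z = C2 z / (z - z0) ^ 2 \<and> Q3 z = C3 z / (z - z0) ^ 3"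
    using assms unfolding local_data_def by blast
  have n: "n1 < n2" "n2 < n3" using assms by (auto simp: local_data_def)
  have Q': "Q2 z = C2 z / (z - z0) ^ Suc 1" "Q3 z = C3 z / (z - z0) ^ Suc 2" if "z \<in> ball z0 R - {z0}" for z
    using Q[OF that] by (simp_all add: numeral_2_eq_2 numeral_3_eq_3)
  show ?thesis
    unfolding local_exponents_def
  proof (intro conjI, goal_cases)
    case 3
    show ?case
    proof (rule exI[of _ "C2 z0"], rule exI[of _ "C3 z0"], intro conjI allI)
    show "(\<lambda>z. Q2 z - C2 z0 * (z - z0) powi - 2) \<in> O[at z0](\<lambda>z. (z - z0) powi - 1)"
      using bigo_quotient[OF R(1,2) Q'(1)] by simp
    show "(\<lambda>z. Q3 z - C3 z0 * (z - z0) powi - 3) \<in> O[at z0](\<lambda>z. (z - z0) powi - 2)"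
      using bigo_quotient[OF R(1,3) Q'(2)] by simp
    show "x * (x - 1) * (x - 2) + C2 z0 * x + C3 z0 =
         (x - complex_of_real ((2 * real n1 - real n2 - real n3 + 3) / 3)) *
         (x - complex_of_real ((2 * real n2 - real n1 - real n3 + 3) / 3)) *
         (x - complex_of_real ((2 * real n3 - real n1 - real n2 + 3) / 3))" for x
      unfolding ind by (simp add: field_simps)
    qed
  qed (use n in auto)
qed

lemma local_data_apparent:
  assumes "local_data z0 n1 n2 n3"
  shows "apparent Q2 Q3 z0"
proof -
  obtain R C2 C3 where R: "0 < R" "ball z0 R \<subseteq> upper_half_plane" "C2 holomorphic_on ball z0 R" "C3 holomorphic_on ball z0 R"
    and Q: "\<And>z. z \<in> ball z0 R - {z0} \<Longrightarrow> Q2 z = C2 z / (z - z0) ^ 2 \<and> Q3 z = C3 z / (z - z0) ^ 3"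
    and app: "\<And>y. solution_on Q2 Q3 {z \<in> ball z0 R. z - z0 \<notin> \<real>\<^sub>\<le>\<^sub>0} y \<Longrightarrow>
        (\<exists>e F. F holomorphic_on ball z0 R \<and>
          (\<forall>z\<in>ball z0 R. z - z0 \<notin> \<real>\<^sub>\<le>\<^sub>0 \<longrightarrow> y z = (z - z0) powr e * F z))"
    using assms unfolding local_data_def by blast
  have o: "open (ball z0 R - {z0})" by (auto intro: open_delete)
  have hol: "(\<lambda>z. C2 z / (z - z0) ^ 2) holomorphic_on ball z0 R - {z0}"
    "(\<lambda>z. C3 z / (z - z0) ^ 3) holomorphic_on ball z0 R - {z0}"
    by (intro holomorphic_intros holomorphic_on_subset[OF R(3)] holomorphic_on_subset[OF R(4)]; auto)+
  have hQ: "Q2 holomorphic_on ball z0 R - {z0}" "Q3 holomorphic_on ball z0 R - {z0}"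
    by (rule holomorphic_transform[OF hol(1)], use Q in simp)
      (rule holomorphic_transform[OF hol(2)], use Q in simp)
  show ?thesis
    unfolding apparent_def
  proof (intro exI[of _ R] conjI R ballI allI impI)
    fix z assume "z \<in> ball z0 R - {z0}"
    then show "\<not> singular_point Q2 Q3 z"
      unfolding singular_point_def using not_is_pole_holomorphic[OF o _ hQ(1)] not_is_pole_holomorphic[OF o _ hQ(2)] by blast
  next
    fix y assume "solution_on Q2 Q3 {z \<in> ball z0 R. z - z0 \<notin> \<real>\<^sub>\<le>\<^sub>0} y"
    then obtain e F where "F holomorphic_on ball z0 R"
      "\<forall>z\<in>ball z0 R. z - z0 \<notin> \<real>\<^sub>\<le>\<^sub>0 \<longrightarrow> y z = (z - z0) powr e * F z" using app by blast
    then show "\<exists>(n::nat) l G. (\<forall>i<n. G i holomorphic_on ball z0 R) \<and>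
              (\<forall>z\<in>ball z0 R. z - z0 \<notin> \<real>\<^sub>\<le>\<^sub>0 \<longrightarrow> y z = (\<Sum>i<n. (z - z0) powr l i * G i z))"
      by (intro exI[of _ 1] exI[of _ "\<lambda>_. e"] exI[of _ "\<lambda>_. F"]) auto
  qed
qed

lemma local_data_zorder:
  assumes "local_data z0 n1 n2 n3"
  shows "is_pole Q2 z0 \<Longrightarrow> zorder Q2 z0 \<ge> - 2" "is_pole Q3 z0 \<Longrightarrow> zorder Q3 z0 \<ge> - 3"
proof -
  obtain R C2 C3 where R: "0 < R" "C2 holomorphic_on ball z0 R" "C3 holomorphic_on ball z0 R"
    and Q: "\<And>z. z \<in> ball z0 R - {z0} \<Longrightarrow> Q2 z = C2 z / (z - z0) ^ 2 \<and> Q3 z = C3 z / (z - z0) ^ 3"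
    using assms unfolding local_data_def by blast
  show "is_pole Q2 z0 \<Longrightarrow> zorder Q2 z0 \<ge> - 2" "is_pole Q3 z0 \<Longrightarrow> zorder Q3 z0 \<ge> - 3"
    using zorder_pole_ge[OF R(1,2), of Q2 2] zorder_pole_ge[OF R(1,3), of Q3 3] Q by auto
qed

lemma cond_H2: "cond_H2 Q2 Q3"
  unfolding cond_H2_def
proof (intro ballI impI)
  fix z0 assume z0: "z0 \<in> upper_half_plane"
  then have "Im z0 > 0" by simp
  then obtain n1 n2 n3 where ld: "local_data z0 n1 n2 n3" by (rule local_data_exists)
  then have n: "n1 < n2" "n2 < n3" by (auto simp: local_data_def)
  have "\<exists>\<kappa>1 \<kappa>2 \<kappa>3. local_exponents Q2 Q3 z0 \<kappa>1 \<kappa>2 \<kappa>3 \<and> \<kappa>1 < \<kappa>2 \<and> \<kappa>2 < \<kappa>3 \<and>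
           3 * \<kappa>1 \<in> \<int> \<and> \<kappa>1 \<le> 0 \<and> \<kappa>2 - \<kappa>1 \<in> \<int> \<and> \<kappa>3 - \<kappa>1 \<in> \<int>"
  proof (intro exI conjI)
    show "local_exponents Q2 Q3 z0 ((2 * real n1 - real n2 - real n3 + 3) / 3)
     ((2 * real n2 - real n1 - real n3 + 3) / 3) ((2 * real n3 - real n1 - real n2 + 3) / 3)"
      by (rule local_data_exponents[OF ld])
    have "(2 * real n2 - real n1 - real n3 + 3) / 3 - (2 * real n1 - real n2 - real n3 + 3) / 3 = real n2 - real n1"
      "(2 * real n3 - real n1 - real n2 + 3) / 3 - (2 * real n1 - real n2 - real n3 + 3) / 3 = real n3 - real n1"
      by (simp_all add: field_simps)
    then show "(2 * real n2 - real n1 - real n3 + 3) / 3 - (2 * real n1 - real n2 - real n3 + 3) / 3 \<in> \<int>"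
      "(2 * real n3 - real n1 - real n2 + 3) / 3 - (2 * real n1 - real n2 - real n3 + 3) / 3 \<in> \<int>" by auto
    have "3 * ((2 * real n1 - real n2 - real n3 + 3) / 3) = of_int (2 * int n1 - int n2 - int n3 + 3)" by simp
    then show "3 * ((2 * real n1 - real n2 - real n3 + 3) / 3) \<in> \<int>" by (metis Ints_of_int)
  qed (use n in auto)
  then show "(\<exists>\<kappa>1 \<kappa>2 \<kappa>3. local_exponents Q2 Q3 z0 \<kappa>1 \<kappa>2 \<kappa>3 \<and> \<kappa>1 < \<kappa>2 \<and> \<kappa>2 < \<kappa>3 \<and>
           3 * \<kappa>1 \<in> \<int> \<and> \<kappa>1 \<le> 0 \<and> \<kappa>2 - \<kappa>1 \<in> \<int> \<and> \<kappa>3 - \<kappa>1 \<in> \<int>) \<and> apparent Q2 Q3 z0"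
    using local_data_apparent[OF ld] by blast
qed

section \<open>Slashed equations\<close>

lemma slashed_meromorphic:
  assumes \<sigma>: "det \<sigma> = 1"
  shows "slashed_Q2 \<sigma> Q2 meromorphic_on upper_half_plane" "slashed_Q3 \<sigma> Q2 Q3 meromorphic_on upper_half_plane"
proof -
  have an: "moebius \<sigma> analytic_on upper_half_plane" "automorphy \<sigma> analytic_on upper_half_plane"
    using moebius_holomorphic[OF \<sigma>] automorphy_holomorphic upper_half_plane_open by (auto simp: analytic_on_open)
  have im: "moebius \<sigma> ` upper_half_plane \<subseteq> upper_half_plane" using Im_moebius_pos[OF \<sigma>] by auto
  have m: "(\<lambda>z. Q2 (moebius \<sigma> z)) meromorphic_on upper_half_plane" "(\<lambda>z. Q3 (moebius \<sigma> z)) meromorphic_on upper_half_plane"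
    using meromorphic_on_compose[OF Q_meromorphic(1) an(1) im] meromorphic_on_compose[OF Q_meromorphic(2) an(1) im] by auto
  show "slashed_Q2 \<sigma> Q2 meromorphic_on upper_half_plane" "slashed_Q3 \<sigma> Q2 Q3 meromorphic_on upper_half_plane"
    unfolding slashed_Q2_def [abs_def] slashed_Q3_def [abs_def]
    by (intro meromorphic_intros m analytic_on_imp_meromorphic_on[OF an(2)])+
qed

lemma slashed_analytic:
  assumes \<sigma>: "det \<sigma> = 1" and z: "Im z > 0" and an: "Q2 analytic_on {moebius \<sigma> z}" "Q3 analytic_on {moebius \<sigma> z}"
  shows "slashed_Q2 \<sigma> Q2 analytic_on {z}" "slashed_Q3 \<sigma> Q2 Q3 analytic_on {z}"
proof -
  have am: "moebius \<sigma> analytic_on {z}" "automorphy \<sigma> analytic_on {z}"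
    using moebius_holomorphic[OF \<sigma>] automorphy_holomorphic upper_half_plane_open z by (auto simp: analytic_at)
  have j0: "automorphy \<sigma> z \<noteq> 0" by (rule automorphy_nonzero[OF \<sigma> z])
  have m: "(\<lambda>z. Q2 (moebius \<sigma> z)) analytic_on {z}" "(\<lambda>z. Q3 (moebius \<sigma> z)) analytic_on {z}"
    using analytic_on_compose[OF am(1), of Q2] analytic_on_compose[OF am(1), of Q3] an by (auto simp: comp_def)
  show "slashed_Q2 \<sigma> Q2 analytic_on {z}" "slashed_Q3 \<sigma> Q2 Q3 analytic_on {z}"
    unfolding slashed_Q2_def [abs_def] slashed_Q3_def [abs_def]
    by (intro analytic_intros m am; use j0 in auto)+
qed

abbreviation "R2 \<sigma> \<equiv> remove_sings (slashed_Q2 \<sigma> Q2)"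
abbreviation "R3 \<sigma> \<equiv> remove_sings (slashed_Q3 \<sigma> Q2 Q3)"

text \<open>
  Bol's identity gives the equation with coefficients \<open>slashed_Q2\<close> and \<open>slashed_Q3\<close>, which are analytic
  over regular points and hence unchanged there by the removal of singularities.
\<close>

lemma slashed_equation_R:
  assumes \<sigma>: "det \<sigma> = 1"
  shows "slashed_equation \<sigma> Q2 Q3 (R2 \<sigma>) (R3 \<sigma>)"
  unfolding slashed_equation_def
proof (intro conjI allI impI)
  show "R2 \<sigma> nicely_meromorphic_on upper_half_plane" "R3 \<sigma> nicely_meromorphic_on upper_half_plane"
    by (intro remove_sings_nicely_meromorphic slashed_meromorphic \<sigma>)+
  fix V y assume V: "open V" "V \<subseteq> upper_half_plane" "\<forall>z\<in>V. \<not> singular_point Q2 Q3 z" and y: "solution_on Q2 Q3 V y"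
  define S where "S = {z \<in> upper_half_plane. moebius \<sigma> z \<in> V}"
  have S_eq: "S = upper_half_plane \<inter> moebius \<sigma> -` V" by (auto simp: S_def)
  have oS: "open S"
    unfolding S_eq
    by (intro continuous_open_preimage holomorphic_on_imp_continuous_on moebius_holomorphic \<sigma>
        upper_half_plane_open V)
  have "solution_on (slashed_Q2 \<sigma> Q2) (slashed_Q3 \<sigma> Q2 Q3) S (slash (- 2) \<sigma> y)"
    unfolding S_def by (rule bol[OF \<sigma> V(1) y])
  moreover have "R2 \<sigma> z = slashed_Q2 \<sigma> Q2 z" "R3 \<sigma> z = slashed_Q3 \<sigma> Q2 Q3 z" if "z \<in> S" for z
  proof -
    have z: "Im z > 0" and m: "moebius \<sigma> z \<in> V" using that by (auto simp: S_def)
    have "Q2 analytic_on {moebius \<sigma> z}" "Q3 analytic_on {moebius \<sigma> z}"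
      using Q_analytic[OF Im_moebius_pos[OF \<sigma> z]] V(3) m by auto
    from slashed_analytic[OF \<sigma> z this] show "R2 \<sigma> z = slashed_Q2 \<sigma> Q2 z" "R3 \<sigma> z = slashed_Q3 \<sigma> Q2 Q3 z"
      by (simp_all only: remove_sings_at_analytic)
  qed
  ultimately show "solution_on (R2 \<sigma>) (R3 \<sigma>) {z \<in> upper_half_plane. moebius \<sigma> z \<in> V} (slash (- 2) \<sigma> y)"
    unfolding S_def[symmetric] using solution_on_cong[OF oS refl] by blast
qed


lemma slashed_eventually:
  assumes \<sigma>: "det \<sigma> = 1" and z0: "Im z0 > 0"
  shows "\<forall>\<^sub>F z in at z0. Im z > 0 \<and> Q2 analytic_on {moebius \<sigma> z} \<and> Q3 analytic_on {moebius \<sigma> z} \<and>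
    projective_equation (h1_slash \<alpha> \<sigma> k \<phi> f0 f1 f2) (h2_slash \<alpha> \<sigma> k \<phi> f0 f1 f2)
      (form_slash \<alpha> \<sigma> k \<phi> f0 f1 f2) (slashed_Q2 \<sigma> Q2) (slashed_Q3 \<sigma> Q2 Q3) z"
proof -
  have "\<forall>\<^sub>F z in at z0. z \<in> upper_half_plane - {z0}"
    using z0 by (intro eventually_at_in_open upper_half_plane_open) simp
  moreover have "\<forall>\<^sub>F z in at z0. Q2 analytic_on {moebius \<sigma> z} \<and> Q3 analytic_on {moebius \<sigma> z} \<and>
      projective_equation w1 w2 f Q2 Q3 (moebius \<sigma> z) \<and> W (moebius \<sigma> z) \<noteq> 0"
    using eventually_compose_filterlim[OF good_eventually[OF Im_moebius_pos[OF \<sigma> z0]] moebius_at_filterlim[OF \<sigma> z0]] .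
  ultimately show ?thesis
  proof eventually_elim
    case (elim z)
    have z: "Im z > 0" using elim(1) by blast
    from elim(2) have "projective_equation w1 w2 f Q2 Q3 (moebius \<sigma> z)" by blast
    from projective_equation_slash[OF \<sigma> z f_eq_all this] z elim(2) show ?case by blast
  qed
qed

lemma slash_6_eventually:
  assumes \<sigma>: "det \<sigma> = 1" and z0: "Im z0 > 0"
  shows "\<forall>\<^sub>F z in at z0. slash 6 \<sigma> (\<lambda>z. Q3 z - 1/2 * deriv Q2 z) z
     = slashed_Q3 \<sigma> Q2 Q3 z - 1/2 * deriv (slashed_Q2 \<sigma> Q2) z"
  using slashed_eventually[OF assms]
proof eventually_elim
  case (elim z)
  then have z: "Im z > 0" and "Q2 analytic_on {moebius \<sigma> z}" by blast+
  then have "Q2 field_differentiable (at (moebius \<sigma> z))"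
    using analytic_on_imp_differentiable_at by blast
  then show ?case by (rule slash6_slashed[OF \<sigma> z])
qed

text \<open>
  For \<open>\<gamma>\<close> in \<open>\<Gamma>\<close> the slashed functions are the original ones up to the factor \<open>chi \<gamma>\<close>, so the slashed
  equation has the same solutions up to a common factor and equals the original one by uniqueness.
\<close>

lemma invariant_eventually:
  assumes g: "\<gamma> \<in> \<Gamma>" and z0: "Im z0 > 0"
  shows "\<forall>\<^sub>F z in at z0. slashed_Q2 \<gamma> Q2 z = Q2 z \<and> slashed_Q3 \<gamma> Q2 Q3 z = Q3 z"
  using slashed_eventually[OF det_\<Gamma>[OF g] z0] good_eventually[OF z0]
proof eventually_elim
  case (elim z)
  then have z: "Im z > 0" and Wz: "wronskian3 w1 w2 f z \<noteq> 0" unfolding W_form_def by blast+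
  have "projective_equation w1 w2 f (slashed_Q2 \<gamma> Q2) (slashed_Q3 \<gamma> Q2 Q3) z"
    by (rule projective_equation_scale[OF elim(1)[THEN conjunct2, THEN conjunct2, THEN conjunct2]
          upper_half_plane_open _ chi_nonzero[OF g]])
      (simp_all add: slash_\<Gamma>[OF g] z)
  with elim Wz show ?case
    using projective_equation_unique[of w1 w2 f Q2 Q3 z "slashed_Q2 \<gamma> Q2" "slashed_Q3 \<gamma> Q2 Q3"] by blast
qed

lemma slash_invariant:
  assumes g: "\<gamma> \<in> \<Gamma>" and z0: "Im z0 > 0"
  shows "\<forall>\<^sub>F z in at z0. slash 4 \<gamma> Q2 z = Q2 z"
    "\<forall>\<^sub>F z in at z0. slash 6 \<gamma> (\<lambda>z. Q3 z - 1/2 * deriv Q2 z) z = Q3 z - 1/2 * deriv Q2 z"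
proof -
  note inv = invariant_eventually[OF g z0]
  show "\<forall>\<^sub>F z in at z0. slash 4 \<gamma> Q2 z = Q2 z"
    unfolding slash_4_eq using inv by eventually_elim simp
  show "\<forall>\<^sub>F z in at z0. slash 6 \<gamma> (\<lambda>z. Q3 z - 1/2 * deriv Q2 z) z = Q3 z - 1/2 * deriv Q2 z"
    using slash_6_eventually[OF det_\<Gamma>[OF g] z0] inv eventually_at_imp_eventually_nhds[OF inv]
  proof eventually_elim
    case (elim z)
    have "\<forall>\<^sub>F w in nhds z. slashed_Q2 \<gamma> Q2 w = Q2 w" using elim(3) by eventually_elim simp
    then have "deriv (slashed_Q2 \<gamma> Q2) z = deriv Q2 z" by (intro deriv_cong_ev) auto
    with elim show ?case by simp
  qed
qed


section \<open>The equation at the cusps\<close>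

text \<open>
  The slashed components have period \<open>N\<close> only up to the root of unity \<open>\<epsilon>\<close>.  They are expanded with
  respect to the period \<open>n N\<close>, where \<open>\<epsilon> ^ n = 1\<close>, and \<open>\<epsilon>\<close> becomes a multiplier for a rotation.
\<close>

lemma cusp_expansion:
  assumes \<sigma>: "\<sigma> \<in> SL2Z"
  defines "N \<equiv> cusp_width \<Gamma> \<sigma>"
  obtains n \<epsilon> \<rho> F X C where "n > 0" "\<epsilon> \<noteq> 0" "\<rho> > 0"
    "F holomorphic_on ball 0 \<rho>" "X holomorphic_on ball 0 \<rho>" "C holomorphic_on ball 0 \<rho>"
    "\<And>z. nome (real n * N) z \<in> ball 0 \<rho> \<Longrightarrow> Im z > 0"
    "\<And>z. nome (real n * N) z \<in> ball 0 \<rho> \<Longrightarrow> form_slash \<alpha> \<sigma> k \<phi> f0 f1 f2 z = F (nome (real n * N) z)"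
    "\<And>z. nome (real n * N) z \<in> ball 0 \<rho> \<Longrightarrow> h2_slash \<alpha> \<sigma> k \<phi> f0 f1 f2 z =
       2 * z * F (nome (real n * N) z) + X (nome (real n * N) z)"
    "\<And>z. nome (real n * N) z \<in> ball 0 \<rho> \<Longrightarrow> h1_slash \<alpha> \<sigma> k \<phi> f0 f1 f2 z =
       z ^ 2 * F (nome (real n * N) z) + z * X (nome (real n * N) z) + C (nome (real n * N) z)"
    "\<And>q. q \<in> ball 0 \<rho> - {0} \<Longrightarrow> F (nome (real n * N) (of_real N) * q) = \<epsilon> * F q"
    "\<And>q. q \<in> ball 0 \<rho> - {0} \<Longrightarrow> X (nome (real n * N) (of_real N) * q) = \<epsilon> * X q"
    "\<And>q. q \<in> ball 0 \<rho> - {0} \<Longrightarrow> C (nome (real n * N) (of_real N) * q) = \<epsilon> * C q"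
proof -
  have d: "det \<sigma> = 1" using \<sigma> by (simp add: SL2Z_def)
  have N: "N > 0" unfolding N_def by (rule cusp_width_in[OF \<sigma>])
  define p0 p1 p2 p where "p0 = slash k \<sigma> f0" and "p1 = slash (k - 2) \<sigma> f1"
    and "p2 = slash (k - 4) \<sigma> f2" and "p = phi_slash \<alpha> \<sigma> \<phi>"
  obtain \<epsilon> n where \<epsilon>: "\<epsilon> ^ n = 1" "n > 0"
    and per: "\<And>z. Im z > 0 \<Longrightarrow> p0 (z + of_real N) = \<epsilon> * p0 z" "\<And>z. Im z > 0 \<Longrightarrow> p1 (z + of_real N) = \<epsilon> * p1 z"
      "\<And>z. Im z > 0 \<Longrightarrow> p2 (z + of_real N) = \<epsilon> * p2 z" "\<And>z. Im z > 0 \<Longrightarrow> p (z + of_real N) = p z"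
    using slash_period_width[OF \<sigma>] unfolding p0_def p1_def p2_def p_def N_def by blast
  have \<epsilon>0: "\<epsilon> \<noteq> 0" using \<epsilon> by (metis power_0_left zero_neq_one less_irrefl)
  define M where "M = real n * N"
  have M: "M > 0" using N \<epsilon>(2) by (simp add: M_def)
  have iter: "F (z + of_nat j * of_real N) = e ^ j * F z"
    if "\<And>z. Im z > 0 \<Longrightarrow> F (z + of_real N) = e * F z" "Im z > 0"
    for F :: "complex \<Rightarrow> complex" and e z j
    using that(2)
  proof (induction j)
    case (Suc j)
    have "F (z + of_nat j * of_real N + of_real N) = e * F (z + of_nat j * of_real N)"
      by (rule that(1)) (use Suc.prems in simp)
    then show ?case using Suc by (simp add: add.commute add.left_commute distrib_right mult.assoc)
  qed simp
  have perM: "p0 (z + of_real M) = p0 z" "p1 (z + of_real M) = p1 z" "p2 (z + of_real M) = p2 z"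
    "p (z + of_real M) = p z" if z: "Im z > 0" for z
    using iter[of p0 \<epsilon>, OF per(1) z, of n] iter[of p1 \<epsilon>, OF per(2) z, of n] iter[of p2 \<epsilon>, OF per(3) z, of n]
      iter[of p 1, OF _ z, of n] per(4) \<epsilon>(1) by (simp_all add: M_def)
  have hol: "p0 holomorphic_on upper_half_plane" "p1 holomorphic_on upper_half_plane"
    "p2 holomorphic_on upper_half_plane"
    unfolding p0_def p1_def p2_def
    by (rule slash_holomorphic[OF d holomorphic(2)] slash_holomorphic[OF d holomorphic(3)]
        slash_holomorphic[OF d holomorphic(4)])+
  have holp: "p holomorphic_on upper_half_plane"
    unfolding p_def phi_slash_def [abs_def]
    by (intro holomorphic_intros slash_holomorphic d holomorphic automorphy_holomorphic)
      (use automorphy_nonzero[OF d] in auto)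
  have ex: "\<exists>N>0. holomorphic_at_infty N p0" "\<exists>N>0. holomorphic_at_infty N p1" "\<exists>N>0. holomorphic_at_infty N p2"
    "\<exists>N>0. holomorphic_at_infty N p"
    using forms(1) forms(2) forms(3) wt2 \<sigma>
    unfolding modular_forms_def quasimodular_weight2_def p0_def p1_def p2_def p_def phi_slash_def [abs_def]
    by simp_all
  obtain R0 P0 where 0: "R0 > 0" "P0 holomorphic_on ball 0 R0"
    "\<And>z. nome M z \<in> ball 0 R0 \<Longrightarrow> Im z > 0 \<and> p0 z = P0 (nome M z)"
    using holomorphic_at_inftyE[OF M holomorphic_at_infty_change_period[OF M hol(1) perM(1) ex(1)]] by blast
  obtain R1 P1 where 1: "R1 > 0" "P1 holomorphic_on ball 0 R1"
    "\<And>z. nome M z \<in> ball 0 R1 \<Longrightarrow> Im z > 0 \<and> p1 z = P1 (nome M z)"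
    using holomorphic_at_inftyE[OF M holomorphic_at_infty_change_period[OF M hol(2) perM(2) ex(2)]] by blast
  obtain R2 P2 where 2: "R2 > 0" "P2 holomorphic_on ball 0 R2"
    "\<And>z. nome M z \<in> ball 0 R2 \<Longrightarrow> Im z > 0 \<and> p2 z = P2 (nome M z)"
    using holomorphic_at_inftyE[OF M holomorphic_at_infty_change_period[OF M hol(3) perM(3) ex(3)]] by blast
  obtain R3 P where 3: "R3 > 0" "P holomorphic_on ball 0 R3"
    "\<And>z. nome M z \<in> ball 0 R3 \<Longrightarrow> Im z > 0 \<and> p z = P (nome M z)"
    using holomorphic_at_inftyE[OF M holomorphic_at_infty_change_period[OF M holp perM(4) ex(4)]] by blast
  define \<rho> where "\<rho> = min (min R0 R1) (min R2 R3)"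
  have \<rho>: "\<rho> > 0" using 0 1 2 3 by (simp add: \<rho>_def)
  have sub: "ball 0 \<rho> \<subseteq> ball (0::complex) R0" "ball 0 \<rho> \<subseteq> ball (0::complex) R1"
    "ball 0 \<rho> \<subseteq> ball (0::complex) R2" "ball 0 \<rho> \<subseteq> ball (0::complex) R3"
    by (auto simp: \<rho>_def)
  have h: "P0 holomorphic_on ball 0 \<rho>" "P1 holomorphic_on ball 0 \<rho>" "P2 holomorphic_on ball 0 \<rho>" "P holomorphic_on ball 0 \<rho>"
    using 0(2) 1(2) 2(2) 3(2) sub holomorphic_on_subset by blast+
  have im: "Im z > 0" if "nome M z \<in> ball 0 \<rho>" for z using 0(3) sub that by blast
  have eq: "p0 z = P0 (nome M z)" "p1 z = P1 (nome M z)" "p2 z = P2 (nome M z)" "p z = P (nome M z)"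
    if "nome M z \<in> ball 0 \<rho>" for z using 0(3) 1(3) 2(3) 3(3) sub that by blast+
  have rot: "P0 (nome M (of_real N) * q) = \<epsilon> * P0 q \<and> P1 (nome M (of_real N) * q) = \<epsilon> * P1 q
      \<and> P2 (nome M (of_real N) * q) = \<epsilon> * P2 q \<and> P (nome M (of_real N) * q) = P q"
    if q: "q \<in> ball 0 \<rho> - {0}" for q
  proof -
    obtain z where z: "nome M z = q" using nome_surj[OF M, of q] q by blast
    have n1: "nome M z \<in> ball 0 \<rho>" using q z by blast
    have n2: "nome M (z + of_real N) \<in> ball 0 \<rho>" using n1 by (simp add: norm_nome dist_norm)
    have e: "nome M (of_real N) * nome M z = nome M (z + of_real N)" by (simp add: nome_add mult.commute)
    show ?thesis
      unfolding z[symmetric] e eq[OF n1, symmetric] eq[OF n2, symmetric] using per[OF im[OF n1]] by simp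
  qed
  define F X C where "F = (\<lambda>q. P0 q + P1 q * P q + P2 q * P q ^ 2)"
    and "X = (\<lambda>q. \<alpha> * (P1 q + 2 * P2 q * P q))" and "C = (\<lambda>q. \<alpha> ^ 2 * P2 q)"
  show ?thesis
  proof (rule that[OF \<epsilon>(2) \<epsilon>0 \<rho>, of F X C, folded M_def])
    show "F holomorphic_on ball 0 \<rho>" "X holomorphic_on ball 0 \<rho>" "C holomorphic_on ball 0 \<rho>"
      unfolding F_def X_def C_def by (intro holomorphic_intros h)+
    fix z assume n: "nome M z \<in> ball 0 \<rho>"
    show "Im z > 0" by (rule im[OF n])
    have F: "form_slash \<alpha> \<sigma> k \<phi> f0 f1 f2 z = F (nome M z)"
      unfolding form_slash_def F_def using eq[OF n] unfolding p0_def p1_def p2_def p_def by simp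
    then show "form_slash \<alpha> \<sigma> k \<phi> f0 f1 f2 z = F (nome M z)" .
    show "h2_slash \<alpha> \<sigma> k \<phi> f0 f1 f2 z = 2 * z * F (nome M z) + X (nome M z)"
      unfolding h2_slash_def h2_def F X_def using eq[OF n] unfolding p0_def p1_def p2_def p_def by simp
    show "h1_slash \<alpha> \<sigma> k \<phi> f0 f1 f2 z = z ^ 2 * F (nome M z) + z * X (nome M z) + C (nome M z)"
      unfolding h1_slash_def h1_def F X_def C_def using eq[OF n] unfolding p0_def p1_def p2_def p_def
      by (simp add: algebra_simps)
  next
    fix q :: complex assume q: "q \<in> ball 0 \<rho> - {0}"
    show "F (nome M (of_real N) * q) = \<epsilon> * F q" "X (nome M (of_real N) * q) = \<epsilon> * X q"
      "C (nome M (of_real N) * q) = \<epsilon> * C q"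
      unfolding F_def X_def C_def using rot[OF q] by (simp_all add: algebra_simps)
  qed
qed

text \<open>
  The slashed equation and the one found by \<open>cusp_structure\<close> have the same solutions up to a common
  factor, so they agree by uniqueness.
\<close>

lemma cusp_coefficients:
  assumes \<sigma>: "\<sigma> \<in> SL2Z"
  defines "N \<equiv> cusp_width \<Gamma> \<sigma>"
  obtains M R A2 A3 and a b :: int where "M > 0" "R > 0" "A2 holomorphic_on ball 0 R" "A3 holomorphic_on ball 0 R"
    "\<And>z. nome M z \<in> ball 0 R \<Longrightarrow> Im z > 0"
    "\<And>z. nome M z \<in> ball 0 R \<Longrightarrow> \<forall>\<^sub>F w in at z. slashed_Q2 \<sigma> Q2 w = A2 (nome M w) \<and> slashed_Q3 \<sigma> Q2 Q3 w = A3 (nome M w)"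
    "\<And>q. q \<in> ball 0 R - {0} \<Longrightarrow> A2 (nome M (of_real N) * q) = A2 q"
    "\<And>q. q \<in> ball 0 R - {0} \<Longrightarrow> A3 (nome M (of_real N) * q) = A3 q"
    "\<And>x::complex. x ^ 3 + (of_real N / (2 * of_real pi * \<i>)) ^ 2 * A2 0 * x + (of_real N / (2 * of_real pi * \<i>)) ^ 3 * A3 0
       = (x + (2 * of_int a + of_int b) / 3) * (x - (of_int a - of_int b) / 3) * (x - (of_int a + 2 * of_int b) / 3)"
proof -
  have d: "det \<sigma> = 1" using \<sigma> by (simp add: SL2Z_def)
  have N: "N > 0" unfolding N_def by (rule cusp_width_in[OF \<sigma>])
  note ce = cusp_expansion[OF \<sigma>, folded N_def]
  obtain n \<epsilon> \<rho> F X C where n: "n > 0" and \<epsilon>: "\<epsilon> \<noteq> 0" and \<rho>: "\<rho> > 0"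
    and hol: "F holomorphic_on ball 0 \<rho>" "X holomorphic_on ball 0 \<rho>" "C holomorphic_on ball 0 \<rho>"
    and im: "\<And>z. nome (real n * N) z \<in> ball 0 \<rho> \<Longrightarrow> Im z > 0"
    and u: "\<And>z. nome (real n * N) z \<in> ball 0 \<rho> \<Longrightarrow> form_slash \<alpha> \<sigma> k \<phi> f0 f1 f2 z = F (nome (real n * N) z)"
    "\<And>z. nome (real n * N) z \<in> ball 0 \<rho> \<Longrightarrow> h2_slash \<alpha> \<sigma> k \<phi> f0 f1 f2 z =
       2 * z * F (nome (real n * N) z) + X (nome (real n * N) z)"
    "\<And>z. nome (real n * N) z \<in> ball 0 \<rho> \<Longrightarrow> h1_slash \<alpha> \<sigma> k \<phi> f0 f1 f2 z =
       z ^ 2 * F (nome (real n * N) z) + z * X (nome (real n * N) z) + C (nome (real n * N) z)"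
    and rot: "\<And>q. q \<in> ball 0 \<rho> - {0} \<Longrightarrow> F (nome (real n * N) (of_real N) * q) = \<epsilon> * F q"
    "\<And>q. q \<in> ball 0 \<rho> - {0} \<Longrightarrow> X (nome (real n * N) (of_real N) * q) = \<epsilon> * X q"
    "\<And>q. q \<in> ball 0 \<rho> - {0} \<Longrightarrow> C (nome (real n * N) (of_real N) * q) = \<epsilon> * C q"
    by (rule ce) blast
  define M where "M = real n * N"
  have M: "M > 0" using N n by (simp add: M_def)
  note u = u[folded M_def] and im = im[folded M_def] and rot = rot[folded M_def]
  have freq: "\<exists>\<^sub>F q in at 0. F q \<noteq> 0"
  proof (rule nonzero_frequently[OF holomorphic_on_subset[OF hol(1)] _ \<rho>])
    fix r assume r: "0 < r" "r \<le> \<rho>"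
    define U where "U = nome M -` ball 0 r"
    have U: "open U" unfolding U_def
      by (intro open_vimage open_ball holomorphic_on_imp_continuous_on nome_holomorphic)
    have sub: "ball (0::complex) r \<subseteq> ball 0 \<rho>" using r by auto
    have "of_real (r / 2) \<noteq> (0::complex)" using r by simp
    then obtain z where z: "nome M z = of_real (r / 2)" using nome_surj[OF M] by blast
    have "norm (nome M z) = r / 2" unfolding z norm_of_real using r by simp
    then have "z \<in> U" using r unfolding U_def by simp
    then have "U \<noteq> {}" by blast
    moreover have "U \<subseteq> upper_half_plane" using im sub unfolding U_def by blast
    ultimately obtain z where z: "z \<in> U" "form_slash \<alpha> \<sigma> k \<phi> f0 f1 f2 z \<noteq> 0"
      using form_slash_nonzero[OF d U] by blast
    then have "nome M z \<in> ball 0 r" unfolding U_def by blast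
    moreover from this have "F (nome M z) \<noteq> 0" using u(1)[of z] z(2) sub by auto
    ultimately show "\<exists>q\<in>ball 0 r - {0}. F q \<noteq> 0" by (intro bexI[of _ "nome M z"]) auto
  qed auto
  have \<zeta>: "norm (nome M (of_real N)) = 1" by (simp add: norm_nome)
  show ?thesis
  proof (rule cusp_structure[where F = F and X = X and C = C and \<zeta> = "nome M (of_real N)" and \<epsilon> = \<epsilon>
        and ?u1.0 = "h1_slash \<alpha> \<sigma> k \<phi> f0 f1 f2" and ?u2.0 = "h2_slash \<alpha> \<sigma> k \<phi> f0 f1 f2"
        and ?u3.0 = "form_slash \<alpha> \<sigma> k \<phi> f0 f1 f2", OF M \<rho> hol freq u \<zeta> \<epsilon> rot])
  fix R A2 A3 and m l :: int
  assume R: "0 < R" "R \<le> \<rho>" "A2 holomorphic_on ball 0 R" "A3 holomorphic_on ball 0 R"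
    and pr: "\<And>z. nome M z \<in> ball 0 R \<Longrightarrow> wronskian3 (h1_slash \<alpha> \<sigma> k \<phi> f0 f1 f2) (h2_slash \<alpha> \<sigma> k \<phi> f0 f1 f2) (form_slash \<alpha> \<sigma> k \<phi> f0 f1 f2) z \<noteq> 0 \<and>
       projective_equation (h1_slash \<alpha> \<sigma> k \<phi> f0 f1 f2) (h2_slash \<alpha> \<sigma> k \<phi> f0 f1 f2) (form_slash \<alpha> \<sigma> k \<phi> f0 f1 f2) (\<lambda>z. A2 (nome M z)) (\<lambda>z. A3 (nome M z)) z"
    and inv: "\<And>q. q \<in> ball 0 R - {0} \<Longrightarrow> A2 (nome M (of_real N) * q) = A2 q" "\<And>q. q \<in> ball 0 R - {0} \<Longrightarrow> A3 (nome M (of_real N) * q) = A3 q"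
    and ind: "\<And>t x::complex. x ^ 3 + (t / (2 * of_real pi * \<i> / of_real M)) ^ 2 * A2 0 * x + (t / (2 * of_real pi * \<i> / of_real M)) ^ 3 * A3 0
       = (x + t * (2 * of_int m + of_int l) / 3) * (x - t * (of_int m - of_int l) / 3)
          * (x - t * (of_int m + 2 * of_int l) / 3)"
    and ml: "nome M (of_real N) powi m = 1" "nome M (of_real N) powi l = 1"
  have imR: "Im z > 0" if "nome M z \<in> ball 0 R" for z
    using im[OF subsetD[OF subset_ball[OF R(2)] that]] .
  have ev: "\<forall>\<^sub>F w in at z. slashed_Q2 \<sigma> Q2 w = A2 (nome M w) \<and> slashed_Q3 \<sigma> Q2 Q3 w = A3 (nome M w)"
    if z: "nome M z \<in> ball 0 R" for z
  proof -
    have "\<forall>\<^sub>F w in at z. nome M w \<in> ball 0 R"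
      by (rule eventually_nhds_conv_at[THEN iffD1, THEN conjunct1, OF nome_eventually_in_ball[OF z]])
    with slashed_eventually[OF d imR[OF z]] show ?thesis
    proof eventually_elim
      case (elim w)
      from elim(1) have "projective_equation (h1_slash \<alpha> \<sigma> k \<phi> f0 f1 f2) (h2_slash \<alpha> \<sigma> k \<phi> f0 f1 f2)
        (form_slash \<alpha> \<sigma> k \<phi> f0 f1 f2) (slashed_Q2 \<sigma> Q2) (slashed_Q3 \<sigma> Q2 Q3) w" by blast
      from projective_equation_unique[OF conjunct2[OF pr[OF elim(2)]] this conjunct1[OF pr[OF elim(2)]]]
      show ?case by simp
    qed
  qed
  obtain a :: int where a: "m = int n * a"
    using nome_power_one_imp_multiple[OF n N ml(1)[unfolded M_def]] by (rule exE)
  obtain b :: int where b: "l = int n * b"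
    using nome_power_one_imp_multiple[OF n N ml(2)[unfolded M_def]] by (rule exE)
  note ab = a b
  have n0: "(of_nat n :: complex) \<noteq> 0" "complex_of_real N \<noteq> 0" using n N by simp_all
  have ind': "x ^ 3 + (of_real N / (2 * of_real pi * \<i>)) ^ 2 * A2 0 * x + (of_real N / (2 * of_real pi * \<i>)) ^ 3 * A3 0
       = (x + (2 * of_int a + of_int b) / 3) * (x - (of_int a - of_int b) / 3) * (x - (of_int a + 2 * of_int b) / 3)" for x
  proof -
    have t: "1 / of_nat n / (2 * of_real pi * \<i> / of_real M) = of_real N / (2 * of_real pi * \<i>)"
      using n0 by (simp add: M_def field_simps)
    have r: "1 / of_nat n * (2 * of_int m + of_int l) = (2 * of_int a + of_int b :: complex)"
      "1 / of_nat n * (of_int m - of_int l) = (of_int a - of_int b :: complex)"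
      "1 / of_nat n * (of_int m + 2 * of_int l) = (of_int a + 2 * of_int b :: complex)"
      using n0 by (simp_all add: ab field_simps)
    show ?thesis using ind[of x "1 / of_nat n"] unfolding t r .
  qed
  show thesis by (rule that[OF M R(1,3,4) imR ev inv ind'])
  qed
qed


section \<open>Modularity and the conditions at the cusps\<close>

lemma meromorphic_modular_Q2: "meromorphic_modular_form \<Gamma> 4 Q2"
  unfolding meromorphic_modular_form_def
proof (intro conjI ballI)
  show "Q2 meromorphic_on upper_half_plane" by (rule Q_meromorphic)
  show "\<forall>\<^sub>\<approx>z\<in>upper_half_plane. slash 4 \<gamma> Q2 z = Q2 z" if "\<gamma> \<in> \<Gamma>" for \<gamma>
    unfolding eventually_cosparse_open_eq[OF upper_half_plane_open] using slash_invariant(1)[OF that] by simp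
  fix \<sigma> assume "\<sigma> \<in> SL2Z"
  then obtain M R A2 A3 a b where M: "M > 0" "R > 0" "A2 holomorphic_on ball 0 R"
    and ev: "\<And>z. nome M z \<in> ball 0 R \<Longrightarrow> \<forall>\<^sub>F w in at z. slashed_Q2 \<sigma> Q2 w = A2 (nome M w) \<and> slashed_Q3 \<sigma> Q2 Q3 w = A3 (nome M w)"
    by (rule cusp_coefficients) blast
  have "meromorphic_at_infty M (slash 4 \<sigma> Q2)"
    unfolding slash_4_eq
    by (rule nome_comp_meromorphic_at_infty[OF M]) (rule eventually_mono[OF ev conjunct1])
  then show "\<exists>N>0. meromorphic_at_infty N (slash 4 \<sigma> Q2)" using M(1) by blast
qed

lemma meromorphic_modular_Q3: "meromorphic_modular_form \<Gamma> 6 (\<lambda>z. Q3 z - 1/2 * deriv Q2 z)"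
  unfolding meromorphic_modular_form_def
proof (intro conjI ballI)
  show "(\<lambda>z. Q3 z - 1/2 * deriv Q2 z) meromorphic_on upper_half_plane"
    by (intro meromorphic_intros Q_meromorphic)
  show "\<forall>\<^sub>\<approx>z\<in>upper_half_plane. slash 6 \<gamma> (\<lambda>z. Q3 z - 1/2 * deriv Q2 z) z = Q3 z - 1/2 * deriv Q2 z"
    if "\<gamma> \<in> \<Gamma>" for \<gamma>
    unfolding eventually_cosparse_open_eq[OF upper_half_plane_open] using slash_invariant(2)[OF that] by simp
  fix \<sigma> assume \<sigma>: "\<sigma> \<in> SL2Z"
  then have d: "det \<sigma> = 1" by (simp add: SL2Z_def)
  obtain M R A2 A3 a b where M: "M > 0" "R > 0" and A: "A2 holomorphic_on ball 0 R" "A3 holomorphic_on ball 0 R"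
    and im: "\<And>z. nome M z \<in> ball 0 R \<Longrightarrow> Im z > 0"
    and ev: "\<And>z. nome M z \<in> ball 0 R \<Longrightarrow> \<forall>\<^sub>F w in at z. slashed_Q2 \<sigma> Q2 w = A2 (nome M w) \<and> slashed_Q3 \<sigma> Q2 Q3 w = A3 (nome M w)"
    using \<sigma> by (rule cusp_coefficients) blast
  \<comment> \<open>the last factor comes from the derivative of \<open>nome M\<close>\<close>
  define B where "B q = A3 q - 1/2 * (deriv A2 q * (2 * of_real pi * \<i> / of_real M * q))" for q
  have "meromorphic_at_infty M (slash 6 \<sigma> (\<lambda>z. Q3 z - 1/2 * deriv Q2 z))"
  proof (rule nome_comp_meromorphic_at_infty[OF M])
    show "B holomorphic_on ball 0 R"
      unfolding B_def using M by (intro holomorphic_intros A holomorphic_deriv open_ball) auto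
    fix z assume z: "nome M z \<in> ball 0 R"
    have "\<forall>\<^sub>F w in at z. nome M w \<in> ball 0 R"
      by (rule eventually_nhds_conv_at[THEN iffD1, THEN conjunct1, OF nome_eventually_in_ball[OF z]])
    with eventually_at_imp_eventually_nhds[OF ev[OF z]] ev[OF z] slash_6_eventually[OF d im[OF z]]
    show "\<forall>\<^sub>F w in at z. slash 6 \<sigma> (\<lambda>z. Q3 z - 1/2 * deriv Q2 z) w = B (nome M w)"
    proof eventually_elim
      case (elim w)
      have "\<forall>\<^sub>F v in nhds w. slashed_Q2 \<sigma> Q2 v = A2 (nome M v)" by (rule eventually_mono[OF elim(1) conjunct1])
      then have "deriv (slashed_Q2 \<sigma> Q2) w = deriv (\<lambda>v. A2 (nome M v)) w" by (intro deriv_cong_ev) auto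
      also have "\<dots> = deriv A2 (nome M w) * (2 * of_real pi * \<i> / of_real M * nome M w)"
        by (intro DERIV_imp_deriv DERIV_chain2[OF _ nome_deriv] holomorphic_derivI[OF A(1) open_ball elim(4)])
      finally show ?case using elim(2,3) by (simp only: B_def)
    qed
  qed
  then show "\<exists>N>0. meromorphic_at_infty N (slash 6 \<sigma> (\<lambda>z. Q3 z - 1/2 * deriv Q2 z))" using M(1) by blast
qed

lemma cusp_equation:
  assumes \<sigma>: "\<sigma> \<in> SL2Z"
  defines "N \<equiv> cusp_width \<Gamma> \<sigma>"
  shows "holomorphic_at_infty N (R2 \<sigma>)" "holomorphic_at_infty N (R3 \<sigma>)"
    "\<exists>\<kappa>1 \<kappa>2 \<kappa>3. exponents_at_infty N (R2 \<sigma>) (R3 \<sigma>) \<kappa>1 \<kappa>2 \<kappa>3 \<and>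
        3 * \<kappa>1 \<in> \<int> \<and> \<kappa>1 \<le> 0 \<and> \<kappa>2 - \<kappa>1 \<in> \<int> \<and> \<kappa>3 - \<kappa>1 \<in> \<int>"
proof -
  have N: "N > 0" unfolding N_def by (rule cusp_width_in[OF \<sigma>])
  note cc = cusp_coefficients[OF \<sigma>, folded N_def]
  obtain M R A2 A3 and a b :: int where M: "M > 0" "R > 0" and A: "A2 holomorphic_on ball 0 R" "A3 holomorphic_on ball 0 R"
    and ev: "\<And>z. nome M z \<in> ball 0 R \<Longrightarrow> \<forall>\<^sub>F w in at z. slashed_Q2 \<sigma> Q2 w = A2 (nome M w) \<and> slashed_Q3 \<sigma> Q2 Q3 w = A3 (nome M w)"
    and inv: "\<And>q. q \<in> ball 0 R - {0} \<Longrightarrow> A2 (nome M (of_real N) * q) = A2 q"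
    "\<And>q. q \<in> ball 0 R - {0} \<Longrightarrow> A3 (nome M (of_real N) * q) = A3 q"
    and ind: "\<And>x::complex. x ^ 3 + (of_real N / (2 * of_real pi * \<i>)) ^ 2 * A2 0 * x + (of_real N / (2 * of_real pi * \<i>)) ^ 3 * A3 0
       = (x + (2 * of_int a + of_int b) / 3) * (x - (of_int a - of_int b) / 3) * (x - (of_int a + 2 * of_int b) / 3)"
    by (rule cc) blast
  have R2: "R2 \<sigma> z = A2 (nome M z)" if z: "nome M z \<in> ball 0 R" for z
  proof -
    have "\<forall>\<^sub>F w in at z. slashed_Q2 \<sigma> Q2 w = A2 (nome M w)" using ev[OF z] by eventually_elim blast
    then have "R2 \<sigma> z = remove_sings (\<lambda>w. A2 (nome M w)) z" by (intro remove_sings_cong refl)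
    also have "\<dots> = A2 (nome M z)" by (rule remove_sings_at_analytic[OF nome_comp_analytic[OF A(1) z]])
    finally show ?thesis .
  qed
  have R3: "R3 \<sigma> z = A3 (nome M z)" if z: "nome M z \<in> ball 0 R" for z
  proof -
    have "\<forall>\<^sub>F w in at z. slashed_Q3 \<sigma> Q2 Q3 w = A3 (nome M w)" using ev[OF z] by eventually_elim blast
    then have "R3 \<sigma> z = remove_sings (\<lambda>w. A3 (nome M w)) z" by (intro remove_sings_cong refl)
    also have "\<dots> = A3 (nome M z)" by (rule remove_sings_at_analytic[OF nome_comp_analytic[OF A(2) z]])
    finally show ?thesis .
  qed
  show "holomorphic_at_infty N (R2 \<sigma>)"
    by (rule holomorphic_at_infty_width[OF M(1) N M(2) A(1) inv(1) R2])
  show "holomorphic_at_infty N (R3 \<sigma>)"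
    by (rule holomorphic_at_infty_width[OF M(1) N M(2) A(2) inv(2) R3])
  have lim: "(R2 \<sigma> \<longlongrightarrow> A2 0) (filtercomap Im at_top)" "(R3 \<sigma> \<longlongrightarrow> A3 0) (filtercomap Im at_top)"
    by (rule nome_comp_tendsto[OF M A(1) R2], assumption) (rule nome_comp_tendsto[OF M A(2) R3], assumption)
  \<comment> \<open>the three exponents differ by integers and add up to zero, so that the least of them is at most zero\<close>
  define P where "P x y z \<longleftrightarrow> x + y + z = 0 \<and> 3 * x \<in> \<int> \<and> y - x \<in> \<int> \<and> z - x \<in> \<int> \<and>
    (\<forall>t::complex. t ^ 3 + (of_real N / (2 * of_real pi * \<i>)) ^ 2 * A2 0 * t + (of_real N / (2 * of_real pi * \<i>)) ^ 3 * A3 0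
       = (t - of_real x) * (t - of_real y) * (t - of_real z))" for x y z :: real
  have "\<exists>x y z. P x y z \<and> x \<le> y \<and> y \<le> z"
  proof (rule sort3)
    have d: "real_of_int (a - b) / 3 - - real_of_int (2 * a + b) / 3 = of_int a"
      "real_of_int (a + 2 * b) / 3 - - real_of_int (2 * a + b) / 3 = of_int (a + b)" by (simp_all add: field_simps)
    have i: "3 * (- real_of_int (2 * a + b) / 3) = of_int (- (2 * a + b))" by simp
    have s: "- real_of_int (2 * a + b) / 3 + real_of_int (a - b) / 3 + real_of_int (a + 2 * b) / 3 = 0"
      by (simp add: field_simps)
    have c: "complex_of_real (- real_of_int (2 * a + b) / 3) = - ((2 * of_int a + of_int b) / 3)"
      "complex_of_real (real_of_int (a - b) / 3) = (of_int a - of_int b) / 3"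
      "complex_of_real (real_of_int (a + 2 * b) / 3) = (of_int a + 2 * of_int b) / 3"
      by (simp_all add: field_simps)
    show "P (- real_of_int (2 * a + b) / 3) (real_of_int (a - b) / 3) (real_of_int (a + 2 * b) / 3)"
      unfolding P_def d i s ind c by simp
    fix x y z assume P: "P x y z"
    have xy: "y - x \<in> \<int>" "z - x \<in> \<int>" "3 * x \<in> \<int>" using P by (auto simp: P_def)
    have "3 * (y - x) + 3 * x \<in> \<int>" "- (y - x) \<in> \<int>" "(z - x) - (y - x) \<in> \<int>"
      by (rule Ints_add Ints_mult Ints_diff Ints_minus xy Ints_numeral)+
    then have "3 * y \<in> \<int>" "x - y \<in> \<int>" "z - y \<in> \<int>" by simp_all
    moreover have "(t - of_real x) * (t - of_real y) * (t - of_real z) = (t - of_real y) * (t - of_real x) * (t - of_real z)"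
      "(t - of_real x) * (t - of_real y) * (t - of_real z) = (t - of_real x) * (t - of_real z) * (t - of_real y)" for t :: complex
      by (simp_all only: mult_ac)
    ultimately show "P y x z" "P x z y" using P unfolding P_def by (simp_all add: add_ac)
  qed
  then obtain x y z where P: "P x y z" and le: "x \<le> y" "y \<le> z" by blast
  have "x \<le> 0" using P le by (simp add: P_def)
  moreover have "exponents_at_infty N (R2 \<sigma>) (R3 \<sigma>) x y z"
    unfolding exponents_at_infty_def using le P lim unfolding P_def by blast
  ultimately show "\<exists>\<kappa>1 \<kappa>2 \<kappa>3. exponents_at_infty N (R2 \<sigma>) (R3 \<sigma>) \<kappa>1 \<kappa>2 \<kappa>3 \<and>
        3 * \<kappa>1 \<in> \<int> \<and> \<kappa>1 \<le> 0 \<and> \<kappa>2 - \<kappa>1 \<in> \<int> \<and> \<kappa>3 - \<kappa>1 \<in> \<int>"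
    using P unfolding P_def by blast
qed

lemma cond_H1: "cond_H1 \<Gamma> Q2 Q3"
  unfolding cond_H1_def
proof (intro conjI ballI Q_meromorphic)
  fix z assume "z \<in> upper_half_plane"
  then have "Im z > 0" by simp
  then obtain n1 n2 n3 where ld: "local_data z n1 n2 n3" by (rule local_data_exists)
  show "is_pole Q2 z \<longrightarrow> zorder Q2 z \<ge> - 2" "is_pole Q3 z \<longrightarrow> zorder Q3 z \<ge> - 3"
    using local_data_zorder[OF ld] by blast+
next
  fix \<sigma> assume \<sigma>: "\<sigma> \<in> SL2Z"
  then have "det \<sigma> = 1" by (simp add: SL2Z_def)
  then show "\<exists>R2 R3. slashed_equation \<sigma> Q2 Q3 R2 R3 \<and>
        holomorphic_at_infty (cusp_width \<Gamma> \<sigma>) R2 \<and> holomorphic_at_infty (cusp_width \<Gamma> \<sigma>) R3"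
    using slashed_equation_R cusp_equation(1,2)[OF \<sigma>] by blast
qed

lemma cond_H3: "cond_H3 \<Gamma> Q2 Q3"
  unfolding cond_H3_def
proof
  fix \<sigma> assume \<sigma>: "\<sigma> \<in> SL2Z"
  then have "det \<sigma> = 1" by (simp add: SL2Z_def)
  then show "\<exists>R2 R3 \<kappa>1 \<kappa>2 \<kappa>3. slashed_equation \<sigma> Q2 Q3 R2 R3 \<and>
        exponents_at_infty (cusp_width \<Gamma> \<sigma>) R2 R3 \<kappa>1 \<kappa>2 \<kappa>3 \<and>
        3 * \<kappa>1 \<in> \<int> \<and> \<kappa>1 \<le> 0 \<and> \<kappa>2 - \<kappa>1 \<in> \<int> \<and> \<kappa>3 - \<kappa>1 \<in> \<int>"
    using slashed_equation_R cusp_equation(3)[OF \<sigma>] by blast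
qed

end

section \<open>Elliptic points of the full modular group\<close>

text \<open>
  Comparison of the leading coefficients at \<open>z0\<close>, where \<open>\<gamma>\<close> has derivative \<open>(c z0 + d) ^ (- 2)\<close>.  If
  this is a root of unity, the eigenvalue determines the order of vanishing modulo its order.
\<close>

lemma order_at_fixed_point:
  assumes d: "det \<gamma> = 1" and z0: "Im z0 > 0" and fixp: "moebius \<gamma> z0 = z0"
    and eig: "\<And>z. Im z > 0 \<Longrightarrow> y (moebius \<gamma> z) = lam * automorphy \<gamma> z powi K * y z"
    and ord: "vanishes_to_order y z0 n"
  shows "(1 / automorphy \<gamma> z0 ^ 2) ^ n = lam * automorphy \<gamma> z0 powi K"
proof -
  obtain R F where R: "R > 0" "F holomorphic_on ball z0 R" "F z0 \<noteq> 0"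
    "\<And>z. z \<in> ball z0 R \<Longrightarrow> y z = (z - z0) ^ n * F z"
    using ord unfolding vanishes_to_order_def by blast
  have F: "isCont F z0"
    using R holomorphic_on_imp_continuous_on[OF R(2)] by (simp add: continuous_on_eq_continuous_at)
  have D: "(moebius \<gamma> has_field_derivative 1 / automorphy \<gamma> z0 ^ 2) (at z0)" by (rule moebius_deriv[OF d z0])
  have m: "(moebius \<gamma> \<longlongrightarrow> z0) (at z0)" using DERIV_isCont[OF D] by (simp add: isCont_def fixp)
  have "((\<lambda>z. (moebius \<gamma> z - z0) / (z - z0)) \<longlongrightarrow> 1 / automorphy \<gamma> z0 ^ 2) (at z0)"
    using D by (simp add: has_field_derivative_iff fixp)
  moreover have "((\<lambda>z. F (moebius \<gamma> z)) \<longlongrightarrow> F z0) (at z0)" by (rule isCont_tendsto_compose[OF F m])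
  ultimately have l: "((\<lambda>z. ((moebius \<gamma> z - z0) / (z - z0)) ^ n * F (moebius \<gamma> z))
      \<longlongrightarrow> (1 / automorphy \<gamma> z0 ^ 2) ^ n * F z0) (at z0)"
    by (intro tendsto_mult tendsto_power)
  have j: "(automorphy \<gamma> \<longlongrightarrow> automorphy \<gamma> z0) (at z0)"
    unfolding automorphy_def [abs_def] by (intro tendsto_intros)
  have "((\<lambda>z. lam * automorphy \<gamma> z powi K * F z) \<longlongrightarrow> lam * automorphy \<gamma> z0 powi K * F z0) (at z0)"
    by (intro tendsto_intros j tendsto_power_int automorphy_nonzero[OF d z0]) (use F in \<open>simp add: isCont_def\<close>)
  moreover have "\<forall>\<^sub>F z in at z0. lam * automorphy \<gamma> z powi K * F z
      = ((moebius \<gamma> z - z0) / (z - z0)) ^ n * F (moebius \<gamma> z)"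
  proof -
    have "\<forall>\<^sub>F z in at z0. z \<in> upper_half_plane - {z0}" "\<forall>\<^sub>F z in at z0. z \<in> ball z0 R - {z0}"
      using z0 R by (intro eventually_at_in_open upper_half_plane_open open_ball; simp)+
    moreover have "\<forall>\<^sub>F z in at z0. moebius \<gamma> z \<in> ball z0 R"
      by (rule topological_tendstoD[OF m]) (use R in auto)
    ultimately show ?thesis
    proof eventually_elim
      case (elim z)
      have z: "Im z > 0" "z \<noteq> z0" "z \<in> ball z0 R" using elim(1,2) by blast+
      have "(moebius \<gamma> z - z0) ^ n * F (moebius \<gamma> z) = lam * automorphy \<gamma> z powi K * ((z - z0) ^ n * F z)"
        using eig[OF z(1)] R(4)[OF z(3)] R(4)[OF elim(3)] by simp
      then show ?case using z(2) by (simp add: field_simps)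
    qed
  qed
  ultimately have "((\<lambda>z. ((moebius \<gamma> z - z0) / (z - z0)) ^ n * F (moebius \<gamma> z))
      \<longlongrightarrow> lam * automorphy \<gamma> z0 powi K * F z0) (at z0)"
    by (rule Lim_transform_eventually)
  from tendsto_unique[OF _ l this] R(3) show ?thesis by simp
qed

lemma cube_root_power_eq_iff:
  fixes r :: complex
  assumes r: "r ^ 2 + r + 1 = 0"
  shows "r ^ m = r ^ n \<longleftrightarrow> m mod 3 = n mod 3"
proof -
  have r3: "r ^ 3 = 1" using r by algebra
  have mod: "r ^ j = r ^ (j mod 3)" for j
  proof -
    have "r ^ j = r ^ (3 * (j div 3) + j mod 3)" by simp
    also have "\<dots> = r ^ (j mod 3)" unfolding power_add power_mult r3 by simp
    finally show ?thesis .
  qed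
  have ne: "r \<noteq> 1" "r ^ 2 \<noteq> 1" "r ^ 2 \<noteq> r"
  proof -
    show "r \<noteq> 1" using r by auto
    show "r ^ 2 \<noteq> r"
    proof
      assume "r ^ 2 = r"
      with r r3 have "(3 :: complex) = 0" by algebra
      then show False by simp
    qed
    show "r ^ 2 \<noteq> 1"
    proof
      assume "r ^ 2 = 1"
      with r r3 have "(3 :: complex) = 0" by algebra
      then show False by simp
    qed
  qed
  have c: "j mod 3 = 0 \<or> j mod 3 = 1 \<or> j mod 3 = 2" for j :: nat by presburger
  show ?thesis
    using c[of m] c[of n] ne by (subst mod, subst (2) mod) auto
qed

context quasimodular_setup
begin

lemma combination_order:
  assumes z0: "Im z0 > 0" and nz: "\<not> (p = 0 \<and> q = 0 \<and> r = 0)"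
  shows "\<exists>n. vanishes_to_order (\<lambda>z. p * w1 z + q * w2 z + r * f z) z0 n"
proof -
  obtain s where s: "s > 0" "ball z0 s \<subseteq> upper_half_plane"
    using z0 upper_half_plane_open by (metis (mono_tags) mem_Collect_eq open_contains_ball)
  have hol: "(\<lambda>z. p * w1 z + q * w2 z + r * f z) holomorphic_on ball z0 s"
    by (intro holomorphic_intros holomorphic_on_subset[OF holomorphic(6) s(2)]
        holomorphic_on_subset[OF holomorphic(7) s(2)] holomorphic_on_subset[OF holomorphic(5) s(2)])
  have ne: "ball z0 s \<noteq> {}" using s(1) by simp
  have "\<exists>z\<in>ball z0 s. p * w1 z + q * w2 z + r * f z \<noteq> 0"
  proof (rule ccontr)
    assume "\<not> ?thesis"
    then have "p * w1 z + q * w2 z + r * f z = 0" if "z \<in> ball z0 s" for z using that by blast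
    from independent_open[OF open_ball ne s(2) this] nz show False by blast
  qed
  then obtain z1 where "z1 \<in> ball z0 s" "p * w1 z1 + q * w2 z1 + r * f z1 \<noteq> 0" by blast
  then show ?thesis by (rule vanishes_to_order_exists[OF hol s(1)]) (rule exI)
qed

text \<open>
  Three times the exponents, with their order forgotten.
\<close>

definition exponent_triple :: "complex \<Rightarrow> int \<Rightarrow> int \<Rightarrow> int \<Rightarrow> bool" where
  "exponent_triple z0 a b c \<longleftrightarrow> (\<exists>\<kappa>1 \<kappa>2 \<kappa>3. \<exists>m1 m2 m3 :: int. local_exponents Q2 Q3 z0 \<kappa>1 \<kappa>2 \<kappa>3 \<and>
     3 * \<kappa>1 = of_int m1 \<and> 3 * \<kappa>2 = of_int m2 \<and> 3 * \<kappa>3 = of_int m3 \<and> {#m1, m2, m3#} = {#a, b, c#})"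

lemma exponent_triple_swap:
  "exponent_triple z0 b a c = exponent_triple z0 a b c" "exponent_triple z0 a c b = exponent_triple z0 a b c"
  unfolding exponent_triple_def by (simp_all add: add_mset_commute)

lemma exponents_of_distinct_orders:
  assumes z0: "Im z0 > 0" and n: "n1 \<noteq> n2" "n1 \<noteq> n3" "n2 \<noteq> n3" and span: "span3 y1 y2 y3 = span3 w1 w2 f"
    and ord: "vanishes_to_order y1 z0 n1" "vanishes_to_order y2 z0 n2" "vanishes_to_order y3 z0 n3"
  defines "s \<equiv> int n1 + int n2 + int n3 - 3"
  shows "exponent_triple z0 (3 * int n1 - s) (3 * int n2 - s) (3 * int n3 - s)"
proof -
  define T where "T n1 n2 n3 = exponent_triple z0 (3 * int n1 - (int n1 + int n2 + int n3 - 3))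
    (3 * int n2 - (int n1 + int n2 + int n3 - 3)) (3 * int n3 - (int n1 + int n2 + int n3 - 3))" for n1 n2 n3
  have swap: "T b a c = T a b c" "T a c b = T a b c" for a b c
    unfolding T_def using exponent_triple_swap by (simp_all add: add_ac)
  have sorted: "T n1 n2 n3"
    if n: "n1 < n2" "n2 < n3" and span: "span3 y1 y2 y3 = span3 w1 w2 f"
      and ord: "vanishes_to_order y1 z0 n1" "vanishes_to_order y2 z0 n2" "vanishes_to_order y3 z0 n3"
    for n1 n2 n3 y1 y2 y3
    unfolding T_def exponent_triple_def
    by (rule exI, rule exI, rule exI, rule exI, rule exI, rule exI,
        rule conjI[OF local_data_exponents[OF local_dataI[OF z0 n span ord]]],
        intro conjI; (rule refl | simp))
  have "T n1 n2 n3"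
  proof -
    consider "n1 < n2" "n2 < n3" | "n1 < n3" "n3 < n2" | "n2 < n1" "n1 < n3" | "n2 < n3" "n3 < n1"
      | "n3 < n1" "n1 < n2" | "n3 < n2" "n2 < n1" using n by linarith
    then show ?thesis
    proof cases
      case 1
      show ?thesis by (rule sorted[OF 1 span ord])
    next
      case 2
      have "span3 y1 y3 y2 = span3 w1 w2 f" using span by (simp only: span3_swap(2))
      from sorted[OF 2 this ord(1,3,2)] show ?thesis by (simp only: swap)
    next
      case 3
      have "span3 y2 y1 y3 = span3 w1 w2 f" using span by (simp only: span3_swap(1))
      from sorted[OF 3 this ord(2,1,3)] show ?thesis by (simp only: swap(1))
    next
      case 4
      have "span3 y2 y3 y1 = span3 w1 w2 f"
        using span span3_swap(2)[of y2 y1 y3] span3_swap(1)[of y2 y1 y3] by simp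
      from sorted[OF 4 this ord(2,3,1)] show ?thesis using swap(2)[of n2 n1 n3] swap(1)[of n2 n1 n3] by simp
    next
      case 5
      have "span3 y3 y1 y2 = span3 w1 w2 f"
        using span span3_swap(1)[of y3 y1 y2] span3_swap(2)[of y1 y2 y3] by simp
      from sorted[OF 5 this ord(3,1,2)] show ?thesis using swap(1)[of n3 n1 n2] swap(2)[of n1 n2 n3] by simp
    next
      case 6
      have "span3 y3 y2 y1 = span3 w1 w2 f"
        using span span3_swap(2)[of y3 y1 y2] span3_swap(1)[of y3 y1 y2] span3_swap(2)[of y1 y2 y3] by simp
      from sorted[OF 6 this ord(3,2,1)] show ?thesis
        using swap(2)[of n3 n1 n2] swap(1)[of n3 n1 n2] swap(2)[of n1 n2 n3] by simp
    qed
  qed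
  then show ?thesis unfolding T_def s_def .
qed

text \<open>
  The transformation \<open>z \<mapsto> - 1 / z\<close> exchanges \<open>h1\<close> and \<open>f\<close> and changes the sign of \<open>h2\<close>, up to a common
  factor.  It has one eigenvalue on \<open>h1 + f\<close> and the opposite one on \<open>h1 - f\<close> and \<open>h2\<close>.  Its derivative at
  the fixed point is \<open>-1\<close>, so the eigenvalue determines the parity of the order of vanishing: two
  orders of an adapted basis have one parity and the third has the other one.
\<close>

lemma exponents_at_i:
  assumes full: "\<Gamma> = SL2Z"
  shows "\<exists>\<kappa>1 \<kappa>2 \<kappa>3. \<exists>m1 m2 m3 :: int.
        local_exponents Q2 Q3 \<i> \<kappa>1 \<kappa>2 \<kappa>3 \<and>
        3 * \<kappa>1 = of_int m1 \<and> 3 * \<kappa>2 = of_int m2 \<and> 3 * \<kappa>3 = of_int m3 \<and>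
        {#m1 mod 2, m2 mod 2, m3 mod 2#} = {#0, 0, 1#}"
proof -
  define \<gamma> where "\<gamma> = mat2 0 (-1) 1 0"
  have d: "det \<gamma> = 1" by (simp add: det_entries \<gamma>_def)
  then have g: "\<gamma> \<in> \<Gamma>" unfolding full SL2Z_iff by (simp add: \<gamma>_def)
  have j: "automorphy \<gamma> z = z" for z by (simp add: automorphy_def \<gamma>_def)
  have fixp: "moebius \<gamma> \<i> = \<i>" by (simp add: moebius_def j) (simp add: \<gamma>_def field_simps)
  have tr: "w1 (moebius \<gamma> z) = chi \<gamma> * automorphy \<gamma> z powi (k - 2) * f z"
    "w2 (moebius \<gamma> z) = - (chi \<gamma> * automorphy \<gamma> z powi (k - 2) * w2 z)"
    "f (moebius \<gamma> z) = chi \<gamma> * automorphy \<gamma> z powi (k - 2) * w1 z" if "Im z > 0" for z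
    using transform_\<Gamma>[OF g that] by (simp_all add: \<gamma>_def)
  define \<mu> where "\<mu> = chi \<gamma> * \<i> powi (k - 2)"
  have even_case: "(- 1) ^ n = \<mu>"
    if "vanishes_to_order (\<lambda>z. 1 * w1 z + 0 * w2 z + 1 * f z) \<i> n" for n
    using order_at_fixed_point[OF d _ fixp _ that, of "chi \<gamma>" "k - 2"] by (simp add: tr j \<mu>_def algebra_simps)
  have odd_case: "(- 1) ^ n = - \<mu>" if "vanishes_to_order (\<lambda>z. p * w1 z + q * w2 z + (- p) * f z) \<i> n" for p q n
    using order_at_fixed_point[OF d _ fixp _ that, of "- chi \<gamma>" "k - 2"] by (simp add: tr j \<mu>_def algebra_simps)
  define y where "y = (\<lambda>p q z. p * w1 z + q * w2 z + (- p) * f z)"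
  define y0 where "y0 = (\<lambda>z. 1 * w1 z + 0 * w2 z + 1 * f z)"
  have span: "span3 y0 (y 1 0) (y 0 1) = span3 w1 w2 f"
  proof (intro equalityI span3_mono)
    show "y0 \<in> span3 w1 w2 f" "y 1 0 \<in> span3 w1 w2 f" "y 0 1 \<in> span3 w1 w2 f"
      unfolding y_def y0_def span3_def by blast+
    have "w1 = (\<lambda>z. 1/2 * y0 z + 1/2 * y 1 0 z + 0 * y 0 1 z)" "w2 = (\<lambda>z. 0 * y0 z + 0 * y 1 0 z + 1 * y 0 1 z)"
      "f = (\<lambda>z. 1/2 * y0 z + (- 1/2) * y 1 0 z + 0 * y 0 1 z)"
      by (simp_all add: fun_eq_iff y_def y0_def field_simps)
    then show "w1 \<in> span3 y0 (y 1 0) (y 0 1)" "w2 \<in> span3 y0 (y 1 0) (y 0 1)" "f \<in> span3 y0 (y 1 0) (y 0 1)"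
      unfolding span3_def by blast+
  qed
  obtain n0 where n0: "vanishes_to_order y0 \<i> n0"
    using combination_order[of \<i> 1 0 1] unfolding y0_def by fastforce
  \<comment> \<open>two antiinvariant combinations may have the same order; then one of them is reduced by the other\<close>
  have reduce: "\<exists>n1 n2 y1 y2. n1 \<noteq> n2 \<and> (- 1) ^ n1 = - \<mu> \<and> (- 1) ^ n2 = - \<mu> \<and>
      vanishes_to_order y1 \<i> n1 \<and> vanishes_to_order y2 \<i> n2 \<and> span3 y0 y1 y2 = span3 w1 w2 f"
    if n: "vanishes_to_order (y p q) \<i> n" "vanishes_to_order (y p' q') \<i> m" "n \<le> m"
      and S: "span3 y0 (y p q) (y p' q') = span3 w1 w2 f"
      and ind: "\<And>c. \<not> (p' - c * p = 0 \<and> q' - c * q = 0)" for p q p' q' n m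
  proof -
    obtain c where c: "\<And>k. vanishes_to_order (\<lambda>z. y p' q' z - c * y p q z) \<i> k \<Longrightarrow> n < k"
      using vanishes_to_order_diff[OF n] by blast
    have e: "(\<lambda>z. y p' q' z - c * y p q z) = y (p' - c * p) (q' - c * q)"
      by (simp add: y_def fun_eq_iff algebra_simps)
    obtain k where k: "vanishes_to_order (y (p' - c * p) (q' - c * q)) \<i> k"
      using combination_order[of \<i> "p' - c * p" "q' - c * q" "- (p' - c * p)"] ind[of c] unfolding y_def by fastforce
    have "n < k" using c[unfolded e, OF k] .
    moreover have "(- 1) ^ n = - \<mu>" "(- 1) ^ k = - \<mu>" using odd_case n(1) k unfolding y_def by blast+
    moreover have "span3 y0 (y p q) (\<lambda>z. y p' q' z - c * y p q z) = span3 w1 w2 f"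
      using S span3_sub[of "y p q" "y p' q'" c y0] span3_swap(1)[of "y p q" y0] span3_swap(2)[of "y p q" _ y0] by metis
    ultimately show ?thesis using n(1) k unfolding e by (metis less_irrefl)
  qed
  have "\<exists>n. vanishes_to_order (y 1 0) \<i> n" "\<exists>m. vanishes_to_order (y 0 1) \<i> m"
    unfolding y_def by (rule combination_order; simp)+
  then obtain n m where nm: "vanishes_to_order (y 1 0) \<i> n" "vanishes_to_order (y 0 1) \<i> m" by (elim exE)
  have "\<exists>n1 n2 y1 y2. n1 \<noteq> n2 \<and> (- 1) ^ n1 = - \<mu> \<and> (- 1) ^ n2 = - \<mu> \<and>
      vanishes_to_order y1 \<i> n1 \<and> vanishes_to_order y2 \<i> n2 \<and> span3 y0 y1 y2 = span3 w1 w2 f"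
  proof (cases "n \<le> m")
    case True
    show ?thesis by (rule reduce[OF nm True span]) auto
  next
    case False
    then have "m \<le> n" by simp
    moreover have "span3 y0 (y 0 1) (y 1 0) = span3 w1 w2 f" using span by (simp only: span3_swap(2))
    ultimately show ?thesis by (rule reduce[OF nm(2,1)]) auto
  qed
  then obtain n1 n2 y1 y2 where n: "n1 \<noteq> n2" and sgn: "(- 1) ^ n1 = - \<mu>" "(- 1) ^ n2 = - \<mu>"
    and ord: "vanishes_to_order y1 \<i> n1" "vanishes_to_order y2 \<i> n2" and S: "span3 y0 y1 y2 = span3 w1 w2 f"
    by blast
  have \<mu>: "(- 1) ^ n0 = \<mu>" by (rule even_case[OF n0[unfolded y0_def]])
  have "\<mu> \<noteq> - \<mu>" using chi_nonzero[OF g] by (simp add: \<mu>_def)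
  then have par: "even n1 \<longleftrightarrow> odd n0" "even n2 \<longleftrightarrow> odd n0"
    using sgn \<mu> by (auto simp: minus_one_power_iff split: if_splits)
  then have "n0 \<noteq> n1" "n0 \<noteq> n2" by auto
  from exponents_of_distinct_orders[OF _ this n S n0 ord]
  have tri: "exponent_triple \<i> (3 * int n0 - (int n0 + int n1 + int n2 - 3))
     (3 * int n1 - (int n0 + int n1 + int n2 - 3)) (3 * int n2 - (int n0 + int n1 + int n2 - 3))"
    by simp
  then obtain \<kappa>1 \<kappa>2 \<kappa>3 and m1 m2 m3 :: int where \<kappa>: "local_exponents Q2 Q3 \<i> \<kappa>1 \<kappa>2 \<kappa>3"
    "3 * \<kappa>1 = of_int m1" "3 * \<kappa>2 = of_int m2" "3 * \<kappa>3 = of_int m3"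
    and ms: "{#m1, m2, m3#} = {#3 * int n0 - (int n0 + int n1 + int n2 - 3),
      3 * int n1 - (int n0 + int n1 + int n2 - 3), 3 * int n2 - (int n0 + int n1 + int n2 - 3)#}"
    unfolding exponent_triple_def by blast
  have "{#m1 mod 2, m2 mod 2, m3 mod 2#} = image_mset (\<lambda>m. m mod 2) {#m1, m2, m3#}" by simp
  also have "\<dots> = {#1, 0, 0#}"
  proof -
    have "(3 * int n0 - (int n0 + int n1 + int n2 - 3)) mod 2 = 1"
      "(3 * int n1 - (int n0 + int n1 + int n2 - 3)) mod 2 = 0"
      "(3 * int n2 - (int n0 + int n1 + int n2 - 3)) mod 2 = 0"
      using par by presburger+
    then show ?thesis unfolding ms by simp
  qed
  finally have "{#m1 mod 2, m2 mod 2, m3 mod 2#} = {#0, 0, 1#}" by (simp add: add_mset_commute)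
  with \<kappa> show ?thesis by blast
qed

text \<open>
  The transformation \<open>z \<mapsto> - (z + 1) / z\<close> has derivative \<open>\<rho>\<close> at its fixed point, and its eigenvalues are
  the three cube roots of unity, up to a common factor.  Hence the orders of vanishing of the
  eigenfunctions are distinct modulo \<open>3\<close>; their sum is then divisible by \<open>3\<close>, which makes the exponents
  integers.
\<close>

lemma exponents_at_rho:
  assumes full: "\<Gamma> = SL2Z"
  defines "\<rho> \<equiv> (- 1 + of_real (sqrt 3) * \<i>) / 2"
  shows "\<exists>\<kappa>1 \<kappa>2 \<kappa>3. \<exists>m1 m2 m3 :: int.
        local_exponents Q2 Q3 \<rho> \<kappa>1 \<kappa>2 \<kappa>3 \<and>
        \<kappa>1 = of_int m1 \<and> \<kappa>2 = of_int m2 \<and> \<kappa>3 = of_int m3 \<and>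
        {#m1 mod 3, m2 mod 3, m3 mod 3#} = {#0, 1, 2#}"
proof -
  have r: "\<rho> ^ 2 + \<rho> + 1 = 0"
  proof -
    have "complex_of_real (sqrt 3) ^ 2 = 3" by (metis of_real_power real_sqrt_pow2 of_real_numeral zero_le_numeral)
    then show ?thesis unfolding \<rho>_def by (simp add: field_simps power2_eq_square)
  qed
  then have r3: "\<rho> ^ 3 = 1" by algebra
  have r0: "\<rho> \<noteq> 0" using r by auto
  have im: "Im \<rho> > 0" by (simp add: \<rho>_def)
  define \<gamma> where "\<gamma> = mat2 (- 1) (- 1) 1 0"
  have d: "det \<gamma> = 1" by (simp add: det_entries \<gamma>_def)
  then have g: "\<gamma> \<in> \<Gamma>" unfolding full SL2Z_iff by (simp add: \<gamma>_def)
  have j: "automorphy \<gamma> z = z" for z by (simp add: automorphy_def \<gamma>_def)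
  have "(- \<rho> - 1) / \<rho> = \<rho>" using r r0 by (simp add: field_simps) algebra
  then have fixp: "moebius \<gamma> \<rho> = \<rho>" by (simp add: moebius_def j) (simp add: \<gamma>_def)
  have tr: "w1 (moebius \<gamma> z) = chi \<gamma> * automorphy \<gamma> z powi (k - 2) * (w1 z + w2 z + f z)"
    "w2 (moebius \<gamma> z) = chi \<gamma> * automorphy \<gamma> z powi (k - 2) * (- 2 * w1 z - w2 z)"
    "f (moebius \<gamma> z) = chi \<gamma> * automorphy \<gamma> z powi (k - 2) * w1 z" if "Im z > 0" for z
    using transform_\<Gamma>[OF g that] by (simp_all add: \<gamma>_def)
  define \<mu> where "\<mu> = chi \<gamma> * \<rho> powi (k - 2)"
  have inv: "1 / \<rho> ^ 2 = \<rho>" using r3 r0 by (simp add: field_simps power2_eq_square power3_eq_cube)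
  have order: "\<rho> ^ n = lam * \<mu>"
    if q: "p - q = lam * q" "p - 2 * q + 1 = lam * p" "p = lam"
      and v: "vanishes_to_order (\<lambda>z. p * w1 z + q * w2 z + 1 * f z) \<rho> n" for p q lam n
  proof -
    have "p * w1 (moebius \<gamma> z) + q * w2 (moebius \<gamma> z) + 1 * f (moebius \<gamma> z)
        = (lam * chi \<gamma>) * automorphy \<gamma> z powi (k - 2) * (p * w1 z + q * w2 z + 1 * f z)" if "Im z > 0" for z
    proof -
      have "p * (w1 z + w2 z + f z) + q * (- 2 * w1 z - w2 z) + 1 * w1 z
          = (p - 2 * q + 1) * w1 z + (p - q) * w2 z + p * f z" by (simp add: algebra_simps)
      also have "\<dots> = lam * (p * w1 z + q * w2 z + f z)" unfolding q(1,2) unfolding q(3) by (simp add: algebra_simps)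
      finally have e: "p * (w1 z + w2 z + f z) + q * (- 2 * w1 z - w2 z) + 1 * w1 z
        = lam * (p * w1 z + q * w2 z + f z)" .
      have "p * w1 (moebius \<gamma> z) + q * w2 (moebius \<gamma> z) + 1 * f (moebius \<gamma> z)
        = chi \<gamma> * automorphy \<gamma> z powi (k - 2) * (p * (w1 z + w2 z + f z) + q * (- 2 * w1 z - w2 z) + 1 * w1 z)"
        unfolding tr[OF that] by (simp only: distrib_left mult_ac)
      then show ?thesis unfolding e by (simp only: mult_ac mult_1)
    qed
    from order_at_fixed_point[OF d im fixp this v] show ?thesis unfolding j inv \<mu>_def by (simp only: mult.assoc)
  qed
  \<comment> \<open>the eigenfunctions are \<open>lam * h1 + lam / (1 + lam) * h2 + f\<close> for the cube roots of unity \<open>lam\<close>\<close>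
  define y where "y = (\<lambda>p q z. p * w1 z + q * w2 z + 1 * f z)"
  have "\<exists>n. vanishes_to_order (y p q) \<rho> n" for p q
    unfolding y_def by (rule combination_order[OF im]) simp
  then obtain n0 n1 n2 where n: "vanishes_to_order (y 1 (1/2)) \<rho> n0" "vanishes_to_order (y \<rho> (- (\<rho> ^ 2))) \<rho> n1"
    "vanishes_to_order (y (\<rho> ^ 2) (- \<rho>)) \<rho> n2"
    by metis
  have e0: "\<rho> ^ n0 = 1 * \<mu>" by (rule order[OF _ _ _ n(1)[unfolded y_def]]) simp_all
  have e1: "\<rho> ^ n1 = \<rho> * \<mu>" by (rule order[OF _ _ refl n(2)[unfolded y_def]]; use r in algebra)
  have e2: "\<rho> ^ n2 = \<rho> ^ 2 * \<mu>" by (rule order[OF _ _ refl n(3)[unfolded y_def]]; use r in algebra)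
  have "\<rho> ^ n1 = \<rho> ^ (n0 + 1)" "\<rho> ^ n2 = \<rho> ^ (n0 + 2)" using e0 e1 e2 by (simp_all add: power2_eq_square)
  then have res: "n1 mod 3 = (n0 + 1) mod 3" "n2 mod 3 = (n0 + 2) mod 3"
    unfolding cube_root_power_eq_iff[OF r] .
  have "int (n1 mod 3) = int ((n0 + 1) mod 3)" "int (n2 mod 3) = int ((n0 + 2) mod 3)" by (simp_all only: res)
  then have "int n1 mod 3 = (int n0 + 1) mod 3" "int n2 mod 3 = (int n0 + 2) mod 3" by (simp_all add: zmod_int add.commute)
  then have "3 dvd int n1 - (int n0 + 1)" "3 dvd int n2 - (int n0 + 2)" by (simp_all only: mod_eq_dvd_iff)
  then obtain a b where ab: "int n1 - (int n0 + 1) = 3 * a" "int n2 - (int n0 + 2) = 3 * b" by (elim dvdE)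
  have ne: "n0 \<noteq> n1" "n0 \<noteq> n2" "n1 \<noteq> n2" using ab by presburger+
  have span: "span3 (y 1 (1/2)) (y \<rho> (- (\<rho> ^ 2))) (y (\<rho> ^ 2) (- \<rho>)) = span3 w1 w2 f"
  proof (intro equalityI span3_mono)
    show "y p q \<in> span3 w1 w2 f" for p q unfolding y_def span3_def by blast
    show "y p q \<in> span3 w1 w2 f" "y p q \<in> span3 w1 w2 f" for p q unfolding y_def span3_def by blast+
    let ?S = "span3 (y 1 (1/2)) (y \<rho> (- (\<rho> ^ 2))) (y (\<rho> ^ 2) (- \<rho>))"
    have r2: "\<rho> ^ 2 = - 1 - \<rho>" using r by (simp add: eq_neg_iff_add_eq_0 algebra_simps)
    have rr: "\<rho> * (\<rho> * x) = - x - \<rho> * x" for x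
      unfolding mult.assoc[symmetric] power2_eq_square[symmetric] r2 by (simp add: algebra_simps)
    have k: "y 1 (1/2) z + \<rho> * y \<rho> (- (\<rho> ^ 2)) z + \<rho> ^ 2 * y (\<rho> ^ 2) (- \<rho>) z = - (3/2) * w2 z"
      "y 1 (1/2) z + y \<rho> (- (\<rho> ^ 2)) z + y (\<rho> ^ 2) (- \<rho>) z = 3/2 * w2 z + 3 * f z"
      "y 1 (1/2) z + \<rho> ^ 2 * y \<rho> (- (\<rho> ^ 2)) z + \<rho> * y (\<rho> ^ 2) (- \<rho>) z = 3 * w1 z + 3/2 * w2 z" for z
      unfolding y_def r2 by (simp_all add: algebra_simps rr)
    have "w2 z = (-2/3) * y 1 (1/2) z + (-2/3 * \<rho>) * y \<rho> (- (\<rho> ^ 2)) z + (-2/3 * \<rho> ^ 2) * y (\<rho> ^ 2) (- \<rho>) z" for z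
    proof -
      have "w2 z = (-2/3) * (- (3/2) * w2 z)" by simp
      then show ?thesis unfolding k(1)[symmetric] by (simp only: distrib_left mult.assoc)
    qed
    then show "w2 \<in> ?S" unfolding span3_def by blast
    have "f z = (2/3) * y 1 (1/2) z + (1/3 + 1/3 * \<rho>) * y \<rho> (- (\<rho> ^ 2)) z + (1/3 + 1/3 * \<rho> ^ 2) * y (\<rho> ^ 2) (- \<rho>) z" for z
    proof -
      have "f z = 1/3 * (3/2 * w2 z + 3 * f z) + 1/3 * (- (3/2) * w2 z)" by (simp add: field_simps)
      also have "\<dots> = (2/3) * y 1 (1/2) z + (1/3 + 1/3 * \<rho>) * y \<rho> (- (\<rho> ^ 2)) z + (1/3 + 1/3 * \<rho> ^ 2) * y (\<rho> ^ 2) (- \<rho>) z"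
        unfolding k(1)[of z, symmetric] k(2)[of z, symmetric] by (simp add: algebra_simps)
      finally show ?thesis .
    qed
    then show "f \<in> ?S" unfolding span3_def by blast
    have "w1 z = (2/3) * y 1 (1/2) z + (1/3 * \<rho> ^ 2 + 1/3 * \<rho>) * y \<rho> (- (\<rho> ^ 2)) z + (1/3 * \<rho> + 1/3 * \<rho> ^ 2) * y (\<rho> ^ 2) (- \<rho>) z" for z
    proof -
      have "w1 z = 1/3 * (3 * w1 z + 3/2 * w2 z) + 1/3 * (- (3/2) * w2 z)" by (simp add: field_simps)
      also have "\<dots> = (2/3) * y 1 (1/2) z + (1/3 * \<rho> ^ 2 + 1/3 * \<rho>) * y \<rho> (- (\<rho> ^ 2)) z + (1/3 * \<rho> + 1/3 * \<rho> ^ 2) * y (\<rho> ^ 2) (- \<rho>) z"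
        unfolding k(1)[of z, symmetric] k(3)[of z, symmetric] by (simp add: algebra_simps)
      finally show ?thesis .
    qed
    then show "w1 \<in> ?S" unfolding span3_def by blast
  qed
  from exponents_of_distinct_orders[OF im ne span n]
  obtain \<kappa>1 \<kappa>2 \<kappa>3 and m1 m2 m3 :: int where \<kappa>: "local_exponents Q2 Q3 \<rho> \<kappa>1 \<kappa>2 \<kappa>3"
    "3 * \<kappa>1 = of_int m1" "3 * \<kappa>2 = of_int m2" "3 * \<kappa>3 = of_int m3"
    and ms: "{#m1, m2, m3#} = {#3 * int n0 - (int n0 + int n1 + int n2 - 3),
      3 * int n1 - (int n0 + int n1 + int n2 - 3), 3 * int n2 - (int n0 + int n1 + int n2 - 3)#}"
    unfolding exponent_triple_def by blast
  define t where "t = int n0 + a + b"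
  have t: "int n0 + int n1 + int n2 - 3 = 3 * t" using ab by (simp add: t_def)
  have ms': "{#m1, m2, m3#} = {#3 * (int n0 - t), 3 * (int n1 - t), 3 * (int n2 - t)#}"
    unfolding ms t by (simp add: algebra_simps)
  have "3 dvd m" if "m \<in># {#m1, m2, m3#}" for m using that unfolding ms' by auto
  then have "3 dvd m1" "3 dvd m2" "3 dvd m3" by simp_all
  then have \<kappa>': "\<kappa>1 = of_int (m1 div 3)" "\<kappa>2 = of_int (m2 div 3)" "\<kappa>3 = of_int (m3 div 3)"
    using \<kappa>(2-4) by auto
  have residues: "{#u mod 3, (u + 1) mod 3, (u + 2) mod 3#} = {#0, 1, 2#}" for u :: int
  proof -
    have "(u + 1) mod 3 = (u mod 3 + 1) mod 3" "(u + 2) mod 3 = (u mod 3 + 2) mod 3"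
      by (simp_all only: mod_add_left_eq)
    moreover have "u mod 3 = 0 \<or> u mod 3 = 1 \<or> u mod 3 = 2" by presburger
    ultimately show ?thesis by (elim disjE) (simp_all add: add_mset_commute)
  qed
  have "{#m1 div 3 mod 3, m2 div 3 mod 3, m3 div 3 mod 3#} = image_mset (\<lambda>m. m div 3 mod 3) {#m1, m2, m3#}" by simp
  also have "\<dots> = {#(int n0 - t) mod 3, (int n1 - t) mod 3, (int n2 - t) mod 3#}" unfolding ms' by simp
  also have "\<dots> = {#0, 1, 2#}"
  proof -
    have "int n1 - t = int n0 - t + 1 + 3 * a" "int n2 - t = int n0 - t + 2 + 3 * b" using ab by simp_all
    then have "(int n1 - t) mod 3 = (int n0 - t + 1) mod 3" "(int n2 - t) mod 3 = (int n0 - t + 2) mod 3"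
      by (simp_all only: mod_mult_self2)
    then show ?thesis using residues[of "int n0 - t"] by simp
  qed
  finally show ?thesis using \<kappa>(1) \<kappa>' by blast
qed

end

section \<open>The differential equation of a quasimodular form\<close>

theorem theorem1p1:
  fixes \<Gamma> :: "(real^2^2) set" and chi :: "real^2^2 \<Rightarrow> complex"
    and \<phi> f f0 f1 f2 Q2 Q3 :: "complex \<Rightarrow> complex"
    and \<alpha> :: complex and k :: int
  assumes "subgroup \<Gamma> SL2R" and "discrete \<Gamma>" and "commensurable \<Gamma> SL2Z"
    and "finite_order_character \<Gamma> chi"
    and "quasimodular_weight2 \<Gamma> \<alpha> \<phi>"
    and "quasimodular_depth2 \<Gamma> chi \<phi> k f f0 f1 f2"
    and "Q2 = Q2_form \<alpha> \<phi> f f1 f2"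
    and "Q3 = Q3_form \<alpha> \<phi> f f1 f2"
  shows "MODE \<Gamma> Q2 Q3 \<and>
    cond_H1 \<Gamma> Q2 Q3 \<and> cond_H2 Q2 Q3 \<and> cond_H3 \<Gamma> Q2 Q3 \<and>
    (\<Gamma> = SL2Z \<longrightarrow>
      (\<exists>\<kappa>1 \<kappa>2 \<kappa>3. \<exists>m1 m2 m3 :: int.
        local_exponents Q2 Q3 \<i> \<kappa>1 \<kappa>2 \<kappa>3 \<and>
        3 * \<kappa>1 = of_int m1 \<and> 3 * \<kappa>2 = of_int m2 \<and> 3 * \<kappa>3 = of_int m3 \<and>
        {#m1 mod 2, m2 mod 2, m3 mod 2#} = {#0, 0, 1#}) \<and>
      (\<exists>\<kappa>1 \<kappa>2 \<kappa>3. \<exists>m1 m2 m3 :: int.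
        local_exponents Q2 Q3 ((- 1 + of_real (sqrt 3) * \<i>) / 2) \<kappa>1 \<kappa>2 \<kappa>3 \<and>
        \<kappa>1 = of_int m1 \<and> \<kappa>2 = of_int m2 \<and> \<kappa>3 = of_int m3 \<and>
        {#m1 mod 3, m2 mod 3, m3 mod 3#} = {#0, 1, 2#}))"
proof -
  interpret quasimodular_setup \<Gamma> chi \<phi> f f0 f1 f2 \<alpha> k
    using assms(1-6) by (rule quasimodular_setup.intro)
  have mode: "MODE \<Gamma> (Q2_form \<alpha> \<phi> f f1 f2) (Q3_form \<alpha> \<phi> f f1 f2)"
    unfolding MODE_def using meromorphic_modular_Q2 meromorphic_modular_Q3 by blast
  show ?thesis
    unfolding assms(7,8)
    by (intro conjI impI mode cond_H1 cond_H2 cond_H3 exponents_at_i exponents_at_rho)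
qed

end
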